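(* Suppose that $\Gamma$ is a discrete quantum group of subexponential growth. Then $\Gamma$ is amenable.
   Context: $\Gamma$ is the discrete dual of a compact quantum group $\mathbb G$. For $\alpha\in\mathrm{Irr}(\mathbb G)$ fix a unitary representative $u^\alpha=(u^\alpha_{ij})$ of dimension $n_\alpha$; $\rho_\alpha\in M_{n_\alpha}$ is the unique positive definite matrix with $\mathrm{Tr}(\rho_\alpha)=\mathrm{Tr}(\rho_\alpha^{-1})$ and $(\mathrm{id}\otimes S_{\mathbb G}^2)(u^\alpha)=\rho_\alpha u^\alpha\rho_\alpha^{-1}$. Put $\ell^\infty(\Gamma)=\ell^\infty\text{-}\bigoplus_{\alpha}M_{n_\alpha}$, $c_{00}(\Gamma)=c_{00}\text{-}\bigoplus_\alpha M_{n_\alpha}$, $W=\sum_\alpha\sum_{i,j}e^\alpha_{ij}\otimes u^\alpha_{ij}$. The comultiplication $\Delta$ on $\ell^\infty(\Gamma)$ is the normal $*$-homomorphism with $(\Delta\otimes\mathrm{id})(W)=W_{23}W_{13}$. The right Haar weight is $\widehat{h_R}(x)=\sum_\alpha\mathrm{Tr}(\rho_\alpha)\mathrm{Tr}(\rho_\alpha x_\alpha)$. $R$ is the unitary antipode of $(\ell^\infty(\Gamma),\Delta)$ and $\varepsilon$ the counit (the component at the trivial representation). For $P,x\in c_{00}(\Gamma)$, $P\ast x$ is the element with $\widehat{h_R}(y(P\ast x))=(\widehat{h_R}\otimes\widehat{h_R})(\Delta(y)(P\otimes x))$ for all $y\in c_{00}(\Gamma)$; $P^{\ast n}$ is the $n$-fold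 convolution power, and $[T]$ is the range projection of $T$. $\Gamma$ is of subexponential growth if there is a projection $P\in c_{00}(\Gamma)$ with $R(P)=P$, $\varepsilon(P)=1$ and $\bigvee_n[P^{\ast n}]=1$ in $\ell^\infty(\Gamma)$ such that $\lim_{n\to\infty}\big(\widehat{h_R}([P^{\ast n}])\big)^{1/n}=1$. $\Gamma$ is amenable if there is a state $\mu$ on $\ell^\infty(\Gamma)$ with $\mu((\omega\otimes\mathrm{id})\Delta(x))=\omega(1)\mu(x)$ for all normal functionals $\omega$ and all $x\in\ell^\infty(\Gamma)$. *)

theory Defs
  imports "Jordan_Normal_Form.Schur_Decomposition" "HOL-Analysis.Infinite_Sum"
begin

section \<open>Complex *-algebras\<close>

class complex_space = ab_group_add +
  fixes scaleC :: "complex \<Rightarrow> 'a \<Rightarrow> 'a" (infixr \<open>*\<^sub>C\<close> 75)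
  assumes scaleC_add_right: "c *\<^sub>C (x + y) = c *\<^sub>C x + c *\<^sub>C y"
    and scaleC_add_left: "(c + d) *\<^sub>C x = c *\<^sub>C x + d *\<^sub>C x"
    and scaleC_scaleC: "c *\<^sub>C (d *\<^sub>C x) = (c * d) *\<^sub>C x"
    and scaleC_one: "1 *\<^sub>C x = x"

class complex_star_algebra = complex_space + ring + monoid_mult +
  fixes star :: "'a \<Rightarrow> 'a"
  assumes scaleC_mult_left: "(c *\<^sub>C x) * y = c *\<^sub>C (x * y)"
    and scaleC_mult_right: "x * (c *\<^sub>C y) = c *\<^sub>C (x * y)"
    and star_star: "star (star x) = x"
    and star_add: "star (x + y) = star x + star y"
    and star_scaleC: "star (c *\<^sub>C x) = cnj c *\<^sub>C star x"
    and star_mult: "star (x * y) = star y * star x"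

instantiation complex :: complex_star_algebra
begin
definition "scaleC_complex = ((*) :: complex \<Rightarrow> complex \<Rightarrow> complex)"
definition "star_complex = cnj"
instance
  by standard (auto simp: scaleC_complex_def star_complex_def algebra_simps)
end

interpretation cvs: vector_space "scaleC :: complex \<Rightarrow> 'a::complex_space \<Rightarrow> 'a"
  by standard (simp_all add: scaleC_add_right scaleC_add_left scaleC_scaleC scaleC_one)

definition clinear :: "('a::complex_space \<Rightarrow> 'b::complex_space) \<Rightarrow> bool" where
  "clinear f \<longleftrightarrow> (\<forall>x y. f (x + y) = f x + f y) \<and> (\<forall>c x. f (c *\<^sub>C x) = c *\<^sub>C f x)"

definition cbilinear :: "('a::complex_space \<Rightarrow> 'b::complex_space \<Rightarrow> 'c::complex_space) \<Rightarrow> bool" where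
  "cbilinear f \<longleftrightarrow> (\<forall>x. clinear (f x)) \<and> (\<forall>y. clinear (\<lambda>x. f x y))"

section \<open>The algebraic tensor product\<close>

text \<open>
  An element of the tensor product is represented by a list of pairs $(a_k, b_k)$, standing for
  $\sum_k a_k \otimes b_k$; two lists are identified when no bilinear form separates them.
\<close>

definition bil_sum :: "('a \<Rightarrow> 'b \<Rightarrow> 'c::monoid_add) \<Rightarrow> ('a \<times> 'b) list \<Rightarrow> 'c" where
  "bil_sum f xs = (\<Sum>(a, b)\<leftarrow>xs. f a b)"

definition tensor_eq :: "('a::complex_space \<times> 'b::complex_space) list \<Rightarrow> ('a \<times> 'b) list \<Rightarrow> bool" where
  "tensor_eq xs ys \<longleftrightarrow>
     (\<forall>f :: 'a \<Rightarrow> 'b \<Rightarrow> complex. cbilinear f \<longrightarrow> bil_sum f xs = bil_sum f ys)"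

lemma bil_sum_Nil [simp]: "bil_sum f [] = 0"
  and bil_sum_Cons [simp]: "bil_sum f ((a, b) # xs) = f a b + bil_sum f xs"
  and bil_sum_append [simp]: "bil_sum f (xs @ ys) = bil_sum f xs + bil_sum f ys"
  by (simp_all add: bil_sum_def)

quotient_type (overloaded) ('a, 'b) tensor =
    "('a::complex_space \<times> 'b::complex_space) list" / tensor_eq
  by (auto intro!: equivpI reflpI sympI transpI simp: tensor_eq_def)

lift_definition tensor :: "'a::complex_space \<Rightarrow> 'b::complex_space \<Rightarrow> ('a, 'b) tensor"
    (infixr \<open>\<otimes>\<^sub>t\<close> 78)
  is "\<lambda>a b. [(a, b)]" .

lemma clinear_zero: "clinear f \<Longrightarrow> f 0 = 0"
  unfolding clinear_def by (metis add_cancel_right_left)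

lemma clinear_bil_sum: "clinear g \<Longrightarrow> g (bil_sum f xs) = bil_sum (\<lambda>a b. g (f a b)) xs"
  by (induction xs) (auto simp: clinear_zero, simp add: clinear_def)

lemma bil_sum_map: "bil_sum f (map (\<lambda>(a, b). (g a, h b)) xs) = bil_sum (\<lambda>a b. f (g a) (h b)) xs"
  by (induction xs) auto

lemma bil_sum_scale_left:
  assumes "cbilinear f"
  shows "bil_sum f (map (\<lambda>(a, b). (c *\<^sub>C a, b)) xs) = c *\<^sub>C bil_sum f xs"
  using assms
  by (induction xs) (auto simp: scaleC_add_right, simp add: cbilinear_def clinear_def)

instantiation tensor :: (complex_space, complex_space) complex_space
begin

lift_definition zero_tensor :: "('a, 'b) tensor" is "[]" .

lift_definition plus_tensor :: "('a, 'b) tensor \<Rightarrow> ('a, 'b) tensor \<Rightarrow> ('a, 'b) tensor" is "(@)"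
  by (simp add: tensor_eq_def)

lift_definition scaleC_tensor :: "complex \<Rightarrow> ('a, 'b) tensor \<Rightarrow> ('a, 'b) tensor"
  is "\<lambda>c. map (\<lambda>(a, b). (c *\<^sub>C a, b))"
  by (simp add: tensor_eq_def bil_sum_scale_left)

lift_definition uminus_tensor :: "('a, 'b) tensor \<Rightarrow> ('a, 'b) tensor"
  is "map (\<lambda>(a, b). ((-1) *\<^sub>C a, b))"
  unfolding tensor_eq_def using bil_sum_scale_left by metis

definition minus_tensor :: "('a, 'b) tensor \<Rightarrow> ('a, 'b) tensor \<Rightarrow> ('a, 'b) tensor" where
  "minus_tensor s t = s + - t"

instance
proof
  fix s t r :: "('a, 'b) tensor" and c d :: complex
  show "s + t + r = s + (t + r)" by transfer (simp add: tensor_eq_def)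
  show "s + t = t + s" by transfer (simp add: tensor_eq_def)
  show "0 + t = t" by transfer (simp add: tensor_eq_def)
  show "- t + t = 0"
  proof (transfer, unfold tensor_eq_def, intro allI impI)
    fix xs and f :: "'a \<Rightarrow> 'b \<Rightarrow> complex"
    assume f: "cbilinear f"
    show "bil_sum f (map (\<lambda>(a, b). ((-1) *\<^sub>C a, b)) xs @ xs) = bil_sum f []"
      unfolding bil_sum_append bil_sum_scale_left[OF f] by (simp add: scaleC_complex_def)
  qed
  show "s - t = s + - t" by (rule minus_tensor_def)
  show "c *\<^sub>C (s + t) = c *\<^sub>C s + c *\<^sub>C t" by transfer (simp add: tensor_eq_def)
  show "(c + d) *\<^sub>C t = c *\<^sub>C t + d *\<^sub>C t"
  proof (transfer, unfold tensor_eq_def, intro allI impI)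
    fix c d xs and f :: "'a \<Rightarrow> 'b \<Rightarrow> complex"
    assume f: "cbilinear f"
    show "bil_sum f (map (\<lambda>(a, b). ((c + d) *\<^sub>C a, b)) xs)
        = bil_sum f (map (\<lambda>(a, b). (c *\<^sub>C a, b)) xs @ map (\<lambda>(a, b). (d *\<^sub>C a, b)) xs)"
      unfolding bil_sum_append bil_sum_scale_left[OF f] by (rule scaleC_add_left)
  qed
  show "c *\<^sub>C d *\<^sub>C t = (c * d) *\<^sub>C t"
    by transfer (simp add: tensor_eq_def bil_sum_scale_left scaleC_scaleC del: map_map)
  show "1 *\<^sub>C t = t"
    by transfer (simp add: tensor_eq_def bil_sum_scale_left scaleC_one)
qed

end


definition list_mult ::
    "('a::times \<times> 'b::times) list \<Rightarrow> ('a \<times> 'b) list \<Rightarrow> ('a \<times> 'b) list" where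
  "list_mult xs ys = concat (map (\<lambda>(a, b). map (\<lambda>(c, d). (a * c, b * d)) ys) xs)"

lemma bil_sum_list_mult:
  "bil_sum f (list_mult xs ys) = bil_sum (\<lambda>a b. bil_sum (\<lambda>c d. f (a * c) (b * d)) ys) xs"
proof (induction xs)
  case (Cons x xs)
  obtain a b where x: "x = (a, b)" by (cases x)
  have "list_mult (x # xs) ys = map (\<lambda>(c, d). (a * c, b * d)) ys @ list_mult xs ys"
    by (simp add: list_mult_def x)
  then show ?case
    using Cons.IH bil_sum_map[of f "(*) a" "(*) b" ys] by (simp add: x)
qed (simp add: list_mult_def)

lemma cbilinear_mult:
  fixes f :: "'a::complex_star_algebra \<Rightarrow> 'b::complex_star_algebra \<Rightarrow> 'c::complex_space"
  assumes "cbilinear f"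
  shows "cbilinear (\<lambda>c d. f (a * c) (b * d))" "cbilinear (\<lambda>c d. f (c * a) (d * b))"
  using assms
  by (auto simp: cbilinear_def clinear_def distrib_left distrib_right
      scaleC_mult_left scaleC_mult_right)

lemma cbilinear_bil_sum:
  assumes "\<And>a b. cbilinear (\<lambda>c d. f a b c d)"
  shows "cbilinear (\<lambda>c d. bil_sum (\<lambda>a b. f a b c d) xs)"
proof (induction xs)
  case Nil
  then show ?case by (simp add: cbilinear_def clinear_def)
next
  case (Cons x xs)
  then show ?case
    using assms[of "fst x" "snd x"]
    by (cases x) (simp add: cbilinear_def clinear_def algebra_simps scaleC_add_right)
qed

lemma tensor_eq_list_mult:
  fixes xs xs' :: "('a::complex_star_algebra \<times> 'b::complex_star_algebra) list"
  assumes "tensor_eq xs xs'" "tensor_eq ys ys'"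
  shows "tensor_eq (list_mult xs ys) (list_mult xs' ys')"
  unfolding tensor_eq_def
proof (intro allI impI)
  fix f :: "'a \<Rightarrow> 'b \<Rightarrow> complex"
  assume f: "cbilinear f"
  have "bil_sum f (list_mult xs ys) = bil_sum (\<lambda>a b. bil_sum (\<lambda>c d. f (a * c) (b * d)) ys') xs"
    using assms(2) cbilinear_mult(1)[OF f] by (simp add: bil_sum_list_mult tensor_eq_def)
  also have "\<dots> = bil_sum f (list_mult xs' ys')"
    using assms(1) cbilinear_bil_sum[of "\<lambda>c d a b. f (a * c) (b * d)", OF cbilinear_mult(2)[OF f]]
    by (simp add: bil_sum_list_mult tensor_eq_def)
  finally show "bil_sum f (list_mult xs ys) = bil_sum f (list_mult xs' ys')" .
qed

lemma bil_sum_star: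
  "bil_sum f (map (\<lambda>(a, b). (star a, star b)) xs) = cnj (bil_sum (\<lambda>a b. cnj (f (star a) (star b))) xs)"
  by (induction xs) auto

lemma cbilinear_star:
  fixes f :: "'a::complex_star_algebra \<Rightarrow> 'b::complex_star_algebra \<Rightarrow> complex"
  assumes "cbilinear f"
  shows "cbilinear (\<lambda>a b. cnj (f (star a) (star b)))"
  using assms
  by (auto simp: cbilinear_def clinear_def star_add star_scaleC scaleC_complex_def)

instantiation tensor :: (complex_star_algebra, complex_star_algebra) complex_star_algebra
begin

lift_definition one_tensor :: "('a, 'b) tensor" is "[(1, 1)]" .

lift_definition times_tensor :: "('a, 'b) tensor \<Rightarrow> ('a, 'b) tensor \<Rightarrow> ('a, 'b) tensor"
  is list_mult by (rule tensor_eq_list_mult)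

lift_definition star_tensor :: "('a, 'b) tensor \<Rightarrow> ('a, 'b) tensor"
  is "map (\<lambda>(a, b). (star a, star b))"
  using cbilinear_star by (auto simp: tensor_eq_def bil_sum_star)

instance
proof
  fix s t r :: "('a, 'b) tensor" and c :: complex
  show "s * t * r = s * (t * r)"
    by transfer (simp add: tensor_eq_def bil_sum_list_mult mult.assoc)
  show "1 * t = t" by transfer (simp add: tensor_eq_def bil_sum_list_mult)
  show "t * 1 = t" by transfer (simp add: tensor_eq_def bil_sum_list_mult)
  show "(s + t) * r = s * r + t * r" by transfer (simp add: tensor_eq_def bil_sum_list_mult)
  show "s * (t + r) = s * t + s * r"
  proof (transfer, unfold tensor_eq_def bil_sum_list_mult bil_sum_append, intro allI impI)
    fix xs ys zs :: "('a \<times> 'b) list" and f :: "'a \<Rightarrow> 'b \<Rightarrow> complex"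
    show "bil_sum (\<lambda>a b. bil_sum (\<lambda>c d. f (a * c) (b * d)) ys + bil_sum (\<lambda>c d. f (a * c) (b * d)) zs) xs
        = bil_sum (\<lambda>a b. bil_sum (\<lambda>c d. f (a * c) (b * d)) ys) xs
        + bil_sum (\<lambda>a b. bil_sum (\<lambda>c d. f (a * c) (b * d)) zs) xs"
      by (induction xs) auto
  qed
  show "c *\<^sub>C s * t = c *\<^sub>C (s * t)"
  proof (transfer, unfold tensor_eq_def, intro allI impI)
    fix c and xs ys :: "('a \<times> 'b) list" and f :: "'a \<Rightarrow> 'b \<Rightarrow> complex"
    assume f: "cbilinear f"
    show "bil_sum f (list_mult (map (\<lambda>(a, b). (c *\<^sub>C a, b)) xs) ys)
        = bil_sum f (map (\<lambda>(a, b). (c *\<^sub>C a, b)) (list_mult xs ys))"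
      using bil_sum_scale_left[OF f] f
        bil_sum_scale_left[OF cbilinear_bil_sum[of "\<lambda>c d a b. f (a * c) (b * d)", OF cbilinear_mult(2)[OF f]]]
      by (simp add: bil_sum_list_mult)
  qed
  show "s * c *\<^sub>C t = c *\<^sub>C (s * t)"
  proof (transfer, unfold tensor_eq_def, intro allI impI)
    fix c and xs ys :: "('a \<times> 'b) list" and f :: "'a \<Rightarrow> 'b \<Rightarrow> complex"
    assume f: "cbilinear f"
    have "clinear (\<lambda>z. c *\<^sub>C z :: complex)" by (simp add: clinear_def scaleC_complex_def algebra_simps)
    note push = clinear_bil_sum[OF this]
    show "bil_sum f (list_mult xs (map (\<lambda>(a, b). (c *\<^sub>C a, b)) ys))
        = bil_sum f (map (\<lambda>(a, b). (c *\<^sub>C a, b)) (list_mult xs ys))"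
      unfolding bil_sum_list_mult bil_sum_scale_left[OF f] 
        bil_sum_scale_left[OF cbilinear_mult(1)[OF f]] push ..
  qed
  show "star (star t) = t" 
    by transfer (simp add: tensor_eq_def o_def case_prod_beta star_star)
  show "star (s + t) = star s + star t" by transfer (simp add: tensor_eq_def)
  show "star (c *\<^sub>C t) = cnj c *\<^sub>C star t"
    by transfer (simp add: tensor_eq_def o_def case_prod_beta star_scaleC)
  show "star (s * t) = star t * star s"
  proof (transfer, unfold tensor_eq_def, intro allI impI)
    fix xs ys :: "('a \<times> 'b) list" and f :: "'a \<Rightarrow> 'b \<Rightarrow> complex"
    have swap: "bil_sum (\<lambda>a b. bil_sum (g a b) ys) xs = bil_sum (\<lambda>c d. bil_sum (\<lambda>a b. g a b c d) xs) ys"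
      for g :: "'a \<Rightarrow> 'b \<Rightarrow> 'a \<Rightarrow> 'b \<Rightarrow> complex"
      by (simp add: bil_sum_def case_prod_beta sum_list_sum_nth sum.swap[of _ "{0..<length xs}"])
    show "bil_sum f (map (\<lambda>(a, b). (star a, star b)) (list_mult xs ys))
        = bil_sum f (list_mult (map (\<lambda>(a, b). (star a, star b)) ys) (map (\<lambda>(a, b). (star a, star b)) xs))"
      by (simp add: bil_sum_list_mult bil_sum_map star_mult swap)
  qed
qed

end

text \<open>
  \<open>tensor_lift f\<close> is the linear map induced by a bilinear map \<open>f\<close>; by \<open>tensor_lift_abs\<close> it does
  not depend on the representative chosen.
\<close>

definition tensor_lift ::
    "('a::complex_space \<Rightarrow> 'b::complex_space \<Rightarrow> 'c::complex_space) \<Rightarrow> ('a, 'b) tensor \<Rightarrow> 'c" where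
  "tensor_lift f t = bil_sum f (rep_tensor t)"

lemma clinear_separates:
  fixes x y :: "'a::complex_space"
  assumes "\<And>f :: 'a \<Rightarrow> complex. clinear f \<Longrightarrow> f x = f y"
  shows "x = y"
proof (rule ccontr)
  assume "x \<noteq> y"
  interpret cc: vector_space_pair "scaleC :: complex \<Rightarrow> 'a \<Rightarrow> 'a" "(*) :: complex \<Rightarrow> complex \<Rightarrow> complex"
    by unfold_locales (auto simp: algebra_simps)
  have "cvs.independent {x - y}"
    using \<open>x \<noteq> y\<close> by (simp add: cvs.dependent_single)
  from cc.linear_independent_extend[OF this, of "\<lambda>_. 1"]
  obtain f where f: "Vector_Spaces.linear scaleC (*) f" "f (x - y) = 1" by auto
  then interpret f: Vector_Spaces.linear scaleC "(*)" f by simp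
  have "clinear f" by (simp add: clinear_def f.add f.scale scaleC_complex_def)
  with assms have "f x = f y" by blast
  with f(2) show False by (simp add: f.diff)
qed

lemma tensor_lift_abs:
  assumes "cbilinear f"
  shows "tensor_lift f (abs_tensor xs) = bil_sum f xs"
proof (rule clinear_separates)
  fix g :: "'c \<Rightarrow> complex"
  assume g: "clinear g"
  have "cbilinear (\<lambda>a b. g (f a b))"
    using assms g by (auto simp: cbilinear_def clinear_def)
  moreover have "tensor_eq (rep_tensor (abs_tensor xs)) xs"
    by (metis Quotient3_abs_rep Quotient3_tensor tensor.abs_eq_iff)
  ultimately show "g (tensor_lift f (abs_tensor xs)) = g (bil_sum f xs)"
    unfolding tensor_lift_def clinear_bil_sum[OF g] by (simp add: tensor_eq_def)
qed


section \<open>Compact quantum groups and their representations\<close>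

definition star_mat :: "'a::complex_star_algebra mat \<Rightarrow> 'a mat" where
  "star_mat v = mat (dim_col v) (dim_row v) (\<lambda>(i, j). star (v $$ (j, i)))"

definition scalar_mat :: "complex mat \<Rightarrow> 'a::complex_star_algebra mat" where
  "scalar_mat = map_mat (\<lambda>c. c *\<^sub>C 1)"

definition unitary_rep ::
    "('a::complex_star_algebra \<Rightarrow> ('a, 'a) tensor) \<Rightarrow> 'a mat \<Rightarrow> bool" where
  "unitary_rep \<Delta> v \<longleftrightarrow>
     square_mat v \<and>
     star_mat v * v = 1\<^sub>m (dim_row v) \<and> v * star_mat v = 1\<^sub>m (dim_row v) \<and>
     (\<forall>i<dim_row v. \<forall>j<dim_row v.
        \<Delta> (v $$ (i, j)) = (\<Sum>k<dim_row v. v $$ (i, k) \<otimes>\<^sub>t v $$ (k, j)))"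

definition intertwiners ::
    "'a::complex_star_algebra mat \<Rightarrow> 'a mat \<Rightarrow> complex mat set" where
  "intertwiners v w =
     {T \<in> carrier_mat (dim_row w) (dim_row v). scalar_mat T * v = w * scalar_mat T}"

definition irreducible_rep ::
    "('a::complex_star_algebra \<Rightarrow> ('a, 'a) tensor) \<Rightarrow> 'a mat \<Rightarrow> bool" where
  "irreducible_rep \<Delta> v \<longleftrightarrow>
     unitary_rep \<Delta> v \<and> 0 < dim_row v \<and>
     intertwiners v v = {c \<cdot>\<^sub>m 1\<^sub>m (dim_row v) | c. True}"

definition equivalent_reps :: "'a::complex_star_algebra mat \<Rightarrow> 'a mat \<Rightarrow> bool" where
  "equivalent_reps v w \<longleftrightarrow> (\<exists>T \<in> intertwiners v w. invertible_mat T)"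

text \<open>
  A compact quantum group is given by its Hopf *-algebra $\mathrm{Pol}(\mathbb{G})$ (a CQG algebra):
  a Hopf *-algebra spanned by the coefficients of its finite-dimensional unitary representations.
\<close>

locale compact_quantum_group =
  fixes \<Delta>G :: "'a::complex_star_algebra \<Rightarrow> ('a, 'a) tensor"
    and \<epsilon>G :: "'a \<Rightarrow> complex"
    and SG :: "'a \<Rightarrow> 'a"
  assumes comult_linear: "clinear \<Delta>G"
    and comult_mult: "\<Delta>G (a * b) = \<Delta>G a * \<Delta>G b"
    and comult_one: "\<Delta>G 1 = 1"
    and comult_star: "\<Delta>G (star a) = star (\<Delta>G a)"
    and coassoc: "tensor_lift (\<lambda>a b. \<Delta>G a \<otimes>\<^sub>t b) (\<Delta>G x)
      = tensor_lift (\<lambda>a t. tensor_lift (\<lambda>b c. (a \<otimes>\<^sub>t b) \<otimes>\<^sub>t c) (\<Delta>G t)) (\<Delta>G x)"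
    and counit_linear: "clinear \<epsilon>G"
    and counit_mult: "\<epsilon>G (a * b) = \<epsilon>G a * \<epsilon>G b"
    and counit_one: "\<epsilon>G 1 = 1"
    and counit_left: "tensor_lift (\<lambda>a b. \<epsilon>G a *\<^sub>C b) (\<Delta>G x) = x"
    and counit_right: "tensor_lift (\<lambda>a b. \<epsilon>G b *\<^sub>C a) (\<Delta>G x) = x"
    and antipode_linear: "clinear SG"
    and antipode_left: "tensor_lift (\<lambda>a b. SG a * b) (\<Delta>G x) = \<epsilon>G x *\<^sub>C 1"
    and antipode_right: "tensor_lift (\<lambda>a b. a * SG b) (\<Delta>G x) = \<epsilon>G x *\<^sub>C 1"
    and coefficients_span: "module.span scaleC
      {v $$ (i, j) | v i j. unitary_rep \<Delta>G v \<and> i < dim_row v \<and> j < dim_row v} = UNIV"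

section \<open>Direct sums of matrix algebras\<close>

definition mat_trace :: "complex mat \<Rightarrow> complex" where
  "mat_trace A = (\<Sum>i<dim_row A. A $$ (i, i))"

definition kron :: "complex mat \<Rightarrow> complex mat \<Rightarrow> complex mat" where
  "kron A B = mat (dim_row A * dim_row B) (dim_col A * dim_col B)
     (\<lambda>(i, j). A $$ (i div dim_row B, j div dim_col B) * B $$ (i mod dim_row B, j mod dim_col B))"

definition positive_definite :: "complex mat \<Rightarrow> bool" where
  "positive_definite A \<longleftrightarrow> square_mat A \<and> mat_adjoint A = A \<and>
     (\<forall>v \<in> carrier_vec (dim_row A). v \<noteq> 0\<^sub>v (dim_row A) \<longrightarrow> 0 < (A *\<^sub>v v) \<bullet>c v)"

text \<open>
  For \<open>d :: 'k \<Rightarrow> nat\<close>, the families \<open>x\<close> with \<open>x k\<close> a $d_k \times d_k$ matrix form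
  $\prod_k M_{d_k}$; \<open>linf d\<close> and \<open>c00 d\<close> are the families bounded in operator norm and
  the finitely supported families.
\<close>

type_synonym 'k family = "'k \<Rightarrow> complex mat"

definition families :: "('k \<Rightarrow> nat) \<Rightarrow> 'k family set" where
  "families d = {x. \<forall>k. x k \<in> carrier_mat (d k) (d k)}"

definition linf :: "('k \<Rightarrow> nat) \<Rightarrow> 'k family set" where
  "linf d = {x \<in> families d. \<exists>C. \<forall>k. \<forall>v \<in> carrier_vec (d k).
     (x k *\<^sub>v v) \<bullet>c (x k *\<^sub>v v) \<le> complex_of_real C * (v \<bullet>c v)}"

definition supp :: "('k \<Rightarrow> nat) \<Rightarrow> 'k family \<Rightarrow> 'k set" where
  "supp d x = {k. x k \<noteq> 0\<^sub>m (d k) (d k)}"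

definition c00 :: "('k \<Rightarrow> nat) \<Rightarrow> 'k family set" where
  "c00 d = {x \<in> families d. finite (supp d x)}"

definition fam_add :: "'k family \<Rightarrow> 'k family \<Rightarrow> 'k family" (infixl \<open>+\<^sub>f\<close> 65) where
  "x +\<^sub>f y = (\<lambda>k. x k + y k)"

definition fam_scale :: "complex \<Rightarrow> 'k family \<Rightarrow> 'k family" (infixr \<open>\<cdot>\<^sub>f\<close> 75) where
  "c \<cdot>\<^sub>f x = (\<lambda>k. c \<cdot>\<^sub>m x k)"

definition fam_mult :: "'k family \<Rightarrow> 'k family \<Rightarrow> 'k family" (infixl \<open>*\<^sub>f\<close> 70) where
  "x *\<^sub>f y = (\<lambda>k. x k * y k)"

definition fam_adj :: "'k family \<Rightarrow> 'k family" where
  "fam_adj x = (\<lambda>k. mat_adjoint (x k))"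

definition fam_one :: "('k \<Rightarrow> nat) \<Rightarrow> 'k family" where
  "fam_one d = (\<lambda>k. 1\<^sub>m (d k))"

definition mat_unit :: "('k \<Rightarrow> nat) \<Rightarrow> 'k \<Rightarrow> nat \<Rightarrow> nat \<Rightarrow> 'k family" where
  "mat_unit d \<gamma> i j = (\<lambda>k. mat (d k) (d k) (\<lambda>p. if k = \<gamma> \<and> p = (i, j) then 1 else 0))"

definition linear_on :: "('k \<Rightarrow> nat) \<Rightarrow> ('k family \<Rightarrow> 'l family) \<Rightarrow> bool" where
  "linear_on d T \<longleftrightarrow>
     (\<forall>x \<in> linf d. \<forall>y \<in> linf d. T (x +\<^sub>f y) = T x +\<^sub>f T y) \<and>
     (\<forall>c. \<forall>x \<in> linf d. T (c \<cdot>\<^sub>f x) = c \<cdot>\<^sub>f T x)"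

definition linear_functional_on :: "('k \<Rightarrow> nat) \<Rightarrow> ('k family \<Rightarrow> complex) \<Rightarrow> bool" where
  "linear_functional_on d \<phi> \<longleftrightarrow>
     (\<forall>x \<in> linf d. \<forall>y \<in> linf d. \<phi> (x +\<^sub>f y) = \<phi> x + \<phi> y) \<and>
     (\<forall>c. \<forall>x \<in> linf d. \<phi> (c \<cdot>\<^sub>f x) = c * \<phi> x)"

definition state_on :: "('k \<Rightarrow> nat) \<Rightarrow> ('k family \<Rightarrow> complex) \<Rightarrow> bool" where
  "state_on d \<mu> \<longleftrightarrow> linear_functional_on d \<mu> \<and>
     (\<forall>x \<in> linf d. 0 \<le> \<mu> (fam_adj x *\<^sub>f x)) \<and> \<mu> (fam_one d) = 1"

text \<open>
  Normal functionals are the $\sigma$-weakly continuous ones on the Hilbert space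
  $\bigoplus_k \mathbb{C}^{d_k}$, i.e. $x \mapsto \sum_m \langle x \xi_m, \eta_m \rangle$ with
  $\sum_m \|\xi_m\|^2 < \infty$ and $\sum_m \|\eta_m\|^2 < \infty$.
\<close>

definition normal_functional :: "('k \<Rightarrow> nat) \<Rightarrow> ('k family \<Rightarrow> complex) \<Rightarrow> bool" where
  "normal_functional d \<omega> \<longleftrightarrow>
     (\<exists>\<xi> \<eta> :: nat \<Rightarrow> 'k \<Rightarrow> complex vec.
        (\<forall>m k. \<xi> m k \<in> carrier_vec (d k) \<and> \<eta> m k \<in> carrier_vec (d k)) \<and>
        (\<lambda>(m, k). \<xi> m k \<bullet>c \<xi> m k) summable_on UNIV \<and>
        (\<lambda>(m, k). \<eta> m k \<bullet>c \<eta> m k) summable_on UNIV \<and>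
        (\<forall>x \<in> linf d. \<omega> x = (\<Sum>\<^sub>\<infinity>(m, k). (x k *\<^sub>v \<xi> m k) \<bullet>c \<eta> m k)))"

definition normal_star_hom ::
    "('k \<Rightarrow> nat) \<Rightarrow> ('l \<Rightarrow> nat) \<Rightarrow> ('k family \<Rightarrow> 'l family) \<Rightarrow> bool" where
  "normal_star_hom d e T \<longleftrightarrow>
     T ` linf d \<subseteq> linf e \<and> linear_on d T \<and>
     (\<forall>x \<in> linf d. \<forall>y \<in> linf d. T (x *\<^sub>f y) = T x *\<^sub>f T y) \<and>
     (\<forall>x \<in> linf d. T (fam_adj x) = fam_adj (T x)) \<and>
     (\<forall>\<omega>. normal_functional e \<omega> \<longrightarrow> normal_functional d (\<lambda>x. \<omega> (T x)))"

definition star_antiautomorphism :: "('k \<Rightarrow> nat) \<Rightarrow> ('k family \<Rightarrow> 'k family) \<Rightarrow> bool" where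
  "star_antiautomorphism d T \<longleftrightarrow>
     bij_betw T (linf d) (linf d) \<and> linear_on d T \<and>
     (\<forall>x \<in> linf d. \<forall>y \<in> linf d. T (x *\<^sub>f y) = T y *\<^sub>f T x) \<and>
     (\<forall>x \<in> linf d. T (fam_adj x) = fam_adj (T x))"

definition projection :: "('k \<Rightarrow> nat) \<Rightarrow> 'k family \<Rightarrow> bool" where
  "projection d p \<longleftrightarrow> p \<in> linf d \<and> p *\<^sub>f p = p \<and> fam_adj p = p"

definition proj_le :: "'k family \<Rightarrow> 'k family \<Rightarrow> bool" where
  "proj_le p q \<longleftrightarrow> q *\<^sub>f p = p"

definition mat_range :: "complex mat \<Rightarrow> complex vec set" where
  "mat_range A = {A *\<^sub>v v | v. v \<in> carrier_vec (dim_col A)}"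

definition range_projection :: "('k \<Rightarrow> nat) \<Rightarrow> 'k family \<Rightarrow> 'k family" where
  "range_projection d x = (THE p. projection d p \<and> (\<forall>k. mat_range (p k) = mat_range (x k)))"

text \<open>
  $\ell^\infty(\Gamma \times \Gamma)$ is indexed by pairs, the entry
  $e_{ij} \otimes e_{kl}$ of $M_{n_\alpha} \otimes M_{n_\beta}$ sitting at position
  $(i n_\beta + k, j n_\beta + l)$ as in \<^const>\<open>kron\<close>; \<open>slice n \<omega>\<close> is
  $\omega \otimes \mathrm{id}$.
\<close>

definition sq_dim :: "('i \<Rightarrow> nat) \<Rightarrow> 'i \<times> 'i \<Rightarrow> nat" where
  "sq_dim n = (\<lambda>(\<alpha>, \<beta>). n \<alpha> * n \<beta>)"

definition fam_tensor :: "'i family \<Rightarrow> 'i family \<Rightarrow> ('i \<times> 'i) family" (infixr \<open>\<otimes>\<^sub>f\<close> 72) where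
  "x \<otimes>\<^sub>f y = (\<lambda>(\<alpha>, \<beta>). kron (x \<alpha>) (y \<beta>))"

definition slice ::
    "('i \<Rightarrow> nat) \<Rightarrow> ('i family \<Rightarrow> complex) \<Rightarrow> ('i \<times> 'i) family \<Rightarrow> 'i family" where
  "slice n \<omega> X = (\<lambda>\<beta>. mat (n \<beta>) (n \<beta>) (\<lambda>(k, l).
     \<omega> (\<lambda>\<alpha>. mat (n \<alpha>) (n \<alpha>) (\<lambda>(i, j). X (\<alpha>, \<beta>) $$ (i * n \<beta> + k, j * n \<beta> + l)))))"

text \<open>
  \<open>has_leg n \<phi> v a\<close> says that $(\phi \otimes \mathrm{id})
  (\sum_\gamma \sum_{i,j} e^\gamma_{ij} \otimes v^\gamma_{ij})$ is a finite sum with value \<open>a\<close>.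
\<close>

definition has_leg ::
    "('i \<Rightarrow> nat) \<Rightarrow> ('i family \<Rightarrow> complex) \<Rightarrow> ('i \<Rightarrow> 'a::complex_star_algebra mat) \<Rightarrow> 'a \<Rightarrow> bool" where
  "has_leg n \<phi> v a \<longleftrightarrow>
     (let G = {\<gamma>. \<exists>i<n \<gamma>. \<exists>j<n \<gamma>. \<phi> (mat_unit n \<gamma> i j) \<noteq> 0} in
      finite G \<and>
      a = (\<Sum>\<gamma>\<in>G. \<Sum>i<n \<gamma>. \<Sum>j<n \<gamma>. \<phi> (mat_unit n \<gamma> i j) *\<^sub>C v \<gamma> $$ (i, j)))"

section \<open>The discrete dual\<close>

text \<open>
  The index type \<open>'i\<close> plays the role of $\mathrm{Irr}(\mathbb{G})$. The locale below fixes
  $\rho$, $\Delta$ and $R$ through their defining properties, each of which determines its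
  object uniquely (for $\Delta$ and $R$: on $\ell^\infty(\Gamma)$).
\<close>

definition irr_representatives ::
    "('a::complex_star_algebra \<Rightarrow> ('a, 'a) tensor) \<Rightarrow> ('i \<Rightarrow> 'a mat) \<Rightarrow> bool" where
  "irr_representatives \<Delta>G u \<longleftrightarrow>
     (\<forall>\<alpha>. irreducible_rep \<Delta>G (u \<alpha>)) \<and>
     (\<forall>\<alpha> \<beta>. equivalent_reps (u \<alpha>) (u \<beta>) \<longrightarrow> \<alpha> = \<beta>) \<and>
     (\<forall>v. irreducible_rep \<Delta>G v \<longrightarrow> (\<exists>\<alpha>. equivalent_reps v (u \<alpha>)))"

definition irr_dim :: "('i \<Rightarrow> 'a mat) \<Rightarrow> 'i \<Rightarrow> nat" where
  "irr_dim u \<alpha> = dim_row (u \<alpha>)"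

definition trivial_index :: "('i \<Rightarrow> 'a::complex_star_algebra mat) \<Rightarrow> 'i" where
  "trivial_index u = (THE \<alpha>. u \<alpha> = 1\<^sub>m 1)"

definition modular_matrix ::
    "('a::complex_star_algebra \<Rightarrow> 'a) \<Rightarrow> 'a mat \<Rightarrow> complex mat \<Rightarrow> bool" where
  "modular_matrix SG v \<rho> \<longleftrightarrow>
     \<rho> \<in> carrier_mat (dim_row v) (dim_row v) \<and> positive_definite \<rho> \<and>
     (\<exists>\<sigma>. inverts_mat \<rho> \<sigma> \<and> inverts_mat \<sigma> \<rho> \<and> mat_trace \<rho> = mat_trace \<sigma> \<and>
        map_mat (\<lambda>a. SG (SG a)) v = scalar_mat \<rho> * v * scalar_mat \<sigma>)"

text \<open>
  \<open>dual_comult u \<Delta>\<close>: \<open>\<Delta>\<close> is the normal *-homomorphism with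
  $(\Delta \otimes \mathrm{id})(W) = W_{23} W_{13}$, where the coefficient of
  $e^\alpha_{ij} \otimes e^\beta_{kl}$ in $W_{23} W_{13}$ is $u^\beta_{kl} u^\alpha_{ij}$.
\<close>

definition dual_comult ::
    "('i \<Rightarrow> 'a::complex_star_algebra mat) \<Rightarrow> ('i family \<Rightarrow> ('i \<times> 'i) family) \<Rightarrow> bool" where
  "dual_comult u \<Delta> \<longleftrightarrow>
     (let n = irr_dim u in
      normal_star_hom n (sq_dim n) \<Delta> \<and>
      (\<forall>\<alpha> \<beta>. \<forall>i<n \<alpha>. \<forall>j<n \<alpha>. \<forall>k<n \<beta>. \<forall>l<n \<beta>.
         has_leg n (\<lambda>x. \<Delta> x (\<alpha>, \<beta>) $$ (i * n \<beta> + k, j * n \<beta> + l)) u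
           (u \<beta> $$ (k, l) * u \<alpha> $$ (i, j))))"

text \<open>
  The antipode \<open>S\<close> of $(\ell^\infty(\Gamma), \Delta)$ is given on $c_{00}(\Gamma)$ by
  $(S \otimes \mathrm{id})(W^{*}) = W$. Since $(\mathrm{id} \otimes S_{\mathbb{G}})(W) = W^{*}$, it
  satisfies $S^2(x)_\alpha = \rho_\alpha^{-1} x_\alpha \rho_\alpha$, so that the scaling group is
  $\tau_t(x)_\alpha = \rho_\alpha^{-it} x_\alpha \rho_\alpha^{it}$. The unitary antipode is the
  *-antiautomorphism \<open>R\<close> in the polar decomposition $S = R \tau_{-i/2}$, where
  $\tau_{-i/2}(x)_\alpha = \rho_\alpha^{-1/2} x_\alpha \rho_\alpha^{1/2}$. Below
  $r_\alpha = \rho_\alpha^{1/2}$ and $s_\alpha = \rho_\alpha^{-1/2}$.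
\<close>

definition unitary_antipode ::
    "('i \<Rightarrow> 'a::complex_star_algebra mat) \<Rightarrow> ('i \<Rightarrow> complex mat) \<Rightarrow> ('i family \<Rightarrow> 'i family) \<Rightarrow> bool" where
  "unitary_antipode u \<rho> R \<longleftrightarrow>
     (let n = irr_dim u in
      star_antiautomorphism n R \<and>
      (\<exists>r s. (\<forall>\<alpha>. positive_definite (r \<alpha>) \<and> r \<alpha> * r \<alpha> = \<rho> \<alpha> \<and>
                 inverts_mat (r \<alpha>) (s \<alpha>) \<and> inverts_mat (s \<alpha>) (r \<alpha>)) \<and>
         (\<forall>\<beta>. \<forall>k<n \<beta>. \<forall>l<n \<beta>.
            has_leg n (\<lambda>x. R (s *\<^sub>f x *\<^sub>f r) \<beta> $$ (k, l)) (\<lambda>\<alpha>. star_mat (u \<alpha>))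
              (u \<beta> $$ (k, l)))))"

locale discrete_quantum_group = compact_quantum_group \<Delta>G \<epsilon>G SG
  for \<Delta>G :: "'a::complex_star_algebra \<Rightarrow> ('a, 'a) tensor" and \<epsilon>G SG +
  fixes u :: "'i \<Rightarrow> 'a mat"
    and \<rho> :: "'i \<Rightarrow> complex mat"
    and \<Delta> :: "'i family \<Rightarrow> ('i \<times> 'i) family"
    and R :: "'i family \<Rightarrow> 'i family"
  assumes irr: "irr_representatives \<Delta>G u"
    and modular: "modular_matrix SG (u \<alpha>) (\<rho> \<alpha>)"
    and comult: "dual_comult u \<Delta>"
    and antipode: "unitary_antipode u \<rho> R"

text \<open>
  The right Haar weight is only needed on $c_{00}(\Gamma)$, where the sum is finite;
  \<open>haar_sq\<close> is its tensor square.
\<close>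

definition haar :: "('i \<Rightarrow> complex mat) \<Rightarrow> 'i family \<Rightarrow> complex" where
  "haar \<rho> x = (\<Sum>\<alpha>\<in>supp (\<lambda>\<alpha>. dim_row (\<rho> \<alpha>)) x. mat_trace (\<rho> \<alpha>) * mat_trace (\<rho> \<alpha> * x \<alpha>))"

definition haar_sq :: "('i \<Rightarrow> complex mat) \<Rightarrow> ('i \<times> 'i) family \<Rightarrow> complex" where
  "haar_sq \<rho> X =
     (\<Sum>(\<alpha>, \<beta>)\<in>supp (sq_dim (\<lambda>\<alpha>. dim_row (\<rho> \<alpha>))) X.
        mat_trace (\<rho> \<alpha>) * mat_trace (\<rho> \<beta>) * mat_trace (kron (\<rho> \<alpha>) (\<rho> \<beta>) * X (\<alpha>, \<beta>)))"

definition convolution ::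
    "('i \<Rightarrow> nat) \<Rightarrow> ('i \<Rightarrow> complex mat) \<Rightarrow> ('i family \<Rightarrow> ('i \<times> 'i) family) \<Rightarrow>
     'i family \<Rightarrow> 'i family \<Rightarrow> 'i family" where
  "convolution n \<rho> \<Delta> P x =
     (THE z. z \<in> c00 n \<and> (\<forall>y \<in> c00 n. haar \<rho> (y *\<^sub>f z) = haar_sq \<rho> (\<Delta> y *\<^sub>f (P \<otimes>\<^sub>f x))))"

text \<open>The convolution power is only used for exponents at least one.\<close>

definition conv_power ::
    "('i \<Rightarrow> nat) \<Rightarrow> ('i \<Rightarrow> complex mat) \<Rightarrow> ('i family \<Rightarrow> ('i \<times> 'i) family) \<Rightarrow>
     'i family \<Rightarrow> nat \<Rightarrow> 'i family" where
  "conv_power n \<rho> \<Delta> P m = (convolution n \<rho> \<Delta> P ^^ (m - 1)) P"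

definition subexponential_growth ::
    "('i \<Rightarrow> 'a::complex_star_algebra mat) \<Rightarrow> ('i \<Rightarrow> complex mat) \<Rightarrow>
     ('i family \<Rightarrow> ('i \<times> 'i) family) \<Rightarrow> ('i family \<Rightarrow> 'i family) \<Rightarrow> bool" where
  "subexponential_growth u \<rho> \<Delta> R \<longleftrightarrow>
     (let n = irr_dim u in
      \<exists>P. P \<in> c00 n \<and> projection n P \<and> R P = P \<and>
        P (trivial_index u) $$ (0, 0) = 1 \<and>
        (\<forall>q. projection n q \<and>
           (\<forall>m\<ge>1. proj_le (range_projection n (conv_power n \<rho> \<Delta> P m)) q) \<longrightarrow> q = fam_one n) \<and>
        (\<lambda>m. root m (Re (haar \<rho> (range_projection n (conv_power n \<rho> \<Delta> P m))))) \<longlonglongrightarrow> 1)"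

definition amenable ::
    "('i \<Rightarrow> 'a::complex_star_algebra mat) \<Rightarrow> ('i family \<Rightarrow> ('i \<times> 'i) family) \<Rightarrow> bool" where
  "amenable u \<Delta> \<longleftrightarrow>
     (let n = irr_dim u in
      \<exists>\<mu>. state_on n \<mu> \<and>
        (\<forall>\<omega>. normal_functional n \<omega> \<longrightarrow>
           (\<forall>x \<in> linf n. \<mu> (slice n \<omega> (\<Delta> x)) = \<omega> (fam_one n) * \<mu> x)))"

end

theory Submission
  imports Defs "HOL-Analysis.Function_Topology" "HOL-Analysis.Topology_Euclidean_Space" "HOL-Analysis.L2_Norm"
    "HOL-Analysis.Uniform_Limit"
begin

text \<open>
  Convolution is multiplication in disguise. For $z \in c_{00}(\Gamma)$ let
  $F(z) = \sum_\gamma \mathrm{Tr}(\rho_\gamma) \sum_{i,j,s} (z_\gamma)_{js} (\rho_\gamma)_{si}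
  u^\gamma_{ij}$. Then $F(P \ast x) = F(x) F(P)$, the counit of $\mathbb{G}$ satisfies
  $\varepsilon(F(z)) = \widehat{h_R}(z)$, and $\langle F(z), F(w) \rangle = \widehat{h_R}(w z^{*})$
  for the inner product $\langle a, b \rangle = h(S^2(a^{*}) b)$ given by the Haar state $h$. Put
  $p = F(P)$, $\tau = \widehat{h_R}(P)$ and $q_m = [P^{\ast m}]$. The Cauchy-Schwarz inequality yields
  $\tau^m = \langle F(q_m), p^m \rangle \le \widehat{h_R}(q_m)^{1/2} \|p^m\|$. Left
  multiplication by $p$ has norm at most $\tau$, and subexponential growth forces equality, so
  there are unit vectors $a_k$ with $\|p a_k\| \to \tau$. By a quantitative form of the equality case
  (\<open>defect_identity\<close>) the columns of $P$ act on $a_k$ asymptotically by scalars; because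
  the component of $P$ at the trivial representation is $1$, these scalars are given by the counit.

  The elements $b$ with $\|b a_k - \varepsilon(b) a_k\| \to 0$ form a subalgebra. Applying
  $\Delta_{\mathbb{G}}$ to $p^m$ shows that this subalgebra contains the coefficients
  $\sum_j v_j u^\gamma_{kj}$ for all $v$ in the range of $P^{\ast m}$; since $\bigvee_m q_m = 1$, it is
  the whole algebra spanned by the coefficients. A cluster point of the vector states of
  $\ell^\infty(\Gamma)$ at $a_k^{*}$ is then an invariant mean.
\<close>

hide_const (open) Finite_Cartesian_Product.mat Finite_Cartesian_Product.vec Finite_Cartesian_Product.row
hide_type (open) Finite_Cartesian_Product.vec

section \<open>Preliminaries\<close>

text \<open>Nontrivial \<open>rho\<close> is the main obstacle. For the untwisted form
  \<open>hG (star a * b)\<close> every unitary u is isometric, but a Cauchy-Schwarz estimate of p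
  pairs \<open>rho\<close> v with v for each column v of P and misses the constant \<tau>, without
  which growth gives nothing. Inserting S^2 makes u isometric for a form weighted by
  \<open>rho\<close>, and the weighted lengths of the columns of P add up to exactly \<tau>. The
  same twist puts \<open>rho\<close> on the row index of the adjoints, so that families in
  \<open>linf\<close> act on the column index with their own operator norm. The price is that
  pairing with F(q) needs q as a right support, which is why self-adjointness of the powers of p
  enters.

  The starting data are purely algebraic. The Haar functional has to be prescribed on coefficients,
  so their linear independence must be proved without it, and its positivity is a consequence of the
  orthogonality relations. Growth enters only through the norm of p, in the manner of Kesten's
  criterion.\<close>

lemma clinear_add: "clinear f \<Longrightarrow> f (x + y) = f x + f y"
  and clinear_scale: "clinear f \<Longrightarrow> f (c *\<^sub>C x) = c *\<^sub>C f x"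
  by (auto simp: clinear_def)

lemma clinear_scale_complex: "clinear f \<Longrightarrow> f (c *\<^sub>C x) = c * f x" for f :: "_ \<Rightarrow> complex"
  by (simp add: clinear_scale scaleC_complex_def)

lemma clinear_sum: "clinear f \<Longrightarrow> f (sum g A) = (\<Sum>i\<in>A. f (g i))"
  by (induction A rule: infinite_finite_induct) (auto simp: clinear_zero clinear_add)

lemma clinear_iff_linear: "clinear f \<longleftrightarrow> Vector_Spaces.linear scaleC scaleC f"
proof
  assume "clinear f"
  then show "Vector_Spaces.linear scaleC scaleC f"
    by unfold_locales (auto simp: clinear_def)
next
  assume "Vector_Spaces.linear scaleC scaleC f"
  then interpret Vector_Spaces.linear scaleC scaleC f .
  show "clinear f" by (simp add: clinear_def add scale)
qed

lemma clinear_minus: "clinear f \<Longrightarrow> f (x - y) = f x - f y"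
  using clinear_add[of f "x - y" y] by (simp add: algebra_simps)

lemma scaleC_sum_right: "c *\<^sub>C (\<Sum>i\<in>A. g i) = (\<Sum>i\<in>A. c *\<^sub>C (g i :: 'a::complex_space))"
  by (induction A rule: infinite_finite_induct) (auto simp: scaleC_add_right)

lemma scaleC_sum_left: "(\<Sum>i\<in>A. g i) *\<^sub>C (x :: 'a::complex_space) = (\<Sum>i\<in>A. g i *\<^sub>C x)"
  by (induction A rule: infinite_finite_induct) (auto simp: scaleC_add_left)

lemma star_zero [simp]: "star (0::'a::complex_star_algebra) = 0"
  using star_add[of "0::'a" 0] by simp

lemma star_one [simp]: "star (1::'a::complex_star_algebra) = 1"
proof -
  have "star (star (1::'a)) * star 1 = star (star 1)"
    by (metis mult_1_left star_mult star_star)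
  then show ?thesis by (simp add: star_star)
qed

lemma star_sum: "star (\<Sum>i\<in>A. g i) = (\<Sum>i\<in>A. star (g i :: 'a::complex_star_algebra))"
  by (induction A rule: infinite_finite_induct) (auto simp: star_add)

lemma star_minus: "star (x - y) = star x - star (y :: 'a::complex_star_algebra)"
  using star_add[of "x - y" y] by (simp add: algebra_simps)

lemma sum_delta_times:
  fixes g :: "nat \<Rightarrow> 'b::semiring_0"
  assumes "j < (m::nat)"
  shows "(\<Sum>i<m. (if i = j then c else 0) * g i) = c * g j"
    and "(\<Sum>i<m. (if j = i then c else 0) * g i) = c * g j"
    and "(\<Sum>i<m. g i * (if i = j then c else 0)) = g j * c"
    and "(\<Sum>i<m. g i * (if j = i then c else 0)) = g j * c"
  using assms by (auto simp: if_distrib[of "\<lambda>x. _ * x"] if_distrib[of "\<lambda>x. x * _"] cong: if_cong)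

lemma sum_delta_scaleC:
  fixes g :: "nat \<Rightarrow> 'b::complex_space"
  assumes "j < (m::nat)"
  shows "(\<Sum>i<m. (if i = j then c else 0) *\<^sub>C g i) = c *\<^sub>C g j"
    and "(\<Sum>i<m. (if j = i then c else 0) *\<^sub>C g i) = c *\<^sub>C g j"
  using assms by (auto simp: if_distrib[of "\<lambda>x. x *\<^sub>C _"] cong: if_cong)

lemma sum_mult_split:
  fixes f :: "nat \<Rightarrow> 'b::comm_monoid_add"
  shows "(\<Sum>r<a * b. f r) = (\<Sum>i<a. \<Sum>k<b. f (i * b + k))"
proof -
  have "(\<Sum>r<a * b. f r) = (\<Sum>i<a. sum f {i * b..<i * b + b})"
    by (rule sum.nat_group[symmetric])
  moreover have "sum f {i * b..<i * b + b} = (\<Sum>k<b. f (i * b + k))" for i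
    using sum.shift_bounds_nat_ivl[of f 0 "i * b" b] by (simp add: lessThan_atLeast0 add.commute)
  ultimately show ?thesis by simp
qed

lemma sum_swap3:
  fixes f :: "_ \<Rightarrow> _ \<Rightarrow> _ \<Rightarrow> 'b::comm_monoid_add"
  shows "(\<Sum>i\<in>A. \<Sum>j\<in>B. \<Sum>k\<in>C. f i j k) = (\<Sum>k\<in>C. \<Sum>j\<in>B. \<Sum>i\<in>A. f i j k)"
proof -
  have "(\<Sum>i\<in>A. \<Sum>j\<in>B. \<Sum>k\<in>C. f i j k) = (\<Sum>i\<in>A. \<Sum>k\<in>C. \<Sum>j\<in>B. f i j k)"
    by (rule sum.cong[OF refl], rule sum.swap)
  also have "\<dots> = (\<Sum>k\<in>C. \<Sum>i\<in>A. \<Sum>j\<in>B. f i j k)"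
    by (rule sum.swap)
  also have "\<dots> = (\<Sum>k\<in>C. \<Sum>j\<in>B. \<Sum>i\<in>A. f i j k)"
    by (rule sum.cong[OF refl], rule sum.swap)
  finally show ?thesis .
qed

subsection \<open>Tensor products\<close>

lemma tensor_lift_tensor [simp]: "cbilinear f \<Longrightarrow> tensor_lift f (a \<otimes>\<^sub>t b) = f a b"
  using tensor_lift_abs[of f "[(a, b)]"] by (simp add: tensor.abs_eq)

lemma clinear_tensor_lift:
  fixes f :: "'b::complex_space \<Rightarrow> 'c::complex_space \<Rightarrow> 'd::complex_space"
  shows "cbilinear f \<Longrightarrow> clinear (tensor_lift f)"
  unfolding clinear_def
proof (intro conjI allI)
  fix s t :: "('b, 'c) tensor" and c
  assume f: "cbilinear f"
  obtain xs where xs: "s = abs_tensor xs" by (metis Quotient3_abs_rep Quotient3_tensor)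
  obtain ys where ys: "t = abs_tensor ys" by (metis Quotient3_abs_rep Quotient3_tensor)
  show "tensor_lift f (s + t) = tensor_lift f s + tensor_lift f t"
    by (simp add: xs ys plus_tensor.abs_eq tensor_lift_abs[OF f])
  show "tensor_lift f (c *\<^sub>C s) = c *\<^sub>C tensor_lift f s"
    by (simp add: xs scaleC_tensor.abs_eq tensor_lift_abs[OF f] bil_sum_scale_left[OF f])
qed

lemma tensor_mult: "(a \<otimes>\<^sub>t b) * (c \<otimes>\<^sub>t d) = (a * c) \<otimes>\<^sub>t (b * d)"
  by transfer (simp add: tensor_eq_def list_mult_def)

lemma tensor_star: "star (a \<otimes>\<^sub>t b) = star a \<otimes>\<^sub>t star b"
  by transfer (simp add: tensor_eq_def)

lemma tensor_add_left: "(a + a') \<otimes>\<^sub>t b = a \<otimes>\<^sub>t b + a' \<otimes>\<^sub>t b"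
  and tensor_add_right: "a \<otimes>\<^sub>t (b + b') = a \<otimes>\<^sub>t b + a \<otimes>\<^sub>t b'"
  and tensor_scale_left: "(c *\<^sub>C a) \<otimes>\<^sub>t b = c *\<^sub>C (a \<otimes>\<^sub>t b)"
  and tensor_scale_right: "a \<otimes>\<^sub>t (c *\<^sub>C b) = c *\<^sub>C (a \<otimes>\<^sub>t b)"
  by (transfer, auto simp: tensor_eq_def cbilinear_def clinear_def)+

lemma cbilinear_tensor: "cbilinear (\<otimes>\<^sub>t)"
  by (simp add: cbilinear_def clinear_def tensor_add_left tensor_add_right
      tensor_scale_left tensor_scale_right)

subsection \<open>Orthogonal projections in finite dimension\<close>

text \<open>Gram-Schmidt by induction on the coordinates: the members of L vanishing at the new
  coordinate b form a subspace of codimension at most one, to which the induction hypothesis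
  applies. Only values on B enter the inner product, so L may consist of functions on the whole
  type, and E is determined on B only.\<close>

lemma orthogonal_decomposition:
  fixes L :: "('b \<Rightarrow> complex) set"
  assumes "finite B"
    and "(\<lambda>_. 0) \<in> L"
    and "\<And>x y. x \<in> L \<Longrightarrow> y \<in> L \<Longrightarrow> (\<lambda>b. x b + y b) \<in> L"
    and "\<And>c x. x \<in> L \<Longrightarrow> (\<lambda>b. c * x b) \<in> L"
  shows "\<exists>E\<in>L. \<forall>x\<in>L. (\<Sum>b\<in>B. (D b - E b) * cnj (x b)) = 0"
  using assms
proof (induction B arbitrary: L D rule: finite_induct)
  case empty
  then show ?case by auto
next
  case (insert b B)
  define ip where "ip x y = (\<Sum>b\<in>insert b B. x b * cnj (y b))" for x y :: "'b \<Rightarrow> complex"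
  have ip_add: "ip (\<lambda>b. x b + y b) z = ip x z + ip y z"
    and ip_add2: "ip z (\<lambda>b. x b + y b) = ip z x + ip z y"
    and ip_scale: "ip (\<lambda>b. c * x b) z = c * ip x z"
    and ip_scale2: "ip z (\<lambda>b. c * x b) = cnj c * ip z x" for x y z c
    by (auto simp: ip_def algebra_simps sum.distrib sum_distrib_left)
  define L0 where "L0 = {x \<in> L. x b = 0}"
  have IH: "\<exists>E\<in>L0. \<forall>x\<in>L0. ip (\<lambda>b. D b - E b) x = 0" for D
  proof -
    have "\<exists>E\<in>L0. \<forall>x\<in>L0. (\<Sum>b\<in>B. (D b - E b) * cnj (x b)) = 0"
      by (rule insert.IH) (use insert.prems in \<open>auto simp: L0_def\<close>)
    then show ?thesis
      using insert.hyps by (auto simp: ip_def L0_def)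
  qed
  obtain E where E: "E \<in> L0" "\<And>x. x \<in> L0 \<Longrightarrow> ip (\<lambda>b. D b - E b) x = 0"
    using IH by blast
  show ?case
  proof (cases "L0 = L")
    case True
    then show ?thesis using E by (auto simp: ip_def)
  next
    case False
    then obtain w where w: "w \<in> L" "w b \<noteq> 0" by (auto simp: L0_def)
    obtain w1 where w1: "w1 \<in> L0" "\<And>x. x \<in> L0 \<Longrightarrow> ip (\<lambda>b. w b - w1 b) x = 0"
      using IH by blast
    \<comment> \<open>Subtracting from w its projection to L0 gives a vector orthogonal to L0 whose
      value at b is still nonzero; L is therefore L0 plus the multiples of v.\<close>
    define v where "v = (\<lambda>b. w b + (-1) * w1 b)"
    have v: "v \<in> L" "v b \<noteq> 0" and v0: "\<And>x. x \<in> L0 \<Longrightarrow> ip v x = 0"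
      using w w1 insert.prems(2)[OF w(1) insert.prems(3)[of w1 "-1"]] by (auto simp: L0_def v_def)
    have vv: "ip v v \<noteq> 0"
    proof -
      have "ip v v = of_real (\<Sum>b\<in>insert b B. (cmod (v b))\<^sup>2)"
        by (simp add: ip_def complex_mult_cnj cmod_def)
      moreover have "(\<Sum>b\<in>insert b B. (cmod (v b))\<^sup>2) > 0"
        using insert.hyps v by (intro sum_pos2[of _ b]) auto
      ultimately show ?thesis by (metis less_irrefl of_real_eq_0_iff)
    qed
    define c where "c = ip (\<lambda>b. D b - E b) v / ip v v"
    define E' where "E' = (\<lambda>b. E b + c * v b)"
    have "E' \<in> L" unfolding E'_def
      using E(1) v insert.prems by (auto simp: L0_def)
    moreover have "ip (\<lambda>b. D b - E' b) x = 0" if x: "x \<in> L" for x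
    proof -
      define x0 where "x0 = (\<lambda>b. x b + (- (x b / v b)) * v b)" for b :: 'b
      define y where "y = (\<lambda>a. x a + (- (x b / v b)) * v a)"
      have y: "y \<in> L0"
        using x v insert.prems(2)[OF x insert.prems(3)[OF v(1), of "- (x b / v b)"]]
        by (simp add: L0_def y_def)
      have x_eq: "x = (\<lambda>a. y a + (x b / v b) * v a)" by (auto simp: y_def)
      have D: "(\<lambda>a. D a - E' a) = (\<lambda>a. (D a - E a) + (-c) * v a)" by (auto simp: E'_def)
      have "ip (\<lambda>b. D b - E' b) y = 0"
        unfolding D ip_add ip_scale using E(2)[OF y] v0[OF y] by simp
      moreover have "ip (\<lambda>b. D b - E' b) v = 0"
        unfolding D ip_add ip_scale using vv by (simp add: c_def)
      ultimately show ?thesis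
        by (subst x_eq) (simp only: ip_add2 ip_scale2, simp)
    qed
    ultimately show ?thesis by (auto simp: ip_def)
  qed
qed

subsection \<open>Uniformly bounded families of matrices\<close>

text \<open>The constant C bounds the square of the operator norm, uniformly over all blocks; hence
  the \<open>sqrt C\<close> in the later norm estimates. Entries are functions, so that families
  without a matrix representation at hand can be treated too.\<close>

definition op_bounded :: "('k \<Rightarrow> nat) \<Rightarrow> real \<Rightarrow> ('k \<Rightarrow> nat \<Rightarrow> nat \<Rightarrow> complex) \<Rightarrow> bool" where
  "op_bounded n C g \<longleftrightarrow> (\<forall>\<gamma> x. (\<Sum>l<n \<gamma>. (cmod (\<Sum>q<n \<gamma>. g \<gamma> l q * x q))\<^sup>2) \<le> C * (\<Sum>q<n \<gamma>. (cmod (x q))\<^sup>2))"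

subsection \<open>Generalised limits\<close>

text \<open>Tychonoff in place of a Banach limit: the pointwise bounds put the sequence into a
  compact product of discs, so a cluster point l exists, and F is \<open>sequentially\<close>
  refined by the preimages of the neighbourhoods of l. Being finer than \<open>sequentially\<close>,
  F preserves ordinary limits.\<close>

lemma pointwise_convergent_filter:
  fixes m :: "nat \<Rightarrow> 'x \<Rightarrow> complex"
  assumes "\<And>x. x \<in> X \<Longrightarrow> \<exists>B. \<forall>k. cmod (m k x) \<le> B"
  shows "\<exists>F l. F \<noteq> bot \<and> F \<le> sequentially \<and> (\<forall>x\<in>X. ((\<lambda>k. m k x) \<longlongrightarrow> l x) F)"
proof -
  obtain B where B: "\<And>x k. x \<in> X \<Longrightarrow> cmod (m k x) \<le> B x" using assms by metis
  \<comment> \<open>Outside X, where no bound is given, the value 0 keeps every factor of the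
    product compact.\<close>
  define m' where "m' k x = (if x \<in> X then m k x else 0)" for k x
  define K where "K = (\<Pi>\<^sub>E x\<in>UNIV. cball (0::complex) (if x \<in> X then B x else 0))"
  have "compactin (product_topology (\<lambda>_. euclidean) UNIV) K"
    unfolding K_def by (subst compactin_PiE) simp
  then have K: "compact K"
    by (simp add: euclidean_product_topology)
  have "\<forall>\<^sub>F x in filtermap m' sequentially. x \<in> K"
    by (auto simp: eventually_filtermap K_def m'_def B PiE_iff)
  moreover have "filtermap m' sequentially \<noteq> bot" by (simp add: filtermap_bot_iff)
  ultimately obtain l where l: "inf (nhds l) (filtermap m' sequentially) \<noteq> bot"
    using K unfolding compact_filter by blast
  define F where "F = inf (filtercomap m' (nhds l)) sequentially"
  have "F \<noteq> bot"
  proof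
    assume "F = bot"
    then have "eventually (\<lambda>_. False) F" by simp
    then obtain P Q where PQ: "eventually P (filtercomap m' (nhds l))" "eventually Q sequentially"
      "\<And>k. P k \<Longrightarrow> Q k \<Longrightarrow> False"
      unfolding F_def eventually_inf by blast
    obtain P' where P': "eventually P' (nhds l)" "\<And>k. P' (m' k) \<Longrightarrow> P k"
      using PQ(1) unfolding eventually_filtercomap by blast
    have "eventually (\<lambda>y. \<not> P' y) (filtermap m' sequentially)"
      unfolding eventually_filtermap by (rule eventually_mono[OF PQ(2)]) (use PQ(3) P'(2) in blast)
    then have "eventually (\<lambda>_. False) (inf (nhds l) (filtermap m' sequentially))"
      unfolding eventually_inf using P'(1) by blast
    then show False using l by (simp add: eventually_False)
  qed
  moreover have "F \<le> sequentially" by (simp add: F_def)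
  moreover have "((\<lambda>k. m k x) \<longlongrightarrow> l x) F" if "x \<in> X" for x
  proof -
    have "filterlim m' (nhds l) F"
      unfolding filterlim_def F_def
      by (rule order_trans[OF filtermap_mono[OF inf_le1] filtermap_filtercomap])
    moreover have "filterlim (\<lambda>f. f x) (nhds (l x)) (nhds l)"
    proof (rule topological_tendstoI)
      fix S :: "complex set" assume S: "open S" "l x \<in> S"
      have "open ((\<lambda>f. f x) -` S)"
        by (rule open_vimage[OF S(1)]) simp
      then have "eventually (\<lambda>f. f \<in> (\<lambda>f. f x) -` S) (nhds l)"
        using S(2) by (intro eventually_nhds_in_open) auto
      then show "eventually (\<lambda>f. f x \<in> S) (nhds l)" by simp
    qed
    ultimately have "((\<lambda>k. m' k x) \<longlongrightarrow> l x) F"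
      using filterlim_compose by blast
    then show ?thesis using that by (simp add: m'_def)
  qed
  ultimately show ?thesis by blast
qed

text \<open>Dominated convergence for unordered sums: the Weierstrass test makes the finite partial
  sums converge uniformly in k, so the two limits may be exchanged.\<close>

lemma infsum_tendsto_zero:
  fixes a :: "nat \<Rightarrow> 'p \<Rightarrow> complex"
  assumes "\<And>k p. cmod (a k p) \<le> M p" and "M summable_on UNIV" and lim: "\<And>p. (\<lambda>k. a k p) \<longlonglongrightarrow> 0"
  shows "(\<lambda>k. \<Sum>\<^sub>\<infinity>p. a k p) \<longlonglongrightarrow> 0"
proof (rule swap_uniform_limit'[where F = "finite_subsets_at_top UNIV" and g = "\<lambda>_. 0" and S = UNIV])
  show "uniform_limit UNIV (\<lambda>X k. \<Sum>p\<in>X. a k p) (\<lambda>k. \<Sum>\<^sub>\<infinity>p. a k p) (finite_subsets_at_top UNIV)"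
    by (rule Weierstrass_m_test_general[OF assms(1,2)])
  show "\<forall>\<^sub>F X in finite_subsets_at_top UNIV. (\<lambda>k. \<Sum>p\<in>X. a k p) \<longlonglongrightarrow> 0"
    by (intro always_eventually allI tendsto_null_sum lim)
qed simp_all

subsection \<open>Vectors and matrices as functions\<close>

lemma cauchy_schwarz_sum:
  fixes x y :: "nat \<Rightarrow> complex"
  shows "(cmod (\<Sum>i<m. x i * y i))\<^sup>2 \<le> (\<Sum>i<m. (cmod (x i))\<^sup>2) * (\<Sum>i<m. (cmod (y i))\<^sup>2)"
proof -
  have "cmod (\<Sum>i<m. x i * y i) \<le> (\<Sum>i<m. cmod (x i) * cmod (y i))"
    by (rule order_trans[OF norm_sum]) (simp add: norm_mult)
  also have "\<dots> \<le> sqrt ((\<Sum>i<m. (cmod (x i))\<^sup>2) * (\<Sum>i<m. (cmod (y i))\<^sup>2))"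
    using L2_set_mult_ineq[of "\<lambda>i. cmod (x i)" "\<lambda>i. cmod (y i)" "{..<m}"]
    by (simp add: L2_set_def real_sqrt_mult)
  finally have "(cmod (\<Sum>i<m. x i * y i))\<^sup>2 \<le> (sqrt ((\<Sum>i<m. (cmod (x i))\<^sup>2) * (\<Sum>i<m. (cmod (y i))\<^sup>2)))\<^sup>2"
    by (rule power_mono) simp
  then show ?thesis by (simp add: sum_nonneg)
qed

lemma index_mult_mat_sum:
  assumes "A \<in> carrier_mat a b" "B \<in> carrier_mat b c" "i < a" "j < c"
  shows "(A * B) $$ (i, j) = (\<Sum>k<b. A $$ (i, k) * B $$ (k, j))"
  using assms by (simp add: scalar_prod_def lessThan_atLeast0)

lemma index_mult_mat_vec_sum:
  assumes "A \<in> carrier_mat a b" "v \<in> carrier_vec b" "i < a"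
  shows "(A *\<^sub>v v) $ i = (\<Sum>k<b. A $$ (i, k) * v $ k)"
  using assms by (simp add: scalar_prod_def lessThan_atLeast0)

lemma cscalar_prod_sum:
  assumes "v \<in> carrier_vec m" "w \<in> carrier_vec m"
  shows "v \<bullet>c w = (\<Sum>i<m. v $ i * cnj (w $ i))"
  using assms by (simp add: scalar_prod_def lessThan_atLeast0)

lemma cscalar_prod_self:
  assumes "v \<in> carrier_vec m"
  shows "v \<bullet>c v = of_real (\<Sum>i<m. (cmod (v $ i))\<^sup>2)"
  unfolding cscalar_prod_sum[OF assms assms] of_real_sum complex_norm_square ..

lemma index_mat_adjoint:
  assumes "A \<in> carrier_mat a b" "i < b" "j < a"
  shows "mat_adjoint A $$ (i, j) = cnj (A $$ (j, i))"
  using assms unfolding mat_adjoint_def by (simp add: mat_of_rows_def)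

lemma carrier_mat_adjoint: "A \<in> carrier_mat a b \<Longrightarrow> mat_adjoint A \<in> carrier_mat b a"
  unfolding mat_adjoint_def by (auto simp: mat_of_rows_def)

definition entries :: "'k family \<Rightarrow> 'k \<Rightarrow> nat \<Rightarrow> nat \<Rightarrow> complex" where
  "entries x = (\<lambda>\<gamma> i j. x \<gamma> $$ (i, j))"

text \<open>Both scalar products are real, so the order on complex numbers reduces to that on the
  reals. From here on bounds concern entries, with arbitrary functions in place of vectors.\<close>

lemma linf_bound_iff:
  assumes "x \<in> families n"
  shows "(\<forall>k. \<forall>v \<in> carrier_vec (n k). (x k *\<^sub>v v) \<bullet>c (x k *\<^sub>v v) \<le> complex_of_real C * (v \<bullet>c v))
    \<longleftrightarrow> op_bounded n C (entries x)"
proof -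
  have x: "x k \<in> carrier_mat (n k) (n k)" for k using assms by (simp add: families_def)
  have iff: "(x k *\<^sub>v v) \<bullet>c (x k *\<^sub>v v) \<le> complex_of_real C * (v \<bullet>c v)
    \<longleftrightarrow> (\<Sum>l<n k. (cmod (\<Sum>q<n k. entries x k l q * v $ q))\<^sup>2) \<le> C * (\<Sum>q<n k. (cmod (v $ q))\<^sup>2)"
    if v: "v \<in> carrier_vec (n k)" for k v
  proof -
    have "(\<Sum>l<n k. (cmod (\<Sum>q<n k. entries x k l q * v $ q))\<^sup>2) = (\<Sum>l<n k. (cmod ((x k *\<^sub>v v) $ l))\<^sup>2)"
      by (intro sum.cong refl) (simp add: index_mult_mat_vec_sum[OF x v] entries_def)
    moreover have "x k *\<^sub>v v \<in> carrier_vec (n k)" using x[of k] v by simp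
    ultimately show ?thesis
      by (simp add: cscalar_prod_self[OF v] cscalar_prod_self[of "x k *\<^sub>v v"] less_eq_complex_def
          flip: of_real_mult)
  qed
  show ?thesis
  proof
    assume L: "\<forall>k. \<forall>v \<in> carrier_vec (n k). (x k *\<^sub>v v) \<bullet>c (x k *\<^sub>v v) \<le> complex_of_real C * (v \<bullet>c v)"
    show "op_bounded n C (entries x)" unfolding op_bounded_def
    proof (intro allI)
      fix k and y :: "nat \<Rightarrow> complex"
      have "vec (n k) y \<in> carrier_vec (n k)" by simp
      then show "(\<Sum>l<n k. (cmod (\<Sum>q<n k. entries x k l q * y q))\<^sup>2) \<le> C * (\<Sum>q<n k. (cmod (y q))\<^sup>2)"
        using L iff[of "vec (n k) y" k] by simp
    qed
  next
    assume "op_bounded n C (entries x)"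
    then show "\<forall>k. \<forall>v \<in> carrier_vec (n k). (x k *\<^sub>v v) \<bullet>c (x k *\<^sub>v v) \<le> complex_of_real C * (v \<bullet>c v)"
      using iff by (simp add: op_bounded_def)
  qed
qed

lemma op_bounded_mono: "op_bounded n C g \<Longrightarrow> C \<le> D \<Longrightarrow> op_bounded n D g"
  unfolding op_bounded_def by (meson mult_right_mono order_trans sum_nonneg zero_le_power2)

lemma linf_iff: "x \<in> linf n \<longleftrightarrow> x \<in> families n \<and> (\<exists>C\<ge>0. op_bounded n C (entries x))"
proof -
  have "(\<exists>C\<ge>0. op_bounded n C (entries x)) \<longleftrightarrow> (\<exists>C. op_bounded n C (entries x))"
    using op_bounded_mono[of n _ "entries x"] by (metis linorder_linear)
  then show ?thesis using linf_bound_iff[of x n] by (auto simp: linf_def)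
qed

lemma c00_subset_linf: "x \<in> c00 n \<Longrightarrow> x \<in> linf n"
proof -
  assume x: "x \<in> c00 n"
  define S where "S = supp n x"
  have S: "finite S" using x by (simp add: c00_def S_def)
  \<comment> \<open>Squared Frobenius norms dominate squared operator norms; summed over the finite
    support they give one constant for all blocks.\<close>
  define C where "C = (\<Sum>\<gamma>\<in>S. \<Sum>l<n \<gamma>. \<Sum>q<n \<gamma>. (cmod (entries x \<gamma> l q))\<^sup>2)"
  have "op_bounded n C (entries x)" unfolding op_bounded_def
  proof (intro allI)
    fix \<gamma> and y :: "nat \<Rightarrow> complex"
    have "(\<Sum>l<n \<gamma>. (cmod (\<Sum>q<n \<gamma>. entries x \<gamma> l q * y q))\<^sup>2)
      \<le> (\<Sum>l<n \<gamma>. (\<Sum>q<n \<gamma>. (cmod (entries x \<gamma> l q))\<^sup>2) * (\<Sum>q<n \<gamma>. (cmod (y q))\<^sup>2))"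
      by (intro sum_mono cauchy_schwarz_sum)
    also have "\<dots> = (\<Sum>l<n \<gamma>. \<Sum>q<n \<gamma>. (cmod (entries x \<gamma> l q))\<^sup>2) * (\<Sum>q<n \<gamma>. (cmod (y q))\<^sup>2)"
      by (simp add: sum_distrib_right)
    also have "\<dots> \<le> C * (\<Sum>q<n \<gamma>. (cmod (y q))\<^sup>2)"
    proof (rule mult_right_mono)
      show "(\<Sum>l<n \<gamma>. \<Sum>q<n \<gamma>. (cmod (entries x \<gamma> l q))\<^sup>2) \<le> C"
      proof (cases "\<gamma> \<in> S")
        case True
        then show ?thesis unfolding C_def using S
          by (intro member_le_sum[of \<gamma> S "\<lambda>\<gamma>. \<Sum>l<n \<gamma>. \<Sum>q<n \<gamma>. (cmod (entries x \<gamma> l q))\<^sup>2"]) (auto intro!: sum_nonneg)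
      next
        case False
        then have "(\<Sum>l<n \<gamma>. \<Sum>q<n \<gamma>. (cmod (entries x \<gamma> l q))\<^sup>2) = 0"
          by (simp add: S_def supp_def entries_def)
        then show ?thesis by (simp add: C_def sum_nonneg)
      qed
    qed (simp add: sum_nonneg)
    finally show "(\<Sum>l<n \<gamma>. (cmod (\<Sum>q<n \<gamma>. entries x \<gamma> l q * y q))\<^sup>2) \<le> C * (\<Sum>q<n \<gamma>. (cmod (y q))\<^sup>2)" .
  qed
  moreover have "0 \<le> C" by (simp add: C_def sum_nonneg)
  ultimately show ?thesis using x by (auto simp: linf_iff c00_def)
qed

lemma mat_unit_c00: "mat_unit n \<gamma> i j \<in> c00 n"
proof -
  have "supp n (mat_unit n \<gamma> i j) \<subseteq> {\<gamma>}"
    by (auto simp: supp_def mat_unit_def intro!: eq_matI)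
  then have "finite (supp n (mat_unit n \<gamma> i j))" by (rule finite_subset) simp
  then show ?thesis by (simp add: c00_def families_def mat_unit_def)
qed

text \<open>Nested conditionals instead of a conjunction let the inner and the outer sum collapse
  one after the other.\<close>

lemma entries_mat_unit:
  "a < n \<alpha> \<Longrightarrow> b < n \<alpha> \<Longrightarrow> entries (mat_unit n \<gamma> i j) \<alpha> a b = (if \<alpha> = \<gamma> then if a = i then if b = j then 1 else 0 else 0 else 0)"
  by (simp add: entries_def mat_unit_def)

lemma fam_one_linf: "fam_one n \<in> linf n"
proof -
  have "(\<Sum>q<n \<gamma>. entries (fam_one n) \<gamma> l q * x q) = x l" if "l < n \<gamma>" for \<gamma> l and x :: "nat \<Rightarrow> complex"
  proof -
    have "(\<Sum>q<n \<gamma>. entries (fam_one n) \<gamma> l q * x q) = (\<Sum>q<n \<gamma>. if q = l then x q else 0)"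
      using that by (intro sum.cong refl) (auto simp: entries_def fam_one_def)
    then show ?thesis using that by simp
  qed
  then have "op_bounded n 1 (entries (fam_one n))" by (simp add: op_bounded_def)
  then show ?thesis unfolding linf_iff
    by (intro conjI exI[of _ 1]) (auto simp: families_def fam_one_def)
qed

subsection \<open>Normal functionals\<close>

text \<open>A vector representation with both indices merged into p, together with a summable weight
  w dominating the product of the norms of \<open>\<xi> p\<close> and \<open>\<eta> p\<close>. The
  weight is what dominated convergence will need.\<close>

definition normal_rep ::
    "('k \<Rightarrow> nat) \<Rightarrow> ('k family \<Rightarrow> complex) \<Rightarrow> (nat \<times> 'k \<Rightarrow> nat \<Rightarrow> complex) \<Rightarrow> (nat \<times> 'k \<Rightarrow> nat \<Rightarrow> complex) \<Rightarrow>
     (nat \<times> 'k \<Rightarrow> real) \<Rightarrow> bool" where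
  "normal_rep n \<omega> \<xi> \<eta> w \<longleftrightarrow>
    w summable_on UNIV \<and> (\<forall>p. 0 \<le> w p) \<and>
    (\<forall>p. (\<Sum>i<n (snd p). (cmod (\<xi> p i))\<^sup>2) * (\<Sum>i<n (snd p). (cmod (\<eta> p i))\<^sup>2) \<le> (w p)\<^sup>2) \<and>
    (\<forall>x \<in> linf n. \<omega> x = (\<Sum>\<^sub>\<infinity>p. \<Sum>i<n (snd p). \<Sum>j<n (snd p). x (snd p) $$ (i, j) * \<xi> p j * cnj (\<eta> p i)))"

lemma normal_functional_rep:
  fixes n :: "'k \<Rightarrow> nat"
  assumes "normal_functional n \<omega>"
  shows "\<exists>\<xi> \<eta> w. normal_rep n \<omega> \<xi> \<eta> w"
proof -
  obtain \<xi> \<eta> :: "nat \<Rightarrow> 'k \<Rightarrow> complex vec" where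
    c: "\<And>m k. \<xi> m k \<in> carrier_vec (n k)" "\<And>m k. \<eta> m k \<in> carrier_vec (n k)"
    and s: "(\<lambda>(m, k). \<xi> m k \<bullet>c \<xi> m k) summable_on UNIV" "(\<lambda>(m, k). \<eta> m k \<bullet>c \<eta> m k) summable_on UNIV"
    and \<omega>: "\<And>x. x \<in> linf n \<Longrightarrow> \<omega> x = (\<Sum>\<^sub>\<infinity>(m, k). (x k *\<^sub>v \<xi> m k) \<bullet>c \<eta> m k)"
    using assms unfolding normal_functional_def by blast
  define X where "X p = (\<lambda>i. \<xi> (fst p) (snd p) $ i)" for p
  define Y where "Y p = (\<lambda>i. \<eta> (fst p) (snd p) $ i)" for p
  \<comment> \<open>The product of two norms is at most the sum of their squares, and the squares
    are summable by assumption.\<close>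
  define w where "w p = (\<Sum>i<n (snd p). (cmod (X p i))\<^sup>2) + (\<Sum>i<n (snd p). (cmod (Y p i))\<^sup>2)" for p
  have X: "(\<lambda>p. \<Sum>i<n (snd p). (cmod (X p i))\<^sup>2) summable_on UNIV"
    using summable_on_Re[OF s(1)] by (simp add: split_beta cscalar_prod_self[OF c(1)] X_def)
  have Y: "(\<lambda>p. \<Sum>i<n (snd p). (cmod (Y p i))\<^sup>2) summable_on UNIV"
    using summable_on_Re[OF s(2)] by (simp add: split_beta cscalar_prod_self[OF c(2)] Y_def)
  show ?thesis
  proof (rule exI[of _ X], rule exI[of _ Y], rule exI[of _ w], unfold normal_rep_def, intro conjI allI ballI)
    show "w summable_on UNIV" unfolding w_def by (intro summable_on_add X Y)
    show "0 \<le> w p" for p by (simp add: w_def sum_nonneg)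
    show "(\<Sum>i<n (snd p). (cmod (X p i))\<^sup>2) * (\<Sum>i<n (snd p). (cmod (Y p i))\<^sup>2) \<le> (w p)\<^sup>2" for p
    proof -
      have "a * b \<le> (a + b)\<^sup>2" if "0 \<le> a" "0 \<le> b" for a b :: real
        using that by (simp add: power2_sum)
      then show ?thesis unfolding w_def by (simp add: sum_nonneg)
    qed
    fix x assume x: "x \<in> linf n"
    then have xc: "x k \<in> carrier_mat (n k) (n k)" for k by (simp add: linf_def families_def)
    have "(case p of (m, k) \<Rightarrow> (x k *\<^sub>v \<xi> m k) \<bullet>c \<eta> m k)
      = (\<Sum>i<n (snd p). \<Sum>j<n (snd p). x (snd p) $$ (i, j) * X p j * cnj (Y p i))" for p
    proof -
      obtain m k where p: "p = (m, k)" by (cases p)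
      have "x k *\<^sub>v \<xi> m k \<in> carrier_vec (n k)" using xc[of k] c(1)[of m k] by simp
      from cscalar_prod_sum[OF this c(2)[of m k]]
      have "(x k *\<^sub>v \<xi> m k) \<bullet>c \<eta> m k = (\<Sum>i<n k. (\<Sum>j<n k. x k $$ (i, j) * \<xi> m k $ j) * cnj (\<eta> m k $ i))"
        by (simp add: index_mult_mat_vec_sum[OF xc c(1)])
      then show ?thesis by (simp add: p X_def Y_def sum_distrib_right)
    qed
    then show "\<omega> x = (\<Sum>\<^sub>\<infinity>p. \<Sum>i<n (snd p). \<Sum>j<n (snd p). x (snd p) $$ (i, j) * X p j * cnj (Y p i))"
      unfolding \<omega>[OF x] by (intro infsum_cong) simp
  qed
qed

lemma bilinear_bound:
  assumes g: "op_bounded n C g" and C: "0 \<le> C" and w: "0 \<le> w"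
    and xy: "(\<Sum>i<n \<gamma>. (cmod (x i))\<^sup>2) * (\<Sum>i<n \<gamma>. (cmod (y i))\<^sup>2) \<le> w\<^sup>2"
  shows "cmod (\<Sum>i<n \<gamma>. \<Sum>j<n \<gamma>. g \<gamma> i j * x j * cnj (y i)) \<le> sqrt C * w"
proof -
  have "(cmod (\<Sum>i<n \<gamma>. \<Sum>j<n \<gamma>. g \<gamma> i j * x j * cnj (y i)))\<^sup>2 = (cmod (\<Sum>i<n \<gamma>. (\<Sum>j<n \<gamma>. g \<gamma> i j * x j) * cnj (y i)))\<^sup>2"
    by (simp add: sum_distrib_right)
  also have "\<dots> \<le> (\<Sum>i<n \<gamma>. (cmod (\<Sum>j<n \<gamma>. g \<gamma> i j * x j))\<^sup>2) * (\<Sum>i<n \<gamma>. (cmod (cnj (y i)))\<^sup>2)"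
    by (rule cauchy_schwarz_sum)
  also have "\<dots> \<le> (C * (\<Sum>i<n \<gamma>. (cmod (x i))\<^sup>2)) * (\<Sum>i<n \<gamma>. (cmod (y i))\<^sup>2)"
    using g by (simp add: op_bounded_def mult_right_mono sum_nonneg)
  also have "\<dots> \<le> C * w\<^sup>2" using mult_left_mono[OF xy C] by (simp add: mult.assoc)
  also have "\<dots> = (sqrt C * w)\<^sup>2" using C by (simp add: power_mult_distrib)
  finally show ?thesis by (rule power2_le_imp_le) (use C w in simp)
qed

lemma normal_rep_has_sum:
  assumes rep: "normal_rep n \<omega> \<xi> \<eta> w" and x: "x \<in> linf n"
  shows "((\<lambda>p. \<Sum>i<n (snd p). \<Sum>j<n (snd p). x (snd p) $$ (i, j) * \<xi> p j * cnj (\<eta> p i)) has_sum \<omega> x) UNIV"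
proof -
  note w = rep[unfolded normal_rep_def, THEN conjunct1]
    rep[unfolded normal_rep_def, THEN conjunct2, THEN conjunct1, rule_format]
    rep[unfolded normal_rep_def, THEN conjunct2, THEN conjunct2, THEN conjunct1, rule_format]
    rep[unfolded normal_rep_def, THEN conjunct2, THEN conjunct2, THEN conjunct2, rule_format, OF x]
  obtain C where C: "0 \<le> C" "op_bounded n C (entries x)" using x unfolding linf_iff by blast
  have "cmod (\<Sum>i<n (snd p). \<Sum>j<n (snd p). x (snd p) $$ (i, j) * \<xi> p j * cnj (\<eta> p i)) \<le> sqrt C * w p" for p
    using bilinear_bound[OF C(2,1) w(2,3), of p] by (simp add: entries_def)
  then have "(\<lambda>p. \<Sum>i<n (snd p). \<Sum>j<n (snd p). x (snd p) $$ (i, j) * \<xi> p j * cnj (\<eta> p i)) summable_on UNIV"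
    by (rule abs_summable_summable[OF summable_on_comparison_test[OF summable_on_cmult_right[OF w(1)]]]) auto
  then show ?thesis unfolding w(4) by (rule has_sum_infsum)
qed

lemma sum_double_delta:
  fixes X :: "nat \<Rightarrow> nat \<Rightarrow> complex"
  assumes "i < m" "j < m"
  shows "(\<Sum>a<m. \<Sum>b<m. (if a = i then if b = j then 1 else 0 else 0) * X a b) = X i j"
proof -
  have "(\<Sum>b<m. (if a = i then if b = j then 1 else 0 else 0) * X a b) = (if a = i then X i j else 0)" for a
    using assms by (auto simp: sum_delta_times)
  then show ?thesis using assms by simp
qed

lemma has_sum_finite_sum:
  fixes f :: "'b \<Rightarrow> 'c \<Rightarrow> complex"
  assumes "\<And>i. i \<in> I \<Longrightarrow> (f i has_sum s i) A"
  shows "((\<lambda>x. \<Sum>i\<in>I. f i x) has_sum (\<Sum>i\<in>I. s i)) A"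
  using assms by (induction I rule: infinite_finite_induct) (auto intro: has_sum_add)

text \<open>Normality makes the sum over vectors and blocks summable as a double sum, so it can be
  sorted by blocks; within a block the sum over the vectors gives the values at matrix units. This
  is how a finite leg determines an entry of \<Delta> x for every bounded x and not only for
  finitely supported ones.\<close>

lemma normal_functional_expand:
  fixes n :: "'k \<Rightarrow> nat"
  assumes \<omega>: "normal_functional n \<omega>" and x: "x \<in> linf n"
    and G: "finite G" "\<And>\<gamma> i j. \<gamma> \<notin> G \<Longrightarrow> i < n \<gamma> \<Longrightarrow> j < n \<gamma> \<Longrightarrow> \<omega> (mat_unit n \<gamma> i j) = 0"
  shows "\<omega> x = (\<Sum>\<gamma>\<in>G. \<Sum>i<n \<gamma>. \<Sum>j<n \<gamma>. \<omega> (mat_unit n \<gamma> i j) * x \<gamma> $$ (i, j))"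
proof -
  obtain \<xi> \<eta> w where rep: "normal_rep n \<omega> \<xi> \<eta> w"
    using normal_functional_rep[OF \<omega>] by blast
  define t where "t x m k = (\<Sum>i<n k. \<Sum>j<n k. x k $$ (i, j) * \<xi> (m, k) j * cnj (\<eta> (m, k) i))"
    for x :: "'k family" and m k
  have sum: "((\<lambda>(m, k). t x m k) has_sum \<omega> x) UNIV" if "x \<in> linf n" for x
    using normal_rep_has_sum[OF rep that] unfolding t_def split_beta by simp
  note summable = has_sum_imp_summable[OF sum]
  have \<omega>_swap: "\<omega> x = (\<Sum>\<^sub>\<infinity>k. \<Sum>\<^sub>\<infinity>m. t x m k)" if x: "x \<in> linf n" for x
  proof -
    have "\<omega> x = (\<Sum>\<^sub>\<infinity>(m, k). t x m k)" by (rule infsumI[symmetric, OF sum[OF x]])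
    also have "\<dots> = (\<Sum>\<^sub>\<infinity>m. \<Sum>\<^sub>\<infinity>k. t x m k)"
      using infsum_Sigma'_banach[of "t x" UNIV "\<lambda>_. UNIV"] summable[OF x] by simp
    also have "\<dots> = (\<Sum>\<^sub>\<infinity>k. \<Sum>\<^sub>\<infinity>m. t x m k)"
      by (rule infsum_swap_banach) (use summable[OF x] in simp)
    finally show ?thesis .
  qed
  define c where "c k i j = \<omega> (mat_unit n k i j)" for k i j
  have coeff_t: "t (mat_unit n k i j) m l = (if l = k then \<xi> (m, k) j * cnj (\<eta> (m, k) i) else 0)"
    if "i < n k" "j < n k" for k i j m l
  proof -
    have "t (mat_unit n k i j) m l = (\<Sum>a<n l. \<Sum>b<n l. (if l = k then if a = i then if b = j then 1 else 0 else 0 else 0) * \<xi> (m, l) b * cnj (\<eta> (m, l) a))"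
      unfolding t_def using entries_mat_unit[of _ n l _ k i j]
      by (intro sum.cong refl) (simp add: entries_def)
    then show ?thesis
      using sum_double_delta[OF that, of "\<lambda>a b. \<xi> (m, k) b * cnj (\<eta> (m, k) a)"]
      by (cases "l = k") (simp_all add: mult.assoc)
  qed
  have mu: "mat_unit n k i j \<in> linf n" for k i j by (intro c00_subset_linf mat_unit_c00)
  have c_eq: "c k i j = (\<Sum>\<^sub>\<infinity>m. \<xi> (m, k) j * cnj (\<eta> (m, k) i))" if "i < n k" "j < n k" for k i j
  proof -
    have "c k i j = (\<Sum>\<^sub>\<infinity>l. if l = k then (\<Sum>\<^sub>\<infinity>m. \<xi> (m, k) j * cnj (\<eta> (m, k) i)) else 0)"
      unfolding c_def \<omega>_swap[OF mu] by (intro infsum_cong) (simp add: coeff_t[OF that])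
    also have "\<dots> = (\<Sum>\<^sub>\<infinity>l\<in>{k}. (\<Sum>\<^sub>\<infinity>m. \<xi> (m, k) j * cnj (\<eta> (m, k) i)))"
      by (rule infsum_cong_neutral) auto
    finally show ?thesis by simp
  qed
  have c_summable: "(\<lambda>m. \<xi> (m, k) j * cnj (\<eta> (m, k) i)) summable_on UNIV" if "i < n k" "j < n k" for k i j
  proof -
    have "(\<lambda>p. case p of (m, l) \<Rightarrow> t (mat_unit n k i j) m l) summable_on (\<lambda>m. (m, k)) ` UNIV"
      by (rule summable_on_subset_banach[OF summable[OF mu]]) simp
    then have "((\<lambda>p. case p of (m, l) \<Rightarrow> t (mat_unit n k i j) m l) \<circ> (\<lambda>m. (m, k))) summable_on UNIV"
      by (subst (asm) summable_on_reindex) (auto intro: inj_onI)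
    then show ?thesis by (simp add: o_def coeff_t[OF that])
  qed
  have inner: "(\<Sum>\<^sub>\<infinity>m. t x m k) = (\<Sum>i<n k. \<Sum>j<n k. c k i j * x k $$ (i, j))" for k
  proof -
    have "((\<lambda>m. t x m k) has_sum (\<Sum>i<n k. \<Sum>j<n k. x k $$ (i, j) * c k i j)) UNIV"
      unfolding t_def mult.assoc
      by (intro has_sum_finite_sum has_sum_cmult_right) (auto simp: c_eq intro!: has_sum_infsum c_summable)
    then show ?thesis by (simp add: infsumI mult.commute)
  qed
  have "\<omega> x = (\<Sum>\<^sub>\<infinity>k. \<Sum>i<n k. \<Sum>j<n k. c k i j * x k $$ (i, j))"
    unfolding \<omega>_swap[OF x] inner ..
  also have "\<dots> = (\<Sum>\<^sub>\<infinity>k\<in>G. \<Sum>i<n k. \<Sum>j<n k. c k i j * x k $$ (i, j))"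
    by (rule infsum_cong_neutral) (auto simp: c_def G(2) intro!: sum.neutral)
  also have "\<dots> = (\<Sum>\<gamma>\<in>G. \<Sum>i<n \<gamma>. \<Sum>j<n \<gamma>. \<omega> (mat_unit n \<gamma> i j) * x \<gamma> $$ (i, j))"
    using G(1) by (simp add: c_def)
  finally show ?thesis .
qed

text \<open>A single pair of unit vectors, placed at the index \<open>(0, k0)\<close>, represents
  the functional; all other terms vanish.\<close>

lemma normal_functional_coordinate:
  assumes "r < n k0" "s < n k0"
  shows "normal_functional n (\<lambda>X. X k0 $$ (r, s))"
proof -
  define \<xi> where "\<xi> m k = (if m = (0::nat) \<and> k = k0 then unit_vec (n k0) s else 0\<^sub>v (n k) :: complex vec)" for m k
  define \<eta> where "\<eta> m k = (if m = (0::nat) \<and> k = k0 then unit_vec (n k0) r else 0\<^sub>v (n k) :: complex vec)" for m k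
  have zero: "\<xi> m k = 0\<^sub>v (n k)" "\<eta> m k = 0\<^sub>v (n k)" if "(m, k) \<noteq> (0, k0)" for m k
    using that by (auto simp: \<xi>_def \<eta>_def)
  have sum: "f summable_on UNIV" if "\<And>p. p \<noteq> (0, k0) \<Longrightarrow> f p = 0" for f :: "nat \<times> _ \<Rightarrow> complex"
    using summable_on_cong_neutral[of "{(0, k0)}" UNIV f f] that by auto
  have single: "infsum f UNIV = f (0, k0)" if "\<And>p. p \<noteq> (0, k0) \<Longrightarrow> f p = 0" for f :: "nat \<times> _ \<Rightarrow> complex"
  proof -
    have "infsum f UNIV = infsum f {(0, k0)}"
      by (rule infsum_cong_neutral) (use that in auto)
    then show ?thesis by simp
  qed
  show ?thesis
    unfolding normal_functional_def
  proof (rule exI[of _ \<xi>], rule exI[of _ \<eta>], intro conjI ballI allI)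
    fix m k
    show "\<xi> m k \<in> carrier_vec (n k)" "\<eta> m k \<in> carrier_vec (n k)" by (auto simp: \<xi>_def \<eta>_def)
  next
    show "(\<lambda>(m, k). \<xi> m k \<bullet>c \<xi> m k) summable_on UNIV"
    proof (rule sum)
      fix p :: "nat \<times> _" assume "p \<noteq> (0, k0)"
      then show "(case p of (m, k) \<Rightarrow> \<xi> m k \<bullet>c \<xi> m k) = 0"
        using zero[of "fst p" "snd p"] by (cases p) simp
    qed
    show "(\<lambda>(m, k). \<eta> m k \<bullet>c \<eta> m k) summable_on UNIV"
    proof (rule sum)
      fix p :: "nat \<times> _" assume "p \<noteq> (0, k0)"
      then show "(case p of (m, k) \<Rightarrow> \<eta> m k \<bullet>c \<eta> m k) = 0"
        using zero[of "fst p" "snd p"] by (cases p) simp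
    qed
    fix X assume "X \<in> linf n"
    then have X: "X k \<in> carrier_mat (n k) (n k)" for k by (simp add: linf_def families_def)
    have "(\<Sum>\<^sub>\<infinity>(m, k). (X k *\<^sub>v \<xi> m k) \<bullet>c \<eta> m k) = (X k0 *\<^sub>v \<xi> 0 k0) \<bullet>c \<eta> 0 k0"
    proof -
      have "(\<Sum>\<^sub>\<infinity>(m, k). (X k *\<^sub>v \<xi> m k) \<bullet>c \<eta> m k) = (case (0, k0) of (m, k) \<Rightarrow> (X k *\<^sub>v \<xi> m k) \<bullet>c \<eta> m k)"
      proof (rule single)
        fix p :: "nat \<times> _" assume "p \<noteq> (0, k0)"
        then show "(case p of (m, k) \<Rightarrow> (X k *\<^sub>v \<xi> m k) \<bullet>c \<eta> m k) = 0"
          using zero[of "fst p" "snd p"] X[of "snd p"] by (cases p) simp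
      qed
      then show ?thesis by simp
    qed
    also have "\<dots> = X k0 $$ (r, s)"
    proof -
      have c: "X k0 *\<^sub>v unit_vec (n k0) s \<in> carrier_vec (n k0)" using X[of k0] by simp
      have "(X k0 *\<^sub>v unit_vec (n k0) s) $ i = X k0 $$ (i, s)" if "i < n k0" for i
        using assms that by (subst index_mult_mat_vec_sum[OF X]) (simp_all add: unit_vec_def sum_delta_times)
      then have "(X k0 *\<^sub>v unit_vec (n k0) s) \<bullet>c unit_vec (n k0) r = (\<Sum>i<n k0. X k0 $$ (i, s) * (if i = r then 1 else 0))"
        by (subst cscalar_prod_sum[OF c]) (auto simp: unit_vec_def intro!: sum.cong)
      then show ?thesis using assms by (simp add: \<xi>_def \<eta>_def sum_delta_times)
    qed
    finally show "X k0 $$ (r, s) = (\<Sum>\<^sub>\<infinity>(m, k). (X k *\<^sub>v \<xi> m k) \<bullet>c \<eta> m k)" ..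
  qed
qed

section \<open>Linear independence of the coefficients\<close>

text \<open>Coordinate form of the facts about irreducible representations. The assumption
  \<open>schur\<close> contains both halves of Schur's lemma: T satisfies
  \<open>U \<alpha> T = T U \<beta>\<close>, so it is the scalar \<open>T 0 0\<close> when the
  indices agree and 0 otherwise.\<close>

locale peter_weyl = compact_quantum_group \<Delta>G \<epsilon>G SG
  for \<Delta>G :: "'a::complex_star_algebra \<Rightarrow> ('a, 'a) tensor" and \<epsilon>G SG +
  fixes n :: "'i \<Rightarrow> nat"
    and U :: "'i \<Rightarrow> nat \<Rightarrow> nat \<Rightarrow> 'a"
    and triv :: 'i
  assumes unitary_left: "\<lbrakk>i < n \<gamma>; j < n \<gamma>\<rbrakk> \<Longrightarrow>
      (\<Sum>k<n \<gamma>. star (U \<gamma> k i) * U \<gamma> k j) = (if i = j then 1 else 0)"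
    and unitary_right: "\<lbrakk>i < n \<gamma>; j < n \<gamma>\<rbrakk> \<Longrightarrow>
      (\<Sum>k<n \<gamma>. U \<gamma> i k * star (U \<gamma> j k)) = (if i = j then 1 else 0)"
    and comult_U: "\<lbrakk>i < n \<gamma>; j < n \<gamma>\<rbrakk> \<Longrightarrow>
      \<Delta>G (U \<gamma> i j) = (\<Sum>k<n \<gamma>. U \<gamma> i k \<otimes>\<^sub>t U \<gamma> k j)"
    and schur: "\<lbrakk>\<And>i l. \<lbrakk>i < n \<alpha>; l < n \<beta>\<rbrakk> \<Longrightarrow>
        (\<Sum>k<n \<alpha>. T k l *\<^sub>C U \<alpha> i k) = (\<Sum>k<n \<beta>. T i k *\<^sub>C U \<beta> k l);
      i < n \<alpha>; l < n \<beta>\<rbrakk> \<Longrightarrow> T i l = (if \<alpha> = \<beta> \<and> i = l then T 0 0 else 0)"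
    and triv: "n triv = 1" "U triv 0 0 = 1"
begin

lemma lift_comult_U:
  assumes "cbilinear f" "i < n \<gamma>" "j < n \<gamma>"
  shows "tensor_lift f (\<Delta>G (U \<gamma> i j)) = (\<Sum>k<n \<gamma>. f (U \<gamma> i k) (U \<gamma> k j))"
  by (simp add: comult_U assms clinear_sum[OF clinear_tensor_lift])

lemma clinear_lift_comult: "cbilinear f \<Longrightarrow> clinear (\<lambda>a. tensor_lift f (\<Delta>G a))"
  using clinear_tensor_lift[of f] comult_linear by (simp add: clinear_def)

text \<open>The counit axiom reads c u = u for the matrix c of values of the counit. Multiplying by
  the adjoint of u gives c = 1 inside the algebra, and a further application of the counit compares
  the scalars.\<close>

lemma counit_U:
  assumes "i < n \<gamma>" "j < n \<gamma>"
  shows "\<epsilon>G (U \<gamma> i j) = (if i = j then 1 else 0)"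
proof -
  have cb: "cbilinear (\<lambda>a b. \<epsilon>G a *\<^sub>C b)"
    using counit_linear
    by (auto simp: cbilinear_def clinear_def scaleC_add_left scaleC_add_right scaleC_scaleC
        mult.commute scaleC_complex_def)
  have eq: "(\<Sum>k<n \<gamma>. \<epsilon>G (U \<gamma> i k) *\<^sub>C U \<gamma> k l) = U \<gamma> i l" if "l < n \<gamma>" for l
    using counit_left[of "U \<gamma> i l"] lift_comult_U[OF cb assms(1) that] by simp
  have "(\<Sum>l<n \<gamma>. (\<Sum>k<n \<gamma>. \<epsilon>G (U \<gamma> i k) *\<^sub>C U \<gamma> k l) * star (U \<gamma> j l))
      = (\<Sum>l<n \<gamma>. U \<gamma> i l * star (U \<gamma> j l))"
    by (simp add: eq)
  also have "(\<Sum>l<n \<gamma>. (\<Sum>k<n \<gamma>. \<epsilon>G (U \<gamma> i k) *\<^sub>C U \<gamma> k l) * star (U \<gamma> j l))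
      = (\<Sum>k<n \<gamma>. \<epsilon>G (U \<gamma> i k) *\<^sub>C (\<Sum>l<n \<gamma>. U \<gamma> k l * star (U \<gamma> j l)))"
    unfolding scaleC_sum_right sum_distrib_right by (subst sum.swap) (simp add: scaleC_mult_left)
  also have "\<dots> = (\<Sum>k<n \<gamma>. if k = j then \<epsilon>G (U \<gamma> i k) *\<^sub>C 1 else 0)"
    by (intro sum.cong) (auto simp: unitary_right assms)
  also have "\<dots> = \<epsilon>G (U \<gamma> i j) *\<^sub>C 1"
    using assms by simp
  finally have "\<epsilon>G (U \<gamma> i j) *\<^sub>C 1 = (if i = j then 1 else (0::'a))"
    using assms by (simp add: unitary_right)
  then have "\<epsilon>G (\<epsilon>G (U \<gamma> i j) *\<^sub>C 1) = \<epsilon>G (if i = j then 1 else (0::'a))"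
    by simp
  then show ?thesis
    using clinear_zero[OF counit_linear]
    by (simp add: clinear_scale_complex[OF counit_linear] counit_one split: if_splits)
qed

text \<open>The antipode axiom makes S(u) a left inverse of u, and the adjoint is a right inverse,
  so the two agree.\<close>

lemma antipode_U:
  assumes "i < n \<gamma>" "j < n \<gamma>"
  shows "SG (U \<gamma> i j) = star (U \<gamma> j i)"
proof -
  have cb: "cbilinear (\<lambda>a b. SG a * b)"
    using antipode_linear
    by (auto simp: cbilinear_def clinear_def distrib_left distrib_right scaleC_mult_left scaleC_mult_right)
  have eq: "(\<Sum>k<n \<gamma>. SG (U \<gamma> i k) * U \<gamma> k l) = (if i = l then 1 else 0)" if "l < n \<gamma>" for l
    using antipode_left[of "U \<gamma> i l"] lift_comult_U[OF cb assms(1) that]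
    by (auto simp: counit_U assms that scaleC_one)
  have "(\<Sum>l<n \<gamma>. (\<Sum>k<n \<gamma>. SG (U \<gamma> i k) * U \<gamma> k l) * star (U \<gamma> j l))
      = (\<Sum>l<n \<gamma>. (if i = l then 1 else 0) * star (U \<gamma> j l))"
    by (simp add: eq)
  also have "\<dots> = star (U \<gamma> j i)"
    using assms by (simp add: sum_delta_times)
  finally have star: "(\<Sum>l<n \<gamma>. (\<Sum>k<n \<gamma>. SG (U \<gamma> i k) * U \<gamma> k l) * star (U \<gamma> j l))
      = star (U \<gamma> j i)" .
  have "(\<Sum>l<n \<gamma>. (\<Sum>k<n \<gamma>. SG (U \<gamma> i k) * U \<gamma> k l) * star (U \<gamma> j l))
      = (\<Sum>k<n \<gamma>. SG (U \<gamma> i k) * (\<Sum>l<n \<gamma>. U \<gamma> k l * star (U \<gamma> j l)))"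
    unfolding sum_distrib_left sum_distrib_right by (subst sum.swap) (simp add: mult.assoc)
  also have "\<dots> = (\<Sum>k<n \<gamma>. SG (U \<gamma> i k) * (if k = j then 1 else 0))"
    by (intro sum.cong) (auto simp: unitary_right assms)
  also have "\<dots> = SG (U \<gamma> i j)"
    using assms by (simp add: sum_delta_times)
  finally show ?thesis using star by simp
qed

text \<open>
  The orthogonal projection onto the space of relations commutes with right multiplication by the
  matrices of all functionals, hence by Schur's lemma is a left multiplication. So relations are
  stable under arbitrary right multiplications, and the counit shows that they are trivial.
\<close>

lemma relation_trivial:
  fixes D :: "'i \<times> nat \<times> nat \<Rightarrow> complex"
  assumes F: "finite F" and rel: "(\<Sum>\<gamma>\<in>F. \<Sum>i<n \<gamma>. \<Sum>j<n \<gamma>. D (\<gamma>, j, i) *\<^sub>C U \<gamma> i j) = 0"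
    and idx: "\<gamma>0 \<in> F" "k0 < n \<gamma>0" "l0 < n \<gamma>0"
  shows "D (\<gamma>0, l0, k0) = 0"
proof -
  define B where "B = (SIGMA \<gamma>:F. {..<n \<gamma>} \<times> {..<n \<gamma>})"
  have finB: "finite B" using F by (auto simp: B_def)
  have sumB: "(\<Sum>b\<in>B. f b) = (\<Sum>\<gamma>\<in>F. \<Sum>i<n \<gamma>. \<Sum>j<n \<gamma>. f (\<gamma>, i, j))"
    for f :: "_ \<Rightarrow> complex"
    unfolding B_def using F
    by (simp add: sum.Sigma sum.cartesian_product split_def)
  \<comment> \<open>Relations are indexed by block, column, row: slicing acts on the last index
    only, and the column index is a spectator.\<close>
  define R where "R D = (\<Sum>\<gamma>\<in>F. \<Sum>i<n \<gamma>. \<Sum>j<n \<gamma>. D (\<gamma>, j, i) *\<^sub>C U \<gamma> i j)"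
    for D :: "'i \<times> nat \<times> nat \<Rightarrow> complex"
  define L where "L = {D. R D = 0}"
  have R_add: "R (\<lambda>b. x b + y b) = R x + R y" for x y
    by (simp add: R_def scaleC_add_left sum.distrib)
  have R_scale: "R (\<lambda>b. c * x b) = c *\<^sub>C R x" for c x
    by (simp add: R_def scaleC_sum_right scaleC_scaleC)
  have R_sum: "R (\<lambda>b. \<Sum>k\<in>K. c k * x k b) = (\<Sum>k\<in>K. c k *\<^sub>C R (x k))" for K :: "'k set" and c x
    by (induction K rule: infinite_finite_induct) (auto simp: R_add R_scale, auto simp: R_def)
  have R_cong: "R x = R y" if "\<And>b. b \<in> B \<Longrightarrow> x b = y b" for x y
    unfolding R_def by (intro sum.cong refl) (use that in \<open>auto simp: B_def\<close>)
  have L0: "(\<lambda>_. 0) \<in> L" by (simp add: L_def R_def)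
  have L_add: "(\<lambda>b. x b + y b) \<in> L" if "x \<in> L" "y \<in> L" for x y
    using that by (simp add: L_def R_add)
  have L_scale: "(\<lambda>b. c * x b) \<in> L" if "x \<in> L" for x c
    using that by (simp add: L_def R_scale)
  have L_sum: "(\<lambda>b. \<Sum>k\<in>K. c k * x k b) \<in> L" if "\<And>k. k \<in> K \<Longrightarrow> x k \<in> L" for K :: "'k set" and c x
    using that by (simp add: L_def R_sum)
  define perp where "perp y \<longleftrightarrow> (\<forall>x\<in>L. (\<Sum>b\<in>B. y b * cnj (x b)) = 0)" for y
  have perp_add: "perp (\<lambda>b. x b + y b)" if "perp x" "perp y" for x y
    using that by (simp add: perp_def distrib_right sum.distrib)
  have perp_scale: "perp (\<lambda>b. c * x b)" if "perp x" for x c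
    using that by (simp add: perp_def mult.assoc sum_distrib_left[symmetric])
  have perp_sum: "perp (\<lambda>b. \<Sum>k\<in>K. c k * x k b)" if "\<And>k. k \<in> K \<Longrightarrow> perp (x k)" for K :: "'k set" and c x
    using that
  proof (induction K rule: infinite_finite_induct)
    case (insert k K)
    then show ?case using perp_add[OF perp_scale[of "x k" "c k"]] by simp
  qed (auto simp: perp_def)
  have perp_cong: "perp x" if "perp y" "\<And>b. b \<in> B \<Longrightarrow> x b = y b" for x y
    using that by (simp add: perp_def)
  have L_perp: "x b = 0" if "x \<in> L" "perp x" "b \<in> B" for x b
  proof -
    have "(\<Sum>b\<in>B. x b * cnj (x b)) = 0" using that by (simp add: perp_def)
    then have "of_real (\<Sum>b\<in>B. (cmod (x b))\<^sup>2) = (0::complex)"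
      by (simp only: of_real_sum complex_norm_square)
    then have "(\<Sum>b\<in>B. (cmod (x b))\<^sup>2) = 0" by (simp only: of_real_eq_0_iff)
    then show ?thesis using finB that(3) by (simp add: sum_nonneg_eq_0_iff)
  qed
  have "\<exists>E\<in>L. perp (\<lambda>b. D b - E b)" for D
    unfolding perp_def using orthogonal_decomposition[OF finB L0 L_add L_scale, of D] by blast
  then obtain E where E: "\<And>D. E D \<in> L" "\<And>D. perp (\<lambda>b. D b - E D b)" by metis

  \<comment> \<open>The map induced on relations by slicing the first leg of the comultiplication
    with f.\<close>
  define act where "act f D = (\<lambda>(\<gamma>, s, l). \<Sum>k<n \<gamma>. D (\<gamma>, s, k) * f (U \<gamma> k l))"
    for f :: "'a \<Rightarrow> complex" and D :: "'i \<times> nat \<times> nat \<Rightarrow> complex"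
  have act_L: "act f D \<in> L" if f: "clinear f" and D: "D \<in> L" for f D
  proof -
    have cb: "cbilinear (\<lambda>a b. f a *\<^sub>C b)"
      using f by (auto simp: cbilinear_def clinear_def scaleC_add_left scaleC_add_right scaleC_scaleC
        mult.commute scaleC_complex_def)
    note cl = clinear_lift_comult[OF cb]
    have "0 = tensor_lift (\<lambda>a b. f a *\<^sub>C b) (\<Delta>G (R D))"
      using D clinear_zero[OF cl] by (simp add: L_def)
    also have "\<dots> = (\<Sum>\<gamma>\<in>F. \<Sum>i<n \<gamma>. \<Sum>j<n \<gamma>. D (\<gamma>, j, i) *\<^sub>C (\<Sum>k<n \<gamma>. f (U \<gamma> i k) *\<^sub>C U \<gamma> k j))"
      by (simp add: R_def clinear_sum[OF cl] clinear_scale[OF cl] lift_comult_U[OF cb])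
    also have "\<dots> = R (act f D)"
    proof -
      have "(\<Sum>i<n \<gamma>. \<Sum>j<n \<gamma>. D (\<gamma>, j, i) *\<^sub>C (\<Sum>k<n \<gamma>. f (U \<gamma> i k) *\<^sub>C U \<gamma> k j))
        = (\<Sum>i<n \<gamma>. \<Sum>j<n \<gamma>. \<Sum>k<n \<gamma>. (D (\<gamma>, j, i) * f (U \<gamma> i k)) *\<^sub>C U \<gamma> k j)" for \<gamma>
        by (simp add: scaleC_sum_right scaleC_scaleC)
      also have "\<dots> \<gamma> = (\<Sum>k<n \<gamma>. \<Sum>j<n \<gamma>. \<Sum>i<n \<gamma>. (D (\<gamma>, j, i) * f (U \<gamma> i k)) *\<^sub>C U \<gamma> k j)" for \<gamma>
        by (rule sum_swap3)
      finally show ?thesis by (simp add: R_def act_def scaleC_sum_left)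
    qed
    finally show ?thesis by (simp add: L_def)
  qed
  have act_perp: "perp (act f D)" if f: "clinear f" and D: "perp D" for f D
    unfolding perp_def
  proof
    fix x assume x: "x \<in> L"
    \<comment> \<open>On coefficients the antipode is the adjoint of the transpose, so the adjoint
      of \<open>act f\<close> is again of the form \<open>act g\<close>; hence the complement of L
      is stable as well.\<close>
    define g where "g = (\<lambda>a. cnj (f (star (SG a))))"
    have g: "clinear g"
      using f antipode_linear by (simp add: g_def clinear_def star_add star_scaleC scaleC_complex_def)
    have gU: "g (U \<gamma> l k) = cnj (f (U \<gamma> k l))" if "k < n \<gamma>" "l < n \<gamma>" for \<gamma> k l
      using that by (simp add: g_def antipode_U star_star)
    have "(\<Sum>b\<in>B. act f D b * cnj (x b))
        = (\<Sum>\<gamma>\<in>F. \<Sum>s<n \<gamma>. \<Sum>l<n \<gamma>. \<Sum>k<n \<gamma>. D (\<gamma>, s, k) * f (U \<gamma> k l) * cnj (x (\<gamma>, s, l)))"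
      by (simp add: sumB act_def sum_distrib_right)
    also have "\<dots> = (\<Sum>\<gamma>\<in>F. \<Sum>s<n \<gamma>. \<Sum>k<n \<gamma>. \<Sum>l<n \<gamma>. D (\<gamma>, s, k) * f (U \<gamma> k l) * cnj (x (\<gamma>, s, l)))"
      by (rule sum.cong[OF refl], rule sum.cong[OF refl], rule sum.swap)
    also have "\<dots> = (\<Sum>b\<in>B. D b * cnj (act g x b))"
      by (simp add: sumB act_def sum_distrib_left gU mult_ac)
    also have "\<dots> = 0"
      using D act_L[OF g x] by (simp add: perp_def)
    finally show "(\<Sum>b\<in>B. act f D b * cnj (x b)) = 0" .
  qed
  have act_diff: "act f (\<lambda>b. x b - y b) b = act f x b - act f y b" for f x y b
    by (cases b) (simp add: act_def left_diff_distrib sum_subtractf)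

  define \<delta> where "\<delta> b = (\<lambda>b'. if b' = b then 1 else (0::complex))" for b :: "'i \<times> nat \<times> nat"
  \<comment> \<open>The matrix of the orthogonal projection onto L. Stability of L and of its
    complement makes it commute with every \<open>act f\<close>, which is the intertwining relation
    \<open>inter\<close>.\<close>
  define T where "T b = E (\<delta> b)" for b
  have T_L: "T b \<in> L" and T_perp: "perp (\<lambda>b'. \<delta> b b' - T b b')" for b
    unfolding T_def by (rule E)+
  have inter: "(\<Sum>l'<n \<alpha>. T (\<alpha>, s, l') (\<beta>, r, l) *\<^sub>C U \<alpha> k l')
      = (\<Sum>k'<n \<beta>. T (\<alpha>, s, k) (\<beta>, r, k') *\<^sub>C U \<beta> k' l)"
    if "\<alpha> \<in> F" "\<beta> \<in> F" "s < n \<alpha>" "k < n \<alpha>" "r < n \<beta>" "l < n \<beta>" for \<alpha> \<beta> s r k l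
  proof (rule clinear_separates)
    fix f :: "'a \<Rightarrow> complex" assume f: "clinear f"
    define x where "x = (\<lambda>b. (\<Sum>l'<n \<alpha>. f (U \<alpha> k l') * T (\<alpha>, s, l') b) + (-1) * act f (T (\<alpha>, s, k)) b)"
    have "x \<in> L" unfolding x_def
      by (intro L_add L_scale L_sum T_L act_L f)
    moreover have "perp x"
    proof (rule perp_cong)
      show "perp (\<lambda>b. act f (\<lambda>b'. \<delta> (\<alpha>, s, k) b' - T (\<alpha>, s, k) b') b
          + (-1) * (\<Sum>l'<n \<alpha>. f (U \<alpha> k l') * (\<delta> (\<alpha>, s, l') b - T (\<alpha>, s, l') b)))"
        by (intro perp_add perp_scale perp_sum T_perp act_perp f)
      fix b assume "b \<in> B"
      then obtain \<gamma> s' l where b: "b = (\<gamma>, s', l)" "\<gamma> \<in> F" "s' < n \<gamma>" "l < n \<gamma>" by (auto simp: B_def)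
      have "act f (\<delta> (\<alpha>, s, k)) b = (\<Sum>l'<n \<alpha>. f (U \<alpha> k l') * \<delta> (\<alpha>, s, l') b)"
      proof (cases "\<gamma> = \<alpha> \<and> s' = s")
        case True
        then have "act f (\<delta> (\<alpha>, s, k)) b = (\<Sum>k'<n \<alpha>. (if k' = k then 1 else 0) * f (U \<alpha> k' l))"
          by (simp add: b act_def \<delta>_def)
        moreover have "(\<Sum>l'<n \<alpha>. f (U \<alpha> k l') * \<delta> (\<alpha>, s, l') b)
            = (\<Sum>l'<n \<alpha>. f (U \<alpha> k l') * (if l = l' then 1 else 0))"
          using True by (simp add: b \<delta>_def)
        ultimately show ?thesis
          using True that b by (simp add: sum_delta_times del: mult_cancel_left1 mult_cancel_right1)
      qed (auto simp: b act_def \<delta>_def)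
      then show "x b = act f (\<lambda>b'. \<delta> (\<alpha>, s, k) b' - T (\<alpha>, s, k) b') b
          + (-1) * (\<Sum>l'<n \<alpha>. f (U \<alpha> k l') * (\<delta> (\<alpha>, s, l') b - T (\<alpha>, s, l') b))"
        by (simp add: x_def act_diff right_diff_distrib sum_subtractf)
    qed
    ultimately have "x (\<beta>, r, l) = 0"
      using L_perp[of x "(\<beta>, r, l)"] that by (simp add: B_def)
    then show "f (\<Sum>l'<n \<alpha>. T (\<alpha>, s, l') (\<beta>, r, l) *\<^sub>C U \<alpha> k l')
        = f (\<Sum>k'<n \<beta>. T (\<alpha>, s, k) (\<beta>, r, k') *\<^sub>C U \<beta> k' l)"
      by (simp add: x_def act_def clinear_sum[OF f] clinear_scale_complex[OF f] mult.commute)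
  qed
  define t where "t \<alpha> s r = T (\<alpha>, s, 0) (\<alpha>, r, 0)" for \<alpha> s r
  have T_eq: "T (\<alpha>, s, k) (\<beta>, r, l) = (if \<alpha> = \<beta> \<and> k = l then t \<alpha> s r else 0)"
    if "\<alpha> \<in> F" "\<beta> \<in> F" "s < n \<alpha>" "k < n \<alpha>" "r < n \<beta>" "l < n \<beta>" for \<alpha> \<beta> s r k l
  proof -
    have "T (\<alpha>, s, k) (\<beta>, r, l) = (if \<alpha> = \<beta> \<and> k = l then T (\<alpha>, s, 0) (\<beta>, r, 0) else 0)"
      by (rule schur[where T = "\<lambda>k l. T (\<alpha>, s, k) (\<beta>, r, l)"]) (use that inter in auto)
    then show ?thesis by (auto simp: t_def)
  qed
  have expand: "x (\<beta>, r, l) = (\<Sum>s<n \<beta>. x (\<beta>, s, l) * t \<beta> s r)"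
    if x: "x \<in> L" and b: "\<beta> \<in> F" "r < n \<beta>" "l < n \<beta>" for x \<beta> r l
  proof -
    define y where "y = (\<lambda>b'. x b' + (-1) * (\<Sum>b\<in>B. x b * T b b'))"
    have "y \<in> L" unfolding y_def by (intro L_add L_scale L_sum T_L x)
    moreover have "perp y"
    proof (rule perp_cong)
      show "perp (\<lambda>b'. \<Sum>b\<in>B. x b * (\<delta> b b' - T b b'))"
        by (intro perp_sum T_perp)
      fix b' assume "b' \<in> B"
      then have "(\<Sum>b\<in>B. x b * \<delta> b b') = x b'"
        using finB by (simp add: \<delta>_def if_distrib[of "\<lambda>c. _ * c"] cong: if_cong)
      then show "y b' = (\<Sum>b\<in>B. x b * (\<delta> b b' - T b b'))"
        by (simp add: y_def right_diff_distrib sum_subtractf)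
    qed
    ultimately have "y (\<beta>, r, l) = 0" using L_perp[of y "(\<beta>, r, l)"] b by (simp add: B_def)
    then have "x (\<beta>, r, l) = (\<Sum>b\<in>B. x b * T b (\<beta>, r, l))" by (simp add: y_def)
    also have "\<dots> = (\<Sum>\<alpha>\<in>F. \<Sum>s<n \<alpha>. \<Sum>k<n \<alpha>. x (\<alpha>, s, k) * (if \<alpha> = \<beta> \<and> k = l then t \<alpha> s r else 0))"
      unfolding sumB using b by (intro sum.cong refl) (simp add: T_eq)
    also have "\<dots> = (\<Sum>\<alpha>\<in>F. if \<alpha> = \<beta> then (\<Sum>s<n \<alpha>. \<Sum>k<n \<alpha>. x (\<alpha>, s, k) * (if k = l then t \<alpha> s r else 0)) else 0)"
      by (intro sum.cong refl) auto
    also have "\<dots> = (\<Sum>s<n \<beta>. x (\<beta>, s, l) * t \<beta> s r)"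
      using b F by (simp add: sum_delta_times)
    finally show ?thesis .
  qed
  \<comment> \<open>Row k0 of D in the block \<gamma>0, moved to row l0, with 0 elsewhere. As the
    projection only mixes columns, Y is fixed by it and hence a relation; it involves the single row
    l0 of U, from which the counit reads off the wanted coefficient.\<close>
  define Y where "Y = (\<lambda>(\<gamma>, s, l). if \<gamma> = \<gamma>0 \<and> l = l0 then D (\<gamma>, s, k0) else (0::complex))"
  have D: "D \<in> L" using rel by (simp add: L_def R_def)
  have "(\<lambda>b'. \<Sum>b\<in>B. Y b * T b b') \<in> L" by (intro L_sum T_L)
  moreover have "(\<Sum>b\<in>B. Y b * T b b') = Y b'" if "b' \<in> B" for b'
  proof -
    from that obtain \<beta> r l where b': "b' = (\<beta>, r, l)" "\<beta> \<in> F" "r < n \<beta>" "l < n \<beta>"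
      by (auto simp: B_def)
    have "(\<Sum>b\<in>B. Y b * T b b')
        = (\<Sum>\<alpha>\<in>F. \<Sum>s<n \<alpha>. \<Sum>k<n \<alpha>. Y (\<alpha>, s, k) * (if \<alpha> = \<beta> \<and> k = l then t \<alpha> s r else 0))"
      unfolding sumB using b' by (intro sum.cong refl) (simp add: T_eq)
    also have "\<dots> = (\<Sum>\<alpha>\<in>F. if \<alpha> = \<beta> then (\<Sum>s<n \<alpha>. \<Sum>k<n \<alpha>. Y (\<alpha>, s, k) * (if k = l then t \<alpha> s r else 0)) else 0)"
      by (intro sum.cong refl) auto
    also have "\<dots> = (\<Sum>s<n \<beta>. Y (\<beta>, s, l) * t \<beta> s r)"
      using b' F by (simp add: sum_delta_times)
    also have "\<dots> = Y b'"
      using expand[OF D, of \<gamma>0 r k0] idx b' by (auto simp: Y_def)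
    finally show ?thesis .
  qed
  ultimately have "R Y = 0"
    using R_cong[of "\<lambda>b'. \<Sum>b\<in>B. Y b * T b b'" Y] by (simp add: L_def)
  also have "R Y = (\<Sum>\<gamma>\<in>F. \<Sum>i<n \<gamma>. \<Sum>j<n \<gamma>. Y (\<gamma>, j, i) *\<^sub>C U \<gamma> i j)" by (simp add: R_def)
  also have "\<dots> = (\<Sum>\<gamma>\<in>F. if \<gamma> = \<gamma>0 then (\<Sum>i<n \<gamma>. if i = l0 then (\<Sum>j<n \<gamma>. D (\<gamma>, j, k0) *\<^sub>C U \<gamma> i j) else 0) else 0)"
  proof (rule sum.cong[OF refl])
    fix \<gamma>
    have "(\<Sum>i<n \<gamma>. \<Sum>j<n \<gamma>. Y (\<gamma>, j, i) *\<^sub>C U \<gamma> i j)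
      = (\<Sum>i<n \<gamma>. if i = l0 then (\<Sum>j<n \<gamma>. D (\<gamma>, j, k0) *\<^sub>C U \<gamma> i j) else 0)" if "\<gamma> = \<gamma>0"
      by (rule sum.cong[OF refl]) (simp add: Y_def that)
    then show "(\<Sum>i<n \<gamma>. \<Sum>j<n \<gamma>. Y (\<gamma>, j, i) *\<^sub>C U \<gamma> i j)
      = (if \<gamma> = \<gamma>0 then (\<Sum>i<n \<gamma>. if i = l0 then (\<Sum>j<n \<gamma>. D (\<gamma>, j, k0) *\<^sub>C U \<gamma> i j) else 0) else 0)"
      by (auto simp: Y_def)
  qed
  also have "\<dots> = (\<Sum>j<n \<gamma>0. D (\<gamma>0, j, k0) *\<^sub>C U \<gamma>0 l0 j)"
    using F idx by simp
  finally have "\<epsilon>G (\<Sum>j<n \<gamma>0. D (\<gamma>0, j, k0) *\<^sub>C U \<gamma>0 l0 j) = 0"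
    by (simp add: clinear_zero[OF counit_linear])
  also have "\<epsilon>G (\<Sum>j<n \<gamma>0. D (\<gamma>0, j, k0) *\<^sub>C U \<gamma>0 l0 j)
      = (\<Sum>j<n \<gamma>0. D (\<gamma>0, j, k0) * (if l0 = j then 1 else 0))"
    using idx by (simp add: clinear_sum[OF counit_linear] clinear_scale_complex[OF counit_linear] counit_U)
  also have "\<dots> = D (\<gamma>0, l0, k0)"
    using idx by (simp add: sum_delta_times)
  finally show ?thesis .
qed

text \<open>Triviality of relations makes the coefficients pairwise distinct as well as independent,
  since two equal ones would give a relation with coefficients 1 and -1. Values on an independent
  set extend linearly.\<close>

lemma functional_exists:
  fixes g :: "'i \<Rightarrow> nat \<Rightarrow> nat \<Rightarrow> complex"
  shows "\<exists>f :: 'a \<Rightarrow> complex. clinear f \<and> (\<forall>\<gamma> i j. i < n \<gamma> \<longrightarrow> j < n \<gamma> \<longrightarrow> f (U \<gamma> i j) = g \<gamma> i j)"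
proof -
  define J where "J = {(\<gamma>, i, j). i < n \<gamma> \<and> j < n \<gamma>}"
  define V where "V = (\<lambda>(\<gamma>, i, j). U \<gamma> i j)"
  have zero: "c b = 0" if "finite K" "K \<subseteq> J" "(\<Sum>b\<in>K. c b *\<^sub>C V b) = 0" "b \<in> K"
    for K and c :: "_ \<Rightarrow> complex" and b
  proof -
    define F where "F = fst ` K"
    define D where "D = (\<lambda>(\<gamma>, j, i). if (\<gamma>, i, j) \<in> K then c (\<gamma>, i, j) else 0)"
    have F: "finite F" using that by (simp add: F_def)
    have "(\<Sum>\<gamma>\<in>F. \<Sum>i<n \<gamma>. \<Sum>j<n \<gamma>. D (\<gamma>, j, i) *\<^sub>C U \<gamma> i j)
        = (\<Sum>b\<in>(SIGMA \<gamma>:F. {..<n \<gamma>} \<times> {..<n \<gamma>}). if b \<in> K then c b *\<^sub>C V b else 0)"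
      using F by (subst sum.cartesian_product, subst sum.Sigma)
        (auto simp: D_def V_def intro!: sum.cong)
    also have "\<dots> = (\<Sum>b\<in>K. c b *\<^sub>C V b)"
    proof (rule sum.mono_neutral_cong_right)
      show "K \<subseteq> (SIGMA \<gamma>:F. {..<n \<gamma>} \<times> {..<n \<gamma>})"
        using that(2) by (force simp: F_def J_def)
    qed (use F in auto)
    finally have rel: "(\<Sum>\<gamma>\<in>F. \<Sum>i<n \<gamma>. \<Sum>j<n \<gamma>. D (\<gamma>, j, i) *\<^sub>C U \<gamma> i j) = 0"
      using that by simp
    obtain \<gamma> i j where b: "b = (\<gamma>, i, j)" by (cases b)
    have "D (\<gamma>, j, i) = 0"
      by (rule relation_trivial[OF F rel]) (use that b in \<open>force simp: F_def J_def\<close>)+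
    then show ?thesis using that b by (simp add: D_def)
  qed
  have inj: "inj_on V J"
  proof (rule inj_onI, rule ccontr)
    fix b b' assume *: "b \<in> J" "b' \<in> J" "V b = V b'" "b \<noteq> b'"
    have "(if b = b then 1 else -1 :: complex) = 0"
      by (rule zero[of "{b, b'}" "\<lambda>x. if x = b then 1 else -1"])
        (use * in \<open>auto simp: scaleC_one\<close>)
    then show False by simp
  qed
  have "cvs.independent (V ` J)"
    unfolding cvs.independent_explicit_module
  proof (intro allI impI)
    fix t c v assume t: "finite t" "t \<subseteq> V ` J" "(\<Sum>v\<in>t. c v *\<^sub>C v) = 0" "v \<in> t"
    define K where "K = {b \<in> J. V b \<in> t}"
    have K: "K \<subseteq> J" "V ` K = t" using t by (auto simp: K_def)
    have injK: "inj_on V K" using inj K by (meson inj_on_subset)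
    have "finite K" using t(1) K(2) injK by (metis finite_image_iff)
    moreover have "(\<Sum>b\<in>K. c (V b) *\<^sub>C V b) = 0"
      using t(3) sum.reindex[OF injK, of "\<lambda>v. c v *\<^sub>C v"] K by simp
    moreover obtain b where "b \<in> K" "v = V b" using t K by blast
    ultimately show "c v = 0" using zero[of K "\<lambda>b. c (V b)" b] K by simp
  qed
  interpret cc: vector_space_pair "scaleC :: complex \<Rightarrow> 'a \<Rightarrow> 'a" "scaleC :: complex \<Rightarrow> complex \<Rightarrow> complex" ..
  from cc.linear_independent_extend[OF \<open>cvs.independent (V ` J)\<close>,
      of "\<lambda>v. case inv_into J V v of (\<gamma>, i, j) \<Rightarrow> g \<gamma> i j"]
  obtain f where f: "Vector_Spaces.linear scaleC scaleC f"
    "\<forall>v\<in>V ` J. f v = (case inv_into J V v of (\<gamma>, i, j) \<Rightarrow> g \<gamma> i j)" by blast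
  show ?thesis
  proof (intro exI[of _ f] conjI allI impI)
    show "clinear f" using f by (simp add: clinear_iff_linear)
    fix \<gamma> i j assume "i < n \<gamma>" "j < n \<gamma>"
    then have "(\<gamma>, i, j) \<in> J" by (simp add: J_def)
    then have "f (V (\<gamma>, i, j)) = g \<gamma> i j" using f inj by simp
    then show "f (U \<gamma> i j) = g \<gamma> i j" by (simp add: V_def)
  qed
qed

text \<open>The span of the coefficients of the chosen irreducibles. Its stability under products
  and adjoints will come from the finite legs of \<Delta> and R.\<close>

definition pol :: "'a set" where
  "pol = cvs.span {U \<gamma> i j | \<gamma> i j. i < n \<gamma> \<and> j < n \<gamma>}"

lemma pol_U [simp]: "i < n \<gamma> \<Longrightarrow> j < n \<gamma> \<Longrightarrow> U \<gamma> i j \<in> pol"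
  unfolding pol_def by (rule cvs.span_base) auto

lemma pol_zero [simp]: "0 \<in> pol"
  and pol_add: "a \<in> pol \<Longrightarrow> b \<in> pol \<Longrightarrow> a + b \<in> pol"
  and pol_minus: "a \<in> pol \<Longrightarrow> b \<in> pol \<Longrightarrow> a - b \<in> pol"
  and pol_scale: "a \<in> pol \<Longrightarrow> c *\<^sub>C a \<in> pol"
  and pol_sum: "(\<And>i. i \<in> I \<Longrightarrow> g i \<in> pol) \<Longrightarrow> sum g I \<in> pol"
  unfolding pol_def by (auto intro: cvs.span_zero cvs.span_add cvs.span_diff cvs.span_scale cvs.span_sum)

lemma pol_induct [consumes 1, case_names zero add scale U]:
  assumes "a \<in> pol" "P 0" "\<And>x y. x \<in> pol \<Longrightarrow> y \<in> pol \<Longrightarrow> P x \<Longrightarrow> P y \<Longrightarrow> P (x + y)"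
    "\<And>c x. x \<in> pol \<Longrightarrow> P x \<Longrightarrow> P (c *\<^sub>C x)" "\<And>\<gamma> i j. i < n \<gamma> \<Longrightarrow> j < n \<gamma> \<Longrightarrow> P (U \<gamma> i j)"
  shows "P a"
proof -
  have "a \<in> pol \<and> P a"
    using assms(1) unfolding pol_def
  proof (rule cvs.span_induct)
    show "cvs.subspace {a. a \<in> cvs.span {U \<gamma> i j | \<gamma> i j. i < n \<gamma> \<and> j < n \<gamma>} \<and> P a}"
      unfolding pol_def[symmetric]
      by (rule cvs.subspaceI) (auto intro: assms pol_add pol_scale)
  next
    fix x assume "x \<in> {U \<gamma> i j | \<gamma> i j. i < n \<gamma> \<and> j < n \<gamma>}"
    then show "x \<in> cvs.span {U \<gamma> i j | \<gamma> i j. i < n \<gamma> \<and> j < n \<gamma>} \<and> P x"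
      using assms(5) by (auto intro: cvs.span_base)
  qed
  then show ?thesis ..
qed

lemma clinear_eq_pol:
  assumes "clinear f" "clinear g" "\<And>\<gamma> i j. i < n \<gamma> \<Longrightarrow> j < n \<gamma> \<Longrightarrow> f (U \<gamma> i j) = g (U \<gamma> i j)" "a \<in> pol"
  shows "f a = g a"
  using assms(4)
  by (induction rule: pol_induct)
    (auto simp: clinear_zero clinear_add clinear_scale assms(1-3))

lemma pol_one [simp]: "1 \<in> pol"
  using pol_U[of 0 triv 0] triv by simp

lemma lift_comult_mult:
  assumes f: "cbilinear f"
    and x: "\<Delta>G x = (\<Sum>k\<in>K. a k \<otimes>\<^sub>t b k)" and y: "\<Delta>G y = (\<Sum>l\<in>L. c l \<otimes>\<^sub>t e l)"
  shows "tensor_lift f (\<Delta>G (x * y)) = (\<Sum>k\<in>K. \<Sum>l\<in>L. f (a k * c l) (b k * e l))"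
  by (simp add: comult_mult x y sum_product tensor_mult clinear_sum[OF clinear_tensor_lift[OF f]] f)

lemma comult_star_U:
  assumes "i < n \<gamma>" "j < n \<gamma>"
  shows "\<Delta>G (star (U \<gamma> i j)) = (\<Sum>k<n \<gamma>. star (U \<gamma> i k) \<otimes>\<^sub>t star (U \<gamma> k j))"
  by (simp add: comult_star comult_U assms star_sum tensor_star)

text \<open>Consider the matrix with entries \<open>U \<beta> k r * U \<alpha> i s\<close>. Applying
  the antipode to its entries gives a right inverse by the antipode axiom, while unitarity provides
  an explicit left inverse, made of adjoints in reverse order. Uniqueness of the inverse is
  antimultiplicativity.\<close>

lemma antipode_mult_U:
  assumes a: "a < n \<beta>" "l < n \<beta>" and b: "b < n \<alpha>" "j < n \<alpha>"
  shows "SG (U \<beta> a l * U \<alpha> b j) = SG (U \<alpha> b j) * SG (U \<beta> a l)"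
proof -
  have cb: "cbilinear (\<lambda>x y. x * SG y)"
    using antipode_linear
    by (auto simp: cbilinear_def clinear_def distrib_left distrib_right scaleC_mult_left scaleC_mult_right)
  have inv: "(\<Sum>r<n \<beta>. \<Sum>s<n \<alpha>. (U \<beta> k r * U \<alpha> i s) * SG (U \<beta> r l * U \<alpha> s j))
      = (if k = l then 1 else 0) * (if i = j then 1 else 0)" if "k < n \<beta>" "i < n \<alpha>" for k i
  proof -
    have "(\<Sum>r<n \<beta>. \<Sum>s<n \<alpha>. (U \<beta> k r * U \<alpha> i s) * SG (U \<beta> r l * U \<alpha> s j))
      = tensor_lift (\<lambda>x y. x * SG y) (\<Delta>G (U \<beta> k l * U \<alpha> i j))"
      using lift_comult_mult[OF cb comult_U comult_U, of k \<beta> l i \<alpha> j] that assms by simp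
    also have "\<dots> = (\<epsilon>G (U \<beta> k l) * \<epsilon>G (U \<alpha> i j)) *\<^sub>C 1"
      by (simp add: antipode_right counit_mult)
    finally show ?thesis using that assms by (auto simp: counit_U scaleC_one)
  qed
  have del: "(\<Sum>k<n \<beta>. \<Sum>i<n \<alpha>. star (U \<alpha> i b) * star (U \<beta> k a) * (U \<beta> k r * U \<alpha> i s))
      = (if a = r then 1 else 0) * (if b = s then 1 else 0)" if "r < n \<beta>" "s < n \<alpha>" for r s
  proof -
    have "(\<Sum>k<n \<beta>. \<Sum>i<n \<alpha>. star (U \<alpha> i b) * star (U \<beta> k a) * (U \<beta> k r * U \<alpha> i s))
      = (\<Sum>i<n \<alpha>. star (U \<alpha> i b) * (\<Sum>k<n \<beta>. star (U \<beta> k a) * U \<beta> k r) * U \<alpha> i s)"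
      by (subst sum.swap) (simp add: sum_distrib_left sum_distrib_right mult.assoc)
    also have "\<dots> = (\<Sum>i<n \<alpha>. if a = r then star (U \<alpha> i b) * U \<alpha> i s else 0)"
      by (intro sum.cong refl) (auto simp: unitary_left that assms)
    also have "\<dots> = (if a = r then 1 else 0) * (if b = s then 1 else 0)"
      using that assms by (auto simp: unitary_left)
    finally show ?thesis .
  qed
  have "star (U \<alpha> j b) * star (U \<beta> l a)
      = (\<Sum>k<n \<beta>. \<Sum>i<n \<alpha>. star (U \<alpha> i b) * star (U \<beta> k a) * ((if k = l then 1 else 0) * (if i = j then 1 else 0)))"
    using assms by (simp add: mult.assoc[symmetric] sum_delta_times)
  also have "\<dots> = (\<Sum>k<n \<beta>. \<Sum>i<n \<alpha>. star (U \<alpha> i b) * star (U \<beta> k a)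
      * (\<Sum>r<n \<beta>. \<Sum>s<n \<alpha>. (U \<beta> k r * U \<alpha> i s) * SG (U \<beta> r l * U \<alpha> s j)))"
    by (intro sum.cong refl) (simp add: inv)
  also have "\<dots> = (\<Sum>k<n \<beta>. \<Sum>i<n \<alpha>. \<Sum>r<n \<beta>. \<Sum>s<n \<alpha>. star (U \<alpha> i b) * star (U \<beta> k a)
      * (U \<beta> k r * U \<alpha> i s) * SG (U \<beta> r l * U \<alpha> s j))"
    by (simp add: sum_distrib_left mult.assoc)
  also have "\<dots> = (\<Sum>k<n \<beta>. \<Sum>r<n \<beta>. \<Sum>s<n \<alpha>. \<Sum>i<n \<alpha>. star (U \<alpha> i b) * star (U \<beta> k a)
      * (U \<beta> k r * U \<alpha> i s) * SG (U \<beta> r l * U \<alpha> s j))"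
    by (rule sum.cong[OF refl], subst sum.swap, rule sum.cong[OF refl], rule sum.swap)
  also have "\<dots> = (\<Sum>r<n \<beta>. \<Sum>s<n \<alpha>. \<Sum>k<n \<beta>. \<Sum>i<n \<alpha>. star (U \<alpha> i b) * star (U \<beta> k a)
      * (U \<beta> k r * U \<alpha> i s) * SG (U \<beta> r l * U \<alpha> s j))"
    by (subst sum.swap, rule sum.cong[OF refl], rule sum.swap)
  also have "\<dots> = (\<Sum>r<n \<beta>. \<Sum>s<n \<alpha>. (\<Sum>k<n \<beta>. \<Sum>i<n \<alpha>. star (U \<alpha> i b) * star (U \<beta> k a)
      * (U \<beta> k r * U \<alpha> i s)) * SG (U \<beta> r l * U \<alpha> s j))"
    by (simp add: sum_distrib_right)
  also have "\<dots> = (\<Sum>r<n \<beta>. \<Sum>s<n \<alpha>. if s = b then (if r = a then SG (U \<beta> r l * U \<alpha> s j) else 0) else 0)"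
    by (intro sum.cong refl) (simp add: del)
  also have "\<dots> = SG (U \<beta> a l * U \<alpha> b j)"
    using assms by simp
  finally show ?thesis using assms by (simp add: antipode_U)
qed

end

text \<open>\<open>sig\<close> is the inverse of \<open>rho\<close>, \<open>rt\<close> a hermitian
  square root and \<open>rs\<close> the inverse of \<open>rt\<close>, all given by entries.
  Positivity of \<open>rho\<close> is carried by \<open>rho_rt\<close> and
  \<open>rt_cnj\<close>.\<close>

locale dual_data = peter_weyl \<Delta>G \<epsilon>G SG n U triv
  for \<Delta>G :: "'a::complex_star_algebra \<Rightarrow> ('a, 'a) tensor" and \<epsilon>G SG
    and n :: "'i \<Rightarrow> nat" and U :: "'i \<Rightarrow> nat \<Rightarrow> nat \<Rightarrow> 'a" and triv +
  fixes rho sig rt rs :: "'i \<Rightarrow> nat \<Rightarrow> nat \<Rightarrow> complex"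
  assumes n_pos: "0 < n \<gamma>"
    and star_U_pol: "\<lbrakk>i < n \<gamma>; j < n \<gamma>\<rbrakk> \<Longrightarrow> star (U \<gamma> i j) \<in> pol"
    and mult_U_pol: "\<lbrakk>k < n \<beta>; l < n \<beta>; i < n \<gamma>; j < n \<gamma>\<rbrakk> \<Longrightarrow> U \<beta> k l * U \<gamma> i j \<in> pol"
    and antipode_square_U: "\<lbrakk>i < n \<gamma>; j < n \<gamma>\<rbrakk> \<Longrightarrow>
      SG (SG (U \<gamma> i j)) = (\<Sum>a<n \<gamma>. \<Sum>b<n \<gamma>. (rho \<gamma> i a * sig \<gamma> b j) *\<^sub>C U \<gamma> a b)"
    and rho_sig: "\<lbrakk>i < n \<gamma>; j < n \<gamma>\<rbrakk> \<Longrightarrow> (\<Sum>k<n \<gamma>. rho \<gamma> i k * sig \<gamma> k j) = (if i = j then 1 else 0)"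
    and sig_rho: "\<lbrakk>i < n \<gamma>; j < n \<gamma>\<rbrakk> \<Longrightarrow> (\<Sum>k<n \<gamma>. sig \<gamma> i k * rho \<gamma> k j) = (if i = j then 1 else 0)"
    and trace_eq: "(\<Sum>i<n \<gamma>. sig \<gamma> i i) = (\<Sum>i<n \<gamma>. rho \<gamma> i i)"
    and rho_rt: "\<lbrakk>i < n \<gamma>; j < n \<gamma>\<rbrakk> \<Longrightarrow> rho \<gamma> i j = (\<Sum>k<n \<gamma>. rt \<gamma> i k * rt \<gamma> k j)"
    and rt_cnj: "\<lbrakk>i < n \<gamma>; j < n \<gamma>\<rbrakk> \<Longrightarrow> cnj (rt \<gamma> i j) = rt \<gamma> j i"
    and rs_rt: "\<lbrakk>i < n \<gamma>; j < n \<gamma>\<rbrakk> \<Longrightarrow> (\<Sum>k<n \<gamma>. rs \<gamma> i k * rt \<gamma> k j) = (if i = j then 1 else 0)"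
begin

abbreviation "\<theta> \<equiv> \<lambda>a. SG (SG a)"

definition d :: "'i \<Rightarrow> complex" where "d \<gamma> = (\<Sum>i<n \<gamma>. rho \<gamma> i i)"

lemma d_eq: "d \<gamma> = of_real (\<Sum>i<n \<gamma>. \<Sum>k<n \<gamma>. (cmod (rt \<gamma> i k))\<^sup>2)"
proof -
  have "d \<gamma> = (\<Sum>i<n \<gamma>. \<Sum>k<n \<gamma>. rt \<gamma> i k * cnj (rt \<gamma> i k))"
    by (simp add: d_def rho_rt rt_cnj)
  then show ?thesis by (simp only: of_real_sum complex_norm_square)
qed

lemma d_real: "d \<gamma> = of_real (Re (d \<gamma>))"
  by (simp add: d_eq)

text \<open>The trace of \<open>rho\<close> is the squared Hilbert-Schmidt norm of
  \<open>rt\<close>, and \<open>rt\<close> is not 0 because \<open>rs\<close> inverts it.\<close>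

lemma d_pos: "0 < Re (d \<gamma>)"
proof -
  have "0 \<le> Re (d \<gamma>)" by (simp add: d_eq sum_nonneg)
  moreover have "Re (d \<gamma>) \<noteq> 0"
  proof
    assume "Re (d \<gamma>) = 0"
    then have "(\<Sum>i<n \<gamma>. \<Sum>k<n \<gamma>. (cmod (rt \<gamma> i k))\<^sup>2) = 0"
      by (simp add: d_eq)
    then have "rt \<gamma> i k = 0" if "i < n \<gamma>" "k < n \<gamma>" for i k
      using that by (auto simp: sum_nonneg_eq_0_iff sum_nonneg)
    then show False using rs_rt[of 0 \<gamma> 0] n_pos[of \<gamma>] by simp
  qed
  ultimately show ?thesis by simp
qed

lemma d_nonzero [simp]: "d \<gamma> \<noteq> 0"
  using d_pos[of \<gamma>] by auto

lemma rho_cnj: "i < n \<gamma> \<Longrightarrow> j < n \<gamma> \<Longrightarrow> cnj (rho \<gamma> i j) = rho \<gamma> j i"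
  by (simp add: rho_rt rt_cnj mult.commute)

lemma pol_star: "a \<in> pol \<Longrightarrow> star a \<in> pol"
  by (induction rule: pol_induct) (auto simp: star_add star_scaleC pol_add pol_scale star_U_pol)

lemma pol_mult:
  assumes "a \<in> pol" "b \<in> pol"
  shows "a * b \<in> pol"
  using assms(1)
proof (induction rule: pol_induct)
  case (U \<beta> k l)
  from assms(2) show ?case
    by (induction rule: pol_induct)
      (auto simp: distrib_left scaleC_mult_right pol_add pol_scale mult_U_pol U)
qed (auto simp: distrib_right scaleC_mult_left pol_add pol_scale)

lemma pol_power: "a \<in> pol \<Longrightarrow> a ^ k \<in> pol"
  by (induction k) (auto simp: pol_mult)

lemma pol_antipode: "a \<in> pol \<Longrightarrow> SG a \<in> pol"
  by (induction rule: pol_induct)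
    (auto simp: clinear_zero clinear_add clinear_scale antipode_linear pol_add pol_scale antipode_U star_U_pol)

lemma antipode_mult:
  assumes "a \<in> pol" "b \<in> pol"
  shows "SG (a * b) = SG b * SG a"
  using assms(1)
proof (induction rule: pol_induct)
  case (U \<beta> k l)
  from assms(2) show ?case
    by (induction rule: pol_induct)
      (auto simp: distrib_left distrib_right scaleC_mult_right scaleC_mult_left
        clinear_zero clinear_add clinear_scale antipode_linear antipode_mult_U U)
qed (auto simp: distrib_left distrib_right scaleC_mult_left scaleC_mult_right
    clinear_zero clinear_add clinear_scale antipode_linear)

lemma antipode_star_U: "i < n \<gamma> \<Longrightarrow> j < n \<gamma> \<Longrightarrow> SG (star (U \<gamma> i j)) = \<theta> (U \<gamma> j i)"
  by (simp add: antipode_U)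

lemma theta_linear: "clinear \<theta>"
  using antipode_linear by (simp add: clinear_def)

lemma theta_mult: "a \<in> pol \<Longrightarrow> b \<in> pol \<Longrightarrow> \<theta> (a * b) = \<theta> a * \<theta> b"
  by (simp add: antipode_mult pol_antipode)

lemma pol_theta: "a \<in> pol \<Longrightarrow> \<theta> a \<in> pol"
  by (simp add: pol_antipode)

lemma theta_star_U:
  assumes "k < n \<gamma>" "l < n \<gamma>"
  shows "\<theta> (star (U \<gamma> k l)) = (\<Sum>a<n \<gamma>. \<Sum>b<n \<gamma>. (rho \<gamma> l a * sig \<gamma> b k) *\<^sub>C star (U \<gamma> b a))"
  unfolding antipode_star_U[OF assms] antipode_square_U[OF assms(2,1)]
  by (simp add: clinear_sum[OF antipode_linear] clinear_scale[OF antipode_linear] antipode_U)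

end

section \<open>The Haar functional and orthogonality relations\<close>

locale semi_inner =
  fixes S :: "'a::complex_space set" and B :: "'a \<Rightarrow> 'a \<Rightarrow> complex"
  assumes S_zero: "0 \<in> S" and S_add: "x \<in> S \<Longrightarrow> y \<in> S \<Longrightarrow> x + y \<in> S"
    and S_scale: "x \<in> S \<Longrightarrow> c *\<^sub>C x \<in> S"
    and B_linear: "clinear (B x)"
    and B_cnj: "x \<in> S \<Longrightarrow> y \<in> S \<Longrightarrow> B y x = cnj (B x y)"
    and B_pos: "x \<in> S \<Longrightarrow> 0 \<le> Re (B x x)"
begin

lemmas B_add = clinear_add[OF B_linear]
lemmas B_scale = clinear_scale_complex[OF B_linear]
lemmas B_zero = clinear_zero[OF B_linear]
lemmas B_sum = clinear_sum[OF B_linear]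

lemma B_add_left: "x \<in> S \<Longrightarrow> y \<in> S \<Longrightarrow> z \<in> S \<Longrightarrow> B (x + y) z = B x z + B y z"
  by (metis B_add B_cnj S_add complex_cnj_add)

lemma B_scale_left: "x \<in> S \<Longrightarrow> z \<in> S \<Longrightarrow> B (c *\<^sub>C x) z = cnj c * B x z"
  by (metis B_scale B_cnj S_scale complex_cnj_mult)

lemma S_sum: "(\<And>i. i \<in> I \<Longrightarrow> g i \<in> S) \<Longrightarrow> sum g I \<in> S"
  by (induction I rule: infinite_finite_induct) (auto simp: S_zero S_add)

lemma B_real: "x \<in> S \<Longrightarrow> B x x = of_real (Re (B x x))"
  using B_cnj[of x x] by (simp add: complex_eq_iff)

definition N :: "'a \<Rightarrow> real" where "N x = sqrt (Re (B x x))"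

lemma N_nonneg [simp]: "0 \<le> N x"
  if "x \<in> S" using that by (simp add: N_def B_pos)

lemma N_square: "x \<in> S \<Longrightarrow> (N x)\<^sup>2 = Re (B x x)"
  by (simp add: N_def B_pos)

lemma B_self: "x \<in> S \<Longrightarrow> B x x = of_real ((N x)\<^sup>2)"
  using B_real by (simp add: N_square)

lemma N_square_add:
  assumes "x \<in> S" "y \<in> S"
  shows "(N (x + y))\<^sup>2 = (N x)\<^sup>2 + (N y)\<^sup>2 + 2 * Re (B x y)"
  using assms B_cnj[OF assms]
  by (simp add: N_square S_add B_add B_add_left)

lemma N_scale: "x \<in> S \<Longrightarrow> N (c *\<^sub>C x) = cmod c * N x"
proof -
  assume x: "x \<in> S"
  have "B (c *\<^sub>C x) (c *\<^sub>C x) = (c * cnj c) * B x x"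
    by (simp add: B_scale B_scale_left x S_scale)
  also have "\<dots> = of_real ((cmod c)\<^sup>2 * (N x)\<^sup>2)"
    by (simp only: B_self[OF x] of_real_mult complex_norm_square)
  finally have "(N (c *\<^sub>C x))\<^sup>2 = (cmod c * N x)\<^sup>2"
    by (simp add: N_square x S_scale power_mult_distrib)
  then show ?thesis
    by (simp add: S_scale x power2_eq_iff_nonneg)
qed

lemma cauchy_schwarz:
  assumes x: "x \<in> S" and y: "y \<in> S"
  shows "cmod (B x y) \<le> N x * N y"
proof -
  define q where "q = (cmod (B x y))\<^sup>2"
  have key: "0 \<le> (N x)\<^sup>2 - 2 * t * q + t\<^sup>2 * q * (N y)\<^sup>2" for t :: real
  proof -
    \<comment> \<open>This phase makes the cross term real, so that positivity becomes a quadratic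
      inequality in the real parameter t.\<close>
    define c where "c = - of_real t * cnj (B x y)"
    have "0 \<le> (N (x + c *\<^sub>C y))\<^sup>2" by simp
    also have "\<dots> = (N x)\<^sup>2 + (cmod c)\<^sup>2 * (N y)\<^sup>2 + 2 * Re (c * B x y)"
      by (simp add: N_square_add x y S_scale N_scale B_scale power_mult_distrib)
    also have "c * B x y = - of_real (t * q)"
      by (simp add: c_def q_def complex_norm_square del: of_real_power)
    also have "(cmod c)\<^sup>2 = t\<^sup>2 * q"
      by (simp add: c_def q_def norm_mult power_mult_distrib)
    finally show ?thesis by simp
  qed
  have "q \<le> (N x)\<^sup>2 * (N y)\<^sup>2"
  proof (cases "N y = 0")
    case True
    have "q \<le> 0"
    proof (rule ccontr)
      assume "\<not> q \<le> 0"
      \<comment> \<open>For N y = 0 the inequality is affine in t, and this choice of t drives its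
        right-hand side to -1.\<close>
      then have "0 \<le> (N x)\<^sup>2 - ((N x)\<^sup>2 + 1)"
        using key[of "((N x)\<^sup>2 + 1) / (2 * q)"] True by simp
      then show False by simp
    qed
    then show ?thesis using True by simp
  next
    case False
    then have p: "(N y)\<^sup>2 > 0" by simp
    then have "(1 / (N y)\<^sup>2)\<^sup>2 * q * (N y)\<^sup>2 = q / (N y)\<^sup>2"
      by (simp add: power2_eq_square)
    then have "0 \<le> (N x)\<^sup>2 - q / (N y)\<^sup>2"
      using key[of "1 / (N y)\<^sup>2"] by simp
    then show ?thesis using p by (simp add: field_simps)
  qed
  then have "(cmod (B x y))\<^sup>2 \<le> (N x * N y)\<^sup>2"
    by (simp add: q_def power_mult_distrib)
  then show ?thesis
    by (rule power2_le_imp_le) (simp add: x y)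
qed

lemma triangle:
  assumes x: "x \<in> S" and y: "y \<in> S"
  shows "N (x + y) \<le> N x + N y"
proof -
  have "(N (x + y))\<^sup>2 \<le> (N x)\<^sup>2 + (N y)\<^sup>2 + 2 * (N x * N y)"
    using cauchy_schwarz[OF x y] complex_Re_le_cmod[of "B x y"] by (simp add: N_square_add x y)
  also have "\<dots> = (N x + N y)\<^sup>2" by (simp add: power2_sum)
  finally show ?thesis
    by (rule power2_le_imp_le) (simp add: x y)
qed

lemma N_zero: "N 0 = 0"
  by (simp add: N_def B_zero)

lemma N_sum: "(\<And>i. i \<in> I \<Longrightarrow> g i \<in> S) \<Longrightarrow> N (sum g I) \<le> (\<Sum>i\<in>I. N (g i))"
proof (induction I rule: infinite_finite_induct)
  case (insert i I)
  have "N (g i + sum g I) \<le> N (g i) + N (sum g I)"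
    using insert.prems by (intro triangle S_sum) auto
  also have "N (sum g I) \<le> (\<Sum>i\<in>I. N (g i))"
    using insert by auto
  finally show ?case using insert.hyps by simp
qed (auto simp: N_zero)

end

section \<open>The Haar functional and its invariance\<close>

context dual_data
begin

text \<open>The Haar state in algebraic form: it annihilates every coefficient outside the trivial
  representation, whose single coefficient is 1. Off \<open>pol\<close> any linear extension is
  taken.\<close>

definition hG :: "'a \<Rightarrow> complex" where
  "hG = (SOME f. clinear f \<and>
     (\<forall>\<gamma> i j. i < n \<gamma> \<longrightarrow> j < n \<gamma> \<longrightarrow> f (U \<gamma> i j) = (if \<gamma> = triv then 1 else 0)))"

lemma hG_linear: "clinear hG"
  and hG_U: "i < n \<gamma> \<Longrightarrow> j < n \<gamma> \<Longrightarrow> hG (U \<gamma> i j) = (if \<gamma> = triv then 1 else 0)"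
proof -
  have "\<exists>f :: 'a \<Rightarrow> complex. clinear f \<and>
     (\<forall>\<gamma> i j. i < n \<gamma> \<longrightarrow> j < n \<gamma> \<longrightarrow> f (U \<gamma> i j) = (if \<gamma> = triv then 1 else 0))"
    by (rule functional_exists)
  from someI_ex[OF this, folded hG_def]
  show "clinear hG" "i < n \<gamma> \<Longrightarrow> j < n \<gamma> \<Longrightarrow> hG (U \<gamma> i j) = (if \<gamma> = triv then 1 else 0)" by auto
qed

lemmas hG_simps = clinear_zero[OF hG_linear] clinear_add[OF hG_linear] clinear_minus[OF hG_linear]
  clinear_scale_complex[OF hG_linear] clinear_sum[OF hG_linear]

lemma hG_one: "hG 1 = 1"
  using hG_U[of 0 triv 0] triv by simp

lemma U_triv: "i < n triv \<Longrightarrow> j < n triv \<Longrightarrow> U triv i j = 1"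
  using triv by simp

lemma cbilinear_hG: "cbilinear (\<lambda>a b. hG a *\<^sub>C b)" "cbilinear (\<lambda>a b. hG b *\<^sub>C a)"
  by (auto simp: cbilinear_def clinear_def hG_simps scaleC_add_left scaleC_add_right scaleC_scaleC mult.commute)

text \<open>Both sides are linear, so it is enough to compare them on coefficients, where only the
  trivial block survives.\<close>

lemma hG_invariant:
  assumes "a \<in> pol"
  shows "tensor_lift (\<lambda>a b. hG a *\<^sub>C b) (\<Delta>G a) = hG a *\<^sub>C 1"
    and "tensor_lift (\<lambda>a b. hG b *\<^sub>C a) (\<Delta>G a) = hG a *\<^sub>C 1"
proof -
  have cl: "clinear (\<lambda>a. hG a *\<^sub>C (1::'a))"
    by (simp add: clinear_def hG_simps scaleC_add_left scaleC_scaleC)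
  show "tensor_lift (\<lambda>a b. hG a *\<^sub>C b) (\<Delta>G a) = hG a *\<^sub>C 1"
    by (rule clinear_eq_pol[OF clinear_lift_comult[OF cbilinear_hG(1)] cl _ assms])
      (auto simp: lift_comult_U[OF cbilinear_hG(1)] hG_U U_triv triv)
  show "tensor_lift (\<lambda>a b. hG b *\<^sub>C a) (\<Delta>G a) = hG a *\<^sub>C 1"
    by (rule clinear_eq_pol[OF clinear_lift_comult[OF cbilinear_hG(2)] cl _ assms])
      (auto simp: lift_comult_U[OF cbilinear_hG(2)] hG_U U_triv triv)
qed

text \<open>Invariance applied to an adjoint coefficient gives, after taking adjoints, a linear
  relation between the unit and one column of a nontrivial block. Linear independence, through the
  functional f that reads off the coefficient at (j, j), forces the value to vanish.\<close>

lemma hG_star: "a \<in> pol \<Longrightarrow> hG (star a) = cnj (hG a)"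
proof (induction rule: pol_induct)
  case (U \<gamma> i j)
  show ?case
  proof (cases "\<gamma> = triv")
    case True
    then show ?thesis using U by (simp add: U_triv hG_one)
  next
    case False
    obtain f :: "'a \<Rightarrow> complex" where f: "clinear f"
      and fU: "\<And>\<gamma>' a b. \<lbrakk>a < n \<gamma>'; b < n \<gamma>'\<rbrakk> \<Longrightarrow> f (U \<gamma>' a b) = (if \<gamma>' = \<gamma> \<and> a = j \<and> b = j then 1 else 0)"
      using functional_exists[of "\<lambda>\<gamma>' a b. if \<gamma>' = \<gamma> \<and> a = j \<and> b = j then 1 else 0"]
      by blast
    have "hG (star (U \<gamma> i j)) *\<^sub>C 1 = (\<Sum>k<n \<gamma>. hG (star (U \<gamma> i k)) *\<^sub>C star (U \<gamma> k j))"
      using hG_invariant(1)[OF star_U_pol[OF U]]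
      by (simp add: comult_star_U U clinear_sum[OF clinear_tensor_lift[OF cbilinear_hG(1)]]
          tensor_lift_tensor[OF cbilinear_hG(1)])
    then have "star (hG (star (U \<gamma> i j)) *\<^sub>C 1) = star (\<Sum>k<n \<gamma>. hG (star (U \<gamma> i k)) *\<^sub>C star (U \<gamma> k j))"
      by simp
    then have "cnj (hG (star (U \<gamma> i j))) *\<^sub>C U triv 0 0 = (\<Sum>k<n \<gamma>. cnj (hG (star (U \<gamma> i k))) *\<^sub>C U \<gamma> k j)"
      by (simp add: star_scaleC star_sum star_star triv)
    then have "f (cnj (hG (star (U \<gamma> i j))) *\<^sub>C U triv 0 0) = f (\<Sum>k<n \<gamma>. cnj (hG (star (U \<gamma> i k))) *\<^sub>C U \<gamma> k j)"
      by simp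
    then have "0 = (\<Sum>k<n \<gamma>. cnj (hG (star (U \<gamma> i k))) * (if k = j then 1 else 0))"
      using False U triv(1)
      by (simp add: clinear_scale_complex[OF f] clinear_sum[OF f] fU)
    then show ?thesis using U False by (simp add: sum_delta_times hG_U)
  qed
qed (auto simp: hG_simps star_add star_scaleC)

lemma hG_antipode: "a \<in> pol \<Longrightarrow> hG (SG a) = hG a"
proof (induction rule: pol_induct)
  case (U \<gamma> i j)
  then show ?case
    by (simp add: antipode_U hG_star hG_U)
qed (auto simp: hG_simps clinear_zero clinear_add clinear_scale antipode_linear)

text \<open>Invariance makes the matrix M of Haar values over the row indices an intertwiner, so
  Schur's lemma applies; the column indices j and l are parameters.\<close>

lemma schur_right:
  assumes "i < n \<alpha>" "j < n \<alpha>" "k < n \<beta>" "l < n \<beta>"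
  shows "hG (U \<alpha> i j * star (U \<beta> k l)) =
    (if \<alpha> = \<beta> \<and> i = k then hG (U \<alpha> 0 j * star (U \<beta> 0 l)) else 0)"
proof -
  define M where "M i k = hG (U \<alpha> i j * star (U \<beta> k l))" for i k
  have "M i k = (if \<alpha> = \<beta> \<and> i = k then M 0 0 else 0)"
  proof (rule schur)
    fix i m assume i: "i < n \<alpha>" and m: "m < n \<beta>"
    have inv: "(\<Sum>r<n \<alpha>. \<Sum>s<n \<beta>. M r s *\<^sub>C (U \<alpha> i r * star (U \<beta> k s))) = M i k *\<^sub>C 1" if k: "k < n \<beta>" for k
      using hG_invariant(2)[OF pol_mult[OF pol_U star_U_pol], of i \<alpha> j k \<beta> l] assms i k
        lift_comult_mult[OF cbilinear_hG(2) comult_U[of i \<alpha> j] comult_star_U[of k \<beta> l]]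
      by (simp add: M_def)
    have "(\<Sum>k<n \<beta>. M i k *\<^sub>C U \<beta> k m) = (\<Sum>k<n \<beta>. (M i k *\<^sub>C 1) * U \<beta> k m)"
      by (simp add: scaleC_mult_left)
    also have "\<dots> = (\<Sum>k<n \<beta>. \<Sum>r<n \<alpha>. \<Sum>s<n \<beta>. (M r s *\<^sub>C U \<alpha> i r) * (star (U \<beta> k s) * U \<beta> k m))"
      by (intro sum.cong refl)
        (simp add: inv[symmetric] sum_distrib_right scaleC_mult_left mult.assoc)
    also have "\<dots> = (\<Sum>s<n \<beta>. \<Sum>r<n \<alpha>. (M r s *\<^sub>C U \<alpha> i r) * (\<Sum>k<n \<beta>. star (U \<beta> k s) * U \<beta> k m))"
      by (subst sum_swap3) (simp add: sum_distrib_left)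
    also have "\<dots> = (\<Sum>s<n \<beta>. if s = m then (\<Sum>r<n \<alpha>. M r s *\<^sub>C U \<alpha> i r) else 0)"
      by (intro sum.cong refl) (auto simp: unitary_left m)
    also have "\<dots> = (\<Sum>r<n \<alpha>. M r m *\<^sub>C U \<alpha> i r)" using m by simp
    finally show "(\<Sum>r<n \<alpha>. M r m *\<^sub>C U \<alpha> i r) = (\<Sum>k<n \<beta>. M i k *\<^sub>C U \<beta> k m)" ..
  qed (use assms in auto)
  then show ?thesis by (simp add: M_def)
qed

text \<open>Invariance in the other leg makes the matrix over the column indices an intertwiner,
  with the row indices as parameters.\<close>

lemma schur_left:
  assumes "i < n \<alpha>" "j < n \<alpha>" "k < n \<beta>" "l < n \<beta>"
  shows "hG (star (U \<beta> k l) * U \<alpha> i j) =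
    (if \<alpha> = \<beta> \<and> l = j then hG (star (U \<beta> k 0) * U \<alpha> i 0) else 0)"
proof -
  define M where "M l j = hG (star (U \<beta> k l) * U \<alpha> i j)" for l j
  have "M l j = (if \<beta> = \<alpha> \<and> l = j then M 0 0 else 0)"
  proof (rule schur)
    fix m j assume m: "m < n \<beta>" and j: "j < n \<alpha>"
    have inv: "(\<Sum>r<n \<beta>. \<Sum>s<n \<alpha>. M r s *\<^sub>C (star (U \<beta> r l) * U \<alpha> s j)) = M l j *\<^sub>C 1" if l: "l < n \<beta>" for l
      using hG_invariant(1)[OF pol_mult[OF star_U_pol pol_U], of k \<beta> l i \<alpha> j] assms j l
        lift_comult_mult[OF cbilinear_hG(1) comult_star_U[of k \<beta> l] comult_U[of i \<alpha> j]]
      by (simp add: M_def)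
    have "(\<Sum>l<n \<beta>. M l j *\<^sub>C U \<beta> m l) = (\<Sum>l<n \<beta>. U \<beta> m l * (M l j *\<^sub>C 1))"
      by (simp add: scaleC_mult_right)
    also have "\<dots> = (\<Sum>l<n \<beta>. \<Sum>r<n \<beta>. \<Sum>s<n \<alpha>. (U \<beta> m l * star (U \<beta> r l)) * (M r s *\<^sub>C U \<alpha> s j))"
      by (intro sum.cong refl)
        (simp add: inv[symmetric] sum_distrib_left scaleC_mult_right mult.assoc)
    also have "\<dots> = (\<Sum>s<n \<alpha>. \<Sum>r<n \<beta>. (\<Sum>l<n \<beta>. U \<beta> m l * star (U \<beta> r l)) * (M r s *\<^sub>C U \<alpha> s j))"
      by (subst sum_swap3) (simp add: sum_distrib_right)
    also have "\<dots> = (\<Sum>s<n \<alpha>. \<Sum>r<n \<beta>. if r = m then M r s *\<^sub>C U \<alpha> s j else 0)"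
      by (intro sum.cong refl) (auto simp: unitary_right m)
    also have "\<dots> = (\<Sum>s<n \<alpha>. M m s *\<^sub>C U \<alpha> s j)" using m by simp
    finally show "(\<Sum>l<n \<beta>. M l j *\<^sub>C U \<beta> m l) = (\<Sum>s<n \<alpha>. M m s *\<^sub>C U \<alpha> s j)" .
  qed (use assms in auto)
  then show ?thesis by (auto simp: M_def)
qed

text \<open>The constants left open by Schur's lemma follow from invariance of the Haar functional
  under the antipode: applying \<open>SG\<close> inside expresses their matrix as a number c times
  \<open>rho\<close>, and unitarity normalises c to \<open>1 / d \<alpha>\<close>.\<close>

lemma orthogonality_right:
  assumes "i < n \<alpha>" "j < n \<alpha>" "k < n \<beta>" "l < n \<beta>"
  shows "hG (U \<alpha> i j * star (U \<beta> k l)) = (if \<alpha> = \<beta> \<and> i = k then rho \<alpha> l j / d \<alpha> else 0)"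
proof -
  define lam where "lam j l = hG (U \<alpha> 0 j * star (U \<alpha> 0 l))" for j l
  have M: "hG (U \<alpha> i j * star (U \<alpha> k l)) = (if i = k then lam j l else 0)"
    if "i < n \<alpha>" "j < n \<alpha>" "k < n \<alpha>" "l < n \<alpha>" for i j k l
    using schur_right[of i \<alpha> j k \<alpha> l] that by (simp add: lam_def)
  define c where "c = (\<Sum>b<n \<alpha>. lam b 0 * sig \<alpha> b 0)"
  have lam_eq: "lam j l = c * rho \<alpha> l j" if "j < n \<alpha>" "l < n \<alpha>" for j l
  proof -
    have z: "0 < n \<alpha>" by (rule n_pos)
    have "lam j l = hG (SG (U \<alpha> 0 j * star (U \<alpha> 0 l)))"
      using that z by (simp add: lam_def hG_antipode pol_mult star_U_pol)
    also have "SG (U \<alpha> 0 j * star (U \<alpha> 0 l)) = \<theta> (U \<alpha> l 0) * star (U \<alpha> j 0)"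
      using that z by (simp add: antipode_mult star_U_pol) (simp add: antipode_U)
    also have "hG \<dots> = (\<Sum>a<n \<alpha>. \<Sum>b<n \<alpha>. rho \<alpha> l a * sig \<alpha> b 0 * hG (U \<alpha> a b * star (U \<alpha> j 0)))"
      using that z by (simp add: antipode_square_U sum_distrib_right scaleC_mult_left hG_simps)
    also have "\<dots> = (\<Sum>a<n \<alpha>. if a = j then (\<Sum>b<n \<alpha>. rho \<alpha> l a * sig \<alpha> b 0 * lam b 0) else 0)"
      using that z by (intro sum.cong refl) (auto simp: M)
    also have "\<dots> = c * rho \<alpha> l j"
      using that by (simp add: c_def sum_distrib_left sum_distrib_right mult_ac)
    finally show ?thesis .
  qed
  have "1 = hG (\<Sum>j<n \<alpha>. U \<alpha> 0 j * star (U \<alpha> 0 j))"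
    using n_pos[of \<alpha>] by (simp add: unitary_right hG_one)
  also have "\<dots> = (\<Sum>j<n \<alpha>. c * rho \<alpha> j j)"
    using n_pos[of \<alpha>] by (simp add: hG_simps M lam_eq)
  also have "\<dots> = c * d \<alpha>" by (simp add: d_def sum_distrib_left)
  finally have "c = 1 / d \<alpha>" by (simp add: field_simps)
  then show ?thesis
    using schur_right[OF assms] assms lam_eq[of j l] by (auto simp: lam_def)
qed

text \<open>The same mechanism produces the inverse \<open>sig\<close>. That both relations have the
  denominator \<open>d \<alpha>\<close> is the trace normalisation of \<open>rho\<close>.\<close>

lemma orthogonality_left:
  assumes "i < n \<alpha>" "j < n \<alpha>" "k < n \<beta>" "l < n \<beta>"
  shows "hG (star (U \<beta> k l) * U \<alpha> i j) = (if \<alpha> = \<beta> \<and> l = j then sig \<alpha> i k / d \<alpha> else 0)"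
proof -
  define lam where "lam k i = hG (star (U \<alpha> k 0) * U \<alpha> i 0)" for k i
  have M: "hG (star (U \<alpha> k l) * U \<alpha> i j) = (if l = j then lam k i else 0)"
    if "i < n \<alpha>" "j < n \<alpha>" "k < n \<alpha>" "l < n \<alpha>" for i j k l
    using schur_left[of i \<alpha> j k \<alpha> l] that by (simp add: lam_def)
  define c where "c = (\<Sum>a<n \<alpha>. rho \<alpha> 0 a * lam 0 a)"
  have lam_eq: "lam k i = c * sig \<alpha> i k" if "k < n \<alpha>" "i < n \<alpha>" for k i
  proof -
    have z: "0 < n \<alpha>" by (rule n_pos)
    have "lam k i = hG (SG (star (U \<alpha> k 0) * U \<alpha> i 0))"
      using that z by (simp add: lam_def hG_antipode pol_mult star_U_pol)
    also have "SG (star (U \<alpha> k 0) * U \<alpha> i 0) = star (U \<alpha> 0 i) * \<theta> (U \<alpha> 0 k)"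
      using that z by (simp add: antipode_mult star_U_pol) (simp add: antipode_U)
    also have "hG \<dots> = (\<Sum>a<n \<alpha>. \<Sum>b<n \<alpha>. rho \<alpha> 0 a * sig \<alpha> b k * hG (star (U \<alpha> 0 i) * U \<alpha> a b))"
      using that z by (simp add: antipode_square_U sum_distrib_left scaleC_mult_right hG_simps)
    also have "\<dots> = (\<Sum>a<n \<alpha>. \<Sum>b<n \<alpha>. if b = i then rho \<alpha> 0 a * sig \<alpha> b k * lam 0 a else 0)"
      using that z by (intro sum.cong refl) (auto simp: M)
    also have "\<dots> = c * sig \<alpha> i k"
      using that by (simp add: c_def sum_distrib_left sum_distrib_right mult_ac)
    finally show ?thesis .
  qed
  have "1 = hG (\<Sum>k<n \<alpha>. star (U \<alpha> k 0) * U \<alpha> k 0)"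
    using n_pos[of \<alpha>] by (simp add: unitary_left hG_one)
  also have "\<dots> = (\<Sum>k<n \<alpha>. c * sig \<alpha> k k)"
    using n_pos[of \<alpha>] by (simp add: hG_simps M lam_eq)
  also have "\<dots> = c * d \<alpha>" by (simp add: d_def sum_distrib_left trace_eq[symmetric])
  finally have "c = 1 / d \<alpha>" by (simp add: field_simps)
  then show ?thesis
    using schur_left[OF assms] assms lam_eq[of k i] by (auto simp: lam_def)
qed

section \<open>Coordinates with respect to the coefficients\<close>

definition cf :: "'i \<Rightarrow> nat \<Rightarrow> nat \<Rightarrow> 'a \<Rightarrow> complex" where
  "cf \<gamma> i j = (SOME f. clinear f \<and>
     (\<forall>\<beta> k l. k < n \<beta> \<longrightarrow> l < n \<beta> \<longrightarrow> f (U \<beta> k l) = (if \<gamma> = \<beta> \<and> i = k \<and> j = l then 1 else 0)))"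

lemma cf_linear: "clinear (cf \<gamma> i j)"
  and cf_U: "k < n \<beta> \<Longrightarrow> l < n \<beta> \<Longrightarrow> cf \<gamma> i j (U \<beta> k l) = (if \<gamma> = \<beta> \<and> i = k \<and> j = l then 1 else 0)"
proof -
  have "\<exists>f :: 'a \<Rightarrow> complex. clinear f \<and>
     (\<forall>\<beta> k l. k < n \<beta> \<longrightarrow> l < n \<beta> \<longrightarrow> f (U \<beta> k l) = (if \<gamma> = \<beta> \<and> i = k \<and> j = l then 1 else 0))"
    by (rule functional_exists)
  from someI_ex[OF this, folded cf_def]
  show "clinear (cf \<gamma> i j)"
    "k < n \<beta> \<Longrightarrow> l < n \<beta> \<Longrightarrow> cf \<gamma> i j (U \<beta> k l) = (if \<gamma> = \<beta> \<and> i = k \<and> j = l then 1 else 0)" by auto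
qed

lemmas cf_simps = clinear_zero[OF cf_linear] clinear_add[OF cf_linear] clinear_minus[OF cf_linear]
  clinear_scale_complex[OF cf_linear] clinear_sum[OF cf_linear]

definition csupp :: "'a \<Rightarrow> 'i set" where
  "csupp a = {\<gamma>. \<exists>i<n \<gamma>. \<exists>j<n \<gamma>. cf \<gamma> i j a \<noteq> 0}"

lemma csupp_zero: "\<gamma> \<notin> csupp a \<Longrightarrow> i < n \<gamma> \<Longrightarrow> j < n \<gamma> \<Longrightarrow> cf \<gamma> i j a = 0"
  by (auto simp: csupp_def)

lemma csupp_add: "csupp (x + y) \<subseteq> csupp x \<union> csupp y"
proof
  fix \<gamma> assume "\<gamma> \<in> csupp (x + y)"
  then obtain i j where "i < n \<gamma>" "j < n \<gamma>" "cf \<gamma> i j x + cf \<gamma> i j y \<noteq> 0"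
    by (auto simp: csupp_def cf_simps)
  then show "\<gamma> \<in> csupp x \<union> csupp y" using csupp_zero by fastforce
qed

lemma finite_csupp: "a \<in> pol \<Longrightarrow> finite (csupp a)"
proof (induction rule: pol_induct)
  case (add x y)
  then show ?case using csupp_add[of x y] by (meson finite_UnI finite_subset)
next
  case (scale c x)
  have "csupp (c *\<^sub>C x) \<subseteq> csupp x" by (auto simp: csupp_def cf_simps)
  then show ?case using scale by (meson finite_subset)
next
  case (U \<gamma> i j)
  have "csupp (U \<gamma> i j) \<subseteq> {\<gamma>}" using U by (auto simp: csupp_def cf_U split: if_splits)
  then show ?case by (meson finite.emptyI finite.insertI finite_subset)
qed (auto simp: csupp_def cf_simps)

lemma sum_F_eq:
  assumes "finite F" "\<beta> \<notin> F \<Longrightarrow> g \<beta> = 0" "\<And>\<gamma>. \<gamma> \<in> F \<Longrightarrow> \<gamma> \<noteq> \<beta> \<Longrightarrow> g \<gamma> = 0"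
  shows "(\<Sum>\<gamma>\<in>F. g \<gamma>) = (g \<beta> :: 'c::comm_monoid_add)"
proof (cases "\<beta> \<in> F")
  case True
  then have "(\<Sum>\<gamma>\<in>F. g \<gamma>) = (\<Sum>\<gamma>\<in>{\<beta>}. g \<gamma>)"
    using assms by (intro sum.mono_neutral_right) auto
  then show ?thesis by simp
next
  case False
  then have "(\<Sum>\<gamma>\<in>F. g \<gamma>) = 0" using assms by (intro sum.neutral) auto
  then show ?thesis using False assms by simp
qed

lemma pol_expand:
  assumes "a \<in> pol" "finite F" "csupp a \<subseteq> F"
  shows "a = (\<Sum>\<gamma>\<in>F. \<Sum>i<n \<gamma>. \<Sum>j<n \<gamma>. cf \<gamma> i j a *\<^sub>C U \<gamma> i j)"
proof -
  define e where "e a = (\<Sum>\<gamma>\<in>csupp a. \<Sum>i<n \<gamma>. \<Sum>j<n \<gamma>. cf \<gamma> i j a *\<^sub>C U \<gamma> i j)" for a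
  have e: "e a = (\<Sum>\<gamma>\<in>F. \<Sum>i<n \<gamma>. \<Sum>j<n \<gamma>. cf \<gamma> i j a *\<^sub>C U \<gamma> i j)"
    if "finite F" "csupp a \<subseteq> F" for a F
    unfolding e_def using that by (intro sum.mono_neutral_left) (auto simp: csupp_zero intro!: sum.neutral)
  have "a = e a" using assms(1)
  proof (induction rule: pol_induct)
    case zero
    have "csupp 0 = {}" by (auto simp: csupp_def cf_simps)
    then show ?case by (simp add: e_def)
  next
    case (add x y)
    define F where "F = csupp x \<union> csupp y"
    have F: "finite F" "csupp x \<subseteq> F" "csupp y \<subseteq> F" "csupp (x + y) \<subseteq> F"
      using add finite_csupp csupp_add by (auto simp: F_def)
    show ?case
      by (subst add.IH(1), subst add.IH(2))
        (simp add: e[OF F(1,2)] e[OF F(1,3)] e[OF F(1,4)] cf_simps scaleC_add_left sum.distrib)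
  next
    case (scale c x)
    have F: "finite (csupp x)" "csupp (c *\<^sub>C x) \<subseteq> csupp x"
      using scale finite_csupp by (auto simp: csupp_def cf_simps)
    show ?case
      by (subst scale.IH) (simp add: e[OF F] e[OF F(1) subset_refl] cf_simps scaleC_scaleC scaleC_sum_right)
  next
    case (U \<gamma> i j)
    have F: "finite {\<gamma>}" "csupp (U \<gamma> i j) \<subseteq> {\<gamma>}"
      using U by (auto simp: csupp_def cf_U split: if_splits)
    have "e (U \<gamma> i j) = (\<Sum>k<n \<gamma>. \<Sum>l<n \<gamma>. (if i = k then (if j = l then 1 else 0) else 0) *\<^sub>C U \<gamma> k l)"
      unfolding e[OF F] by (simp add: cf_U U) (intro sum.cong refl, auto simp: cf_U U)
    also have "\<dots> = (\<Sum>k<n \<gamma>. if i = k then (\<Sum>l<n \<gamma>. (if j = l then 1 else 0) *\<^sub>C U \<gamma> k l) else 0)"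
      by (intro sum.cong refl) auto
    also have "\<dots> = U \<gamma> i j" using U by (simp add: sum_delta_scaleC)
    finally show ?case ..
  qed
  then show ?thesis using e[OF assms(2,3)] by simp
qed

text \<open>Coordinates after applying the square root of \<open>rho\<close> to the row index. In
  them the twisted form is a weighted sum of products, and the column index is left as it
  is.\<close>

definition yc :: "'i \<Rightarrow> nat \<Rightarrow> nat \<Rightarrow> 'a \<Rightarrow> complex" where
  "yc \<gamma> s l a = (\<Sum>k<n \<gamma>. rt \<gamma> k s * cf \<gamma> k l a)"

lemma yc_linear: "clinear (yc \<gamma> s l)"
  by (simp add: clinear_def yc_def cf_simps distrib_left sum.distrib sum_distrib_left scaleC_complex_def mult_ac)

lemmas yc_simps = clinear_zero[OF yc_linear] clinear_add[OF yc_linear] clinear_minus[OF yc_linear]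
  clinear_scale_complex[OF yc_linear] clinear_sum[OF yc_linear]

lemma yc_U: "i < n \<beta> \<Longrightarrow> j < n \<beta> \<Longrightarrow> yc \<gamma> s l (U \<beta> i j) = (if \<gamma> = \<beta> \<and> l = j then rt \<gamma> i s else 0)"
proof -
  assume ij: "i < n \<beta>" "j < n \<beta>"
  have "yc \<gamma> s l (U \<beta> i j) = (\<Sum>k<n \<gamma>. rt \<gamma> k s * (if k = i then (if \<gamma> = \<beta> \<and> l = j then 1 else 0) else 0))"
    unfolding yc_def by (intro sum.cong refl) (auto simp: cf_U ij)
  then show ?thesis using ij by (cases "\<gamma> = \<beta>") (auto simp: sum_delta_times)
qed

text \<open>The orthogonality relation carries \<open>rho\<close> on the column index. The twist by
  \<open>\<theta>\<close> contributes \<open>sig\<close> there and \<open>rho\<close> on the row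
  index, so the columns become orthogonal without weight, and \<open>rho\<close> is split between
  the two factors \<open>yc\<close>.\<close>

lemma hG_right_U:
  assumes kl: "k < n \<beta>" "l < n \<beta>" and b: "b \<in> pol"
  shows "hG (\<theta> b * star (U \<beta> k l))
    = inverse (d \<beta>) * (\<Sum>s<n \<beta>. \<Sum>m<n \<beta>. cnj (yc \<beta> s m (U \<beta> k l)) * yc \<beta> s m b)"
proof (rule clinear_eq_pol[where a = b])
  show "clinear (\<lambda>b. hG (\<theta> b * star (U \<beta> k l)))"
    by (simp add: clinear_def hG_simps clinear_add[OF theta_linear] clinear_scale[OF theta_linear]
        distrib_right scaleC_mult_left scaleC_complex_def)
  show "clinear (\<lambda>b. inverse (d \<beta>) * (\<Sum>s<n \<beta>. \<Sum>m<n \<beta>. cnj (yc \<beta> s m (U \<beta> k l)) * yc \<beta> s m b))"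
    by (simp add: clinear_def yc_simps distrib_left sum.distrib sum_distrib_left scaleC_complex_def mult_ac)
  fix \<alpha> i j assume ij: "i < n \<alpha>" "j < n \<alpha>"
  have "hG (\<theta> (U \<alpha> i j) * star (U \<beta> k l))
    = (\<Sum>a<n \<alpha>. \<Sum>b<n \<alpha>. rho \<alpha> i a * sig \<alpha> b j * hG (U \<alpha> a b * star (U \<beta> k l)))"
    by (simp add: antipode_square_U ij sum_distrib_right scaleC_mult_left hG_simps)
  also have "\<dots> = (\<Sum>a<n \<alpha>. if \<alpha> = \<beta> \<and> a = k then rho \<alpha> i a * (\<Sum>b<n \<alpha>. rho \<alpha> l b * sig \<alpha> b j) / d \<alpha> else 0)"
    by (intro sum.cong refl)
      (auto simp: orthogonality_right ij kl sum_distrib_left sum_divide_distrib mult_ac)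
  also have "\<dots> = (if \<alpha> = \<beta> \<and> l = j then rho \<beta> i k / d \<beta> else 0)"
    using ij kl by (cases "\<alpha> = \<beta>") (auto simp: rho_sig)
  finally have 1: "hG (\<theta> (U \<alpha> i j) * star (U \<beta> k l)) = (if \<alpha> = \<beta> \<and> l = j then rho \<beta> i k / d \<beta> else 0)" .
  have "(\<Sum>s<n \<beta>. \<Sum>m<n \<beta>. cnj (yc \<beta> s m (U \<beta> k l)) * yc \<beta> s m (U \<alpha> i j))
      = (\<Sum>s<n \<beta>. \<Sum>m<n \<beta>. (if m = l then 1 else 0) * (rt \<beta> s k * yc \<beta> s m (U \<alpha> i j)))"
    by (intro sum.cong refl) (auto simp: yc_U kl rt_cnj)
  also have "\<dots> = (if \<alpha> = \<beta> \<and> l = j then rho \<beta> i k else 0)"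
    using ij kl by (auto simp: sum_delta_times yc_U rho_rt mult.commute)
  finally show "hG (\<theta> (U \<alpha> i j) * star (U \<beta> k l)) = inverse (d \<beta>) *
      (\<Sum>s<n \<beta>. \<Sum>m<n \<beta>. cnj (yc \<beta> s m (U \<beta> k l)) * yc \<beta> s m (U \<alpha> i j))"
    by (simp add: 1 field_simps)
qed (rule b)

lemma hG_right_eq:
  assumes a: "a \<in> pol" and b: "b \<in> pol" and F: "finite F" "csupp b \<subseteq> F"
  shows "hG (\<theta> b * star a)
    = (\<Sum>\<gamma>\<in>F. inverse (d \<gamma>) * (\<Sum>s<n \<gamma>. \<Sum>m<n \<gamma>. cnj (yc \<gamma> s m a) * yc \<gamma> s m b))"
  using a
proof (induction rule: pol_induct)
  case zero
  then show ?case by (simp add: hG_simps yc_simps)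
next
  case (add x y)
  then show ?case by (simp add: star_add distrib_left distrib_right hG_simps yc_simps sum.distrib)
next
  case (scale c x)
  then show ?case
    by (simp add: star_scaleC scaleC_mult_right hG_simps yc_simps sum_distrib_left mult_ac)
next
  case (U \<beta> k l)
  have "(\<Sum>\<gamma>\<in>F. inverse (d \<gamma>) * (\<Sum>s<n \<gamma>. \<Sum>m<n \<gamma>. cnj (yc \<gamma> s m (U \<beta> k l)) * yc \<gamma> s m b))
    = inverse (d \<beta>) * (\<Sum>s<n \<beta>. \<Sum>m<n \<beta>. cnj (yc \<beta> s m (U \<beta> k l)) * yc \<beta> s m b)"
  proof (rule sum_F_eq[OF F(1)])
    assume "\<beta> \<notin> F"
    then have "\<beta> \<notin> csupp b" using F by blast
    then have "yc \<beta> s m b = 0" if "m < n \<beta>" for s m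
      using that by (simp add: yc_def csupp_zero)
    then show "inverse (d \<beta>) * (\<Sum>s<n \<beta>. \<Sum>m<n \<beta>. cnj (yc \<beta> s m (U \<beta> k l)) * yc \<beta> s m b) = 0"
      by simp
  qed (auto simp: yc_U U)
  then show ?case using hG_right_U[OF U b] by simp
qed

section \<open>The twisted inner product\<close>

definition ip :: "'a \<Rightarrow> 'a \<Rightarrow> complex" where "ip a b = hG (\<theta> (star a) * b)"

lemma ip_eq:
  assumes "a \<in> pol" "b \<in> pol" "finite F" "csupp (star a) \<subseteq> F"
  shows "ip a b = (\<Sum>\<gamma>\<in>F. inverse (d \<gamma>) * (\<Sum>s<n \<gamma>. \<Sum>m<n \<gamma>. cnj (yc \<gamma> s m (star b)) * yc \<gamma> s m (star a)))"
  using hG_right_eq[OF pol_star pol_star, of b a F] assms by (simp add: ip_def star_star)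

text \<open>Positivity is read off from the coordinates of the adjoints, in which the form is a sum
  of squares with the positive weights \<open>inverse (d \<gamma>)\<close>.\<close>

sublocale ip: semi_inner pol ip
proof
  show "clinear (ip x)" for x
    by (simp add: clinear_def ip_def hG_simps distrib_left scaleC_mult_right scaleC_complex_def)
next
  fix x y assume xy: "x \<in> pol" "y \<in> pol"
  define F where "F = csupp (star x) \<union> csupp (star y)"
  have F: "finite F" "csupp (star x) \<subseteq> F" "csupp (star y) \<subseteq> F"
    using xy by (auto simp: F_def finite_csupp pol_star)
  have cd: "cnj (d \<gamma>) = d \<gamma>" for \<gamma> by (metis d_real complex_cnj_complex_of_real)
  show "ip y x = cnj (ip x y)"
    by (simp add: ip_eq[OF xy F(1,2)] ip_eq[OF xy(2,1) F(1,3)] cd mult.commute)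
next
  fix x assume x: "x \<in> pol"
  have F: "finite (csupp (star x))" using x by (simp add: finite_csupp pol_star)
  have "ip x x = of_real (\<Sum>\<gamma>\<in>csupp (star x). inverse (Re (d \<gamma>)) *
      (\<Sum>s<n \<gamma>. \<Sum>m<n \<gamma>. (cmod (yc \<gamma> s m (star x)))\<^sup>2))"
    unfolding ip_eq[OF x x F subset_refl] of_real_sum of_real_mult of_real_inverse d_real[symmetric]
    by (simp only: complex_norm_square mult.commute[of "cnj _"])
  then show "0 \<le> Re (ip x x)"
    by (simp add: sum_nonneg less_imp_le[OF d_pos])
qed (auto simp: pol_add pol_scale)

lemma ip_add_left: "ip (a + b) c = ip a c + ip b c"
  and ip_zero_left: "ip 0 c = 0"
  and ip_scale_left: "ip (k *\<^sub>C a) c = cnj k * ip a c"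
  by (simp_all add: ip_def star_add star_scaleC distrib_right scaleC_mult_left hG_simps
      clinear_add[OF theta_linear] clinear_scale[OF theta_linear] clinear_zero[OF antipode_linear])

lemma ip_sum_left: "ip (sum g I) c = (\<Sum>i\<in>I. ip (g i) c)"
  by (induction I rule: infinite_finite_induct) (auto simp: ip_add_left ip_zero_left)

text \<open>The entries of the matrix product of \<open>rho\<close> and u. In this basis distinct
  rows are orthogonal and \<open>rho\<close> sits on the column index, see \<open>ip_V\<close>; this
  is the shape of the Haar weight.\<close>

definition V :: "'i \<Rightarrow> nat \<Rightarrow> nat \<Rightarrow> 'a" where
  "V \<gamma> s j = (\<Sum>i<n \<gamma>. rho \<gamma> s i *\<^sub>C U \<gamma> i j)"

lemma pol_V [simp]: "j < n \<gamma> \<Longrightarrow> V \<gamma> s j \<in> pol"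
  unfolding V_def by (intro pol_sum pol_scale pol_U) auto

lemma U_eq_V:
  assumes "i < n \<gamma>" "j < n \<gamma>"
  shows "U \<gamma> i j = (\<Sum>s<n \<gamma>. sig \<gamma> i s *\<^sub>C V \<gamma> s j)"
proof -
  have "(\<Sum>s<n \<gamma>. sig \<gamma> i s *\<^sub>C V \<gamma> s j) = (\<Sum>k<n \<gamma>. (\<Sum>s<n \<gamma>. sig \<gamma> i s * rho \<gamma> s k) *\<^sub>C U \<gamma> k j)"
    unfolding V_def scaleC_sum_right scaleC_sum_left scaleC_scaleC by (rule sum.swap)
  also have "\<dots> = (\<Sum>k<n \<gamma>. (if i = k then 1 else 0) *\<^sub>C U \<gamma> k j)"
    by (intro sum.cong refl) (simp add: sig_rho assms)
  finally show ?thesis using assms by (simp add: sum_delta_scaleC)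
qed

lemma counit_V: "s < n \<gamma> \<Longrightarrow> j < n \<gamma> \<Longrightarrow> \<epsilon>G (V \<gamma> s j) = rho \<gamma> s j"
  by (simp add: V_def clinear_sum[OF counit_linear] clinear_scale_complex[OF counit_linear] counit_U
      sum_delta_times)

text \<open>\<open>SG\<close> sends a coefficient to the adjoint of the transposed one and
  \<open>star\<close> removes the adjoint, leaving the transposed index; \<open>\<theta>\<close>
  then carries \<open>rho\<close> from the right side of u to the left.\<close>

lemma conj_V:
  assumes "s < n \<gamma>" "j < n \<gamma>"
  shows "\<theta> (star (SG (V \<gamma> s j))) = V \<gamma> j s"
proof -
  have "\<theta> (star (SG (V \<gamma> s j))) = (\<Sum>i<n \<gamma>. rho \<gamma> i s *\<^sub>C \<theta> (U \<gamma> j i))"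
    using assms
    by (simp add: V_def clinear_sum[OF antipode_linear] clinear_scale[OF antipode_linear] antipode_U
        star_sum star_scaleC star_star rho_cnj)
  also have "\<dots> = (\<Sum>i<n \<gamma>. \<Sum>a<n \<gamma>. \<Sum>b<n \<gamma>. (rho \<gamma> j a * (sig \<gamma> b i * rho \<gamma> i s)) *\<^sub>C U \<gamma> a b)"
    by (intro sum.cong refl)
      (simp add: antipode_square_U assms scaleC_sum_right scaleC_scaleC mult_ac)
  also have "\<dots> = (\<Sum>b<n \<gamma>. \<Sum>a<n \<gamma>. (rho \<gamma> j a * (\<Sum>i<n \<gamma>. sig \<gamma> b i * rho \<gamma> i s)) *\<^sub>C U \<gamma> a b)"
    by (subst sum_swap3) (simp add: scaleC_sum_left sum_distrib_left)
  also have "\<dots> = (\<Sum>b<n \<gamma>. if b = s then V \<gamma> j b else 0)"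
    by (intro sum.cong refl) (simp add: sig_rho assms V_def)
  finally show ?thesis using assms by simp
qed

text \<open>After the twist only a factor \<open>rho\<close> on the column of the adjoint is left;
  \<open>orthogonality_left\<close> contributes \<open>sig\<close>, which cancels the
  \<open>rho\<close> of the second argument.\<close>

lemma ip_V:
  assumes "s < n \<beta>" "j < n \<beta>" "s' < n \<alpha>" "j' < n \<alpha>"
  shows "ip (V \<beta> s j) (V \<alpha> s' j') = (if \<alpha> = \<beta> \<and> s = s' then rho \<alpha> j j' / d \<alpha> else 0)"
proof -
  have "\<theta> (star (V \<beta> s j)) = (\<Sum>k<n \<beta>. rho \<beta> k s *\<^sub>C \<theta> (star (U \<beta> k j)))"
    using assms
    by (simp add: V_def star_sum star_scaleC clinear_sum[OF antipode_linear] clinear_scale[OF antipode_linear] rho_cnj)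
  also have "\<dots> = (\<Sum>k<n \<beta>. \<Sum>a<n \<beta>. \<Sum>b<n \<beta>. (rho \<beta> j a * (sig \<beta> b k * rho \<beta> k s)) *\<^sub>C star (U \<beta> b a))"
    by (intro sum.cong refl)
      (simp add: theta_star_U assms scaleC_sum_right scaleC_scaleC mult_ac)
  also have "\<dots> = (\<Sum>b<n \<beta>. \<Sum>a<n \<beta>. (rho \<beta> j a * (\<Sum>k<n \<beta>. sig \<beta> b k * rho \<beta> k s)) *\<^sub>C star (U \<beta> b a))"
    by (subst sum_swap3) (simp add: scaleC_sum_left sum_distrib_left)
  also have "\<dots> = (\<Sum>b<n \<beta>. if b = s then (\<Sum>a<n \<beta>. rho \<beta> j a *\<^sub>C star (U \<beta> b a)) else 0)"
    by (intro sum.cong refl) (simp add: sig_rho assms)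
  also have "\<dots> = (\<Sum>a<n \<beta>. rho \<beta> j a *\<^sub>C star (U \<beta> s a))" using assms by simp
  finally have *: "\<theta> (star (V \<beta> s j)) = (\<Sum>a<n \<beta>. rho \<beta> j a *\<^sub>C star (U \<beta> s a))" .
  have "ip (V \<beta> s j) (V \<alpha> s' j')
    = (\<Sum>a<n \<beta>. \<Sum>i<n \<alpha>. rho \<beta> j a * rho \<alpha> s' i * hG (star (U \<beta> s a) * U \<alpha> i j'))"
    unfolding ip_def * V_def[of \<alpha>]
    by (simp add: sum_product scaleC_mult_left scaleC_mult_right hG_simps mult_ac)
  also have "\<dots> = (\<Sum>a<n \<beta>. if a = j' then (if \<alpha> = \<beta> then rho \<beta> j a * (\<Sum>i<n \<alpha>. rho \<alpha> s' i * sig \<alpha> i s) / d \<alpha> else 0) else 0)"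
    by (intro sum.cong refl)
      (auto simp: orthogonality_left assms sum_distrib_left sum_divide_distrib mult_ac)
  also have "\<dots> = (if \<alpha> = \<beta> \<and> s = s' then rho \<alpha> j j' / d \<alpha> else 0)"
    using assms by (auto simp: rho_sig)
  finally show ?thesis .
qed

end

section \<open>Densities\<close>

context dual_data
begin

text \<open>The index set A is a parameter and not the support, so that several densities can be
  compared over a common set. With these indices the inner sum is the trace of the product of z,
  \<open>rho\<close> and u.\<close>

definition FF :: "'i set \<Rightarrow> ('i \<Rightarrow> nat \<Rightarrow> nat \<Rightarrow> complex) \<Rightarrow> 'a" where
  "FF A z = (\<Sum>\<gamma>\<in>A. d \<gamma> *\<^sub>C (\<Sum>s<n \<gamma>. \<Sum>j<n \<gamma>. z \<gamma> j s *\<^sub>C V \<gamma> s j))"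

definition haar_FF :: "'i set \<Rightarrow> ('i \<Rightarrow> nat \<Rightarrow> nat \<Rightarrow> complex) \<Rightarrow> complex" where
  "haar_FF A z = (\<Sum>\<gamma>\<in>A. d \<gamma> * (\<Sum>s<n \<gamma>. \<Sum>j<n \<gamma>. z \<gamma> j s * rho \<gamma> s j))"

lemma pol_FF [simp]: "FF A z \<in> pol"
  unfolding FF_def by (intro pol_sum pol_scale pol_V) auto

lemma clinear_FF: "clinear f \<Longrightarrow> f (FF A z) = (\<Sum>\<gamma>\<in>A. d \<gamma> * (\<Sum>s<n \<gamma>. \<Sum>j<n \<gamma>. z \<gamma> j s * f (V \<gamma> s j)))"
  by (simp add: FF_def clinear_sum clinear_scale_complex)

lemma counit_FF: "\<epsilon>G (FF A z) = haar_FF A z"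
  unfolding clinear_FF[OF counit_linear] haar_FF_def
  by (intro sum.cong refl arg_cong2[of _ _ _ _ "(*)"]) (simp add: counit_V)

lemma cnj_d [simp]: "cnj (d \<gamma>) = d \<gamma>"
  by (metis d_real complex_cnj_complex_of_real)

lemma conj_FF: "\<theta> (star (SG (FF A z))) = FF A (\<lambda>\<gamma> i j. cnj (z \<gamma> j i))"
proof -
  have "\<theta> (star (SG (FF A z)))
    = (\<Sum>\<gamma>\<in>A. d \<gamma> *\<^sub>C (\<Sum>s<n \<gamma>. \<Sum>j<n \<gamma>. cnj (z \<gamma> j s) *\<^sub>C \<theta> (star (SG (V \<gamma> s j)))))"
    by (simp add: FF_def clinear_sum[OF antipode_linear] clinear_scale[OF antipode_linear] star_sum star_scaleC)
  also have "\<dots> = (\<Sum>\<gamma>\<in>A. d \<gamma> *\<^sub>C (\<Sum>s<n \<gamma>. \<Sum>j<n \<gamma>. cnj (z \<gamma> j s) *\<^sub>C V \<gamma> j s))"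
    by (intro sum.cong refl arg_cong2[of _ _ _ _ "(*\<^sub>C)"]) (simp add: conj_V)
  also have "\<dots> = FF A (\<lambda>\<gamma> i j. cnj (z \<gamma> j i))"
    unfolding FF_def by (intro sum.cong refl arg_cong2[of _ _ _ _ "(*\<^sub>C)"] sum.swap)
  finally show ?thesis .
qed

lemma functional_V:
  "\<exists>f :: 'a \<Rightarrow> complex. clinear f \<and> (\<forall>\<gamma> s j. s < n \<gamma> \<longrightarrow> j < n \<gamma> \<longrightarrow> f (V \<gamma> s j) = g \<gamma> s j)"
proof -
  obtain f :: "'a \<Rightarrow> complex" where f: "clinear f"
    and fU: "\<And>\<gamma> i j. i < n \<gamma> \<Longrightarrow> j < n \<gamma> \<Longrightarrow> f (U \<gamma> i j) = (\<Sum>s<n \<gamma>. sig \<gamma> i s * g \<gamma> s j)"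
    using functional_exists[of "\<lambda>\<gamma> i j. \<Sum>s<n \<gamma>. sig \<gamma> i s * g \<gamma> s j"] by blast
  have "f (V \<gamma> s j) = g \<gamma> s j" if "s < n \<gamma>" "j < n \<gamma>" for \<gamma> s j
  proof -
    have "f (V \<gamma> s j) = (\<Sum>i<n \<gamma>. \<Sum>k<n \<gamma>. rho \<gamma> s i * sig \<gamma> i k * g \<gamma> k j)"
      using that by (simp add: V_def clinear_sum[OF f] clinear_scale_complex[OF f] fU sum_distrib_left mult.assoc)
    also have "\<dots> = (\<Sum>k<n \<gamma>. (\<Sum>i<n \<gamma>. rho \<gamma> s i * sig \<gamma> i k) * g \<gamma> k j)"
      by (subst sum.swap) (simp add: sum_distrib_right)
    also have "\<dots> = (\<Sum>k<n \<gamma>. (if s = k then 1 else 0) * g \<gamma> k j)"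
      by (intro sum.cong refl) (simp add: rho_sig that)
    finally show ?thesis using that by (simp add: sum_delta_times)
  qed
  then show ?thesis using f by blast
qed

text \<open>The functional dual to the single element \<open>V \<gamma> j i\<close> recovers the
  entry up to the nonzero factor \<open>d \<gamma>\<close>.\<close>

lemma FF_inject:
  assumes "finite A" "FF A z = FF A w" "\<gamma> \<in> A" "i < n \<gamma>" "j < n \<gamma>"
  shows "z \<gamma> i j = w \<gamma> i j"
proof -
  obtain f :: "'a \<Rightarrow> complex" where f: "clinear f"
    and fV: "\<And>\<beta> s k. s < n \<beta> \<Longrightarrow> k < n \<beta> \<Longrightarrow> f (V \<beta> s k) = (if \<beta> = \<gamma> \<and> s = j \<and> k = i then 1 else 0)"
    using functional_V[of "\<lambda>\<beta> s k. if \<beta> = \<gamma> \<and> s = j \<and> k = i then 1 else 0"] by blast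
  have "f (FF A x) = d \<gamma> * x \<gamma> i j" for x
  proof -
    have "f (FF A x) = (\<Sum>\<beta>\<in>A. if \<beta> = \<gamma> then
      d \<beta> * (\<Sum>s<n \<beta>. if s = j then (\<Sum>k<n \<beta>. if k = i then x \<beta> k s else 0) else 0) else 0)"
      unfolding clinear_FF[OF f]
    proof (rule sum.cong[OF refl])
      fix \<beta>
      have "(\<Sum>s<n \<beta>. \<Sum>k<n \<beta>. x \<beta> k s * f (V \<beta> s k)) = (\<Sum>s<n \<beta>. if s = j then (\<Sum>k<n \<beta>. if k = i then x \<beta> k s else 0) else 0)"
        if "\<beta> = \<gamma>"
        by (rule sum.cong[OF refl]) (use that assms in \<open>auto simp: fV sum_delta_times\<close>)
      moreover have "(\<Sum>s<n \<beta>. \<Sum>k<n \<beta>. x \<beta> k s * f (V \<beta> s k)) = 0" if "\<beta> \<noteq> \<gamma>"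
        using that by (simp add: fV)
      ultimately show "d \<beta> * (\<Sum>s<n \<beta>. \<Sum>k<n \<beta>. x \<beta> k s * f (V \<beta> s k)) = (if \<beta> = \<gamma> then
        d \<beta> * (\<Sum>s<n \<beta>. if s = j then (\<Sum>k<n \<beta>. if k = i then x \<beta> k s else 0) else 0) else 0)"
        by auto
    qed
    then show ?thesis using assms by simp
  qed
  then have "d \<gamma> * z \<gamma> i j = d \<gamma> * w \<gamma> i j" using assms(2) by metis
  then show ?thesis by simp
qed

lemma FF_surj:
  assumes "a \<in> pol"
  shows "a = FF (csupp a) (\<lambda>\<gamma> j s. inverse (d \<gamma>) * (\<Sum>i<n \<gamma>. cf \<gamma> i j a * sig \<gamma> i s))"
proof -
  have "(\<Sum>i<n \<gamma>. \<Sum>j<n \<gamma>. cf \<gamma> i j a *\<^sub>C U \<gamma> i j)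
    = d \<gamma> *\<^sub>C (\<Sum>s<n \<gamma>. \<Sum>j<n \<gamma>. (inverse (d \<gamma>) * (\<Sum>i<n \<gamma>. cf \<gamma> i j a * sig \<gamma> i s)) *\<^sub>C V \<gamma> s j)" for \<gamma>
  proof -
    have "(\<Sum>i<n \<gamma>. \<Sum>j<n \<gamma>. cf \<gamma> i j a *\<^sub>C U \<gamma> i j)
      = (\<Sum>i<n \<gamma>. \<Sum>j<n \<gamma>. \<Sum>s<n \<gamma>. (cf \<gamma> i j a * sig \<gamma> i s) *\<^sub>C V \<gamma> s j)"
      by (intro sum.cong refl) (simp add: U_eq_V[of _ \<gamma>] scaleC_sum_right scaleC_scaleC)
    also have "\<dots> = (\<Sum>s<n \<gamma>. \<Sum>j<n \<gamma>. (\<Sum>i<n \<gamma>. cf \<gamma> i j a * sig \<gamma> i s) *\<^sub>C V \<gamma> s j)"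
      by (subst sum_swap3) (simp add: scaleC_sum_left)
    also have "\<dots> = d \<gamma> *\<^sub>C (\<Sum>s<n \<gamma>. \<Sum>j<n \<gamma>. (inverse (d \<gamma>) * (\<Sum>i<n \<gamma>. cf \<gamma> i j a * sig \<gamma> i s)) *\<^sub>C V \<gamma> s j)"
      unfolding scaleC_sum_right scaleC_scaleC
      by (intro sum.cong refl arg_cong2[of _ _ _ _ "(*\<^sub>C)"]) (simp add: mult.assoc[symmetric])
    finally show ?thesis .
  qed
  then show ?thesis
    unfolding FF_def using pol_expand[OF assms finite_csupp[OF assms] subset_refl] by simp
qed

lemma ip_FF:
  assumes "finite A"
  shows "ip (FF A z) (FF A w) = (\<Sum>\<gamma>\<in>A. d \<gamma> * (\<Sum>s<n \<gamma>. \<Sum>j<n \<gamma>. \<Sum>j'<n \<gamma>. cnj (z \<gamma> j s) * w \<gamma> j' s * rho \<gamma> j j'))"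
proof -
  have 1: "ip (V \<gamma> s j) (FF A w) = (\<Sum>j'<n \<gamma>. w \<gamma> j' s * rho \<gamma> j j')"
    if "\<gamma> \<in> A" "s < n \<gamma>" "j < n \<gamma>" for \<gamma> s j
  proof -
    have "ip (V \<gamma> s j) (FF A w) = (\<Sum>\<alpha>\<in>A. d \<alpha> * (\<Sum>s'<n \<alpha>. \<Sum>j'<n \<alpha>. w \<alpha> j' s' * ip (V \<gamma> s j) (V \<alpha> s' j')))"
      by (rule clinear_FF[OF ip.B_linear])
    also have "\<dots> = d \<gamma> * (\<Sum>s'<n \<gamma>. \<Sum>j'<n \<gamma>. w \<gamma> j' s' * ip (V \<gamma> s j) (V \<gamma> s' j'))"
      by (rule sum_F_eq[OF assms]) (use that in \<open>auto simp: ip_V\<close>)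
    also have "\<dots> = d \<gamma> * (\<Sum>s'<n \<gamma>. if s' = s then (\<Sum>j'<n \<gamma>. w \<gamma> j' s' * (rho \<gamma> j j' / d \<gamma>)) else 0)"
      by (intro arg_cong2[of _ _ _ _ "(*)"] refl sum.cong) (use that in \<open>auto simp: ip_V\<close>)
    also have "\<dots> = (\<Sum>j'<n \<gamma>. w \<gamma> j' s * rho \<gamma> j j')"
      using that by (simp add: sum_distrib_left)
    finally show ?thesis .
  qed
  have "ip (FF A z) (FF A w) = (\<Sum>\<gamma>\<in>A. d \<gamma> * (\<Sum>s<n \<gamma>. \<Sum>j<n \<gamma>. cnj (z \<gamma> j s) * ip (V \<gamma> s j) (FF A w)))"
    by (subst FF_def) (simp add: ip_sum_left ip_scale_left)
  also have "\<dots> = (\<Sum>\<gamma>\<in>A. d \<gamma> * (\<Sum>s<n \<gamma>. \<Sum>j<n \<gamma>. cnj (z \<gamma> j s) * (\<Sum>j'<n \<gamma>. w \<gamma> j' s * rho \<gamma> j j')))"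
    by (intro sum.cong refl arg_cong2[of _ _ _ _ "(*)"]) (simp add: 1)
  finally show ?thesis by (simp add: sum_distrib_left mult.assoc)
qed

section \<open>Powers of a density and their total mass\<close>

lemma conj_power:
  assumes "p \<in> pol" "\<theta> (star (SG p)) = p"
  shows "\<theta> (star (SG (p ^ Suc m))) = p ^ Suc m"
proof (induction m)
  case (Suc m)
  have "\<theta> (star (SG (p * p ^ Suc m))) = \<theta> (star (SG p)) * \<theta> (star (SG (p ^ Suc m)))"
    unfolding antipode_mult[OF assms(1) pol_power[OF assms(1)]] star_mult
    by (rule theta_mult) (intro pol_star pol_antipode pol_power assms)+
  then show ?case using Suc.IH assms(2) by simp
qed (use assms in simp)

lemma counit_power: "\<epsilon>G (p ^ m) = \<epsilon>G p ^ m"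
  by (induction m) (auto simp: counit_one counit_mult)

lemma antipode_one: "SG 1 = 1"
  using antipode_U[of 0 triv 0] triv by simp

lemma N_one: "ip.N 1 = 1"
  by (simp add: ip.N_def ip_def antipode_one hG_one)

text \<open>
  The powers of a self-adjoint density are again self-adjoint: \<open>\<theta> \<circ> star \<circ> SG\<close> is multiplicative and
  corresponds to the adjoint of the density. Hence the range projection is also a right support,
  and the Cauchy-Schwarz inequality bounds the total mass.
\<close>

lemma power_bound:
  assumes B: "finite B" and p: "p \<in> pol" "\<theta> (star (SG p)) = p"
    and z: "p ^ Suc m = FF B z"
    and q_cnj: "\<And>\<gamma> i j. \<gamma> \<in> B \<Longrightarrow> i < n \<gamma> \<Longrightarrow> j < n \<gamma> \<Longrightarrow> cnj (q \<gamma> i j) = q \<gamma> j i"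
    and q_idem: "\<And>\<gamma> i j. \<gamma> \<in> B \<Longrightarrow> i < n \<gamma> \<Longrightarrow> j < n \<gamma> \<Longrightarrow> (\<Sum>k<n \<gamma>. q \<gamma> i k * q \<gamma> k j) = q \<gamma> i j"
    and q_z: "\<And>\<gamma> i j. \<gamma> \<in> B \<Longrightarrow> i < n \<gamma> \<Longrightarrow> j < n \<gamma> \<Longrightarrow> (\<Sum>k<n \<gamma>. q \<gamma> i k * z \<gamma> k j) = z \<gamma> i j"
  shows "cmod (\<epsilon>G p) ^ Suc m \<le> sqrt (Re (haar_FF B q)) * ip.N (p ^ Suc m)"
proof -
  have "FF B (\<lambda>\<gamma> i j. cnj (z \<gamma> j i)) = FF B z"
    using conj_power[OF p, of m] conj_FF[of B z] z by simp
  then have z_cnj: "cnj (z \<gamma> j i) = z \<gamma> i j" if "\<gamma> \<in> B" "i < n \<gamma>" "j < n \<gamma>" for \<gamma> i j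
    using FF_inject[OF B, of "\<lambda>\<gamma> i j. cnj (z \<gamma> j i)" z] that by simp
  have z_q: "(\<Sum>k<n \<gamma>. z \<gamma> i k * q \<gamma> k j) = z \<gamma> i j" if g: "\<gamma> \<in> B" "i < n \<gamma>" "j < n \<gamma>" for \<gamma> i j
  proof -
    have "cnj (\<Sum>k<n \<gamma>. z \<gamma> i k * q \<gamma> k j) = (\<Sum>k<n \<gamma>. q \<gamma> j k * z \<gamma> k i)"
      using g by (simp add: z_cnj q_cnj mult.commute)
    then have "cnj (\<Sum>k<n \<gamma>. z \<gamma> i k * q \<gamma> k j) = cnj (z \<gamma> i j)"
      using g by (simp add: q_z z_cnj)
    then show ?thesis by (simp only: complex_cnj_cancel_iff)
  qed
  \<comment> \<open>Pairing with F(q) multiplies a density by q on the right, so a density with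
    right support q returns its total mass. For z this is the power of the counit, for q itself the
    squared norm.\<close>
  have eq: "ip (FF B q) (FF B w) = haar_FF B w"
    if w: "\<And>\<gamma> i j. \<gamma> \<in> B \<Longrightarrow> i < n \<gamma> \<Longrightarrow> j < n \<gamma> \<Longrightarrow> (\<Sum>k<n \<gamma>. w \<gamma> i k * q \<gamma> k j) = w \<gamma> i j" for w
    unfolding ip_FF[OF B] haar_FF_def
  proof (rule sum.cong[OF refl], rule arg_cong2[of _ _ _ _ "(*)", OF refl])
    fix \<gamma> assume g: "\<gamma> \<in> B"
    have "(\<Sum>s<n \<gamma>. \<Sum>j<n \<gamma>. \<Sum>j'<n \<gamma>. cnj (q \<gamma> j s) * w \<gamma> j' s * rho \<gamma> j j')
      = (\<Sum>j'<n \<gamma>. \<Sum>j<n \<gamma>. \<Sum>s<n \<gamma>. cnj (q \<gamma> j s) * w \<gamma> j' s * rho \<gamma> j j')"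
      by (rule sum_swap3)
    also have "\<dots> = (\<Sum>j'<n \<gamma>. \<Sum>j<n \<gamma>. (\<Sum>s<n \<gamma>. w \<gamma> j' s * q \<gamma> s j) * rho \<gamma> j j')"
      by (simp add: sum_distrib_left sum_distrib_right q_cnj g mult_ac)
    also have "\<dots> = (\<Sum>j'<n \<gamma>. \<Sum>j<n \<gamma>. w \<gamma> j' j * rho \<gamma> j j')"
      by (simp add: w g)
    also have "\<dots> = (\<Sum>j<n \<gamma>. \<Sum>j'<n \<gamma>. w \<gamma> j' j * rho \<gamma> j j')"
      by (rule sum.swap)
    finally show "(\<Sum>s<n \<gamma>. \<Sum>j<n \<gamma>. \<Sum>j'<n \<gamma>. cnj (q \<gamma> j s) * w \<gamma> j' s * rho \<gamma> j j')
      = (\<Sum>s<n \<gamma>. \<Sum>j<n \<gamma>. w \<gamma> j s * rho \<gamma> s j)" .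
  qed
  have "\<epsilon>G p ^ Suc m = ip (FF B q) (p ^ Suc m)"
    using counit_power[of p "Suc m"] by (simp only: z counit_FF eq[OF z_q])
  then have "cmod (\<epsilon>G p) ^ Suc m \<le> ip.N (FF B q) * ip.N (p ^ Suc m)"
    using ip.cauchy_schwarz[of "FF B q" "p ^ Suc m"] pol_power[OF p(1)]
    by (metis norm_power pol_FF)
  also have "ip.N (FF B q) = sqrt (Re (haar_FF B q))"
    by (simp add: ip.N_def eq[OF q_idem])
  finally show ?thesis .
qed

text \<open>The form weighted by \<open>rho\<close> on tuples, that is, on the tensor product of the
  representation space with the algebra.\<close>

definition Qf :: "'i \<Rightarrow> (nat \<Rightarrow> 'a) \<Rightarrow> (nat \<Rightarrow> 'a) \<Rightarrow> complex" where
  "Qf \<gamma> \<xi> \<eta> = (\<Sum>i<n \<gamma>. \<Sum>l<n \<gamma>. rho \<gamma> i l * ip (\<xi> i) (\<eta> l))"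

definition rtv :: "'i \<Rightarrow> (nat \<Rightarrow> 'a) \<Rightarrow> nat \<Rightarrow> 'a" where
  "rtv \<gamma> \<xi> s = (\<Sum>i<n \<gamma>. rt \<gamma> s i *\<^sub>C \<xi> i)"

lemma Qf_rtv: "Qf \<gamma> \<xi> \<eta> = (\<Sum>s<n \<gamma>. ip (rtv \<gamma> \<xi> s) (rtv \<gamma> \<eta> s))"
proof -
  have "(\<Sum>s<n \<gamma>. ip (rtv \<gamma> \<xi> s) (rtv \<gamma> \<eta> s))
    = (\<Sum>s<n \<gamma>. \<Sum>l<n \<gamma>. \<Sum>i<n \<gamma>. rt \<gamma> i s * rt \<gamma> s l * ip (\<xi> i) (\<eta> l))"
    by (simp add: rtv_def ip_sum_left ip_scale_left ip.B_sum ip.B_scale rt_cnj sum_distrib_left mult_ac)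
  also have "\<dots> = Qf \<gamma> \<xi> \<eta>"
    unfolding Qf_def by (subst sum_swap3) (simp add: rho_rt sum_distrib_right)
  finally show ?thesis ..
qed

lemma pol_rtv: "(\<And>i. i < n \<gamma> \<Longrightarrow> \<xi> i \<in> pol) \<Longrightarrow> rtv \<gamma> \<xi> s \<in> pol"
  unfolding rtv_def by (intro pol_sum pol_scale) auto

lemma Qf_self:
  assumes "\<And>i. i < n \<gamma> \<Longrightarrow> \<xi> i \<in> pol"
  shows "Qf \<gamma> \<xi> \<xi> = of_real (\<Sum>s<n \<gamma>. (ip.N (rtv \<gamma> \<xi> s))\<^sup>2)"
  unfolding Qf_rtv of_real_sum by (intro sum.cong refl ip.B_self pol_rtv assms)

text \<open>The weighted form dominates each component because \<open>rs\<close> inverts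
  \<open>rt\<close>; convergence for the weighted form thus passes to the components.\<close>

lemma N_le_Qf:
  assumes \<xi>: "\<And>i. i < n \<gamma> \<Longrightarrow> \<xi> i \<in> pol" and i: "i < n \<gamma>"
  shows "ip.N (\<xi> i) \<le> (\<Sum>s<n \<gamma>. cmod (rs \<gamma> i s)) * sqrt (Re (Qf \<gamma> \<xi> \<xi>))"
proof -
  have "(\<Sum>s<n \<gamma>. rs \<gamma> i s *\<^sub>C rtv \<gamma> \<xi> s) = (\<Sum>l<n \<gamma>. (\<Sum>s<n \<gamma>. rs \<gamma> i s * rt \<gamma> s l) *\<^sub>C \<xi> l)"
    unfolding rtv_def scaleC_sum_right scaleC_sum_left scaleC_scaleC by (rule sum.swap)
  also have "\<dots> = (\<Sum>l<n \<gamma>. (if i = l then 1 else 0) *\<^sub>C \<xi> l)"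
    by (intro sum.cong refl) (simp add: rs_rt i)
  also have "\<dots> = \<xi> i" using i by (simp add: sum_delta_scaleC)
  finally have "ip.N (\<xi> i) = ip.N (\<Sum>s<n \<gamma>. rs \<gamma> i s *\<^sub>C rtv \<gamma> \<xi> s)" by simp
  also have "\<dots> \<le> (\<Sum>s<n \<gamma>. ip.N (rs \<gamma> i s *\<^sub>C rtv \<gamma> \<xi> s))"
    by (intro ip.N_sum pol_scale pol_rtv \<xi>)
  also have "\<dots> = (\<Sum>s<n \<gamma>. cmod (rs \<gamma> i s) * ip.N (rtv \<gamma> \<xi> s))"
    by (intro sum.cong refl ip.N_scale pol_rtv \<xi>)
  also have "\<dots> \<le> (\<Sum>s<n \<gamma>. cmod (rs \<gamma> i s) * sqrt (Re (Qf \<gamma> \<xi> \<xi>)))"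
  proof (intro sum_mono mult_left_mono)
    fix s assume "s \<in> {..<n \<gamma>}"
    then have "(ip.N (rtv \<gamma> \<xi> s))\<^sup>2 \<le> Re (Qf \<gamma> \<xi> \<xi>)"
      using member_le_sum[of s "{..<n \<gamma>}" "\<lambda>s. (ip.N (rtv \<gamma> \<xi> s))\<^sup>2"] Qf_self[of \<gamma> \<xi>, OF \<xi>]
      by simp
    then show "ip.N (rtv \<gamma> \<xi> s) \<le> sqrt (Re (Qf \<gamma> \<xi> \<xi>))" by (rule real_le_rsqrt)
  qed auto
  finally show ?thesis by (simp add: sum_distrib_right)
qed

text \<open>The twist conjugates the adjoint of u by \<open>rho\<close>, and weighting the rows by
  \<open>rho\<close> makes unitarity applicable again. The identity says that u is isometric for the
  form \<open>Qf\<close>.\<close>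

lemma rho_unitary:
  assumes "k < n \<gamma>" "j < n \<gamma>"
  shows "(\<Sum>i<n \<gamma>. \<Sum>l<n \<gamma>. rho \<gamma> i l *\<^sub>C (\<theta> (star (U \<gamma> i k)) * U \<gamma> l j)) = rho \<gamma> k j *\<^sub>C 1"
proof -
  have 1: "(\<Sum>i<n \<gamma>. rho \<gamma> i l *\<^sub>C \<theta> (star (U \<gamma> i k))) = (\<Sum>a<n \<gamma>. rho \<gamma> k a *\<^sub>C star (U \<gamma> l a))"
    if l: "l < n \<gamma>" for l
  proof -
    have "(\<Sum>i<n \<gamma>. rho \<gamma> i l *\<^sub>C \<theta> (star (U \<gamma> i k)))
      = (\<Sum>i<n \<gamma>. \<Sum>a<n \<gamma>. \<Sum>b<n \<gamma>. (rho \<gamma> k a * (sig \<gamma> b i * rho \<gamma> i l)) *\<^sub>C star (U \<gamma> b a))"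
      by (intro sum.cong refl) (simp add: theta_star_U assms scaleC_sum_right scaleC_scaleC mult_ac)
    also have "\<dots> = (\<Sum>b<n \<gamma>. \<Sum>a<n \<gamma>. (rho \<gamma> k a * (\<Sum>i<n \<gamma>. sig \<gamma> b i * rho \<gamma> i l)) *\<^sub>C star (U \<gamma> b a))"
      by (subst sum_swap3) (simp add: scaleC_sum_left sum_distrib_left)
    also have "\<dots> = (\<Sum>b<n \<gamma>. if b = l then (\<Sum>a<n \<gamma>. rho \<gamma> k a *\<^sub>C star (U \<gamma> b a)) else 0)"
      by (intro sum.cong refl) (simp add: sig_rho l)
    finally show ?thesis using l by simp
  qed
  have "(\<Sum>i<n \<gamma>. \<Sum>l<n \<gamma>. rho \<gamma> i l *\<^sub>C (\<theta> (star (U \<gamma> i k)) * U \<gamma> l j))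
    = (\<Sum>l<n \<gamma>. (\<Sum>i<n \<gamma>. rho \<gamma> i l *\<^sub>C \<theta> (star (U \<gamma> i k))) * U \<gamma> l j)"
    by (subst sum.swap) (simp add: sum_distrib_right scaleC_mult_left)
  also have "\<dots> = (\<Sum>l<n \<gamma>. \<Sum>a<n \<gamma>. rho \<gamma> k a *\<^sub>C (star (U \<gamma> l a) * U \<gamma> l j))"
    by (simp add: 1 sum_distrib_right scaleC_mult_left)
  also have "\<dots> = (\<Sum>a<n \<gamma>. rho \<gamma> k a *\<^sub>C (\<Sum>l<n \<gamma>. star (U \<gamma> l a) * U \<gamma> l j))"
    by (subst sum.swap) (simp add: scaleC_sum_right)
  also have "\<dots> = (\<Sum>a<n \<gamma>. if a = j then rho \<gamma> k a *\<^sub>C 1 else 0)"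
    by (intro sum.cong refl) (simp add: unitary_left assms)
  finally show ?thesis using assms by simp
qed

text \<open>The tuple obtained by letting u act on the elementary tensor of v and a.\<close>

definition Uv :: "'i \<Rightarrow> (nat \<Rightarrow> complex) \<Rightarrow> 'a \<Rightarrow> nat \<Rightarrow> 'a" where
  "Uv \<gamma> v a i = (\<Sum>j<n \<gamma>. v j *\<^sub>C (U \<gamma> i j * a))"

lemma pol_Uv: "i < n \<gamma> \<Longrightarrow> a \<in> pol \<Longrightarrow> Uv \<gamma> v a i \<in> pol"
  unfolding Uv_def by (intro pol_sum pol_scale pol_mult pol_U) auto

lemma Qf_Uv:
  assumes a: "a \<in> pol"
  shows "Qf \<gamma> (Uv \<gamma> v a) (Uv \<gamma> v a) = (\<Sum>k<n \<gamma>. \<Sum>j<n \<gamma>. cnj (v k) * rho \<gamma> k j * v j) * ip a a"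
proof -
  have "ip (U \<gamma> i k * a) (U \<gamma> l j * a) = hG (\<theta> (star a) * (\<theta> (star (U \<gamma> i k)) * U \<gamma> l j) * a)"
    if "i < n \<gamma>" "k < n \<gamma>" "l < n \<gamma>" "j < n \<gamma>" for i k l j
    using that a by (simp add: ip_def star_mult theta_mult pol_star mult.assoc)
  then have "Qf \<gamma> (Uv \<gamma> v a) (Uv \<gamma> v a) = (\<Sum>i<n \<gamma>. \<Sum>l<n \<gamma>. \<Sum>j<n \<gamma>. \<Sum>k<n \<gamma>.
      rho \<gamma> i l * (cnj (v k) * v j * hG (\<theta> (star a) * (\<theta> (star (U \<gamma> i k)) * U \<gamma> l j) * a)))"
    by (simp add: Qf_def Uv_def ip_sum_left ip_scale_left ip.B_sum ip.B_scale sum_distrib_left mult_ac)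
  also have "\<dots> = (\<Sum>i<n \<gamma>. \<Sum>k<n \<gamma>. \<Sum>j<n \<gamma>. \<Sum>l<n \<gamma>.
      rho \<gamma> i l * (cnj (v k) * v j * hG (\<theta> (star a) * (\<theta> (star (U \<gamma> i k)) * U \<gamma> l j) * a)))"
    by (rule sum.cong[OF refl], rule sum_swap3)
  also have "\<dots> = (\<Sum>k<n \<gamma>. \<Sum>j<n \<gamma>. \<Sum>i<n \<gamma>. \<Sum>l<n \<gamma>.
      rho \<gamma> i l * (cnj (v k) * v j * hG (\<theta> (star a) * (\<theta> (star (U \<gamma> i k)) * U \<gamma> l j) * a)))"
    by (subst sum.swap, rule sum.cong[OF refl], rule sum.swap)
  also have "\<dots> = (\<Sum>k<n \<gamma>. \<Sum>j<n \<gamma>. cnj (v k) * v j *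
      hG (\<theta> (star a) * (\<Sum>i<n \<gamma>. \<Sum>l<n \<gamma>. rho \<gamma> i l *\<^sub>C (\<theta> (star (U \<gamma> i k)) * U \<gamma> l j)) * a))"
    by (simp add: sum_distrib_left sum_distrib_right hG_simps scaleC_mult_left scaleC_mult_right mult_ac)
  also have "\<dots> = (\<Sum>k<n \<gamma>. \<Sum>j<n \<gamma>. cnj (v k) * v j * (rho \<gamma> k j * ip a a))"
    by (intro sum.cong refl) (simp add: rho_unitary scaleC_mult_left scaleC_mult_right hG_simps ip_def)
  finally show ?thesis by (simp add: sum_distrib_left sum_distrib_right mult_ac)
qed

end

section \<open>Almost invariant vectors\<close>

text \<open>\<open>P_square\<close> factors P as P times its adjoint. It splits P into its columns,
  and the estimates for p are carried out column by column.\<close>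

locale growth = dual_data \<Delta>G \<epsilon>G SG n U triv rho sig rt rs
  for \<Delta>G :: "'a::complex_star_algebra \<Rightarrow> ('a, 'a) tensor" and \<epsilon>G SG
    and n :: "'i \<Rightarrow> nat" and U :: "'i \<Rightarrow> nat \<Rightarrow> nat \<Rightarrow> 'a" and triv rho sig rt rs +
  fixes A :: "'i set" and P :: "'i \<Rightarrow> nat \<Rightarrow> nat \<Rightarrow> complex"
  assumes finite_A: "finite A"
    and P_square: "\<lbrakk>\<gamma> \<in> A; i < n \<gamma>; j < n \<gamma>\<rbrakk> \<Longrightarrow> P \<gamma> i j = (\<Sum>m<n \<gamma>. P \<gamma> i m * cnj (P \<gamma> j m))"
    and triv_A: "triv \<in> A" "P triv 0 0 = 1"
begin

definition p :: 'a where "p = FF A P"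
definition \<tau> :: complex where "\<tau> = haar_FF A P"

lemma pol_p [simp]: "p \<in> pol" by (simp add: p_def)

lemma counit_p: "\<epsilon>G p = \<tau>"
  by (simp add: p_def \<tau>_def counit_FF)

lemma conj_p: "\<theta> (star (SG p)) = p"
proof -
  have "cnj (P \<gamma> j i) = P \<gamma> i j" if g: "\<gamma> \<in> A" "i < n \<gamma>" "j < n \<gamma>" for \<gamma> i j
    unfolding arg_cong[OF P_square[OF g(1,3,2)], of cnj]
    by (subst P_square[OF g]) (simp add: mult.commute)
  then show ?thesis
    unfolding p_def conj_FF by (simp add: FF_def)
qed

definition energy :: "'i \<Rightarrow> (nat \<Rightarrow> complex) \<Rightarrow> complex" where
  "energy \<gamma> v = (\<Sum>k<n \<gamma>. \<Sum>j<n \<gamma>. cnj (v k) * rho \<gamma> k j * v j)"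

abbreviation "Pcol \<gamma> m \<equiv> \<lambda>j. P \<gamma> j m"

text \<open>Splitting P into columns turns its Haar weight into a sum of weighted squared lengths,
  which are the numbers that the isometry property of u reproduces.\<close>

lemma \<tau>_eq: "\<tau> = (\<Sum>\<gamma>\<in>A. d \<gamma> * (\<Sum>m<n \<gamma>. energy \<gamma> (Pcol \<gamma> m)))"
  unfolding \<tau>_def haar_FF_def
proof (rule sum.cong[OF refl], rule arg_cong2[of _ _ _ _ "(*)", OF refl])
  fix \<gamma> assume "\<gamma> \<in> A"
  then have "(\<Sum>s<n \<gamma>. \<Sum>j<n \<gamma>. P \<gamma> j s * rho \<gamma> s j)
    = (\<Sum>s<n \<gamma>. \<Sum>j<n \<gamma>. \<Sum>m<n \<gamma>. cnj (P \<gamma> s m) * rho \<gamma> s j * P \<gamma> j m)"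
    by (intro sum.cong refl, subst P_square) (simp_all add: sum_distrib_left sum_distrib_right mult_ac)
  also have "\<dots> = (\<Sum>m<n \<gamma>. \<Sum>j<n \<gamma>. \<Sum>s<n \<gamma>. cnj (P \<gamma> s m) * rho \<gamma> s j * P \<gamma> j m)"
    by (rule sum_swap3)
  also have "\<dots> = (\<Sum>m<n \<gamma>. energy \<gamma> (Pcol \<gamma> m))"
    unfolding energy_def by (rule sum.cong[OF refl], rule sum.swap)
  finally show "(\<Sum>s<n \<gamma>. \<Sum>j<n \<gamma>. P \<gamma> j s * rho \<gamma> s j) = (\<Sum>m<n \<gamma>. energy \<gamma> (Pcol \<gamma> m))" .
qed

text \<open>The \<open>rho\<close> contained in \<open>V\<close> becomes the weight of
  \<open>Qf\<close>, and the factorisation of P gives one factor to each argument; p thereby appears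
  as a compression of u by the columns of P.\<close>

lemma ip_p_mult:
  "ip b (p * a) = (\<Sum>\<gamma>\<in>A. d \<gamma> * (\<Sum>m<n \<gamma>. Qf \<gamma> (\<lambda>i. Pcol \<gamma> m i *\<^sub>C b) (Uv \<gamma> (Pcol \<gamma> m) a)))"
proof -
  have cl: "clinear (\<lambda>x. ip b (x * a))"
    using ip.B_linear[of b] by (simp add: clinear_def distrib_right scaleC_mult_left)
  have V: "ip b (V \<gamma> s j * a) = (\<Sum>i<n \<gamma>. rho \<gamma> s i * ip b (U \<gamma> i j * a))" for \<gamma> s j
    by (simp add: V_def sum_distrib_right scaleC_mult_left ip.B_sum ip.B_scale)
  have eq: "(\<Sum>s<n \<gamma>. \<Sum>j<n \<gamma>. P \<gamma> j s * ip b (V \<gamma> s j * a))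
    = (\<Sum>m<n \<gamma>. Qf \<gamma> (\<lambda>i. Pcol \<gamma> m i *\<^sub>C b) (Uv \<gamma> (Pcol \<gamma> m) a))" if "\<gamma> \<in> A" for \<gamma>
  proof -
    have "(\<Sum>s<n \<gamma>. \<Sum>j<n \<gamma>. P \<gamma> j s * ip b (V \<gamma> s j * a))
      = (\<Sum>s<n \<gamma>. \<Sum>j<n \<gamma>. \<Sum>m<n \<gamma>. \<Sum>i<n \<gamma>. P \<gamma> j m * cnj (P \<gamma> s m) * (rho \<gamma> s i * ip b (U \<gamma> i j * a)))"
      using that by (intro sum.cong refl, subst P_square)
        (simp_all add: V sum_product)
    also have "\<dots> = (\<Sum>m<n \<gamma>. \<Sum>j<n \<gamma>. \<Sum>s<n \<gamma>. \<Sum>i<n \<gamma>. P \<gamma> j m * cnj (P \<gamma> s m) * (rho \<gamma> s i * ip b (U \<gamma> i j * a)))"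
      by (rule sum_swap3)
    also have "\<dots> = (\<Sum>m<n \<gamma>. \<Sum>s<n \<gamma>. \<Sum>i<n \<gamma>. \<Sum>j<n \<gamma>. P \<gamma> j m * cnj (P \<gamma> s m) * (rho \<gamma> s i * ip b (U \<gamma> i j * a)))"
      by (rule sum.cong[OF refl], subst sum.swap, rule sum.cong[OF refl], rule sum.swap)
    also have "\<dots> = (\<Sum>m<n \<gamma>. Qf \<gamma> (\<lambda>i. Pcol \<gamma> m i *\<^sub>C b) (Uv \<gamma> (Pcol \<gamma> m) a))"
      unfolding Qf_def Uv_def
      by (simp add: ip_scale_left ip.B_sum ip.B_scale sum_distrib_left mult_ac)
    finally show ?thesis .
  qed
  show ?thesis
    unfolding p_def clinear_FF[OF cl] by (simp add: eq)
qed

lemma Qf_scaled: "Qf \<gamma> (\<lambda>i. v i *\<^sub>C b) (\<lambda>i. v i *\<^sub>C b) = energy \<gamma> v * ip b b"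
  by (simp add: Qf_def energy_def ip_scale_left ip.B_scale sum_distrib_left sum_distrib_right mult_ac)

lemma Qf_cnj:
  assumes "\<And>i. i < n \<gamma> \<Longrightarrow> \<xi> i \<in> pol" "\<And>i. i < n \<gamma> \<Longrightarrow> \<eta> i \<in> pol"
  shows "Qf \<gamma> \<xi> \<eta> = cnj (Qf \<gamma> \<eta> \<xi>)"
proof -
  have "cnj (Qf \<gamma> \<eta> \<xi>) = (\<Sum>i<n \<gamma>. \<Sum>l<n \<gamma>. rho \<gamma> l i * ip (\<xi> l) (\<eta> i))"
    using assms by (simp add: Qf_def rho_cnj ip.B_cnj[symmetric])
  also have "\<dots> = Qf \<gamma> \<xi> \<eta>" unfolding Qf_def by (rule sum.swap)
  finally show ?thesis ..
qed

lemma Qf_diff: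
  "Qf \<gamma> (\<lambda>i. \<xi> i - \<eta> i) (\<lambda>i. \<xi> i - \<eta> i) = Qf \<gamma> \<xi> \<xi> + Qf \<gamma> \<eta> \<eta> - Qf \<gamma> \<xi> \<eta> - Qf \<gamma> \<eta> \<xi>"
proof -
  have "ip (x - y) z = ip x z - ip y z" for x y z
    using ip_add_left[of "x - y" y z] by (simp add: eq_diff_eq)
  then show ?thesis
    by (simp add: Qf_def clinear_minus[OF ip.B_linear] right_diff_distrib sum_subtractf)
qed

definition defect :: "'a \<Rightarrow> 'a \<Rightarrow> 'i \<Rightarrow> nat \<Rightarrow> nat \<Rightarrow> 'a" where
  "defect a b \<gamma> m = (\<lambda>i. Uv \<gamma> (Pcol \<gamma> m) a i - Pcol \<gamma> m i *\<^sub>C b)"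

lemma pol_defect: "a \<in> pol \<Longrightarrow> b \<in> pol \<Longrightarrow> i < n \<gamma> \<Longrightarrow> defect a b \<gamma> m i \<in> pol"
  unfolding defect_def by (intro pol_minus pol_Uv pol_scale)

text \<open>Expansion of the square: u preserves the weighted form, so both diagonal terms are the
  energy of the column times a squared norm, and these energies add up to \<tau>; the cross terms
  add up to the matrix element of p. A nearly maximal matrix element therefore makes every defect
  nearly 0.\<close>

lemma defect_identity:
  assumes a: "a \<in> pol" and b: "b \<in> pol"
  shows "(\<Sum>\<gamma>\<in>A. d \<gamma> * (\<Sum>m<n \<gamma>. Qf \<gamma> (defect a b \<gamma> m) (defect a b \<gamma> m)))
    = \<tau> * (ip a a + ip b b) - ip b (p * a) - cnj (ip b (p * a))"
proof -
  have 1: "Qf \<gamma> (defect a b \<gamma> m) (defect a b \<gamma> m) = energy \<gamma> (Pcol \<gamma> m) * (ip a a + ip b b)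
    - cnj (Qf \<gamma> (\<lambda>i. Pcol \<gamma> m i *\<^sub>C b) (Uv \<gamma> (Pcol \<gamma> m) a))
    - Qf \<gamma> (\<lambda>i. Pcol \<gamma> m i *\<^sub>C b) (Uv \<gamma> (Pcol \<gamma> m) a)" for \<gamma> m
    unfolding defect_def Qf_diff Qf_scaled Qf_Uv[OF a, folded energy_def]
    using Qf_cnj[of \<gamma> "Uv \<gamma> (Pcol \<gamma> m) a" "\<lambda>i. Pcol \<gamma> m i *\<^sub>C b"] a b
    by (simp add: pol_Uv pol_scale algebra_simps)
  have "(\<Sum>\<gamma>\<in>A. d \<gamma> * (\<Sum>m<n \<gamma>. Qf \<gamma> (defect a b \<gamma> m) (defect a b \<gamma> m)))
    = (\<Sum>\<gamma>\<in>A. d \<gamma> * (\<Sum>m<n \<gamma>. energy \<gamma> (Pcol \<gamma> m) * (ip a a + ip b b)))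
     - (\<Sum>\<gamma>\<in>A. d \<gamma> * (\<Sum>m<n \<gamma>. cnj (Qf \<gamma> (\<lambda>i. Pcol \<gamma> m i *\<^sub>C b) (Uv \<gamma> (Pcol \<gamma> m) a))))
     - (\<Sum>\<gamma>\<in>A. d \<gamma> * (\<Sum>m<n \<gamma>. Qf \<gamma> (\<lambda>i. Pcol \<gamma> m i *\<^sub>C b) (Uv \<gamma> (Pcol \<gamma> m) a)))"
    unfolding 1 by (simp only: sum_subtractf right_diff_distrib)
  also have "(\<Sum>\<gamma>\<in>A. d \<gamma> * (\<Sum>m<n \<gamma>. energy \<gamma> (Pcol \<gamma> m) * (ip a a + ip b b))) = \<tau> * (ip a a + ip b b)"
    by (simp add: \<tau>_eq sum_distrib_right mult.assoc)
  also have "(\<Sum>\<gamma>\<in>A. d \<gamma> * (\<Sum>m<n \<gamma>. cnj (Qf \<gamma> (\<lambda>i. Pcol \<gamma> m i *\<^sub>C b) (Uv \<gamma> (Pcol \<gamma> m) a)))) = cnj (ip b (p * a))"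
    by (simp add: ip_p_mult)
  finally show ?thesis by (simp add: ip_p_mult)
qed

lemma energy_eq:
  "energy \<gamma> v = of_real (\<Sum>s<n \<gamma>. (cmod (\<Sum>i<n \<gamma>. rt \<gamma> s i * v i))\<^sup>2)"
proof -
  have rtv: "rtv \<gamma> (\<lambda>i. v i *\<^sub>C 1) s = (\<Sum>i<n \<gamma>. rt \<gamma> s i * v i) *\<^sub>C 1" for s
    by (simp add: rtv_def scaleC_sum_left scaleC_scaleC)
  have "energy \<gamma> v = Qf \<gamma> (\<lambda>i. v i *\<^sub>C 1) (\<lambda>i. v i *\<^sub>C 1)"
    by (simp add: Qf_scaled ip_def antipode_one hG_one)
  also have "\<dots> = of_real (\<Sum>s<n \<gamma>. (ip.N (rtv \<gamma> (\<lambda>i. v i *\<^sub>C 1) s))\<^sup>2)"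
    by (rule Qf_self) (simp add: pol_scale)
  finally show ?thesis by (simp add: rtv ip.N_scale N_one)
qed

lemma \<tau>_real: "\<tau> = of_real (Re \<tau>)"
proof -
  have "cnj \<tau> = \<tau>" by (simp add: \<tau>_eq energy_eq)
  then show ?thesis by (simp add: complex_eq_iff)
qed

text \<open>All terms are nonnegative, and the trivial block contributes a strictly positive one
  because P is 1 there.\<close>

lemma \<tau>_pos: "0 < Re \<tau>"
proof -
  have "Re (d \<gamma> * (\<Sum>m<n \<gamma>. energy \<gamma> (Pcol \<gamma> m)))
    = Re (d \<gamma>) * (\<Sum>m<n \<gamma>. \<Sum>s<n \<gamma>. (cmod (\<Sum>i<n \<gamma>. rt \<gamma> s i * P \<gamma> i m))\<^sup>2)" for \<gamma>
    by (subst d_real) (simp add: energy_eq)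
  then have "Re \<tau> = (\<Sum>\<gamma>\<in>A. Re (d \<gamma>) * (\<Sum>m<n \<gamma>. \<Sum>s<n \<gamma>. (cmod (\<Sum>i<n \<gamma>. rt \<gamma> s i * P \<gamma> i m))\<^sup>2))"
    by (simp add: \<tau>_eq)
  moreover have "\<dots> > 0"
  proof (rule sum_pos2[OF finite_A triv_A(1)])
    have "d triv = rt triv 0 0 * rt triv 0 0" by (simp add: d_def rho_rt triv(1))
    then have "rt triv 0 0 \<noteq> 0" using d_nonzero[of triv] by auto
    then show "0 < Re (d triv) * (\<Sum>m<n triv. \<Sum>s<n triv. (cmod (\<Sum>i<n triv. rt triv s i * P triv i m))\<^sup>2)"
      using d_pos[of triv] by (simp add: triv triv_A)
  qed (auto intro!: mult_nonneg_nonneg sum_nonneg less_imp_le[OF d_pos])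
  ultimately show ?thesis by simp
qed

lemma defect_real:
  assumes a: "a \<in> pol" and b: "b \<in> pol"
  shows "(\<Sum>\<gamma>\<in>A. Re (d \<gamma>) * (\<Sum>m<n \<gamma>. Re (Qf \<gamma> (defect a b \<gamma> m) (defect a b \<gamma> m))))
    = Re \<tau> * ((ip.N a)\<^sup>2 + (ip.N b)\<^sup>2) - 2 * Re (ip b (p * a))"
proof -
  have "Im (d \<gamma>) = 0" for \<gamma>
    by (subst d_real) simp
  then have "(\<Sum>\<gamma>\<in>A. Re (d \<gamma>) * (\<Sum>m<n \<gamma>. Re (Qf \<gamma> (defect a b \<gamma> m) (defect a b \<gamma> m))))
    = Re (\<Sum>\<gamma>\<in>A. d \<gamma> * (\<Sum>m<n \<gamma>. Qf \<gamma> (defect a b \<gamma> m) (defect a b \<gamma> m)))"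
    by simp
  also have "\<dots> = Re (\<tau> * (ip a a + ip b b)) - 2 * Re (ip b (p * a))"
    unfolding defect_identity[OF a b] by simp
  also have "\<tau> * (ip a a + ip b b) = of_real (Re \<tau> * ((ip.N a)\<^sup>2 + (ip.N b)\<^sup>2))"
    using a b by (subst \<tau>_real) (simp add: ip.B_self)
  finally show ?thesis by simp
qed

lemma Qf_nonneg: "(\<And>i. i < n \<gamma> \<Longrightarrow> \<xi> i \<in> pol) \<Longrightarrow> 0 \<le> Re (Qf \<gamma> \<xi> \<xi>)"
  by (simp add: Qf_self sum_nonneg)

lemma defect_term_le:
  assumes a: "a \<in> pol" and b: "b \<in> pol" and g: "\<gamma> \<in> A" "m < n \<gamma>"
  shows "Re (d \<gamma>) * Re (Qf \<gamma> (defect a b \<gamma> m) (defect a b \<gamma> m))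
    \<le> Re \<tau> * ((ip.N a)\<^sup>2 + (ip.N b)\<^sup>2) - 2 * Re (ip b (p * a))"
proof -
  have nn: "0 \<le> Re (Qf \<gamma> (defect a b \<gamma> m) (defect a b \<gamma> m))" for \<gamma> m
    by (intro Qf_nonneg pol_defect a b)
  have "Re (d \<gamma>) * Re (Qf \<gamma> (defect a b \<gamma> m) (defect a b \<gamma> m))
    \<le> Re (d \<gamma>) * (\<Sum>m<n \<gamma>. Re (Qf \<gamma> (defect a b \<gamma> m) (defect a b \<gamma> m)))"
    using g d_pos[of \<gamma>] by (intro mult_left_mono member_le_sum) (auto simp: nn)
  also have "\<dots> \<le> (\<Sum>\<gamma>\<in>A. Re (d \<gamma>) * (\<Sum>m<n \<gamma>. Re (Qf \<gamma> (defect a b \<gamma> m) (defect a b \<gamma> m))))"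
    using g finite_A
    by (intro member_le_sum) (auto intro!: mult_nonneg_nonneg sum_nonneg less_imp_le[OF d_pos] nn)
  finally show ?thesis unfolding defect_real[OF a b] .
qed

text \<open>Nonnegativity of the defects at b = p a / \<tau>, the choice that minimises the
  right-hand side of \<open>defect_real\<close> for given a.\<close>

lemma N_p_le: "a \<in> pol \<Longrightarrow> ip.N (p * a) \<le> Re \<tau> * ip.N a"
proof -
  assume a: "a \<in> pol"
  define b where "b = of_real (1 / Re \<tau>) *\<^sub>C (p * a)"
  have pa: "p * a \<in> pol" using a by (simp add: pol_mult)
  have b: "b \<in> pol" using pa by (simp add: b_def pol_scale)
  have Nb: "ip.N b = ip.N (p * a) / Re \<tau>"
    unfolding b_def ip.N_scale[OF pa] using \<tau>_pos by (simp add: norm_divide)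
  have "ip b (p * a) = of_real ((ip.N (p * a))\<^sup>2 / Re \<tau>)"
    unfolding b_def ip_scale_left ip.B_self[OF pa] by simp
  moreover have "0 \<le> (\<Sum>\<gamma>\<in>A. Re (d \<gamma>) * (\<Sum>m<n \<gamma>. Re (Qf \<gamma> (defect a b \<gamma> m) (defect a b \<gamma> m))))"
    by (intro sum_nonneg mult_nonneg_nonneg less_imp_le[OF d_pos] Qf_nonneg pol_defect a b)
  ultimately have "0 \<le> Re \<tau> * ((ip.N a)\<^sup>2 + (ip.N (p * a) / Re \<tau>)\<^sup>2) - 2 * ((ip.N (p * a))\<^sup>2 / Re \<tau>)"
    unfolding defect_real[OF a b] Nb by simp
  also have "\<dots> = Re \<tau> * (ip.N a)\<^sup>2 - (ip.N (p * a))\<^sup>2 / Re \<tau>"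
    using \<tau>_pos by (simp add: field_simps power2_eq_square)
  finally have "(ip.N (p * a))\<^sup>2 \<le> (Re \<tau> * ip.N a)\<^sup>2"
    using \<tau>_pos by (simp add: field_simps power2_eq_square)
  then show ?thesis
    by (rule power2_le_imp_le) (use \<tau>_pos a in simp)
qed

lemma N_power_le:
  assumes "\<And>a. a \<in> pol \<Longrightarrow> ip.N (p * a) \<le> c * ip.N a" "0 \<le> c"
  shows "ip.N (p ^ m) \<le> c ^ m"
proof (induction m)
  case (Suc m)
  have "ip.N (p ^ Suc m) \<le> c * ip.N (p ^ m)" using assms(1)[of "p ^ m"] by (simp add: pol_power)
  also have "\<dots> \<le> c * c ^ m" using Suc assms(2) by (rule mult_left_mono)
  finally show ?case by simp
qed (simp add: N_one)

end

text \<open>\<open>h\<close> stands for the Haar weights of the range projections, of which only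
  their comparison with the norms of the powers and the growth rate are retained.\<close>

locale subexponential = growth \<Delta>G \<epsilon>G SG n U triv rho sig rt rs A P
  for \<Delta>G :: "'a::complex_star_algebra \<Rightarrow> ('a, 'a) tensor" and \<epsilon>G SG
    and n :: "'i \<Rightarrow> nat" and U :: "'i \<Rightarrow> nat \<Rightarrow> nat \<Rightarrow> 'a" and triv rho sig rt rs A P +
  fixes h :: "nat \<Rightarrow> real"
  assumes power_le: "(Re \<tau>) ^ Suc m \<le> sqrt (h (Suc m)) * ip.N (p ^ Suc m)"
    and root_h: "(\<lambda>m. root m (h m)) \<longlonglongrightarrow> 1"
begin

text \<open>If left multiplication by p had a norm c below \<tau>, iterating from the unit would
  bound the norms of the powers by the powers of c, and the Haar weights would grow at least like
  the powers of (\<tau> / c)^2.\<close>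

lemma near_extremal:
  assumes "0 < e"
  shows "\<exists>a\<in>pol. ip.N a = 1 \<and> (Re \<tau>)\<^sup>2 - e < (ip.N (p * a))\<^sup>2"
proof (rule ccontr)
  assume neg: "\<not> ?thesis"
  \<comment> \<open>The entry \<open>Re \<tau> / 2\<close> keeps c positive when e is at least the
    square of \<tau>; the inner maximum guards the square root.\<close>
  define c where "c = max (sqrt (max 0 ((Re \<tau>)\<^sup>2 - e))) (Re \<tau> / 2)"
  have c_pos: "0 < c" using \<tau>_pos by (simp add: c_def)
  have c_less: "c < Re \<tau>"
  proof -
    have "sqrt (max 0 ((Re \<tau>)\<^sup>2 - e)) < sqrt ((Re \<tau>)\<^sup>2)"
      using \<tau>_pos assms by (intro real_sqrt_less_mono) auto
    then show ?thesis using \<tau>_pos by (simp add: c_def)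
  qed
  have bound: "ip.N (p * a) \<le> c * ip.N a" if a: "a \<in> pol" for a
  proof (cases "ip.N a = 0")
    case True
    then show ?thesis using N_p_le[OF a] by simp
  next
    case False
    define b where "b = of_real (1 / ip.N a) *\<^sub>C a"
    have b: "b \<in> pol" "ip.N b = 1"
      using a False by (auto simp: b_def pol_scale ip.N_scale norm_divide)
    have "p * b = of_real (1 / ip.N a) *\<^sub>C (p * a)" by (simp add: b_def scaleC_mult_right)
    then have Npb: "ip.N (p * b) = ip.N (p * a) / ip.N a"
      using a by (simp add: ip.N_scale pol_mult norm_divide)
    have "(ip.N (p * b))\<^sup>2 \<le> max 0 ((Re \<tau>)\<^sup>2 - e)" using neg b by force
    then have "ip.N (p * b) \<le> sqrt (max 0 ((Re \<tau>)\<^sup>2 - e))" by (rule real_le_rsqrt)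
    then have "ip.N (p * b) \<le> c" by (simp add: c_def)
    moreover have "0 < ip.N a" using False a by (simp add: order_less_le)
    ultimately show ?thesis by (simp add: Npb field_simps)
  qed
  define r where "r = (Re \<tau> / c)\<^sup>2"
  have r: "1 < r" using c_pos c_less by (simp add: r_def power2_eq_square field_simps mult_strict_mono)
  have h_ge: "r ^ Suc m \<le> h (Suc m)" for m
  proof -
    have "(Re \<tau>) ^ Suc m \<le> sqrt (h (Suc m)) * c ^ Suc m"
    proof (cases "0 \<le> h (Suc m)")
      case True
      show ?thesis
        by (rule order_trans[OF power_le mult_left_mono[OF N_power_le[OF bound]]])
          (use c_pos True in auto)
    next
      case False
      \<comment> \<open>The real square root is odd, so for negative \<open>h\<close> the right-hand
        side is at most 0, against positivity of \<tau>.\<close>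
      have "sqrt (h (Suc m)) * ip.N (p ^ Suc m) \<le> 0"
        using False pol_power[OF pol_p, of "Suc m"] by (intro mult_nonpos_nonneg) auto
      then have "(Re \<tau>) ^ Suc m \<le> 0" using power_le[of m] by linarith
      then show ?thesis using zero_less_power[OF \<tau>_pos, of "Suc m"] by linarith
    qed
    then have le: "(Re \<tau> / c) ^ Suc m \<le> sqrt (h (Suc m))"
      using c_pos by (simp add: power_divide pos_divide_le_eq)
    have pos: "0 < (Re \<tau> / c) ^ Suc m" using c_pos \<tau>_pos by (intro zero_less_power) simp
    then have "0 < sqrt (h (Suc m))" using le by linarith
    then have "0 < h (Suc m)" by simp
    then have "((Re \<tau> / c) ^ Suc m)\<^sup>2 \<le> h (Suc m)"
      using le pos by (metis less_imp_le power_mono real_sqrt_pow2)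
    then show ?thesis by (simp only: r_def power_mult[symmetric] mult.commute)
  qed
  \<comment> \<open>Exponent 0 is excluded because \<open>root 0\<close> is constantly 0.\<close>
  have "r \<le> root m (h m)" if m: "1 \<le> m" for m
  proof -
    obtain k where k: "m = Suc k" using m by (cases m) auto
    have "root m (r ^ m) \<le> root m (h m)" using h_ge[of k] k by simp
    then show ?thesis using r m by (simp add: real_root_power_cancel)
  qed
  then have "r \<le> 1"
    by (intro LIMSEQ_le_const[OF root_h] exI[of _ 1]) auto
  then show False using r by simp
qed

end

section \<open>Boundedness of left multiplication, further values of the counit\<close>

context dual_data
begin

text \<open>For a single coefficient take v to be the j-th unit vector: the weighted length of u
  applied to the tensor of v and a is known from \<open>Qf_Uv\<close>, and it dominates the
  component i.\<close>

lemma mult_bounded: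
  assumes "c \<in> pol"
  shows "\<exists>K\<ge>0. \<forall>a\<in>pol. ip.N (c * a) \<le> K * ip.N a"
  using assms
proof (induction rule: pol_induct)
  case zero
  show ?case by (auto simp: ip.N_zero)
next
  case (add x y)
  then obtain K L where K: "0 \<le> K" "0 \<le> L" "\<And>a. a \<in> pol \<Longrightarrow> ip.N (x * a) \<le> K * ip.N a"
    "\<And>a. a \<in> pol \<Longrightarrow> ip.N (y * a) \<le> L * ip.N a" by blast
  have "ip.N ((x + y) * a) \<le> (K + L) * ip.N a" if a: "a \<in> pol" for a
    using K(3,4)[OF a] ip.triangle[of "x * a" "y * a"] add a by (simp add: distrib_right pol_mult)
  then show ?case using K by (intro exI[of _ "K + L"]) auto
next
  case (scale c x)
  then obtain K where K: "0 \<le> K" "\<And>a. a \<in> pol \<Longrightarrow> ip.N (x * a) \<le> K * ip.N a" by blast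
  have "ip.N ((c *\<^sub>C x) * a) \<le> (cmod c * K) * ip.N a" if a: "a \<in> pol" for a
    using mult_left_mono[OF K(2)[OF a], of "cmod c"] scale a
    by (simp add: scaleC_mult_left ip.N_scale pol_mult mult.assoc)
  then show ?case using K by (intro exI[of _ "cmod c * K"]) auto
next
  case (U \<gamma> i j)
  define K where "K = (\<Sum>s<n \<gamma>. cmod (rs \<gamma> i s)) * sqrt (Re (rho \<gamma> j j))"
  have "Re (rho \<gamma> j j) \<ge> 0"
  proof -
    have "rho \<gamma> j j = (\<Sum>k<n \<gamma>. rt \<gamma> j k * cnj (rt \<gamma> j k))" using U by (simp add: rho_rt rt_cnj)
    then show ?thesis by (simp add: sum_nonneg)
  qed
  then have "0 \<le> K" by (simp add: K_def sum_nonneg)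
  moreover have "ip.N (U \<gamma> i j * a) \<le> K * ip.N a" if a: "a \<in> pol" for a
  proof -
    define v where "v = (\<lambda>k. if k = j then 1 else (0::complex))"
    have "Uv \<gamma> v a i = U \<gamma> i j * a" unfolding Uv_def v_def using U by (simp add: sum_delta_scaleC)
    moreover have "Qf \<gamma> (Uv \<gamma> v a) (Uv \<gamma> v a) = rho \<gamma> j j * of_real ((ip.N a)\<^sup>2)"
    proof -
      have "(\<Sum>k<n \<gamma>. \<Sum>l<n \<gamma>. cnj (v k) * rho \<gamma> k l * v l) = (\<Sum>k<n \<gamma>. if k = j then rho \<gamma> k j else 0)"
        using U by (intro sum.cong refl) (auto simp: v_def sum_delta_times)
      then show ?thesis using U by (simp add: Qf_Uv a ip.B_self)
    qed
    ultimately have "ip.N (U \<gamma> i j * a) \<le> (\<Sum>s<n \<gamma>. cmod (rs \<gamma> i s)) * sqrt (Re (rho \<gamma> j j) * (ip.N a)\<^sup>2)"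
      using N_le_Qf[of \<gamma> "Uv \<gamma> v a" i] U a by (simp add: pol_Uv)
    then show ?thesis using a by (simp add: K_def real_sqrt_mult)
  qed
  ultimately show ?case by blast
qed

lemma counit_star_U:
  assumes "i < n \<gamma>" "j < n \<gamma>"
  shows "\<epsilon>G (star (U \<gamma> i j)) = (if i = j then 1 else 0)"
proof -
  have "\<epsilon>G (\<Sum>k<n \<gamma>. star (U \<gamma> k j) * U \<gamma> k i) = (\<Sum>k<n \<gamma>. \<epsilon>G (star (U \<gamma> k j)) * (if k = i then 1 else 0))"
    using assms by (simp add: clinear_sum[OF counit_linear] counit_mult counit_U)
  also have "\<dots> = \<epsilon>G (star (U \<gamma> i j))" using assms by (simp add: sum_delta_times)
  finally show ?thesis
    using assms clinear_zero[OF counit_linear] by (auto simp: unitary_left counit_one split: if_splits)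
qed

lemma counit_theta_U:
  assumes "i < n \<gamma>" "j < n \<gamma>"
  shows "\<epsilon>G (\<theta> (U \<gamma> i j)) = (if i = j then 1 else 0)"
proof -
  have "\<epsilon>G (\<theta> (U \<gamma> i j)) = (\<Sum>a<n \<gamma>. \<Sum>b<n \<gamma>. rho \<gamma> i a * sig \<gamma> b j * (if a = b then 1 else 0))"
    by (simp add: antipode_square_U assms clinear_sum[OF counit_linear] clinear_scale_complex[OF counit_linear] counit_U)
  also have "\<dots> = (\<Sum>a<n \<gamma>. rho \<gamma> i a * sig \<gamma> a j)"
    by (intro sum.cong refl) (simp add: sum_delta_times)
  finally show ?thesis by (simp add: rho_sig assms)
qed

end

section \<open>Elements acting on the extremal sequence through the counit\<close>

context subexponential
begin

definition aseq :: "nat \<Rightarrow> 'a" where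
  "aseq k = (SOME a. a \<in> pol \<and> ip.N a = 1 \<and> (Re \<tau>)\<^sup>2 - inverse (real (Suc k)) < (ip.N (p * a))\<^sup>2)"

lemma aseq_pol [simp]: "aseq k \<in> pol"
  and N_aseq [simp]: "ip.N (aseq k) = 1"
  and N_p_aseq: "(Re \<tau>)\<^sup>2 - inverse (real (Suc k)) < (ip.N (p * aseq k))\<^sup>2"
proof -
  have "\<exists>a. a \<in> pol \<and> ip.N a = 1 \<and> (Re \<tau>)\<^sup>2 - inverse (real (Suc k)) < (ip.N (p * a))\<^sup>2"
    using near_extremal[of "inverse (real (Suc k))"] by auto
  from someI_ex[OF this, folded aseq_def]
  show "aseq k \<in> pol" "ip.N (aseq k) = 1"
    "(Re \<tau>)\<^sup>2 - inverse (real (Suc k)) < (ip.N (p * aseq k))\<^sup>2" by auto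
qed

definition fixers :: "'a set" where
  "fixers = {a \<in> pol. (\<lambda>k. ip.N (a * aseq k - \<epsilon>G a *\<^sub>C aseq k)) \<longlonglongrightarrow> 0}"

lemma fixers_pol: "a \<in> fixers \<Longrightarrow> a \<in> pol"
  by (simp add: fixers_def)

lemma fixersI:
  assumes "a \<in> pol" "\<And>k. ip.N (a * aseq k - \<epsilon>G a *\<^sub>C aseq k) \<le> f k" "f \<longlonglongrightarrow> 0"
  shows "a \<in> fixers"
proof -
  have "(\<lambda>k. ip.N (a * aseq k - \<epsilon>G a *\<^sub>C aseq k)) \<longlonglongrightarrow> 0"
  proof (rule tendsto_sandwich[OF _ _ tendsto_const assms(3)])
    show "\<forall>\<^sub>F k in sequentially. 0 \<le> ip.N (a * aseq k - \<epsilon>G a *\<^sub>C aseq k)"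
      using assms(1) by (simp add: pol_minus pol_mult pol_scale)
  qed (use assms(2) in auto)
  then show ?thesis using assms(1) by (simp add: fixers_def)
qed

lemma fixers_lim: "a \<in> fixers \<Longrightarrow> (\<lambda>k. ip.N (a * aseq k - \<epsilon>G a *\<^sub>C aseq k)) \<longlonglongrightarrow> 0"
  by (simp add: fixers_def)

lemma fixers_zero [simp]: "0 \<in> fixers"
  by (rule fixersI[of _ "\<lambda>_. 0"]) (auto simp: clinear_zero[OF counit_linear] ip.N_zero)

lemma fixers_add:
  assumes "a \<in> fixers" "b \<in> fixers"
  shows "a + b \<in> fixers"
proof (rule fixersI)
  show "a + b \<in> pol" using assms by (simp add: fixers_def pol_add)
  fix k
  show "ip.N ((a + b) * aseq k - \<epsilon>G (a + b) *\<^sub>C aseq k)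
    \<le> ip.N (a * aseq k - \<epsilon>G a *\<^sub>C aseq k) + ip.N (b * aseq k - \<epsilon>G b *\<^sub>C aseq k)"
    using ip.triangle[of "a * aseq k - \<epsilon>G a *\<^sub>C aseq k" "b * aseq k - \<epsilon>G b *\<^sub>C aseq k"] assms
    by (simp add: fixers_def pol_minus pol_mult pol_scale distrib_right
        clinear_add[OF counit_linear] scaleC_add_left add_diff_add)
qed (use tendsto_add[OF fixers_lim[OF assms(1)] fixers_lim[OF assms(2)]] in simp)

lemma fixers_scale:
  assumes "a \<in> fixers"
  shows "c *\<^sub>C a \<in> fixers"
proof (rule fixersI)
  show "c *\<^sub>C a \<in> pol" using assms by (simp add: fixers_def pol_scale)
  fix k
  have "(c *\<^sub>C a) * aseq k - \<epsilon>G (c *\<^sub>C a) *\<^sub>C aseq k = c *\<^sub>C (a * aseq k - \<epsilon>G a *\<^sub>C aseq k)"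
    by (simp add: scaleC_mult_left clinear_scale_complex[OF counit_linear] cvs.scale_right_diff_distrib scaleC_scaleC)
  then show "ip.N ((c *\<^sub>C a) * aseq k - \<epsilon>G (c *\<^sub>C a) *\<^sub>C aseq k)
    \<le> cmod c * ip.N (a * aseq k - \<epsilon>G a *\<^sub>C aseq k)"
    using assms by (simp add: ip.N_scale fixers_pol pol_minus pol_mult pol_scale)
qed (use tendsto_mult_left[OF fixers_lim[OF assms], of "cmod c"] in simp)

text \<open>The error for a b is a applied to the error for b, plus the counit of b times the error
  for a; the first summand is controlled because left multiplication by a is bounded.\<close>

lemma fixers_mult:
  assumes a: "a \<in> fixers" and b: "b \<in> fixers"
  shows "a * b \<in> fixers"
proof -
  have ab: "a \<in> pol" "b \<in> pol" using a b by (auto simp: fixers_def)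
  obtain K where K: "\<And>x. x \<in> pol \<Longrightarrow> ip.N (a * x) \<le> K * ip.N x"
    using mult_bounded[OF ab(1)] by blast
  show ?thesis
  proof (rule fixersI)
    show "a * b \<in> pol" using ab by (simp add: pol_mult)
    fix k
    have p1: "b * aseq k - \<epsilon>G b *\<^sub>C aseq k \<in> pol" and p2: "a * aseq k - \<epsilon>G a *\<^sub>C aseq k \<in> pol"
      using ab by (simp_all add: pol_minus pol_mult pol_scale)
    have "(a * b) * aseq k - \<epsilon>G (a * b) *\<^sub>C aseq k
      = a * (b * aseq k - \<epsilon>G b *\<^sub>C aseq k) + \<epsilon>G b *\<^sub>C (a * aseq k - \<epsilon>G a *\<^sub>C aseq k)"
      by (simp add: counit_mult right_diff_distrib scaleC_mult_right cvs.scale_right_diff_distrib scaleC_scaleC mult_ac)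
    then have "ip.N ((a * b) * aseq k - \<epsilon>G (a * b) *\<^sub>C aseq k)
      \<le> ip.N (a * (b * aseq k - \<epsilon>G b *\<^sub>C aseq k)) + ip.N (\<epsilon>G b *\<^sub>C (a * aseq k - \<epsilon>G a *\<^sub>C aseq k))"
      using ip.triangle[of "a * (b * aseq k - \<epsilon>G b *\<^sub>C aseq k)" "\<epsilon>G b *\<^sub>C (a * aseq k - \<epsilon>G a *\<^sub>C aseq k)"] p1 p2 ab
      by (simp add: pol_mult pol_scale)
    also have "\<dots> \<le> K * ip.N (b * aseq k - \<epsilon>G b *\<^sub>C aseq k) + cmod (\<epsilon>G b) * ip.N (a * aseq k - \<epsilon>G a *\<^sub>C aseq k)"
      using K[OF p1] p2 by (simp add: ip.N_scale)
    finally show "ip.N ((a * b) * aseq k - \<epsilon>G (a * b) *\<^sub>C aseq k)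
      \<le> K * ip.N (b * aseq k - \<epsilon>G b *\<^sub>C aseq k) + cmod (\<epsilon>G b) * ip.N (a * aseq k - \<epsilon>G a *\<^sub>C aseq k)" .
  next
    show "(\<lambda>k. K * ip.N (b * aseq k - \<epsilon>G b *\<^sub>C aseq k) + cmod (\<epsilon>G b) * ip.N (a * aseq k - \<epsilon>G a *\<^sub>C aseq k)) \<longlonglongrightarrow> 0"
      using tendsto_add[OF tendsto_mult_left[OF fixers_lim[OF b], of K] tendsto_mult_left[OF fixers_lim[OF a], of "cmod (\<epsilon>G b)"]]
      by simp
  qed
qed

definition bseq :: "nat \<Rightarrow> 'a" where "bseq k = of_real (1 / Re \<tau>) *\<^sub>C (p * aseq k)"

lemma bseq_pol [simp]: "bseq k \<in> pol"
  by (simp add: bseq_def pol_scale pol_mult)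

text \<open>With b_k = p a_k / \<tau> the weighted defects add up to the gap between the square of
  \<tau> and the squared norm of p a_k, divided by \<tau>. By the choice of a_k this gap is below 1
  / (k + 1).\<close>

lemma defect_tendsto:
  assumes g: "\<gamma> \<in> A" "m < n \<gamma>" "i < n \<gamma>"
  shows "(\<lambda>k. ip.N (defect (aseq k) (bseq k) \<gamma> m i)) \<longlonglongrightarrow> 0"
proof -
  define C where "C = (\<Sum>s<n \<gamma>. cmod (rs \<gamma> i s))"
  define q where "q k = Re (Qf \<gamma> (defect (aseq k) (bseq k) \<gamma> m) (defect (aseq k) (bseq k) \<gamma> m))" for k
  have q: "0 \<le> q k" "q k \<le> inverse (real (Suc k)) / (Re \<tau> * Re (d \<gamma>))" for k
  proof -
    show "0 \<le> q k" unfolding q_def by (intro Qf_nonneg pol_defect) auto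
    have pa: "p * aseq k \<in> pol" by (simp add: pol_mult)
    have Nb: "ip.N (bseq k) = ip.N (p * aseq k) / Re \<tau>"
      unfolding bseq_def ip.N_scale[OF pa] using \<tau>_pos by (simp add: norm_divide)
    have "ip (bseq k) (p * aseq k) = of_real ((ip.N (p * aseq k))\<^sup>2 / Re \<tau>)"
      unfolding bseq_def ip_scale_left ip.B_self[OF pa] by simp
    then have "Re (d \<gamma>) * q k \<le> Re \<tau> * (1 + (ip.N (p * aseq k) / Re \<tau>)\<^sup>2) - 2 * ((ip.N (p * aseq k))\<^sup>2 / Re \<tau>)"
      using defect_term_le[of "aseq k" "bseq k", OF _ _ g(1,2)] by (simp add: q_def Nb)
    also have "\<dots> = ((Re \<tau>)\<^sup>2 - (ip.N (p * aseq k))\<^sup>2) / Re \<tau>"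
      using \<tau>_pos by (simp add: field_simps power2_eq_square)
    also have "\<dots> \<le> inverse (real (Suc k)) / Re \<tau>"
      using N_p_aseq[of k] \<tau>_pos by (intro divide_right_mono) auto
    finally have "q k \<le> inverse (real (Suc k)) / Re \<tau> / Re (d \<gamma>)"
      using d_pos[of \<gamma>] by (subst pos_le_divide_eq) (auto simp: mult.commute[of "q k"])
    then show "q k \<le> inverse (real (Suc k)) / (Re \<tau> * Re (d \<gamma>))"
      by (simp only: divide_divide_eq_left)
  qed
  have "(\<lambda>k. inverse (real (Suc k)) / (Re \<tau> * Re (d \<gamma>))) \<longlonglongrightarrow> 0 / (Re \<tau> * Re (d \<gamma>))"
    using \<tau>_pos d_pos[of \<gamma>] by (intro tendsto_divide LIMSEQ_inverse_real_of_nat tendsto_const) auto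
  then have "q \<longlonglongrightarrow> 0"
    by (intro tendsto_sandwich[OF _ _ tendsto_const, of _ q]) (use q in auto)
  then have "(\<lambda>k. C * sqrt (q k)) \<longlonglongrightarrow> C * sqrt 0"
    by (intro tendsto_intros)
  then have lim: "(\<lambda>k. C * sqrt (q k)) \<longlonglongrightarrow> 0" by simp
  have def: "defect (aseq k) (bseq k) \<gamma> m i \<in> pol" if "i < n \<gamma>" for i k
    using that by (simp add: pol_defect)
  show ?thesis
  proof (rule tendsto_sandwich[OF _ _ tendsto_const lim])
    show "\<forall>\<^sub>F k in sequentially. 0 \<le> ip.N (defect (aseq k) (bseq k) \<gamma> m i)"
      using def g by simp
    show "\<forall>\<^sub>F k in sequentially. ip.N (defect (aseq k) (bseq k) \<gamma> m i) \<le> C * sqrt (q k)"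
      unfolding C_def q_def by (intro always_eventually allI N_le_Qf def g)
  qed
qed

text \<open>The trivial block has u = 1 and P = 1, so its defect is the plain difference. This is
  where the auxiliary vectors b_k are identified with a_k in the limit.\<close>

lemma aseq_bseq: "(\<lambda>k. ip.N (aseq k - bseq k)) \<longlonglongrightarrow> 0"
proof -
  have "defect (aseq k) (bseq k) triv 0 0 = aseq k - bseq k" for k
    by (simp add: defect_def Uv_def triv triv_A)
  then show ?thesis using defect_tendsto[OF triv_A(1), of 0 0] by (simp add: triv)
qed

text \<open>u takes a column of P tensored with a_k close to the column tensored with b_k, hence
  with a_k. The scalars that occur are the entries \<open>P \<gamma> i m\<close>, and these are the
  counits of the elements in question.\<close>

lemma P_fixers:
  assumes g: "\<gamma> \<in> A" "m < n \<gamma>" "i < n \<gamma>"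
  shows "(\<Sum>j<n \<gamma>. P \<gamma> j m *\<^sub>C U \<gamma> i j) \<in> fixers"
proof (rule fixersI)
  show pol: "(\<Sum>j<n \<gamma>. P \<gamma> j m *\<^sub>C U \<gamma> i j) \<in> pol"
    by (intro pol_sum pol_scale pol_U) (use g in auto)
  have eps: "\<epsilon>G (\<Sum>j<n \<gamma>. P \<gamma> j m *\<^sub>C U \<gamma> i j) = P \<gamma> i m"
  proof -
    have "\<epsilon>G (\<Sum>j<n \<gamma>. P \<gamma> j m *\<^sub>C U \<gamma> i j) = (\<Sum>j<n \<gamma>. P \<gamma> j m * (if i = j then 1 else 0))"
      using g by (simp add: clinear_sum[OF counit_linear] clinear_scale_complex[OF counit_linear] counit_U)
    then show ?thesis using g by (simp add: sum_delta_times)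
  qed
  fix k
  have "(\<Sum>j<n \<gamma>. P \<gamma> j m *\<^sub>C U \<gamma> i j) * aseq k = Uv \<gamma> (Pcol \<gamma> m) (aseq k) i"
    by (simp add: Uv_def sum_distrib_right scaleC_mult_left)
  then have "(\<Sum>j<n \<gamma>. P \<gamma> j m *\<^sub>C U \<gamma> i j) * aseq k - \<epsilon>G (\<Sum>j<n \<gamma>. P \<gamma> j m *\<^sub>C U \<gamma> i j) *\<^sub>C aseq k
    = defect (aseq k) (bseq k) \<gamma> m i + (- P \<gamma> i m) *\<^sub>C (aseq k - bseq k)"
    by (simp add: eps defect_def cvs.scale_right_diff_distrib)
  moreover have ab: "aseq k - bseq k \<in> pol" by (simp add: pol_minus)
  ultimately show "ip.N ((\<Sum>j<n \<gamma>. P \<gamma> j m *\<^sub>C U \<gamma> i j) * aseq k - \<epsilon>G (\<Sum>j<n \<gamma>. P \<gamma> j m *\<^sub>C U \<gamma> i j) *\<^sub>C aseq k)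
    \<le> ip.N (defect (aseq k) (bseq k) \<gamma> m i) + cmod (P \<gamma> i m) * ip.N (aseq k - bseq k)"
    using ip.triangle[OF pol_defect[OF aseq_pol bseq_pol g(3)] pol_scale[OF ab], of k k m "- P \<gamma> i m"]
    by (simp only: ip.N_scale[OF ab] norm_minus_cancel)
next
  show "(\<lambda>k. ip.N (defect (aseq k) (bseq k) \<gamma> m i) + cmod (P \<gamma> i m) * ip.N (aseq k - bseq k)) \<longlonglongrightarrow> 0"
    using tendsto_add[OF defect_tendsto[OF g] tendsto_mult_left[OF aseq_bseq, of "cmod (P \<gamma> i m)"]] by simp
qed

text \<open>Closed under multiplication, so that it contains every \<open>\<Delta>G (p ^ m)\<close>.\<close>

definition right_fixed :: "('a, 'a) tensor set" where
  "right_fixed = {abs_tensor xs | xs. \<forall>(x, y)\<in>set xs. y \<in> fixers}"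

lemma right_fixed_zero: "0 \<in> right_fixed"
  unfolding right_fixed_def zero_tensor_def by auto

lemma right_fixed_tensor: "y \<in> fixers \<Longrightarrow> x \<otimes>\<^sub>t y \<in> right_fixed"
  unfolding right_fixed_def tensor.abs_eq by (intro CollectI exI[of _ "[(x, y)]"]) auto

lemma right_fixedE:
  assumes "t \<in> right_fixed"
  obtains xs where "t = abs_tensor xs" "\<forall>(x, y)\<in>set xs. y \<in> fixers"
  using assms by (auto simp: right_fixed_def)

lemma right_fixed_abs: "\<forall>(x, y)\<in>set xs. y \<in> fixers \<Longrightarrow> abs_tensor xs \<in> right_fixed"
  by (auto simp: right_fixed_def)

lemma right_fixed_add: "s \<in> right_fixed \<Longrightarrow> t \<in> right_fixed \<Longrightarrow> s + t \<in> right_fixed"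
  by (elim right_fixedE) (auto simp: plus_tensor.abs_eq intro!: right_fixed_abs)

lemma right_fixed_scale: "s \<in> right_fixed \<Longrightarrow> c *\<^sub>C s \<in> right_fixed"
  by (elim right_fixedE) (auto simp: scaleC_tensor.abs_eq intro!: right_fixed_abs)

lemma right_fixed_mult: "s \<in> right_fixed \<Longrightarrow> t \<in> right_fixed \<Longrightarrow> s * t \<in> right_fixed"
  by (elim right_fixedE) (auto simp: times_tensor.abs_eq list_mult_def intro!: right_fixed_abs fixers_mult)

lemma right_fixed_sum: "(\<And>i. i \<in> I \<Longrightarrow> g i \<in> right_fixed) \<Longrightarrow> sum g I \<in> right_fixed"
  by (induction I rule: infinite_finite_induct) (auto simp: right_fixed_zero right_fixed_add)

lemma right_fixed_slice:
  assumes f: "clinear f" and t: "t \<in> right_fixed"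
  shows "tensor_lift (\<lambda>a b. f a *\<^sub>C b) t \<in> fixers"
proof -
  have cb: "cbilinear (\<lambda>a b. f a *\<^sub>C (b :: 'a))"
    using f by (auto simp: cbilinear_def clinear_def scaleC_add_left scaleC_add_right scaleC_scaleC
      mult.commute scaleC_complex_def)
  obtain xs where xs: "t = abs_tensor xs" "\<forall>(x, y)\<in>set xs. y \<in> fixers"
    using t by (auto simp: right_fixed_def)
  have "bil_sum (\<lambda>a b. f a *\<^sub>C b) xs \<in> fixers"
    using xs(2) by (induction xs) (auto simp: fixers_add fixers_scale)
  then show ?thesis by (simp add: xs tensor_lift_abs[OF cb])
qed

text \<open>In the comultiplication of \<open>V\<close> the summation over j against P collects the
  second legs into the elements of \<open>P_fixers\<close>.\<close>

lemma comult_p_fixed: "\<Delta>G p \<in> right_fixed"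
proof -
  have tr: "clinear (\<lambda>b :: 'a. x \<otimes>\<^sub>t b)" for x :: 'a
    using cbilinear_tensor[where 'a = 'a and 'b = 'a] by (simp add: cbilinear_def)
  have "(\<Sum>s<n \<gamma>. \<Sum>j<n \<gamma>. P \<gamma> j s *\<^sub>C \<Delta>G (V \<gamma> s j)) \<in> right_fixed" if g: "\<gamma> \<in> A" for \<gamma>
  proof -
    have "(\<Sum>s<n \<gamma>. \<Sum>j<n \<gamma>. P \<gamma> j s *\<^sub>C \<Delta>G (V \<gamma> s j))
      = (\<Sum>s<n \<gamma>. \<Sum>j<n \<gamma>. \<Sum>i<n \<gamma>. \<Sum>k<n \<gamma>. (P \<gamma> j s * rho \<gamma> s i) *\<^sub>C (U \<gamma> i k \<otimes>\<^sub>t U \<gamma> k j))"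
      by (intro sum.cong refl)
        (simp add: V_def clinear_sum[OF comult_linear] clinear_scale[OF comult_linear] comult_U
          scaleC_sum_right scaleC_scaleC)
    also have "\<dots> = (\<Sum>s<n \<gamma>. \<Sum>k<n \<gamma>. \<Sum>i<n \<gamma>. \<Sum>j<n \<gamma>. (P \<gamma> j s * rho \<gamma> s i) *\<^sub>C (U \<gamma> i k \<otimes>\<^sub>t U \<gamma> k j))"
      by (rule sum.cong[OF refl], rule sum_swap3)
    also have "\<dots> = (\<Sum>s<n \<gamma>. \<Sum>k<n \<gamma>. \<Sum>i<n \<gamma>. rho \<gamma> s i *\<^sub>C (U \<gamma> i k \<otimes>\<^sub>t (\<Sum>j<n \<gamma>. P \<gamma> j s *\<^sub>C U \<gamma> k j)))"
      by (simp add: clinear_sum[OF tr] clinear_scale[OF tr] scaleC_sum_right scaleC_scaleC mult.commute)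
    also have "\<dots> \<in> right_fixed"
      by (intro right_fixed_sum right_fixed_scale right_fixed_tensor P_fixers g) auto
    finally show ?thesis .
  qed
  then show ?thesis
    unfolding p_def FF_def
    by (simp add: clinear_sum[OF comult_linear] clinear_scale[OF comult_linear] right_fixed_sum right_fixed_scale)
qed

lemma comult_power_fixed: "\<Delta>G (p ^ Suc m) \<in> right_fixed"
  by (induction m) (auto simp: comult_mult comult_p_fixed intro!: right_fixed_mult)

text \<open>The comultiplication of the power has its second legs among the fixers, so slicing the
  first leg yields fixers. The functional f takes the value \<open>inverse (d \<gamma>)\<close> at
  \<open>V \<gamma> s k\<close> and 0 at the other elements \<open>V\<close>; slicing with it
  returns the column s of z paired with the row k of U.\<close>

lemma power_columns_fixed:
  assumes B: "finite B" and z: "p ^ Suc m = FF B z" and g: "\<gamma> \<in> B" "s < n \<gamma>" "k < n \<gamma>"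
  shows "(\<Sum>j<n \<gamma>. z \<gamma> j s *\<^sub>C U \<gamma> k j) \<in> fixers"
proof -
  obtain f :: "'a \<Rightarrow> complex" where f: "clinear f"
    and fU: "\<And>\<beta> i l. i < n \<beta> \<Longrightarrow> l < n \<beta> \<Longrightarrow> f (U \<beta> i l) = (if l = k then if \<beta> = \<gamma> then sig \<beta> i s / d \<beta> else 0 else 0)"
    using functional_exists[of "\<lambda>\<beta> i l. if l = k then if \<beta> = \<gamma> then sig \<beta> i s / d \<beta> else 0 else 0"] by blast
  have cb: "cbilinear (\<lambda>a b. f a *\<^sub>C (b :: 'a))"
    using f by (auto simp: cbilinear_def clinear_def scaleC_add_left scaleC_add_right scaleC_scaleC
      mult.commute scaleC_complex_def)
  define sl where "sl a = tensor_lift (\<lambda>a b. f a *\<^sub>C b) (\<Delta>G a)" for a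
  have sl: "clinear sl" unfolding sl_def by (rule clinear_lift_comult[OF cb])
  have slU: "sl (U \<beta> i j) = (if \<beta> = \<gamma> then (sig \<beta> i s / d \<beta>) *\<^sub>C U \<gamma> k j else 0)"
    if "i < n \<beta>" "j < n \<beta>" for \<beta> i j
  proof -
    have "sl (U \<beta> i j) = (\<Sum>l<n \<beta>. (if l = k then if \<beta> = \<gamma> then sig \<beta> i s / d \<beta> else 0 else 0) *\<^sub>C U \<beta> l j)"
      unfolding sl_def lift_comult_U[OF cb that] by (intro sum.cong refl) (simp add: fU that)
    then show ?thesis using g by (cases "\<beta> = \<gamma>") (simp_all add: sum_delta_scaleC)
  qed
  have slV: "sl (V \<beta> s' j) = (if s' = s then if \<beta> = \<gamma> then inverse (d \<beta>) *\<^sub>C U \<gamma> k j else 0 else 0)"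
    if "s' < n \<beta>" "j < n \<beta>" for \<beta> s' j
  proof -
    have "sl (V \<beta> s' j) = (\<Sum>i<n \<beta>. rho \<beta> s' i *\<^sub>C (if \<beta> = \<gamma> then (sig \<beta> i s / d \<beta>) *\<^sub>C U \<gamma> k j else 0))"
      using that by (simp add: V_def clinear_sum[OF sl] clinear_scale[OF sl] slU)
    also have "\<dots> = (if \<beta> = \<gamma> then ((\<Sum>i<n \<beta>. rho \<beta> s' i * sig \<beta> i s) / d \<beta>) *\<^sub>C U \<gamma> k j else 0)"
      by (auto simp: scaleC_sum_left scaleC_scaleC sum_divide_distrib)
    finally show ?thesis using that g by (auto simp: rho_sig divide_inverse)
  qed
  have "sl (FF B z) = (\<Sum>\<beta>\<in>B. d \<beta> *\<^sub>C (\<Sum>s'<n \<beta>. \<Sum>j<n \<beta>. z \<beta> j s' *\<^sub>C sl (V \<beta> s' j)))"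
    by (simp add: FF_def clinear_sum[OF sl] clinear_scale[OF sl])
  also have "\<dots> = d \<gamma> *\<^sub>C (\<Sum>s'<n \<gamma>. \<Sum>j<n \<gamma>. z \<gamma> j s' *\<^sub>C sl (V \<gamma> s' j))"
    by (rule sum_F_eq[OF B]) (use g in \<open>auto simp: slV intro!: sum.neutral\<close>)
  also have "(\<Sum>s'<n \<gamma>. \<Sum>j<n \<gamma>. z \<gamma> j s' *\<^sub>C sl (V \<gamma> s' j))
    = (\<Sum>s'<n \<gamma>. if s' = s then (\<Sum>j<n \<gamma>. z \<gamma> j s' *\<^sub>C inverse (d \<gamma>) *\<^sub>C U \<gamma> k j) else 0)"
    by (intro sum.cong refl) (simp add: slV)
  also have "\<dots> = (\<Sum>j<n \<gamma>. z \<gamma> j s *\<^sub>C inverse (d \<gamma>) *\<^sub>C U \<gamma> k j)" using g by simp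
  finally have "sl (FF B z) = (\<Sum>j<n \<gamma>. z \<gamma> j s *\<^sub>C U \<gamma> k j)"
    by (simp add: scaleC_sum_right scaleC_scaleC mult.left_commute[of "d \<gamma>"])
  moreover have "sl (FF B z) \<in> fixers"
    unfolding sl_def z[symmetric] by (rule right_fixed_slice[OF f comult_power_fixed])
  ultimately show ?thesis by simp
qed

end

section \<open>Almost invariant states\<close>

context dual_data
begin

text \<open>The pairing of a family g with \<open>pol\<close>, which for bounded g is the duality
  between \<open>linf\<close> and the coefficient algebra; off \<open>pol\<close> some linear
  extension is chosen.\<close>

definition fn :: "('i \<Rightarrow> nat \<Rightarrow> nat \<Rightarrow> complex) \<Rightarrow> 'a \<Rightarrow> complex" where
  "fn g = (SOME f. clinear f \<and> (\<forall>\<gamma> i j. i < n \<gamma> \<longrightarrow> j < n \<gamma> \<longrightarrow> f (U \<gamma> i j) = g \<gamma> i j))"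

lemma fn_linear: "clinear (fn g)"
  and fn_U: "i < n \<gamma> \<Longrightarrow> j < n \<gamma> \<Longrightarrow> fn g (U \<gamma> i j) = g \<gamma> i j"
  using someI_ex[OF functional_exists, of g, folded fn_def] by auto

text \<open>Slicing the second leg applies g to the column index of a coefficient and leaves the row
  index alone, see \<open>act_U\<close>.\<close>

definition act :: "('i \<Rightarrow> nat \<Rightarrow> nat \<Rightarrow> complex) \<Rightarrow> 'a \<Rightarrow> 'a" where
  "act g a = tensor_lift (\<lambda>x y. fn g y *\<^sub>C x) (\<Delta>G a)"

lemma cbilinear_fn: "cbilinear (\<lambda>x y. fn g y *\<^sub>C (x :: 'a))"
  using fn_linear[of g] by (auto simp: cbilinear_def clinear_def scaleC_add_left scaleC_add_right scaleC_scaleC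
      mult.commute scaleC_complex_def)

lemma act_linear: "clinear (act g)"
  unfolding act_def by (rule clinear_lift_comult[OF cbilinear_fn])

lemma act_U: "i < n \<gamma> \<Longrightarrow> j < n \<gamma> \<Longrightarrow> act g (U \<gamma> i j) = (\<Sum>k<n \<gamma>. g \<gamma> k j *\<^sub>C U \<gamma> i k)"
  unfolding act_def by (simp add: lift_comult_U[OF cbilinear_fn] fn_U)

lemma act_pol: "a \<in> pol \<Longrightarrow> act g a \<in> pol"
  by (induction rule: pol_induct)
    (auto simp: clinear_zero[OF act_linear] clinear_add[OF act_linear] clinear_scale[OF act_linear]
      pol_add pol_scale act_U intro!: pol_sum)

lemma cf_act:
  assumes "a \<in> pol" "k < n \<gamma>" "r < n \<gamma>"
  shows "cf \<gamma> k r (act g a) = (\<Sum>q<n \<gamma>. g \<gamma> r q * cf \<gamma> k q a)"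
proof (rule clinear_eq_pol[OF _ _ _ assms(1)])
  show "clinear (\<lambda>a. cf \<gamma> k r (act g a))"
    using cf_linear act_linear by (simp add: clinear_def)
  show "clinear (\<lambda>a. \<Sum>q<n \<gamma>. g \<gamma> r q * cf \<gamma> k q a)"
    by (simp add: clinear_def cf_simps distrib_left sum.distrib sum_distrib_left scaleC_complex_def mult_ac)
  fix \<beta> i j assume ij: "i < n \<beta>" "j < n \<beta>"
  have "cf \<gamma> k r (act g (U \<beta> i j)) = (\<Sum>l<n \<beta>. g \<beta> l j * cf \<gamma> k r (U \<beta> i l))"
    using ij by (simp add: act_U cf_simps)
  also have "\<dots> = (\<Sum>l<n \<beta>. g \<beta> l j * (if l = r then (if \<gamma> = \<beta> \<and> k = i then 1 else 0) else 0))"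
    using ij by (intro sum.cong refl) (auto simp: cf_U)
  also have "\<dots> = (if \<gamma> = \<beta> \<and> k = i then g \<gamma> r j else 0)"
    using assms by (auto simp: sum_delta_times)
  also have "\<dots> = (\<Sum>q<n \<gamma>. g \<gamma> r q * (if q = j then (if \<gamma> = \<beta> \<and> k = i then 1 else 0) else 0))"
    using ij by (auto simp: sum_delta_times)
  also have "\<dots> = (\<Sum>q<n \<gamma>. g \<gamma> r q * cf \<gamma> k q (U \<beta> i j))"
    using ij by (intro sum.cong refl) (auto simp: cf_U)
  finally show "cf \<gamma> k r (act g (U \<beta> i j)) = (\<Sum>q<n \<gamma>. g \<gamma> r q * cf \<gamma> k q (U \<beta> i j))" .
qed

lemma yc_act:
  assumes "a \<in> pol" "l < n \<gamma>"
  shows "yc \<gamma> s l (act g a) = (\<Sum>q<n \<gamma>. g \<gamma> l q * yc \<gamma> s q a)"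
proof -
  have "yc \<gamma> s l (act g a) = (\<Sum>k<n \<gamma>. \<Sum>q<n \<gamma>. rt \<gamma> k s * (g \<gamma> l q * cf \<gamma> k q a))"
    using assms by (simp add: yc_def cf_act sum_distrib_left)
  also have "\<dots> = (\<Sum>q<n \<gamma>. \<Sum>k<n \<gamma>. rt \<gamma> k s * (g \<gamma> l q * cf \<gamma> k q a))" by (rule sum.swap)
  finally show ?thesis by (simp add: yc_def sum_distrib_left mult_ac)
qed

lemma csupp_act: "a \<in> pol \<Longrightarrow> csupp (act g a) \<subseteq> csupp a"
proof
  fix \<gamma> assume a: "a \<in> pol" and "\<gamma> \<in> csupp (act g a)"
  then obtain i j where "i < n \<gamma>" "j < n \<gamma>" "cf \<gamma> i j (act g a) \<noteq> 0" by (auto simp: csupp_def)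
  then have "(\<Sum>q<n \<gamma>. g \<gamma> j q * cf \<gamma> i q a) \<noteq> 0" using a by (simp add: cf_act)
  then obtain q where "q < n \<gamma>" "cf \<gamma> i q a \<noteq> 0"
    by (elim sum.not_neutral_contains_not_neutral) auto
  then show "\<gamma> \<in> csupp a" using \<open>i < n \<gamma>\<close> by (auto simp: csupp_def)
qed

lemma ip_star: "ip (star x) y = hG (\<theta> x * y)"
  by (simp add: ip_def star_star)

text \<open>The vector functional of b for the action of g, written out in the coordinates
  \<open>yc\<close>. For b in \<open>pol\<close> it depends on finitely many entries of g only, so
  it commutes with infinite sums.\<close>

definition vstate :: "'a \<Rightarrow> ('i \<Rightarrow> nat \<Rightarrow> nat \<Rightarrow> complex) \<Rightarrow> complex" where
  "vstate b g = (\<Sum>\<gamma>\<in>csupp b. inverse (d \<gamma>) *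
    (\<Sum>s<n \<gamma>. \<Sum>l<n \<gamma>. cnj (yc \<gamma> s l b) * (\<Sum>q<n \<gamma>. g \<gamma> l q * yc \<gamma> s q b)))"

lemma vstate_eq:
  assumes "b \<in> pol"
  shows "vstate b g = ip (star (act g b)) (star b)"
  using hG_right_eq[OF assms act_pol[OF assms] finite_csupp[OF assms] csupp_act[OF assms], of g]
  by (simp add: vstate_def ip_star yc_act assms)

lemma N_star:
  assumes "x \<in> pol" "finite F" "csupp x \<subseteq> F"
  shows "(ip.N (star x))\<^sup>2 = (\<Sum>\<gamma>\<in>F. inverse (Re (d \<gamma>)) * (\<Sum>s<n \<gamma>. \<Sum>l<n \<gamma>. (cmod (yc \<gamma> s l x))\<^sup>2))"
proof -
  have "ip (star x) (star x) = of_real (\<Sum>\<gamma>\<in>F. inverse (Re (d \<gamma>)) *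
      (\<Sum>s<n \<gamma>. \<Sum>m<n \<gamma>. (cmod (yc \<gamma> s m x))\<^sup>2))"
    unfolding ip_star hG_right_eq[OF assms(1,1,2,3)] of_real_sum of_real_mult of_real_inverse d_real[symmetric]
    by (simp only: complex_norm_square mult.commute[of "cnj _"])
  then have "Re (ip (star x) (star x)) = (\<Sum>\<gamma>\<in>F. inverse (Re (d \<gamma>)) *
      (\<Sum>s<n \<gamma>. \<Sum>m<n \<gamma>. (cmod (yc \<gamma> s m x))\<^sup>2))"
    by (simp only: Re_complex_of_real)
  then show ?thesis using assms(1) by (simp only: ip.N_square pol_star)
qed

text \<open>As \<open>yc\<close> weights only the row index, \<open>act g\<close> is plain matrix
  multiplication by g in these coordinates, and the bound applies for each block and each s.\<close>

lemma N_act_le: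
  assumes g: "op_bounded n C g" and C: "0 \<le> C" and x: "x \<in> pol"
  shows "ip.N (star (act g x)) \<le> sqrt C * ip.N (star x)"
proof -
  have "(ip.N (star (act g x)))\<^sup>2 = (\<Sum>\<gamma>\<in>csupp x. inverse (Re (d \<gamma>)) *
      (\<Sum>s<n \<gamma>. \<Sum>l<n \<gamma>. (cmod (\<Sum>q<n \<gamma>. g \<gamma> l q * yc \<gamma> s q x))\<^sup>2))"
    using N_star[OF act_pol[OF x] finite_csupp[OF x] csupp_act[OF x], of g] x by (simp add: yc_act)
  also have "\<dots> \<le> (\<Sum>\<gamma>\<in>csupp x. inverse (Re (d \<gamma>)) * (\<Sum>s<n \<gamma>. C * (\<Sum>q<n \<gamma>. (cmod (yc \<gamma> s q x))\<^sup>2)))"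
    using g by (intro sum_mono mult_left_mono) (auto simp: op_bounded_def less_imp_le[OF d_pos])
  also have "\<dots> = C * (ip.N (star x))\<^sup>2"
    unfolding N_star[OF x finite_csupp[OF x] subset_refl]
    by (simp add: sum_distrib_left mult.left_commute)
  also have "\<dots> = (sqrt C * ip.N (star x))\<^sup>2" using C by (simp add: power_mult_distrib)
  finally show ?thesis by (rule power2_le_imp_le) (use C x in \<open>simp add: pol_star\<close>)
qed

lemma vstate_add: "vstate b (\<lambda>\<gamma> i j. g \<gamma> i j + g' \<gamma> i j) = vstate b g + vstate b g'"
  by (simp add: vstate_def distrib_left distrib_right sum.distrib)

lemma vstate_scale: "vstate b (\<lambda>\<gamma> i j. c * g \<gamma> i j) = c * vstate b g"
  by (simp add: vstate_def sum_distrib_left mult_ac)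

lemma vstate_cong:
  assumes "\<And>\<gamma> i j. i < n \<gamma> \<Longrightarrow> j < n \<gamma> \<Longrightarrow> g \<gamma> i j = g' \<gamma> i j"
  shows "vstate b g = vstate b g'"
  by (simp add: vstate_def assms)

lemma vstate_sum: "vstate b (\<lambda>\<gamma> k l. \<Sum>i\<in>I. g i \<gamma> k l) = (\<Sum>i\<in>I. vstate b (g i))"
proof (induction I rule: infinite_finite_induct)
  case (insert i I)
  then show ?case using vstate_add[of b "g i" "\<lambda>\<gamma> k l. \<Sum>i\<in>I. g i \<gamma> k l"] by simp
qed (simp_all add: vstate_def)

lemma vstate_has_sum:
  assumes "\<And>\<gamma> i j. i < n \<gamma> \<Longrightarrow> j < n \<gamma> \<Longrightarrow> ((\<lambda>p. T p \<gamma> i j) has_sum S \<gamma> i j) A"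
  shows "((\<lambda>p. vstate b (T p)) has_sum vstate b S) A"
  unfolding vstate_def
  by (intro has_sum_finite_sum has_sum_cmult_right has_sum_cmult_left assms) auto

text \<open>The family is the adjoint of g times g, so in coordinates its quadratic form is a sum of
  squares. Positivity of the limit state rests on this.\<close>

lemma vstate_square:
  assumes b: "b \<in> pol"
  shows "vstate b (\<lambda>\<gamma> l q. \<Sum>r<n \<gamma>. cnj (g \<gamma> r l) * g \<gamma> r q)
    = of_real ((ip.N (star (act g b)))\<^sup>2)"
proof -
  have "(\<Sum>l<n \<gamma>. cnj (y l) * (\<Sum>q<n \<gamma>. (\<Sum>r<n \<gamma>. cnj (g \<gamma> r l) * g \<gamma> r q) * y q))
    = (\<Sum>r<n \<gamma>. of_real ((cmod (\<Sum>q<n \<gamma>. g \<gamma> r q * y q))\<^sup>2))" for \<gamma> and y :: "nat \<Rightarrow> complex"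
  proof -
    have "(\<Sum>r<n \<gamma>. of_real ((cmod (\<Sum>q<n \<gamma>. g \<gamma> r q * y q))\<^sup>2))
      = (\<Sum>r<n \<gamma>. \<Sum>q<n \<gamma>. \<Sum>l<n \<gamma>. cnj (y l) * (cnj (g \<gamma> r l) * g \<gamma> r q * y q))"
      unfolding complex_norm_square by (simp add: sum_product mult_ac)
    also have "\<dots> = (\<Sum>l<n \<gamma>. \<Sum>q<n \<gamma>. \<Sum>r<n \<gamma>. cnj (y l) * (cnj (g \<gamma> r l) * g \<gamma> r q * y q))"
      by (rule sum_swap3)
    finally show ?thesis by (simp add: sum_distrib_left sum_distrib_right)
  qed
  then show ?thesis
    unfolding N_star[OF act_pol[OF b] finite_csupp[OF b] csupp_act[OF b]]
      vstate_def of_real_sum of_real_mult of_real_inverse d_real[symmetric] by (simp add: yc_act b)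
qed

lemma vstate_one:
  assumes "b \<in> pol"
  shows "vstate b (\<lambda>\<gamma> i j. if i = j then 1 else 0) = of_real ((ip.N (star b))\<^sup>2)"
proof -
  have "vstate b (\<lambda>\<gamma> i j. if i = j then 1 else 0) = ip (star b) (star b)"
    using hG_right_eq[OF assms assms finite_csupp[OF assms] subset_refl]
    by (simp add: vstate_def ip_star sum_delta_times)
  then show ?thesis using assms by (simp add: ip.B_self pol_star)
qed

text \<open>Multiplicativity of the comultiplication. \<open>G s t\<close> plays the part of the
  block of \<Delta> g with the entry (s, t) of \<alpha> fixed in the first leg; the coefficient of
  \<alpha> contributes the sum over s.\<close>

lemma act_mult:
  assumes G: "\<And>\<beta> k l s t. k < n \<beta> \<Longrightarrow> l < n \<beta> \<Longrightarrow> s < n \<alpha> \<Longrightarrow> t < n \<alpha> \<Longrightarrow> fn g (U \<beta> k l * U \<alpha> s t) = G s t \<beta> k l"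
    and b: "b \<in> pol" and ij: "i < n \<alpha>" "j < n \<alpha>"
  shows "act g (b * U \<alpha> i j) = (\<Sum>s<n \<alpha>. act (G s j) b * U \<alpha> i s)"
proof (rule clinear_eq_pol[OF _ _ _ b])
  show "clinear (\<lambda>b. act g (b * U \<alpha> i j))"
    using act_linear[of g] by (simp add: clinear_def distrib_right scaleC_mult_left)
  show "clinear (\<lambda>b. \<Sum>s<n \<alpha>. act (G s j) b * U \<alpha> i s)"
    by (simp add: clinear_def clinear_add[OF act_linear] clinear_scale[OF act_linear] distrib_right
        scaleC_mult_left sum.distrib scaleC_sum_right)
  fix \<beta> k l assume kl: "k < n \<beta>" "l < n \<beta>"
  have "act g (U \<beta> k l * U \<alpha> i j) = (\<Sum>r<n \<beta>. \<Sum>s<n \<alpha>. fn g (U \<beta> r l * U \<alpha> s j) *\<^sub>C (U \<beta> k r * U \<alpha> i s))"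
    unfolding act_def using kl ij
    by (simp add: lift_comult_mult[OF cbilinear_fn comult_U comult_U])
  also have "\<dots> = (\<Sum>r<n \<beta>. \<Sum>s<n \<alpha>. G s j \<beta> r l *\<^sub>C (U \<beta> k r * U \<alpha> i s))"
    using kl ij by (simp add: G)
  also have "\<dots> = (\<Sum>s<n \<alpha>. \<Sum>r<n \<beta>. G s j \<beta> r l *\<^sub>C (U \<beta> k r * U \<alpha> i s))"
    by (rule sum.swap)
  also have "\<dots> = (\<Sum>s<n \<alpha>. act (G s j) (U \<beta> k l) * U \<alpha> i s)"
    using kl by (simp add: act_U sum_distrib_right scaleC_mult_left)
  finally show "act g (U \<beta> k l * U \<alpha> i j) = (\<Sum>s<n \<alpha>. act (G s j) (U \<beta> k l) * U \<alpha> i s)" .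
qed

end

section \<open>Asymptotic invariance of the vector states\<close>

context subexponential
begin

text \<open>The vector is the adjoint of a_k: right multiplication of the adjoint by a coefficient
  is left multiplication of a_k by the adjoint coefficient, to which the fixing property
  applies.\<close>

definition mu :: "nat \<Rightarrow> ('i \<Rightarrow> nat \<Rightarrow> nat \<Rightarrow> complex) \<Rightarrow> complex" where
  "mu k = vstate (star (aseq k))"

lemma mu_eq: "mu k g = ip (star (act g (star (aseq k)))) (aseq k)"
  by (simp add: mu_def vstate_eq pol_star star_star)

lemma mu_bound:
  assumes "op_bounded n C g" "0 \<le> C"
  shows "cmod (mu k g) \<le> sqrt C"
proof -
  have "cmod (mu k g) \<le> ip.N (star (act g (star (aseq k)))) * ip.N (aseq k)"
    unfolding mu_eq by (intro ip.cauchy_schwarz pol_star act_pol aseq_pol)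
  also have "\<dots> \<le> sqrt C"
    using N_act_le[OF assms, of "star (aseq k)"] by (simp add: pol_star star_star)
  finally show ?thesis .
qed

lemma mu_one: "mu k (\<lambda>\<gamma> i j. if i = j then 1 else 0) = 1"
  by (simp add: mu_def vstate_one pol_star star_star)

text \<open>\<open>act g\<close> is evaluated on b_k U_ij in two ways, with b_k the adjoint of a_k.
  The adjoint of U_ij almost fixes a_k, so the result is close to the delta symbol times the action
  on b_k. By \<open>act_mult\<close> it is also a sum over s in which U_is can be moved to a_k as
  \<open>\<theta>\<close> of U_is; this again acts almost as a delta symbol and leaves
  \<open>G i j\<close>.\<close>

lemma mu_invariant:
  assumes fixed: "\<And>a. a \<in> pol \<Longrightarrow> a \<in> fixers"
    and G: "\<And>\<beta> k l s t. k < n \<beta> \<Longrightarrow> l < n \<beta> \<Longrightarrow> s < n \<alpha> \<Longrightarrow> t < n \<alpha> \<Longrightarrow> fn g (U \<beta> k l * U \<alpha> s t) = G s t \<beta> k l"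
    and C: "0 \<le> C" "op_bounded n C g" "\<And>s t. s < n \<alpha> \<Longrightarrow> t < n \<alpha> \<Longrightarrow> op_bounded n C (G s t)"
    and ij: "i < n \<alpha>" "j < n \<alpha>"
  shows "(\<lambda>k. mu k (G i j) - (if i = j then 1 else 0) * mu k g) \<longlonglongrightarrow> 0"
proof -
  define \<delta> where "\<delta> i j = (if i = j then 1 else (0::complex))" for i j :: nat
  define b where "b k = star (aseq k)" for k
  have b: "b k \<in> pol" "star (b k) = aseq k" for k by (simp_all add: b_def pol_star star_star)
  define w where "w k = b k * U \<alpha> i j - \<delta> i j *\<^sub>C b k" for k
  define e1 where "e1 k = ip.N (star (w k))" for k
  define e2 where "e2 s k = ip.N (\<theta> (U \<alpha> i s) * aseq k - \<delta> i s *\<^sub>C aseq k)" for s k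
  have w: "w k \<in> pol" for k by (simp add: w_def b pol_minus pol_mult pol_scale ij)
  have e1: "e1 \<longlonglongrightarrow> 0"
  proof -
    have "star (w k) = star (U \<alpha> i j) * aseq k - \<epsilon>G (star (U \<alpha> i j)) *\<^sub>C aseq k" for k
      by (simp add: w_def star_minus star_mult star_scaleC b counit_star_U ij \<delta>_def)
    then show ?thesis unfolding e1_def
      using fixers_lim[OF fixed[OF star_U_pol[OF ij]]] by simp
  qed
  have e2: "e2 s \<longlonglongrightarrow> 0" if "s < n \<alpha>" for s
    using fixers_lim[OF fixed[OF pol_theta[OF pol_U[OF ij(1) that]]]] that ij
    by (simp add: e2_def[abs_def] counit_theta_U \<delta>_def)
  have le: "cmod (mu k (G i j) - \<delta> i j * mu k g) \<le> sqrt C * e1 k + (\<Sum>s<n \<alpha>. sqrt C * e2 s k)" for k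
  proof -
    have "ip (star (act g (w k))) (aseq k) = ip (star (act g (b k * U \<alpha> i j))) (aseq k) - \<delta> i j * mu k g"
      by (simp add: ip_star w_def clinear_minus[OF act_linear] clinear_scale[OF act_linear] mu_eq b_def[symmetric]
          clinear_minus[OF theta_linear] clinear_scale[OF theta_linear] left_diff_distrib scaleC_mult_left hG_simps)
    moreover have "ip (star (act g (b k * U \<alpha> i j))) (aseq k)
      = (\<Sum>s<n \<alpha>. ip (star (act (G s j) (b k))) (\<theta> (U \<alpha> i s) * aseq k))"
    proof -
      have "act g (b k * U \<alpha> i j) = (\<Sum>s<n \<alpha>. act (G s j) (b k) * U \<alpha> i s)"
        by (rule act_mult[OF G b(1) ij])
      then show ?thesis unfolding ip_star
      using ij by (simp add: clinear_sum[OF theta_linear] theta_mult act_pol b sum_distrib_right hG_simps mult.assoc)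
    qed
    moreover have "(\<Sum>s<n \<alpha>. \<delta> i s * ip (star (act (G s j) (b k))) (aseq k)) = mu k (G i j)"
      using ij by (simp add: \<delta>_def sum_delta_times mu_eq b_def)
    moreover have "ip (star (act (G s j) (b k))) (\<theta> (U \<alpha> i s) * aseq k - \<delta> i s *\<^sub>C aseq k)
      = ip (star (act (G s j) (b k))) (\<theta> (U \<alpha> i s) * aseq k) - \<delta> i s * ip (star (act (G s j) (b k))) (aseq k)" for s
      by (simp add: clinear_minus[OF ip.B_linear] ip.B_scale)
    ultimately have eq: "mu k (G i j) - \<delta> i j * mu k g = ip (star (act g (w k))) (aseq k)
      - (\<Sum>s<n \<alpha>. ip (star (act (G s j) (b k))) (\<theta> (U \<alpha> i s) * aseq k - \<delta> i s *\<^sub>C aseq k))"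
      by (simp add: sum_subtractf)
    have "cmod (mu k (G i j) - \<delta> i j * mu k g) \<le> cmod (ip (star (act g (w k))) (aseq k))
      + (\<Sum>s<n \<alpha>. cmod (ip (star (act (G s j) (b k))) (\<theta> (U \<alpha> i s) * aseq k - \<delta> i s *\<^sub>C aseq k)))"
      unfolding eq by (rule order_trans[OF norm_triangle_ineq4]) (intro add_left_mono norm_sum)
    also have "\<dots> \<le> sqrt C * e1 k + (\<Sum>s<n \<alpha>. sqrt C * e2 s k)"
    proof (rule add_mono[OF _ sum_mono])
      have "cmod (ip (star (act g (w k))) (aseq k)) \<le> ip.N (star (act g (w k))) * ip.N (aseq k)"
        by (rule ip.cauchy_schwarz[OF pol_star[OF act_pol[OF w]] aseq_pol])
      also have "\<dots> = ip.N (star (act g (w k)))" by simp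
      also have "\<dots> \<le> sqrt C * e1 k" unfolding e1_def by (rule N_act_le[OF C(2,1) w])
      finally show "cmod (ip (star (act g (w k))) (aseq k)) \<le> sqrt C * e1 k" .
      fix s assume "s \<in> {..<n \<alpha>}"
      then have s: "s < n \<alpha>" by simp
      have pol: "\<theta> (U \<alpha> i s) * aseq k - \<delta> i s *\<^sub>C aseq k \<in> pol"
        using s ij by (intro pol_minus pol_mult pol_theta pol_scale) auto
      have "ip.N (star (act (G s j) (b k))) \<le> sqrt C * ip.N (star (b k))"
        by (rule N_act_le[OF C(3)[OF s ij(2)] C(1) b(1)])
      also have "\<dots> = sqrt C" by (simp only: b N_aseq mult_1_right)
      finally have "ip.N (star (act (G s j) (b k))) * e2 s k \<le> sqrt C * e2 s k"
        by (rule mult_right_mono) (simp add: e2_def pol)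
      then show "cmod (ip (star (act (G s j) (b k))) (\<theta> (U \<alpha> i s) * aseq k - \<delta> i s *\<^sub>C aseq k)) \<le> sqrt C * e2 s k"
        using order_trans[OF ip.cauchy_schwarz[OF pol_star[OF act_pol[OF b(1)]] pol]] unfolding e2_def by blast
    qed
    finally show ?thesis .
  qed
  have "(\<lambda>k. sqrt C * e1 k + (\<Sum>s<n \<alpha>. sqrt C * e2 s k)) \<longlonglongrightarrow> sqrt C * 0 + (\<Sum>s<n \<alpha>. sqrt C * 0)"
    by (intro tendsto_add tendsto_mult tendsto_const e1 tendsto_sum e2) simp
  then have lim: "(\<lambda>k. sqrt C * e1 k + (\<Sum>s<n \<alpha>. sqrt C * e2 s k)) \<longlonglongrightarrow> 0" by simp
  have "(\<lambda>k. cmod (mu k (G i j) - \<delta> i j * mu k g)) \<longlonglongrightarrow> 0"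
    by (rule tendsto_sandwich[OF _ _ tendsto_const lim]) (auto simp: le)
  then show ?thesis unfolding \<delta>_def by (rule tendsto_norm_zero_cancel)
qed

text \<open>\<open>T p\<close> is the p-th term of a slice by a normal functional, S the whole slice
  and c the value of the functional at the unit. Each term is asymptotically invariant by
  \<open>mu_invariant\<close>, and w dominates the terms uniformly in k, so the limit may be taken
  inside the sum.\<close>

lemma mu_normal_combination:
  fixes \<xi> \<eta> :: "nat \<times> 'i \<Rightarrow> nat \<Rightarrow> complex" and D :: "'i \<Rightarrow> nat \<Rightarrow> nat \<Rightarrow> 'i \<Rightarrow> nat \<Rightarrow> nat \<Rightarrow> complex"
  defines "T \<equiv> \<lambda>p \<beta> k l. \<Sum>i<n (snd p). \<Sum>j<n (snd p). D (snd p) i j \<beta> k l * \<xi> p j * cnj (\<eta> p i)"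
  assumes fixed: "\<And>a. a \<in> pol \<Longrightarrow> a \<in> fixers"
    and w: "w summable_on UNIV" "\<And>p. 0 \<le> w p"
      "\<And>p. (\<Sum>i<n (snd p). (cmod (\<xi> p i))\<^sup>2) * (\<Sum>i<n (snd p). (cmod (\<eta> p i))\<^sup>2) \<le> (w p)\<^sup>2"
    and D: "\<And>\<alpha> \<beta> k l s t. k < n \<beta> \<Longrightarrow> l < n \<beta> \<Longrightarrow> s < n \<alpha> \<Longrightarrow> t < n \<alpha> \<Longrightarrow> fn g (U \<beta> k l * U \<alpha> s t) = D \<alpha> s t \<beta> k l"
    and C: "0 \<le> C" "op_bounded n C g" "\<And>\<alpha> s t. s < n \<alpha> \<Longrightarrow> t < n \<alpha> \<Longrightarrow> op_bounded n C (D \<alpha> s t)"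
      "\<And>p. op_bounded n (C * (w p)\<^sup>2) (T p)"
    and S: "\<And>\<beta> k l. k < n \<beta> \<Longrightarrow> l < n \<beta> \<Longrightarrow> ((\<lambda>p. T p \<beta> k l) has_sum S \<beta> k l) UNIV"
    and c: "c = (\<Sum>\<^sub>\<infinity>p. \<Sum>i<n (snd p). \<xi> p i * cnj (\<eta> p i))"
  shows "(\<lambda>k. mu k S - c * mu k g) \<longlonglongrightarrow> 0" and "\<exists>B. \<forall>k. cmod (mu k S) \<le> B"
proof -
  define e where "e p = (\<Sum>i<n (snd p). \<xi> p i * cnj (\<eta> p i))" for p
  have e_le: "cmod (e p) \<le> w p" for p
  proof -
    have "(cmod (e p))\<^sup>2 \<le> (\<Sum>i<n (snd p). (cmod (\<xi> p i))\<^sup>2) * (\<Sum>i<n (snd p). (cmod (cnj (\<eta> p i)))\<^sup>2)"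
      unfolding e_def by (rule cauchy_schwarz_sum)
    also have "\<dots> \<le> (w p)\<^sup>2" using w(3)[of p] by simp
    finally show ?thesis by (rule power2_le_imp_le) (rule w(2))
  qed
  have "e summable_on UNIV"
    by (rule abs_summable_summable, rule summable_on_comparison_test[OF w(1)]) (use e_le in auto)
  then have e_sum: "(e has_sum c) UNIV" unfolding c e_def[symmetric] by (rule has_sum_infsum)
  have T_le: "cmod (mu k (T p)) \<le> sqrt C * w p" for k p
    using mu_bound[OF C(4), of p k] C(1) w(2)[of p] by (simp add: real_sqrt_mult)
  have T_sum: "((\<lambda>p. mu k (T p)) has_sum mu k S) UNIV" for k
    unfolding mu_def by (rule vstate_has_sum[OF S])
  have T_eq: "mu k (T p) = (\<Sum>i<n (snd p). \<Sum>j<n (snd p). \<xi> p j * cnj (\<eta> p i) * mu k (D (snd p) i j))" for k p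
  proof -
    have "T p = (\<lambda>\<beta> k l. \<Sum>i<n (snd p). \<Sum>j<n (snd p). (\<xi> p j * cnj (\<eta> p i)) * D (snd p) i j \<beta> k l)"
      by (simp add: T_def mult_ac)
    then show ?thesis by (simp only: mu_def vstate_sum vstate_scale)
  qed
  define a where "a k p = mu k (T p) - e p * mu k g" for k p
  have a_le: "cmod (a k p) \<le> 2 * sqrt C * w p" for k p
  proof -
    have "cmod (e p * mu k g) \<le> w p * sqrt C"
      unfolding norm_mult by (intro mult_mono e_le mu_bound C w) simp
    then show ?thesis using norm_triangle_ineq4[of "mu k (T p)" "e p * mu k g"] T_le[of k p]
      unfolding a_def by (simp only: mult.commute[of "sqrt C"] mult.assoc)
  qed
  have a_lim: "(\<lambda>k. a k p) \<longlonglongrightarrow> 0" for p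
  proof -
    define \<alpha> where "\<alpha> = snd p"
    have "(\<lambda>k. \<Sum>i<n \<alpha>. \<Sum>j<n \<alpha>. \<xi> p j * cnj (\<eta> p i) * (mu k (D \<alpha> i j) - (if i = j then 1 else 0) * mu k g)) \<longlonglongrightarrow> 0"
      by (intro tendsto_null_sum tendsto_mult_right_zero mu_invariant[OF fixed D C(1,2,3)]) auto
    moreover have "(\<Sum>i<n \<alpha>. \<Sum>j<n \<alpha>. \<xi> p j * cnj (\<eta> p i) * (mu k (D \<alpha> i j) - (if i = j then 1 else 0) * mu k g)) = a k p" for k
    proof -
      have "(\<Sum>j<n \<alpha>. \<xi> p j * cnj (\<eta> p i) * ((if i = j then 1 else 0) * mu k g)) = \<xi> p i * cnj (\<eta> p i) * mu k g"
        if "i < n \<alpha>" for i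
      proof -
        have "(\<Sum>j<n \<alpha>. \<xi> p j * cnj (\<eta> p i) * ((if i = j then 1 else 0) * mu k g))
          = (\<Sum>j<n \<alpha>. if j = i then \<xi> p i * cnj (\<eta> p i) * mu k g else 0)"
          by (intro sum.cong refl) auto
        then show ?thesis using that by simp
      qed
      then show ?thesis
        by (simp add: a_def T_eq e_def \<alpha>_def[symmetric] right_diff_distrib sum_subtractf sum_distrib_right)
    qed
    ultimately show ?thesis by simp
  qed
  have "((\<lambda>p. mu k (T p) + (- mu k g) * e p) has_sum (mu k S + (- mu k g) * c)) UNIV" for k
    by (intro has_sum_add T_sum has_sum_cmult_right e_sum)
  then have "((\<lambda>p. a k p) has_sum (mu k S - c * mu k g)) UNIV" for k
    by (simp add: a_def mult.commute)
  then have "(\<Sum>\<^sub>\<infinity>p. a k p) = mu k S - c * mu k g" for k by (rule infsumI)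
  moreover have "(\<lambda>k. \<Sum>\<^sub>\<infinity>p. a k p) \<longlonglongrightarrow> 0"
    by (rule infsum_tendsto_zero[OF a_le summable_on_cmult_right[OF w(1)] a_lim])
  ultimately show "(\<lambda>k. mu k S - c * mu k g) \<longlonglongrightarrow> 0" by simp
  have "cmod (mu k S) \<le> (\<Sum>\<^sub>\<infinity>p. sqrt C * w p)" for k
    by (rule norm_infsum_le[OF T_sum has_sum_infsum[OF summable_on_cmult_right[OF w(1)]] T_le])
  then show "\<exists>B. \<forall>k. cmod (mu k S) \<le> B" by blast
qed

end

section \<open>Irreducible representations and the dual\<close>

context discrete_quantum_group
begin

abbreviation "n \<equiv> irr_dim u"
abbreviation "U \<equiv> \<lambda>\<alpha> i j. u \<alpha> $$ (i, j)"
abbreviation "triv \<equiv> trivial_index u"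

lemma u_irreducible: "irreducible_rep \<Delta>G (u \<alpha>)"
  using irr by (simp add: irr_representatives_def)

lemma u_unitary: "unitary_rep \<Delta>G (u \<alpha>)"
  using u_irreducible[of \<alpha>] by (simp add: irreducible_rep_def)

lemma u_carrier: "u \<alpha> \<in> carrier_mat (n \<alpha>) (n \<alpha>)"
  using u_unitary[of \<alpha>] by (intro carrier_matI) (auto simp: unitary_rep_def irr_dim_def)

lemma n_pos: "0 < n \<alpha>"
  using u_irreducible[of \<alpha>] by (simp add: irreducible_rep_def irr_dim_def)

lemma star_mat_carrier: "star_mat (u \<alpha>) \<in> carrier_mat (n \<alpha>) (n \<alpha>)"
  using u_carrier[of \<alpha>] by (simp add: star_mat_def)

lemma star_mat_index: "i < n \<alpha> \<Longrightarrow> j < n \<alpha> \<Longrightarrow> star_mat (u \<alpha>) $$ (i, j) = star (U \<alpha> j i)"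
  using u_carrier[of \<alpha>] by (simp add: star_mat_def)

lemma u_unitary_left:
  assumes "i < n \<alpha>" "j < n \<alpha>"
  shows "(\<Sum>k<n \<alpha>. star (U \<alpha> k i) * U \<alpha> k j) = (if i = j then 1 else 0)"
proof -
  have "star_mat (u \<alpha>) * u \<alpha> = 1\<^sub>m (n \<alpha>)"
    using u_unitary[of \<alpha>] by (simp add: unitary_rep_def irr_dim_def)
  then have "(star_mat (u \<alpha>) * u \<alpha>) $$ (i, j) = (if i = j then 1 else 0)"
    using assms by simp
  then show ?thesis
    using assms by (simp add: index_mult_mat_sum[OF star_mat_carrier u_carrier assms] star_mat_index
        del: index_mult_mat)
qed

lemma u_unitary_right:
  assumes "i < n \<alpha>" "j < n \<alpha>"
  shows "(\<Sum>k<n \<alpha>. U \<alpha> i k * star (U \<alpha> j k)) = (if i = j then 1 else 0)"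
proof -
  have "u \<alpha> * star_mat (u \<alpha>) = 1\<^sub>m (n \<alpha>)"
    using u_unitary[of \<alpha>] by (simp add: unitary_rep_def irr_dim_def)
  then have "(u \<alpha> * star_mat (u \<alpha>)) $$ (i, j) = (if i = j then 1 else 0)"
    using assms by simp
  then show ?thesis
    using assms by (simp add: index_mult_mat_sum[OF u_carrier star_mat_carrier assms] star_mat_index
        del: index_mult_mat)
qed

lemma u_comult: "i < n \<alpha> \<Longrightarrow> j < n \<alpha> \<Longrightarrow> \<Delta>G (U \<alpha> i j) = (\<Sum>k<n \<alpha>. U \<alpha> i k \<otimes>\<^sub>t U \<alpha> k j)"
  using u_unitary[of \<alpha>] by (simp add: unitary_rep_def irr_dim_def)

text \<open>Same coordinates as in the assumption \<open>schur\<close>; as a matrix, T goes from the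
  space of \<beta> to that of \<alpha>.\<close>

definition intw :: "'i \<Rightarrow> 'i \<Rightarrow> (nat \<Rightarrow> nat \<Rightarrow> complex) \<Rightarrow> bool" where
  "intw \<alpha> \<beta> T \<longleftrightarrow> (\<forall>i<n \<alpha>. \<forall>l<n \<beta>. (\<Sum>k<n \<alpha>. T k l *\<^sub>C U \<alpha> i k) = (\<Sum>k<n \<beta>. T i k *\<^sub>C U \<beta> k l))"

lemma intw_mat:
  assumes "intw \<alpha> \<beta> T"
  shows "mat (n \<alpha>) (n \<beta>) (\<lambda>(i, j). T i j) \<in> intertwiners (u \<beta>) (u \<alpha>)"
proof -
  define M where "M = mat (n \<alpha>) (n \<beta>) (\<lambda>(i, j). T i j)"
  have M: "M \<in> carrier_mat (n \<alpha>) (n \<beta>)" by (simp add: M_def)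
  have sM: "(scalar_mat M :: 'a mat) \<in> carrier_mat (n \<alpha>) (n \<beta>)" using M by (simp add: scalar_mat_def)
  have sM_index: "(scalar_mat M :: 'a mat) $$ (i, j) = T i j *\<^sub>C 1" if "i < n \<alpha>" "j < n \<beta>" for i j
    using that by (simp add: scalar_mat_def M_def)
  have "scalar_mat M * u \<beta> = u \<alpha> * scalar_mat M"
  proof (rule eq_matI)
    fix i j assume "i < dim_row (u \<alpha> * scalar_mat M)" "j < dim_col (u \<alpha> * scalar_mat M)"
    then have ij: "i < n \<alpha>" "j < n \<beta>" using M u_carrier[of \<alpha>] by (auto simp: scalar_mat_def)
    have "(scalar_mat M * u \<beta>) $$ (i, j) = (\<Sum>k<n \<beta>. T i k *\<^sub>C U \<beta> k j)"
      unfolding index_mult_mat_sum[OF sM u_carrier ij]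
      by (intro sum.cong refl) (simp add: sM_index ij scaleC_mult_left)
    also have "\<dots> = (\<Sum>k<n \<alpha>. T k j *\<^sub>C U \<alpha> i k)"
      using assms ij by (simp add: intw_def)
    also have "\<dots> = (u \<alpha> * scalar_mat M) $$ (i, j)"
      unfolding index_mult_mat_sum[OF u_carrier sM ij]
      by (intro sum.cong refl) (simp add: sM_index ij scaleC_mult_right)
    finally show "(scalar_mat M * u \<beta>) $$ (i, j) = (u \<alpha> * scalar_mat M) $$ (i, j)" .
  qed (use M u_carrier[of \<alpha>] u_carrier[of \<beta>] in \<open>auto simp: scalar_mat_def\<close>)
  then show ?thesis
    using M by (simp add: intertwiners_def M_def irr_dim_def)
qed

lemma schur_same:
  assumes "intw \<alpha> \<alpha> T" "i < n \<alpha>" "l < n \<alpha>"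
  shows "T i l = (if i = l then T 0 0 else 0)"
proof -
  have "mat (n \<alpha>) (n \<alpha>) (\<lambda>(i, j). T i j) \<in> {c \<cdot>\<^sub>m 1\<^sub>m (n \<alpha>) | c. True}"
    using intw_mat[OF assms(1)] u_irreducible[of \<alpha>] by (simp add: irreducible_rep_def irr_dim_def)
  then obtain c where c: "mat (n \<alpha>) (n \<alpha>) (\<lambda>(i, j). T i j) = c \<cdot>\<^sub>m 1\<^sub>m (n \<alpha>)" by blast
  have "T a b = c * (if a = b then 1 else 0)" if "a < n \<alpha>" "b < n \<alpha>" for a b
    using arg_cong[OF c, of "\<lambda>M. M $$ (a, b)"] that by simp
  then show ?thesis using assms n_pos[of \<alpha>] by simp
qed

text \<open>Unitarity allows the intertwining relation to be multiplied by the adjoint of u \<alpha>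
  on the left and by that of u \<beta> on the right; the resulting relation between adjoint matrices
  becomes the claim after applying \<open>star\<close>.\<close>

lemma intw_adjoint:
  assumes T: "intw \<alpha> \<beta> T"
  shows "intw \<beta> \<alpha> (\<lambda>l i. cnj (T i l))"
proof -
  have 1: "(\<Sum>i<n \<alpha>. \<Sum>k<n \<beta>. T i k *\<^sub>C (star (U \<alpha> i m) * U \<beta> k l)) = T m l *\<^sub>C 1"
    if "m < n \<alpha>" "l < n \<beta>" for m l
  proof -
    have "(\<Sum>i<n \<alpha>. \<Sum>k<n \<beta>. T i k *\<^sub>C (star (U \<alpha> i m) * U \<beta> k l))
      = (\<Sum>i<n \<alpha>. star (U \<alpha> i m) * (\<Sum>k<n \<beta>. T i k *\<^sub>C U \<beta> k l))"
      by (simp add: sum_distrib_left scaleC_mult_right)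
    also have "\<dots> = (\<Sum>i<n \<alpha>. star (U \<alpha> i m) * (\<Sum>k<n \<alpha>. T k l *\<^sub>C U \<alpha> i k))"
      using T that by (simp add: intw_def)
    also have "\<dots> = (\<Sum>i<n \<alpha>. \<Sum>k<n \<alpha>. T k l *\<^sub>C (star (U \<alpha> i m) * U \<alpha> i k))"
      by (simp add: sum_distrib_left scaleC_mult_right)
    also have "\<dots> = (\<Sum>k<n \<alpha>. T k l *\<^sub>C (\<Sum>i<n \<alpha>. star (U \<alpha> i m) * U \<alpha> i k))"
      by (subst sum.swap) (simp add: scaleC_sum_right)
    also have "\<dots> = (\<Sum>k<n \<alpha>. if k = m then T k l *\<^sub>C 1 else 0)"
      using that by (intro sum.cong refl) (simp add: u_unitary_left)
    finally show ?thesis using that by simp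
  qed
  have 2: "(\<Sum>i<n \<alpha>. T i r *\<^sub>C star (U \<alpha> i m)) = (\<Sum>l<n \<beta>. T m l *\<^sub>C star (U \<beta> r l))"
    if "m < n \<alpha>" "r < n \<beta>" for m r
  proof -
    have "(\<Sum>l<n \<beta>. T m l *\<^sub>C star (U \<beta> r l)) = (\<Sum>l<n \<beta>. (T m l *\<^sub>C 1) * star (U \<beta> r l))"
      by (simp add: scaleC_mult_left)
    also have "\<dots> = (\<Sum>l<n \<beta>. \<Sum>i<n \<alpha>. \<Sum>k<n \<beta>. T i k *\<^sub>C (star (U \<alpha> i m) * (U \<beta> k l * star (U \<beta> r l))))"
      using that by (intro sum.cong refl)
        (simp add: 1[symmetric] sum_distrib_right scaleC_mult_left mult.assoc)
    also have "\<dots> = (\<Sum>k<n \<beta>. \<Sum>i<n \<alpha>. T i k *\<^sub>C (star (U \<alpha> i m) * (\<Sum>l<n \<beta>. U \<beta> k l * star (U \<beta> r l))))"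
      by (subst sum_swap3) (simp add: sum_distrib_left scaleC_sum_right)
    also have "\<dots> = (\<Sum>k<n \<beta>. if k = r then (\<Sum>i<n \<alpha>. T i k *\<^sub>C star (U \<alpha> i m)) else 0)"
      using that by (intro sum.cong refl) (auto simp: u_unitary_right)
    finally show ?thesis using that by simp
  qed
  show ?thesis unfolding intw_def
  proof (intro allI impI)
    fix r m assume "r < n \<beta>" "m < n \<alpha>"
    from arg_cong[OF 2[OF this(2,1)], of star]
    show "(\<Sum>k<n \<beta>. cnj (T m k) *\<^sub>C U \<beta> r k) = (\<Sum>k<n \<alpha>. cnj (T k r) *\<^sub>C U \<alpha> k m)"
      by (simp add: star_sum star_scaleC star_star)
  qed
qed

lemma intw_compose:
  assumes T: "intw \<alpha> \<beta> T" and S: "intw \<beta> \<gamma> S"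
  shows "intw \<alpha> \<gamma> (\<lambda>i l. \<Sum>k<n \<beta>. T i k * S k l)"
  unfolding intw_def
proof (intro allI impI)
  fix i l assume il: "i < n \<alpha>" "l < n \<gamma>"
  have "(\<Sum>k<n \<alpha>. (\<Sum>m<n \<beta>. T k m * S m l) *\<^sub>C U \<alpha> i k) = (\<Sum>m<n \<beta>. S m l *\<^sub>C (\<Sum>k<n \<alpha>. T k m *\<^sub>C U \<alpha> i k))"
    unfolding scaleC_sum_left scaleC_sum_right scaleC_scaleC
    by (subst sum.swap) (simp add: mult.commute)
  also have "\<dots> = (\<Sum>m<n \<beta>. S m l *\<^sub>C (\<Sum>k<n \<beta>. T i k *\<^sub>C U \<beta> k m))"
    using T il by (simp add: intw_def)
  also have "\<dots> = (\<Sum>k<n \<beta>. T i k *\<^sub>C (\<Sum>m<n \<beta>. S m l *\<^sub>C U \<beta> k m))"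
    unfolding scaleC_sum_right scaleC_scaleC
    by (subst sum.swap) (simp add: mult.commute)
  also have "\<dots> = (\<Sum>k<n \<beta>. T i k *\<^sub>C (\<Sum>m<n \<gamma>. S k m *\<^sub>C U \<gamma> m l))"
    using S il by (simp add: intw_def)
  also have "\<dots> = (\<Sum>m<n \<gamma>. (\<Sum>k<n \<beta>. T i k * S k m) *\<^sub>C U \<gamma> m l)"
    unfolding scaleC_sum_left scaleC_sum_right scaleC_scaleC by (rule sum.swap)
  finally show "(\<Sum>k<n \<alpha>. (\<Sum>m<n \<beta>. T k m * S m l) *\<^sub>C U \<alpha> i k) = (\<Sum>k<n \<gamma>. (\<Sum>m<n \<beta>. T i m * S m k) *\<^sub>C U \<gamma> k l)" .
qed

text \<open>T times its adjoint and the adjoint times T are scalars a and b by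
  \<open>schur_same\<close>. If T is not 0 then a is not 0 and a = b, so T is invertible up to its
  shape, and the two representations are equivalent, against the choice of representatives.\<close>

lemma schur_distinct:
  assumes T: "intw \<alpha> \<beta> T" and ne: "\<alpha> \<noteq> \<beta>" and il: "i < n \<alpha>" "l < n \<beta>"
  shows "T i l = 0"
proof (rule ccontr)
  assume nz: "T i l \<noteq> 0"
  define S where "S l i = cnj (T i l)" for l i
  have S: "intw \<beta> \<alpha> S" using intw_adjoint[OF T] by (simp add: S_def[abs_def])
  define a where "a = (\<Sum>k<n \<beta>. T 0 k * S k 0)"
  define b where "b = (\<Sum>k<n \<alpha>. S 0 k * T k 0)"
  have TS: "(\<Sum>k<n \<beta>. T i k * S k j) = (if i = j then a else 0)" if "i < n \<alpha>" "j < n \<alpha>" for i j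
    using schur_same[OF intw_compose[OF T S] that] by (simp add: a_def)
  have ST: "(\<Sum>k<n \<alpha>. S i k * T k j) = (if i = j then b else 0)" if "i < n \<beta>" "j < n \<beta>" for i j
    using schur_same[OF intw_compose[OF S T] that] by (simp add: b_def)
  have "a \<noteq> 0"
  proof
    assume "a = 0"
    then have "(\<Sum>k<n \<beta>. T i k * cnj (T i k)) = 0" using TS[OF il(1,1)] by (simp add: S_def)
    then have "of_real (\<Sum>k<n \<beta>. (cmod (T i k))\<^sup>2) = (0::complex)"
      by (simp only: of_real_sum complex_norm_square)
    then have "(\<Sum>k<n \<beta>. (cmod (T i k))\<^sup>2) = 0" by (simp only: of_real_eq_0_iff)
    then show False using nz il by (simp add: sum_nonneg_eq_0_iff)
  qed
  have "a * T i l = (\<Sum>j<n \<alpha>. (if i = j then a else 0) * T j l)"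
    using il by (simp add: sum_delta_times)
  also have "\<dots> = (\<Sum>j<n \<alpha>. \<Sum>k<n \<beta>. T i k * (S k j * T j l))"
    using il by (intro sum.cong refl) (simp add: TS[symmetric] sum_distrib_right mult.assoc)
  also have "\<dots> = (\<Sum>k<n \<beta>. T i k * (\<Sum>j<n \<alpha>. S k j * T j l))"
    by (subst sum.swap) (simp add: sum_distrib_left)
  also have "\<dots> = (\<Sum>k<n \<beta>. T i k * (if k = l then b else 0))"
    using il by (intro sum.cong refl) (simp add: ST)
  also have "\<dots> = T i l * b" using il by (simp add: sum_delta_times)
  finally have ab: "a = b" using nz by simp
  \<comment> \<open>Comparing the traces of the two products gives equal dimensions, which
    invertibility of a matrix requires.\<close>
  have "of_nat (n \<alpha>) * a = (\<Sum>i<n \<alpha>. \<Sum>k<n \<beta>. T i k * S k i)" by (simp add: TS)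
  also have "\<dots> = (\<Sum>k<n \<beta>. \<Sum>i<n \<alpha>. S k i * T i k)" by (subst sum.swap) (simp add: mult.commute)
  also have "\<dots> = of_nat (n \<beta>) * a" by (simp add: ST ab)
  finally have dim: "n \<alpha> = n \<beta>" using \<open>a \<noteq> 0\<close> by simp
  define M where "M = mat (n \<alpha>) (n \<beta>) (\<lambda>(i, j). T i j)"
  define M' where "M' = mat (n \<beta>) (n \<alpha>) (\<lambda>(i, j). S i j / a)"
  have M: "M \<in> carrier_mat (n \<alpha>) (n \<beta>)" "M' \<in> carrier_mat (n \<beta>) (n \<alpha>)" by (simp_all add: M_def M'_def)
  have "M * M' = 1\<^sub>m (n \<alpha>)"
  proof (rule eq_matI)
    fix i j assume "i < dim_row (1\<^sub>m (n \<alpha>) :: complex mat)" "j < dim_col (1\<^sub>m (n \<alpha>) :: complex mat)"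
    then have ij: "i < n \<alpha>" "j < n \<alpha>" by auto
    have "(M * M') $$ (i, j) = (\<Sum>k<n \<beta>. T i k * S k j) / a"
      unfolding index_mult_mat_sum[OF M ij] sum_divide_distrib
      by (intro sum.cong refl) (simp add: M_def M'_def ij)
    then show "(M * M') $$ (i, j) = 1\<^sub>m (n \<alpha>) $$ (i, j)" using ij \<open>a \<noteq> 0\<close> by (simp add: TS)
  qed (use M in auto)
  moreover have "M' * M = 1\<^sub>m (n \<beta>)"
  proof (rule eq_matI)
    fix i j assume "i < dim_row (1\<^sub>m (n \<beta>) :: complex mat)" "j < dim_col (1\<^sub>m (n \<beta>) :: complex mat)"
    then have ij: "i < n \<beta>" "j < n \<beta>" by auto
    have "(M' * M) $$ (i, j) = (\<Sum>k<n \<alpha>. S i k * T k j) / a"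
      unfolding index_mult_mat_sum[OF M(2,1) ij] sum_divide_distrib
      by (intro sum.cong refl) (simp add: M_def M'_def ij)
    then show "(M' * M) $$ (i, j) = 1\<^sub>m (n \<beta>) $$ (i, j)" using ij \<open>a \<noteq> 0\<close> by (simp add: ST ab)
  qed (use M in auto)
  ultimately have "invertible_mat M"
    using M dim by (auto simp: invertible_mat_def inverts_mat_def)
  moreover have "M \<in> intertwiners (u \<beta>) (u \<alpha>)" unfolding M_def by (rule intw_mat[OF T])
  ultimately have "equivalent_reps (u \<beta>) (u \<alpha>)" by (auto simp: equivalent_reps_def)
  then show False using irr ne by (auto simp: irr_representatives_def)
qed

text \<open>The definite description in \<open>trivial_index\<close> has to be shown meaningful. The
  1 by 1 unit matrix is an irreducible representation, hence equivalent to some u \<alpha>; an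
  equivalence by a nonzero scalar is an equality. Uniqueness is Schur's lemma with T = 1.\<close>

lemma trivial_rep: "u triv = 1\<^sub>m 1"
proof -
  have one_ne: "(1::'a) \<noteq> 0"
    using counit_one clinear_zero[OF counit_linear] by force
  have "irreducible_rep \<Delta>G (1\<^sub>m 1)"
    unfolding irreducible_rep_def
  proof (intro conjI)
    have "(1 :: ('a, 'a) tensor) = 1 \<otimes>\<^sub>t 1" by transfer (simp add: tensor_eq_def)
    moreover have "star_mat (1\<^sub>m 1 :: 'a mat) = 1\<^sub>m 1" by (auto simp: star_mat_def intro!: eq_matI)
    moreover have "1\<^sub>m 1 * 1\<^sub>m 1 = (1\<^sub>m 1 :: 'a mat)"
      by (auto simp: scalar_prod_def intro!: eq_matI)
    ultimately show "unitary_rep \<Delta>G (1\<^sub>m 1)"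
      by (simp add: unitary_rep_def comult_one)
    show "intertwiners (1\<^sub>m 1 :: 'a mat) (1\<^sub>m 1) = {c \<cdot>\<^sub>m 1\<^sub>m (dim_row (1\<^sub>m 1 :: 'a mat)) |c. True}"
    proof (intro equalityI subsetI)
      fix T assume "T \<in> intertwiners (1\<^sub>m 1 :: 'a mat) (1\<^sub>m 1)"
      then have T: "T \<in> carrier_mat 1 1" by (simp add: intertwiners_def)
      have "T = T $$ (0, 0) \<cdot>\<^sub>m 1\<^sub>m 1" using T by (auto intro!: eq_matI)
      then show "T \<in> {c \<cdot>\<^sub>m 1\<^sub>m (dim_row (1\<^sub>m 1 :: 'a mat)) |c. True}" by auto
    next
      fix T :: "complex mat" assume "T \<in> {c \<cdot>\<^sub>m 1\<^sub>m (dim_row (1\<^sub>m 1 :: 'a mat)) |c. True}"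
      then have T: "T \<in> carrier_mat 1 1" by auto
      then have "(scalar_mat T :: 'a mat) \<in> carrier_mat 1 1" by (simp add: scalar_mat_def)
      then have "scalar_mat T * 1\<^sub>m 1 = (1\<^sub>m 1 * scalar_mat T :: 'a mat)"
        by (auto simp: scalar_prod_def intro!: eq_matI)
      then show "T \<in> intertwiners (1\<^sub>m 1 :: 'a mat) (1\<^sub>m 1)"
        using T by (simp add: intertwiners_def)
    qed
  qed simp
  then obtain \<alpha> where "equivalent_reps (1\<^sub>m 1) (u \<alpha>)"
    using irr by (auto simp: irr_representatives_def)
  then obtain T where T: "T \<in> intertwiners (1\<^sub>m 1) (u \<alpha>)" "invertible_mat T"
    by (auto simp: equivalent_reps_def)
  then have dim: "n \<alpha> = 1" and Tc: "T \<in> carrier_mat 1 1"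
    by (auto simp: intertwiners_def invertible_mat_def irr_dim_def)
  have uc: "u \<alpha> \<in> carrier_mat 1 1" using u_carrier[of \<alpha>] dim by simp
  have sc: "(scalar_mat T :: 'a mat) \<in> carrier_mat 1 1" using Tc by (simp add: scalar_mat_def)
  have "scalar_mat T * 1\<^sub>m 1 = u \<alpha> * scalar_mat T" using T by (simp add: intertwiners_def)
  then have "(scalar_mat T * 1\<^sub>m 1) $$ (0, 0) = (u \<alpha> * scalar_mat T) $$ (0, 0)" by simp
  then have eq: "T $$ (0, 0) *\<^sub>C 1 = T $$ (0, 0) *\<^sub>C U \<alpha> 0 0"
  proof -
    have se: "(scalar_mat T :: 'a mat) $$ (0, 0) = T $$ (0, 0) *\<^sub>C 1" using Tc by (simp add: scalar_mat_def)
    have "(scalar_mat T * 1\<^sub>m 1 :: 'a mat) $$ (0, 0) = T $$ (0, 0) *\<^sub>C 1"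
      using index_mult_mat_sum[OF sc, of "1\<^sub>m 1" 1 0 0] se by simp
    moreover have "(u \<alpha> * scalar_mat T) $$ (0, 0) = T $$ (0, 0) *\<^sub>C U \<alpha> 0 0"
      using index_mult_mat_sum[OF uc sc, of 0 0] se by (simp add: scaleC_mult_right)
    ultimately show ?thesis
      using \<open>(scalar_mat T * 1\<^sub>m 1) $$ (0, 0) = (u \<alpha> * scalar_mat T) $$ (0, 0)\<close> by simp
  qed
  have "T $$ (0, 0) \<noteq> 0"
  proof
    assume 0: "T $$ (0, 0) = 0"
    obtain B where B: "inverts_mat T B" "inverts_mat B T" using T(2) by (auto simp: invertible_mat_def)
    have BT: "B * T = 1\<^sub>m (dim_row B)" "T * B = 1\<^sub>m 1" using B Tc by (auto simp: inverts_mat_def)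
    have "dim_col (B * T) = dim_row B" "dim_col (T * B) = 1" unfolding BT by simp_all
    then have "B \<in> carrier_mat 1 1" using Tc by (intro carrier_matI) auto
    then have "(T * B) $$ (0, 0) = T $$ (0, 0) * B $$ (0, 0)"
      using index_mult_mat_sum[OF Tc, of B 1 0 0] by simp
    then show False using \<open>T * B = 1\<^sub>m 1\<close> 0 by simp
  qed
  then have "U \<alpha> 0 0 = 1" using eq by simp
  then have ua: "u \<alpha> = 1\<^sub>m 1" using uc by (auto intro!: eq_matI)
  have uniq: "\<beta> = \<alpha>" if "u \<beta> = 1\<^sub>m 1" for \<beta>
  proof -
    have "intw \<beta> \<alpha> (\<lambda>_ _. 1)" using ua that by (simp add: intw_def irr_dim_def)
    then show ?thesis using schur_distinct[of \<beta> \<alpha> "\<lambda>_ _. 1" 0 0] n_pos by force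
  qed
  have "triv = \<alpha>"
    unfolding trivial_index_def using ua uniq by (rule the_equality)
  then show ?thesis using ua by simp
qed

lemma n_triv: "n triv = 1"
  by (simp add: irr_dim_def trivial_rep)

end

sublocale discrete_quantum_group \<subseteq> pw: peter_weyl \<Delta>G \<epsilon>G SG "irr_dim u" "\<lambda>\<alpha> i j. u \<alpha> $$ (i, j)" "trivial_index u"
proof
  fix \<alpha> \<beta> T i l
  assume *: "\<And>i l. \<lbrakk>i < n \<alpha>; l < n \<beta>\<rbrakk> \<Longrightarrow> (\<Sum>k<n \<alpha>. T k l *\<^sub>C U \<alpha> i k) = (\<Sum>k<n \<beta>. T i k *\<^sub>C U \<beta> k l)"
    and il: "i < n \<alpha>" "l < n \<beta>"
  then have T: "intw \<alpha> \<beta> T" by (simp add: intw_def)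
  show "T i l = (if \<alpha> = \<beta> \<and> i = l then T 0 0 else 0)"
  proof (cases "\<alpha> = \<beta>")
    case True
    then show ?thesis using schur_same[of \<alpha> T i l] T il by simp
  next
    case False
    then show ?thesis using schur_distinct[OF T False il] by simp
  qed
qed (auto simp: u_unitary_left u_unitary_right u_comult trivial_rep n_triv)

section \<open>Structure of the coefficient algebra read off from the dual\<close>

context discrete_quantum_group
begin

lemma \<rho>_carrier: "\<rho> \<alpha> \<in> carrier_mat (n \<alpha>) (n \<alpha>)"
  using modular[of \<alpha>] by (simp add: modular_matrix_def irr_dim_def)

text \<open>The finite leg of an entry of \<Delta> is itself the expansion of a product of two
  coefficients into coefficients; it replaces the decomposition of tensor products into
  irreducibles.\<close>

lemma mult_U_pol:
  assumes "k < n \<beta>" "l < n \<beta>" "i < n \<alpha>" "j < n \<alpha>"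
  shows "U \<beta> k l * U \<alpha> i j \<in> pw.pol"
proof -
  have "has_leg n (\<lambda>x. \<Delta> x (\<alpha>, \<beta>) $$ (i * n \<beta> + k, j * n \<beta> + l)) u (U \<beta> k l * U \<alpha> i j)"
    using comult assms by (simp add: dual_comult_def Let_def)
  then show ?thesis
    unfolding has_leg_def Let_def by (auto intro!: pw.pol_sum pw.pol_scale pw.pol_U)
qed

text \<open>The formula for R expands a coefficient into adjoints of coefficients; taking adjoints
  of both sides gives the claim.\<close>

lemma star_U_pol:
  assumes "k < n \<beta>" "l < n \<beta>"
  shows "star (U \<beta> k l) \<in> pw.pol"
proof -
  obtain r s where leg: "has_leg n (\<lambda>x. R (s *\<^sub>f x *\<^sub>f r) \<beta> $$ (k, l)) (\<lambda>\<alpha>. star_mat (u \<alpha>)) (U \<beta> k l)"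
    using antipode assms unfolding unitary_antipode_def Let_def by blast
  define \<phi> where "\<phi> x = R (s *\<^sub>f x *\<^sub>f r) \<beta> $$ (k, l)" for x
  obtain G where "U \<beta> k l = (\<Sum>\<gamma>\<in>G. \<Sum>i<n \<gamma>. \<Sum>j<n \<gamma>. \<phi> (mat_unit n \<gamma> i j) *\<^sub>C star_mat (u \<gamma>) $$ (i, j))"
    using leg unfolding has_leg_def Let_def \<phi>_def by blast
  also have "\<dots> = (\<Sum>\<gamma>\<in>G. \<Sum>i<n \<gamma>. \<Sum>j<n \<gamma>. \<phi> (mat_unit n \<gamma> i j) *\<^sub>C star (U \<gamma> j i))"
    by (intro sum.cong refl) (simp add: star_mat_index)
  finally have "star (U \<beta> k l) = (\<Sum>\<gamma>\<in>G. \<Sum>i<n \<gamma>. \<Sum>j<n \<gamma>. cnj (\<phi> (mat_unit n \<gamma> i j)) *\<^sub>C U \<gamma> j i)"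
    by (simp add: star_sum star_scaleC star_star)
  then show ?thesis by (auto intro!: pw.pol_sum pw.pol_scale pw.pol_U)
qed

lemma index_of_inverse:
  assumes "A \<in> carrier_mat m m" "B \<in> carrier_mat m m" "inverts_mat A B" "i < m" "j < m"
  shows "(\<Sum>k<m. A $$ (i, k) * B $$ (k, j)) = (if i = j then 1 else (0::complex))"
proof -
  have "A * B = 1\<^sub>m m" using assms by (auto simp: inverts_mat_def)
  from arg_cong[OF this, of "\<lambda>M. M $$ (i, j)"]
  show ?thesis using assms index_mult_mat_sum[OF assms(1,2,4,5)] by simp
qed

text \<open>\<open>inverts_mat\<close> alone leaves the shape of B open; the column counts of the
  two unit matrices determine it.\<close>

lemma inverse_carrier:
  assumes A: "(A :: complex mat) \<in> carrier_mat m m" and B: "inverts_mat A B" "inverts_mat B A"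
  shows "B \<in> carrier_mat m m"
proof -
  have AB: "A * B = 1\<^sub>m m" and BA: "B * A = 1\<^sub>m (dim_row B)"
    using assms by (auto simp: inverts_mat_def)
  have "dim_col (B * A) = dim_row B" "dim_col (A * B) = m" unfolding AB BA by simp_all
  then show ?thesis using A by (intro carrier_matI) auto
qed

text \<open>The inverse \<open>sig\<close> comes from the modular matrix, while \<open>rt\<close>
  and \<open>rs\<close> come from the polar decomposition in the definition of the unitary
  antipode.\<close>

lemma dual_data_exists:
  "\<exists>sig rt rs. dual_data \<Delta>G \<epsilon>G SG n U triv (entries \<rho>) sig rt rs"
proof -
  have "\<exists>\<sigma>. inverts_mat (\<rho> \<alpha>) \<sigma> \<and> inverts_mat \<sigma> (\<rho> \<alpha>) \<and> mat_trace (\<rho> \<alpha>) = mat_trace \<sigma> \<and>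
        map_mat (\<lambda>a. SG (SG a)) (u \<alpha>) = scalar_mat (\<rho> \<alpha>) * u \<alpha> * scalar_mat \<sigma>" for \<alpha>
    using modular[of \<alpha>] by (simp add: modular_matrix_def)
  then obtain \<sigma> where \<sigma>: "inverts_mat (\<rho> \<alpha>) (\<sigma> \<alpha>)" "inverts_mat (\<sigma> \<alpha>) (\<rho> \<alpha>)" "mat_trace (\<rho> \<alpha>) = mat_trace (\<sigma> \<alpha>)"
    "map_mat (\<lambda>a. SG (SG a)) (u \<alpha>) = scalar_mat (\<rho> \<alpha>) * u \<alpha> * scalar_mat (\<sigma> \<alpha>)" for \<alpha>
    by metis
  have \<sigma>c: "\<sigma> \<alpha> \<in> carrier_mat (n \<alpha>) (n \<alpha>)" for \<alpha>
    by (rule inverse_carrier[OF \<rho>_carrier \<sigma>(1,2)])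
  obtain r s where rs: "positive_definite (r \<alpha>)" "r \<alpha> * r \<alpha> = \<rho> \<alpha>"
      "inverts_mat (r \<alpha>) (s \<alpha>)" "inverts_mat (s \<alpha>) (r \<alpha>)" for \<alpha>
    using antipode unfolding unitary_antipode_def Let_def by blast
  have rc: "r \<alpha> \<in> carrier_mat (n \<alpha>) (n \<alpha>)" for \<alpha>
    using rs(1)[of \<alpha>] \<rho>_carrier[of \<alpha>] unfolding rs(2)[symmetric, of \<alpha>]
    by (intro carrier_matI) (auto simp: positive_definite_def)
  have sc: "s \<alpha> \<in> carrier_mat (n \<alpha>) (n \<alpha>)" for \<alpha>
    by (rule inverse_carrier[OF rc rs(3,4)])
  have "dual_data \<Delta>G \<epsilon>G SG n U triv (entries \<rho>) (entries \<sigma>) (entries r) (entries s)"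
  proof
    fix \<gamma> i j assume ij: "i < n \<gamma>" "j < n \<gamma>"
    have s\<rho>: "(scalar_mat (\<rho> \<gamma>) :: 'a mat) \<in> carrier_mat (n \<gamma>) (n \<gamma>)"
      and s\<sigma>: "(scalar_mat (\<sigma> \<gamma>) :: 'a mat) \<in> carrier_mat (n \<gamma>) (n \<gamma>)"
      using \<rho>_carrier[of \<gamma>] \<sigma>c[of \<gamma>] by (simp_all add: scalar_mat_def)
    have s\<rho>u: "scalar_mat (\<rho> \<gamma>) * u \<gamma> \<in> carrier_mat (n \<gamma>) (n \<gamma>)"
      using s\<rho> u_carrier by simp
    have s\<rho>_index: "(scalar_mat (\<rho> \<gamma>) :: 'a mat) $$ (a, b) = entries \<rho> \<gamma> a b *\<^sub>C 1"
      and s\<sigma>_index: "(scalar_mat (\<sigma> \<gamma>) :: 'a mat) $$ (a, b) = entries \<sigma> \<gamma> a b *\<^sub>C 1"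
      if "a < n \<gamma>" "b < n \<gamma>" for a b
      using that \<rho>_carrier[of \<gamma>] \<sigma>c[of \<gamma>] by (simp_all add: scalar_mat_def entries_def)
    have "SG (SG (U \<gamma> i j)) = map_mat (\<lambda>a. SG (SG a)) (u \<gamma>) $$ (i, j)"
      using ij u_carrier[of \<gamma>] by simp
    also have "\<dots> = (\<Sum>b<n \<gamma>. (scalar_mat (\<rho> \<gamma>) * u \<gamma>) $$ (i, b) * scalar_mat (\<sigma> \<gamma>) $$ (b, j))"
      unfolding \<sigma>(4) by (rule index_mult_mat_sum[OF s\<rho>u s\<sigma> ij])
    also have "\<dots> = (\<Sum>b<n \<gamma>. \<Sum>a<n \<gamma>. (entries \<rho> \<gamma> i a * entries \<sigma> \<gamma> b j) *\<^sub>C U \<gamma> a b)"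
    proof (rule sum.cong[OF refl])
      fix b assume "b \<in> {..<n \<gamma>}"
      then have b: "b < n \<gamma>" by simp
      have "(scalar_mat (\<rho> \<gamma>) * u \<gamma>) $$ (i, b) = (\<Sum>a<n \<gamma>. entries \<rho> \<gamma> i a *\<^sub>C U \<gamma> a b)"
        unfolding index_mult_mat_sum[OF s\<rho> u_carrier ij(1) b]
        by (intro sum.cong refl) (simp add: s\<rho>_index ij scaleC_mult_left)
      then show "(scalar_mat (\<rho> \<gamma>) * u \<gamma>) $$ (i, b) * scalar_mat (\<sigma> \<gamma>) $$ (b, j)
        = (\<Sum>a<n \<gamma>. (entries \<rho> \<gamma> i a * entries \<sigma> \<gamma> b j) *\<^sub>C U \<gamma> a b)"
        by (simp add: s\<sigma>_index b ij scaleC_mult_right scaleC_sum_right scaleC_scaleC mult.commute)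
    qed
    also have "\<dots> = (\<Sum>a<n \<gamma>. \<Sum>b<n \<gamma>. (entries \<rho> \<gamma> i a * entries \<sigma> \<gamma> b j) *\<^sub>C U \<gamma> a b)"
      by (rule sum.swap)
    finally show "SG (SG (U \<gamma> i j)) = (\<Sum>a<n \<gamma>. \<Sum>b<n \<gamma>. (entries \<rho> \<gamma> i a * entries \<sigma> \<gamma> b j) *\<^sub>C U \<gamma> a b)" .
    show "(\<Sum>k<n \<gamma>. entries \<rho> \<gamma> i k * entries \<sigma> \<gamma> k j) = (if i = j then 1 else 0)"
      unfolding entries_def by (rule index_of_inverse[OF \<rho>_carrier \<sigma>c \<sigma>(1) ij])
    show "(\<Sum>k<n \<gamma>. entries \<sigma> \<gamma> i k * entries \<rho> \<gamma> k j) = (if i = j then 1 else 0)"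
      unfolding entries_def by (rule index_of_inverse[OF \<sigma>c \<rho>_carrier \<sigma>(2) ij])
    show "entries \<rho> \<gamma> i j = (\<Sum>k<n \<gamma>. entries r \<gamma> i k * entries r \<gamma> k j)"
      unfolding entries_def rs(2)[symmetric, of \<gamma>] by (rule index_mult_mat_sum[OF rc rc ij])
    have "cnj (r \<gamma> $$ (i, j)) = mat_adjoint (r \<gamma>) $$ (j, i)"
      by (rule index_mat_adjoint[OF rc ij(2,1), symmetric])
    then show "cnj (entries r \<gamma> i j) = entries r \<gamma> j i"
      using rs(1)[of \<gamma>] by (simp add: positive_definite_def entries_def)
    show "(\<Sum>k<n \<gamma>. entries s \<gamma> i k * entries r \<gamma> k j) = (if i = j then 1 else 0)"
      unfolding entries_def by (rule index_of_inverse[OF sc rc rs(4) ij])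
    show "star (U \<gamma> i j) \<in> pw.pol" using ij by (rule star_U_pol)
  next
    fix \<beta> \<gamma> k l i j assume "k < n \<beta>" "l < n \<beta>" "i < n \<gamma>" "j < n \<gamma>"
    then show "U \<beta> k l * U \<gamma> i j \<in> pw.pol" by (rule mult_U_pol)
  next
    fix \<gamma>
    show "0 < n \<gamma>" by (rule n_pos)
    show "(\<Sum>i<n \<gamma>. entries \<sigma> \<gamma> i i) = (\<Sum>i<n \<gamma>. entries \<rho> \<gamma> i i)"
      using \<sigma>(3)[of \<gamma>] \<rho>_carrier[of \<gamma>] \<sigma>c[of \<gamma>] by (simp add: mat_trace_def entries_def)
  qed
  then show ?thesis by blast
qed

end

section \<open>The comultiplication as the transpose of multiplication\<close>

locale dqg_dual = discrete_quantum_group \<Delta>G \<epsilon>G SG u \<rho> \<Delta> R +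
  dual_data \<Delta>G \<epsilon>G SG "irr_dim u" "\<lambda>\<alpha> i j. u \<alpha> $$ (i, j)" "trivial_index u" "entries \<rho>" sig rt rs
  for \<Delta>G :: "'a::complex_star_algebra \<Rightarrow> ('a, 'a) tensor" and \<epsilon>G SG
    and u :: "'i \<Rightarrow> 'a mat" and \<rho> :: "'i \<Rightarrow> complex mat"
    and \<Delta> :: "'i family \<Rightarrow> ('i \<times> 'i) family" and R :: "'i family \<Rightarrow> 'i family"
    and sig rt rs
begin

lemma comult_linf: "x \<in> linf n \<Longrightarrow> \<Delta> x \<in> linf (sq_dim n)"
  using comult by (auto simp: dual_comult_def Let_def normal_star_hom_def)

lemma index_less:
  assumes "i < a" "k < (b::nat)"
  shows "i * b + k < a * b"
proof -
  have "i * b + k < Suc i * b" using assms by simp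
  also have "\<dots> \<le> a * b" using assms by (intro mult_right_mono) auto
  finally show ?thesis .
qed

text \<open>The entries of \<open>\<Delta> x\<close> are normal functionals of \<open>x\<close>, hence determined by the matrix units.\<close>

lemma comult_index:
  assumes x: "x \<in> linf n" and ij: "i < n \<alpha>" "j < n \<alpha>" and kl: "k < n \<beta>" "l < n \<beta>"
  shows "\<Delta> x (\<alpha>, \<beta>) $$ (i * n \<beta> + k, j * n \<beta> + l) = fn (entries x) (U \<beta> k l * U \<alpha> i j)"
proof -
  define \<phi> where "\<phi> x = \<Delta> x (\<alpha>, \<beta>) $$ (i * n \<beta> + k, j * n \<beta> + l)" for x
  have "normal_functional (sq_dim n) (\<lambda>X. X (\<alpha>, \<beta>) $$ (i * n \<beta> + k, j * n \<beta> + l))"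
    using ij kl by (intro normal_functional_coordinate) (auto simp: sq_dim_def index_less)
  then have normal: "normal_functional n \<phi>"
    using comult unfolding dual_comult_def Let_def normal_star_hom_def \<phi>_def by blast
  define G where "G = {\<gamma>. \<exists>i<n \<gamma>. \<exists>j<n \<gamma>. \<phi> (mat_unit n \<gamma> i j) \<noteq> 0}"
  have leg: "finite G"
    "U \<beta> k l * U \<alpha> i j = (\<Sum>\<gamma>\<in>G. \<Sum>i<n \<gamma>. \<Sum>j<n \<gamma>. \<phi> (mat_unit n \<gamma> i j) *\<^sub>C U \<gamma> i j)"
    using comult ij kl unfolding dual_comult_def has_leg_def Let_def G_def \<phi>_def by blast+
  have "\<phi> x = (\<Sum>\<gamma>\<in>G. \<Sum>i<n \<gamma>. \<Sum>j<n \<gamma>. \<phi> (mat_unit n \<gamma> i j) * x \<gamma> $$ (i, j))"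
    by (rule normal_functional_expand[OF normal x leg(1)]) (auto simp: G_def)
  also have "\<dots> = (\<Sum>\<gamma>\<in>G. \<Sum>i<n \<gamma>. \<Sum>j<n \<gamma>. \<phi> (mat_unit n \<gamma> i j) * fn (entries x) (U \<gamma> i j))"
    by (intro sum.cong refl) (simp add: fn_U, simp add: entries_def)
  also have "\<dots> = fn (entries x) (U \<beta> k l * U \<alpha> i j)"
    unfolding leg(2) by (simp add: clinear_sum[OF fn_linear] clinear_scale_complex[OF fn_linear])
  finally show ?thesis by (simp add: \<phi>_def)
qed

end

subsection \<open>Range projections\<close>

text \<open>Column j is the projection to V of the j-th unit vector. Idempotence follows from the
  listed properties, as the columns lie in V and q fixes V.\<close>

lemma orthogonal_projection_exists:
  fixes V :: "(nat \<Rightarrow> complex) set"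
  assumes V: "(\<lambda>_. 0) \<in> V" "\<And>x y. x \<in> V \<Longrightarrow> y \<in> V \<Longrightarrow> (\<lambda>b. x b + y b) \<in> V"
    "\<And>c x. x \<in> V \<Longrightarrow> (\<lambda>b. c * x b) \<in> V"
  shows "\<exists>q :: nat \<Rightarrow> nat \<Rightarrow> complex. (\<forall>j<m. (\<lambda>i. q i j) \<in> V) \<and>
    (\<forall>v\<in>V. \<forall>i<m. (\<Sum>k<m. q i k * v k) = v i) \<and>
    (\<forall>i<m. \<forall>j<m. cnj (q i j) = q j i)"
proof -
  define \<delta> where "\<delta> j = (\<lambda>i. if i = j then 1 else (0::complex))" for j :: nat
  have "\<exists>E\<in>V. \<forall>x\<in>V. (\<Sum>b<m. (\<delta> j b - E b) * cnj (x b)) = 0" for j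
    by (rule orthogonal_decomposition[OF _ V]) simp_all
  then obtain E where E: "\<And>j. E j \<in> V" "\<And>j x. x \<in> V \<Longrightarrow> (\<Sum>b<m. (\<delta> j b - E j b) * cnj (x b)) = 0"
    by metis
  have adj: "(\<Sum>k<m. cnj (E j k) * v k) = v j" if "v \<in> V" "j < m" for v j
  proof -
    have "(\<Sum>b<m. \<delta> j b * cnj (v b)) = (\<Sum>b<m. E j b * cnj (v b))"
      using E(2)[OF that(1), of j] by (simp add: left_diff_distrib sum_subtractf)
    then have "cnj (v j) = (\<Sum>b<m. E j b * cnj (v b))"
      using that by (simp add: \<delta>_def sum_delta_times)
    then have "cnj (cnj (v j)) = cnj (\<Sum>b<m. E j b * cnj (v b))" by simp
    then show ?thesis by simp
  qed
  have herm: "cnj (E j i) = E i j" if "i < m" "j < m" for i j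
  proof -
    have "E i j = (\<Sum>k<m. cnj (E j k) * E i k)" using adj[OF E(1) that(2)] by simp
    also have "\<dots> = cnj (\<Sum>k<m. cnj (E i k) * E j k)" by (simp add: mult.commute)
    also have "\<dots> = cnj (E j i)" using adj[OF E(1) that(1)] by simp
    finally show ?thesis ..
  qed
  show ?thesis
  proof (rule exI[of _ "\<lambda>i j. E j i"], intro conjI allI impI ballI)
    show "(\<lambda>i. E j i) \<in> V" for j by (rule E(1))
    show "cnj (E j i) = E i j" if "i < m" "j < m" for i j using herm that by simp
    show "(\<Sum>k<m. E k i * v k) = v i" if "v \<in> V" "i < m" for v i
    proof -
      have "(\<Sum>k<m. E k i * v k) = (\<Sum>k<m. cnj (E i k) * v k)"
        using that by (intro sum.cong refl) (simp add: herm)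
      then show ?thesis using adj[OF that] by simp
    qed
  qed
qed

lemma sum_closed:
  fixes V :: "(nat \<Rightarrow> complex) set"
  assumes V: "(\<lambda>_. 0) \<in> V" "\<And>x y. x \<in> V \<Longrightarrow> y \<in> V \<Longrightarrow> (\<lambda>b. x b + y b) \<in> V"
    "\<And>c x. x \<in> V \<Longrightarrow> (\<lambda>b. c * x b) \<in> V"
    and x: "\<And>j. j \<in> J \<Longrightarrow> x j \<in> V"
  shows "(\<lambda>b. \<Sum>j\<in>J. x j b * c j) \<in> V"
  using x
proof (induction J rule: infinite_finite_induct)
  case (insert j J)
  then show ?case using V(2)[OF V(3)[of "x j" "c j"]] by (simp add: mult.commute)
qed (auto simp: V)

lemma fam_mult_entries:
  assumes "x \<in> families n" "y \<in> families n" "i < n \<gamma>" "j < n \<gamma>"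
  shows "entries (x *\<^sub>f y) \<gamma> i j = (\<Sum>k<n \<gamma>. entries x \<gamma> i k * entries y \<gamma> k j)"
  using assms index_mult_mat_sum[of "x \<gamma>" "n \<gamma>" "n \<gamma>" "y \<gamma>" "n \<gamma>" i j]
  by (simp add: entries_def fam_mult_def families_def)

lemma fam_adj_entries:
  assumes "x \<in> families n" "i < n \<gamma>" "j < n \<gamma>"
  shows "entries (fam_adj x) \<gamma> i j = cnj (entries x \<gamma> j i)"
proof -
  have "x \<gamma> \<in> carrier_mat (n \<gamma>) (n \<gamma>)" using assms(1) by (simp add: families_def)
  from index_mat_adjoint[OF this assms(2,3)] show ?thesis by (simp add: entries_def fam_adj_def)
qed

lemma families_eqI:
  assumes "x \<in> families n" "y \<in> families n"
    "\<And>\<gamma> i j. i < n \<gamma> \<Longrightarrow> j < n \<gamma> \<Longrightarrow> entries x \<gamma> i j = entries y \<gamma> i j"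
  shows "x = y"
proof
  fix \<gamma>
  have "x \<gamma> \<in> carrier_mat (n \<gamma>) (n \<gamma>)" "y \<gamma> \<in> carrier_mat (n \<gamma>) (n \<gamma>)"
    using assms by (auto simp: families_def)
  then show "x \<gamma> = y \<gamma>" using assms(3)[of _ \<gamma>] by (intro eq_matI) (auto simp: entries_def)
qed

lemma families_mult: "x \<in> families n \<Longrightarrow> y \<in> families n \<Longrightarrow> x *\<^sub>f y \<in> families n"
  by (auto simp: families_def fam_mult_def intro!: mult_carrier_mat)

lemma families_adj: "x \<in> families n \<Longrightarrow> fam_adj x \<in> families n"
  by (simp add: families_def fam_adj_def carrier_mat_adjoint)

lemma families_linf: "x \<in> linf n \<Longrightarrow> x \<in> families n"
  by (simp add: linf_def)

lemma projection_entries: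
  assumes "projection n p" "i < n \<gamma>" "j < n \<gamma>"
  shows "(\<Sum>k<n \<gamma>. entries p \<gamma> i k * entries p \<gamma> k j) = entries p \<gamma> i j"
    and "cnj (entries p \<gamma> i j) = entries p \<gamma> j i"
  using assms fam_mult_entries[of p n p i \<gamma> j] fam_adj_entries[of p n j \<gamma> i]
  by (auto simp: projection_def families_linf)

text \<open>Boundedness is automatic: for y = p x the squared norm of y is the scalar product of y
  and x, so Cauchy-Schwarz bounds the norm of p by 1.\<close>

lemma projectionI:
  assumes p: "p \<in> families n"
    and cnj: "\<And>\<gamma> i j. i < n \<gamma> \<Longrightarrow> j < n \<gamma> \<Longrightarrow> cnj (entries p \<gamma> i j) = entries p \<gamma> j i"
    and idem: "\<And>\<gamma> i j. i < n \<gamma> \<Longrightarrow> j < n \<gamma> \<Longrightarrow> (\<Sum>k<n \<gamma>. entries p \<gamma> i k * entries p \<gamma> k j) = entries p \<gamma> i j"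
  shows "projection n p"
proof -
  have "op_bounded n 1 (entries p)" unfolding op_bounded_def
  proof (intro allI)
    fix \<gamma> and x :: "nat \<Rightarrow> complex"
    define y where "y l = (\<Sum>q<n \<gamma>. entries p \<gamma> l q * x q)" for l
    have py: "(\<Sum>l<n \<gamma>. entries p \<gamma> q l * y l) = y q" if "q < n \<gamma>" for q
    proof -
      have "(\<Sum>l<n \<gamma>. entries p \<gamma> q l * y l) = (\<Sum>l<n \<gamma>. \<Sum>k<n \<gamma>. entries p \<gamma> q l * entries p \<gamma> l k * x k)"
        by (simp add: y_def sum_distrib_left mult.assoc)
      also have "\<dots> = (\<Sum>k<n \<gamma>. (\<Sum>l<n \<gamma>. entries p \<gamma> q l * entries p \<gamma> l k) * x k)"
        by (subst sum.swap) (simp add: sum_distrib_right)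
      finally show ?thesis using that by (simp add: idem y_def)
    qed
    define Y where "Y = (\<Sum>l<n \<gamma>. (cmod (y l))\<^sup>2)"
    define X where "X = (\<Sum>l<n \<gamma>. (cmod (x l))\<^sup>2)"
    have Y: "0 \<le> Y" by (simp add: Y_def sum_nonneg)
    have "complex_of_real Y = (\<Sum>l<n \<gamma>. y l * cnj (y l))"
      unfolding Y_def of_real_sum complex_norm_square ..
    also have "\<dots> = (\<Sum>l<n \<gamma>. \<Sum>q<n \<gamma>. entries p \<gamma> q l * y l * cnj (x q))"
      by (intro sum.cong refl) (simp add: y_def[of l for l] cnj sum_distrib_left mult_ac)
    also have "\<dots> = (\<Sum>q<n \<gamma>. (\<Sum>l<n \<gamma>. entries p \<gamma> q l * y l) * cnj (x q))"
      by (subst sum.swap) (simp add: sum_distrib_right)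
    also have "\<dots> = (\<Sum>q<n \<gamma>. y q * cnj (x q))" by (simp add: py)
    finally have "complex_of_real Y = (\<Sum>q<n \<gamma>. y q * cnj (x q))" .
    then have "(cmod (complex_of_real Y))\<^sup>2 \<le> Y * X"
      using cauchy_schwarz_sum[of y "\<lambda>q. cnj (x q)" "n \<gamma>"] by (simp add: Y_def X_def)
    then have "Y * Y \<le> Y * X" by (simp add: power2_eq_square flip: of_real_mult)
    then have "Y \<le> X" using Y by (cases "Y = 0") (auto simp: X_def sum_nonneg)
    then show "(\<Sum>l<n \<gamma>. (cmod (\<Sum>q<n \<gamma>. entries p \<gamma> l q * x q))\<^sup>2) \<le> 1 * (\<Sum>q<n \<gamma>. (cmod (x q))\<^sup>2)"
      by (simp add: Y_def X_def y_def)
  qed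
  then have "p \<in> linf n" using p by (auto simp: linf_iff intro: exI[of _ 1])
  moreover have "p *\<^sub>f p = p"
    by (rule families_eqI[OF families_mult[OF p p] p]) (simp add: fam_mult_entries[OF p p] idem)
  moreover have "fam_adj p = p"
    by (rule families_eqI[OF families_adj[OF p] p]) (simp add: fam_adj_entries[OF p] cnj)
  ultimately show ?thesis by (simp add: projection_def)
qed

text \<open>Ranges are handled as sets of functions, so that they match the subspaces of
  \<open>orthogonal_decomposition\<close>.\<close>

definition fn_range :: "nat \<Rightarrow> (nat \<Rightarrow> nat \<Rightarrow> complex) \<Rightarrow> (nat \<Rightarrow> complex) set" where
  "fn_range m a = {v. \<exists>w. \<forall>i<m. v i = (\<Sum>j<m. a i j * w j)}"

lemma fn_range_subspace:
  "(\<lambda>_. 0) \<in> fn_range m a"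
  "x \<in> fn_range m a \<Longrightarrow> y \<in> fn_range m a \<Longrightarrow> (\<lambda>b. x b + y b) \<in> fn_range m a"
  "x \<in> fn_range m a \<Longrightarrow> (\<lambda>b. c * x b) \<in> fn_range m a"
proof -
  show "(\<lambda>_. 0) \<in> fn_range m a" unfolding fn_range_def by (auto intro: exI[of _ "\<lambda>_. 0"])
  show "(\<lambda>b. x b + y b) \<in> fn_range m a" if "x \<in> fn_range m a" "y \<in> fn_range m a"
  proof -
    from that obtain v w where "\<forall>i<m. x i = (\<Sum>j<m. a i j * v j)" "\<forall>i<m. y i = (\<Sum>j<m. a i j * w j)"
      by (auto simp: fn_range_def)
    then show ?thesis unfolding fn_range_def
      by (auto intro!: exI[of _ "\<lambda>j. v j + w j"] simp: distrib_left sum.distrib)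
  qed
  show "(\<lambda>b. c * x b) \<in> fn_range m a" if "x \<in> fn_range m a"
  proof -
    from that obtain v where "\<forall>i<m. x i = (\<Sum>j<m. a i j * v j)" by (auto simp: fn_range_def)
    then show ?thesis unfolding fn_range_def
      by (auto intro!: exI[of _ "\<lambda>j. c * v j"] simp: sum_distrib_left mult.left_commute)
  qed
qed

lemma mat_range_iff:
  assumes "A \<in> carrier_mat m m"
  shows "v \<in> mat_range A \<longleftrightarrow> v \<in> carrier_vec m \<and> (\<lambda>i. v $ i) \<in> fn_range m (\<lambda>i j. A $$ (i, j))"
proof
  assume "v \<in> mat_range A"
  then obtain w where w: "v = A *\<^sub>v w" "w \<in> carrier_vec m" using assms by (auto simp: mat_range_def)
  then show "v \<in> carrier_vec m \<and> (\<lambda>i. v $ i) \<in> fn_range m (\<lambda>i j. A $$ (i, j))"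
    using assms index_mult_mat_vec_sum[OF assms w(2)]
    by (auto simp: fn_range_def simp del: index_mult_mat_vec intro!: exI[of _ "\<lambda>j. w $ j"])
next
  assume *: "v \<in> carrier_vec m \<and> (\<lambda>i. v $ i) \<in> fn_range m (\<lambda>i j. A $$ (i, j))"
  then obtain w where w: "\<forall>i<m. v $ i = (\<Sum>j<m. A $$ (i, j) * w j)" by (auto simp: fn_range_def)
  have "v = A *\<^sub>v vec m w"
  proof (rule eq_vecI)
    fix i assume "i < dim_vec (A *\<^sub>v vec m w)"
    then have i: "i < m" using assms by simp
    have "(A *\<^sub>v vec m w) $ i = (\<Sum>k<m. A $$ (i, k) * vec m w $ k)"
      by (rule index_mult_mat_vec_sum[OF assms _ i]) simp
    then show "v $ i = (A *\<^sub>v vec m w) $ i" using w i by simp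
  qed (use * assms in auto)
  then show "v \<in> mat_range A" using assms by (auto simp: mat_range_def)
qed

lemma fn_range_cong:
  assumes "v \<in> fn_range m a" "\<And>i. i < m \<Longrightarrow> v i = w i"
  shows "w \<in> fn_range m a"
  using assms unfolding fn_range_def by auto

lemma fn_range_subset:
  assumes A: "A \<in> carrier_mat m m" and B: "B \<in> carrier_mat m m" and sub: "mat_range A \<subseteq> mat_range B"
  shows "fn_range m (\<lambda>i j. A $$ (i, j)) \<subseteq> fn_range m (\<lambda>i j. B $$ (i, j))"
proof
  fix v assume v: "v \<in> fn_range m (\<lambda>i j. A $$ (i, j))"
  have "(\<lambda>i. vec m v $ i) \<in> fn_range m (\<lambda>i j. A $$ (i, j))"
    by (rule fn_range_cong[OF v]) simp
  then have "vec m v \<in> mat_range A" by (simp add: mat_range_iff[OF A])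
  then have "(\<lambda>i. vec m v $ i) \<in> fn_range m (\<lambda>i j. B $$ (i, j))"
    using sub by (auto simp: mat_range_iff[OF B])
  then show "v \<in> fn_range m (\<lambda>i j. B $$ (i, j))" by (rule fn_range_cong) simp
qed

lemma column_fn_range:
  assumes "j < m"
  shows "(\<lambda>i. a i j) \<in> fn_range m a"
  using assms unfolding fn_range_def
  by (auto intro!: exI[of _ "\<lambda>k. if k = j then 1 else 0"] simp: sum_delta_times)

lemma projection_fixes_range:
  assumes p: "projection n p" and v: "v \<in> fn_range (n \<gamma>) (entries p \<gamma>)" and i: "i < n \<gamma>"
  shows "(\<Sum>k<n \<gamma>. entries p \<gamma> i k * v k) = v i"
proof -
  obtain w where w: "\<And>i. i < n \<gamma> \<Longrightarrow> v i = (\<Sum>j<n \<gamma>. entries p \<gamma> i j * w j)"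
    using v by (auto simp: fn_range_def)
  have "(\<Sum>k<n \<gamma>. entries p \<gamma> i k * v k) = (\<Sum>k<n \<gamma>. \<Sum>j<n \<gamma>. entries p \<gamma> i k * entries p \<gamma> k j * w j)"
    by (simp add: w sum_distrib_left mult.assoc)
  also have "\<dots> = (\<Sum>j<n \<gamma>. (\<Sum>k<n \<gamma>. entries p \<gamma> i k * entries p \<gamma> k j) * w j)"
    by (subst sum.swap) (simp add: sum_distrib_right)
  also have "\<dots> = v i" using i by (simp add: projection_entries[OF p] w)
  finally show ?thesis .
qed

text \<open>The projection is built block by block from the range of z. For uniqueness, two
  projections with the same range fix each other's columns, so each of the two products equals its
  right factor, and passing to adjoints identifies them.\<close>

lemma range_projection:
  assumes z: "z \<in> families n"
  shows "projection n (range_projection n z)"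
    and "fn_range (n \<gamma>) (entries (range_projection n z) \<gamma>) = fn_range (n \<gamma>) (entries z \<gamma>)"
proof -
  have zc: "z \<gamma> \<in> carrier_mat (n \<gamma>) (n \<gamma>)" for \<gamma> using z by (simp add: families_def)
  define good where "good \<gamma> q \<longleftrightarrow> (\<forall>j<n \<gamma>. (\<lambda>i. q i j) \<in> fn_range (n \<gamma>) (entries z \<gamma>)) \<and>
    (\<forall>v\<in>fn_range (n \<gamma>) (entries z \<gamma>). \<forall>i<n \<gamma>. (\<Sum>k<n \<gamma>. q i k * v k) = v i) \<and>
    (\<forall>i<n \<gamma>. \<forall>j<n \<gamma>. cnj (q i j) = q j i)" for \<gamma> and q :: "nat \<Rightarrow> nat \<Rightarrow> complex"
  have "\<exists>q. good \<gamma> q" for \<gamma>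
    unfolding good_def by (rule orthogonal_projection_exists) (rule fn_range_subspace; assumption)+
  then obtain q where "\<And>\<gamma>. good \<gamma> (q \<gamma>)" by metis
  then have q: "\<And>\<gamma> j. j < n \<gamma> \<Longrightarrow> (\<lambda>i. q \<gamma> i j) \<in> fn_range (n \<gamma>) (entries z \<gamma>)"
    "\<And>\<gamma> v i. v \<in> fn_range (n \<gamma>) (entries z \<gamma>) \<Longrightarrow> i < n \<gamma> \<Longrightarrow> (\<Sum>k<n \<gamma>. q \<gamma> i k * v k) = v i"
    "\<And>\<gamma> i j. i < n \<gamma> \<Longrightarrow> j < n \<gamma> \<Longrightarrow> cnj (q \<gamma> i j) = q \<gamma> j i"
    by (simp_all add: good_def)
  define p where "p = (\<lambda>\<gamma>. mat (n \<gamma>) (n \<gamma>) (\<lambda>(i, j). q \<gamma> i j))"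
  have pf: "p \<in> families n" by (simp add: p_def families_def)
  then have pc: "p \<gamma> \<in> carrier_mat (n \<gamma>) (n \<gamma>)" for \<gamma> by (simp add: families_def)
  have pe: "entries p \<gamma> i j = q \<gamma> i j" if "i < n \<gamma>" "j < n \<gamma>" for \<gamma> i j
    using that by (simp add: p_def entries_def)
  have proj: "projection n p"
    by (rule projectionI[OF pf]) (simp_all add: pe q(3) q(2)[OF q(1)])
  have range_eq: "fn_range (n \<gamma>) (entries p \<gamma>) = fn_range (n \<gamma>) (entries z \<gamma>)" for \<gamma>
  proof (intro equalityI subsetI)
    fix v assume "v \<in> fn_range (n \<gamma>) (entries p \<gamma>)"
    then obtain w where w: "\<And>i. i < n \<gamma> \<Longrightarrow> v i = (\<Sum>j<n \<gamma>. q \<gamma> i j * w j)"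
      by (auto simp: fn_range_def pe)
    have "(\<lambda>i. \<Sum>j<n \<gamma>. q \<gamma> i j * w j) \<in> fn_range (n \<gamma>) (entries z \<gamma>)"
      by (rule sum_closed[where x = "\<lambda>j i. q \<gamma> i j"]) (use q(1) in \<open>auto intro: fn_range_subspace\<close>)
    then show "v \<in> fn_range (n \<gamma>) (entries z \<gamma>)" by (rule fn_range_cong) (simp add: w)
  next
    fix v assume v: "v \<in> fn_range (n \<gamma>) (entries z \<gamma>)"
    then show "v \<in> fn_range (n \<gamma>) (entries p \<gamma>)"
      unfolding fn_range_def using q(2)[OF v] by (auto simp: pe intro!: exI[of _ v])
  qed
  have mat_range_eq: "mat_range (p' \<gamma>) = mat_range (z \<gamma>) \<longleftrightarrow> fn_range (n \<gamma>) (entries p' \<gamma>) = fn_range (n \<gamma>) (entries z \<gamma>)"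
    if "p' \<gamma> \<in> carrier_mat (n \<gamma>) (n \<gamma>)" for p' \<gamma>
    using fn_range_subset[OF that zc] fn_range_subset[OF zc that] mat_range_iff[OF that] mat_range_iff[OF zc]
    by (auto simp: entries_def)
  have uniq: "p1 = p2" if "projection n p1" "projection n p2"
    and eq: "\<And>\<gamma>. fn_range (n \<gamma>) (entries p1 \<gamma>) = fn_range (n \<gamma>) (entries p2 \<gamma>)" for p1 p2
  proof (rule families_eqI)
    show "p1 \<in> families n" "p2 \<in> families n" using that by (auto simp: projection_def families_linf)
    fix \<gamma> i j assume ij: "i < n \<gamma>" "j < n \<gamma>"
    have a: "(\<Sum>k<n \<gamma>. entries p2 \<gamma> i k * entries p1 \<gamma> k j) = entries p1 \<gamma> i j"
      using projection_fixes_range[OF that(2) _ ij(1), of "\<lambda>i. entries p1 \<gamma> i j"] column_fn_range[OF ij(2), of "entries p1 \<gamma>"] eq by simp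
    have b: "(\<Sum>k<n \<gamma>. entries p1 \<gamma> j k * entries p2 \<gamma> k i) = entries p2 \<gamma> j i"
      using projection_fixes_range[OF that(1) _ ij(2), of "\<lambda>j. entries p2 \<gamma> j i"] column_fn_range[OF ij(1), of "entries p2 \<gamma>"] eq by simp
    have "cnj (\<Sum>k<n \<gamma>. entries p1 \<gamma> j k * entries p2 \<gamma> k i) = (\<Sum>k<n \<gamma>. entries p2 \<gamma> i k * entries p1 \<gamma> k j)"
      using ij by (simp add: projection_entries(2)[OF that(1)] projection_entries(2)[OF that(2)] mult.commute)
    then show "entries p1 \<gamma> i j = entries p2 \<gamma> i j"
      using a b ij by (simp add: projection_entries(2)[OF that(2)])
  qed
  have "\<exists>!p. projection n p \<and> (\<forall>k. mat_range (p k) = mat_range (z k))"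
  proof (rule ex1I[of _ p])
    show "projection n p \<and> (\<forall>k. mat_range (p k) = mat_range (z k))"
      using proj range_eq mat_range_eq pc by blast
    fix p' assume p': "projection n p' \<and> (\<forall>k. mat_range (p' k) = mat_range (z k))"
    then have "p' \<gamma> \<in> carrier_mat (n \<gamma>) (n \<gamma>)" for \<gamma> by (simp add: projection_def linf_def families_def)
    then show "p' = p" using p' proj range_eq mat_range_eq by (intro uniq) auto
  qed
  from theI'[OF this, folded range_projection_def]
  have rp: "projection n (range_projection n z)" "\<And>k. mat_range (range_projection n z k) = mat_range (z k)" by auto
  then have "range_projection n z \<gamma> \<in> carrier_mat (n \<gamma>) (n \<gamma>)" for \<gamma> by (simp add: projection_def linf_def families_def)
  then show "projection n (range_projection n z)"
    "fn_range (n \<gamma>) (entries (range_projection n z) \<gamma>) = fn_range (n \<gamma>) (entries z \<gamma>)"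
    using rp mat_range_eq by auto
qed

section \<open>Convolution\<close>

context dqg_dual
begin

definition EF :: "'i family \<Rightarrow> 'a" where
  "EF z = FF (supp n z) (entries z)"

lemma entries_outside: "\<gamma> \<notin> supp n z \<Longrightarrow> i < n \<gamma> \<Longrightarrow> j < n \<gamma> \<Longrightarrow> entries z \<gamma> i j = 0"
  by (simp add: supp_def entries_def)

lemma EF_superset: "finite F \<Longrightarrow> supp n z \<subseteq> F \<Longrightarrow> EF z = FF F (entries z)"
  unfolding EF_def FF_def
  by (intro sum.mono_neutral_left) (auto simp: entries_outside intro!: sum.neutral)

lemma pol_EF [simp]: "EF z \<in> pw.pol"
  unfolding EF_def by (rule pol_FF)

lemma d_trace: "mat_trace (\<rho> \<gamma>) = d \<gamma>"
  using \<rho>_carrier[of \<gamma>] by (simp add: mat_trace_def d_def) (simp add: entries_def)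

lemma dim_\<rho>: "dim_row (\<rho> \<gamma>) = n \<gamma>"
  using \<rho>_carrier[of \<gamma>] by simp

lemma haar_eq:
  assumes x: "x \<in> families n" and F: "finite F" "supp n x \<subseteq> F"
  shows "haar \<rho> x = haar_FF F (entries x)"
proof -
  have "mat_trace (\<rho> \<gamma> * x \<gamma>) = (\<Sum>s<n \<gamma>. \<Sum>j<n \<gamma>. entries x \<gamma> j s * entries \<rho> \<gamma> s j)" for \<gamma>
  proof -
    have xc: "x \<gamma> \<in> carrier_mat (n \<gamma>) (n \<gamma>)" using x by (simp add: families_def)
    have "(\<rho> \<gamma> * x \<gamma>) $$ (s, s) = (\<Sum>j<n \<gamma>. entries x \<gamma> j s * entries \<rho> \<gamma> s j)" if "s < n \<gamma>" for s
      unfolding index_mult_mat_sum[OF \<rho>_carrier xc that that] by (simp add: entries_def mult.commute)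
    then show ?thesis by (simp add: mat_trace_def dim_\<rho>)
  qed
  then have "haar \<rho> x = haar_FF (supp n x) (entries x)"
    by (simp add: haar_def haar_FF_def dim_\<rho> d_trace)
  also have "\<dots> = haar_FF F (entries x)"
    unfolding haar_FF_def using F
    by (intro sum.mono_neutral_left) (auto simp: entries_outside intro!: sum.neutral)
  finally show ?thesis .
qed

lemma fn_V: "s < n \<gamma> \<Longrightarrow> j < n \<gamma> \<Longrightarrow> fn y (V \<gamma> s j) = (\<Sum>i<n \<gamma>. entries \<rho> \<gamma> s i * y \<gamma> i j)"
  by (simp add: V_def clinear_sum[OF fn_linear] clinear_scale_complex[OF fn_linear] fn_U)

lemma supp_mult: "x \<in> families n \<Longrightarrow> supp n (x *\<^sub>f y) \<subseteq> supp n y"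
proof
  fix \<gamma> assume x: "x \<in> families n" and g: "\<gamma> \<in> supp n (x *\<^sub>f y)"
  show "\<gamma> \<in> supp n y"
  proof (rule ccontr)
    assume "\<gamma> \<notin> supp n y"
    then have "y \<gamma> = 0\<^sub>m (n \<gamma>) (n \<gamma>)" by (simp add: supp_def)
    moreover have "x \<gamma> \<in> carrier_mat (n \<gamma>) (n \<gamma>)" using x by (simp add: families_def)
    ultimately show False using g by (simp add: supp_def fam_mult_def)
  qed
qed

text \<open>The characteristic property of F: pairing y with F(z) integrates y z against the Haar
  weight. The \<open>rho\<close> of the weight is the one contained in \<open>V\<close>.\<close>

lemma haar_mult:
  assumes y: "y \<in> families n" and z: "z \<in> c00 n"
  shows "haar \<rho> (y *\<^sub>f z) = fn (entries y) (EF z)"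
proof -
  have zf: "z \<in> families n" and F: "finite (supp n z)" using z by (auto simp: c00_def)
  have "haar \<rho> (y *\<^sub>f z) = haar_FF (supp n z) (entries (y *\<^sub>f z))"
    by (rule haar_eq[OF families_mult[OF y zf] F supp_mult[OF y]])
  also have "\<dots> = fn (entries y) (EF z)"
    unfolding EF_def clinear_FF[OF fn_linear] haar_FF_def
  proof (rule sum.cong[OF refl], rule arg_cong2[of _ _ _ _ "(*)", OF refl])
    fix \<gamma>
    have "(\<Sum>s<n \<gamma>. \<Sum>j<n \<gamma>. entries (y *\<^sub>f z) \<gamma> j s * entries \<rho> \<gamma> s j)
      = (\<Sum>s<n \<gamma>. \<Sum>j<n \<gamma>. \<Sum>k<n \<gamma>. entries z \<gamma> k s * (entries \<rho> \<gamma> s j * entries y \<gamma> j k))"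
      by (intro sum.cong refl) (simp add: fam_mult_entries[OF y zf] sum_distrib_left sum_distrib_right mult_ac)
    also have "\<dots> = (\<Sum>s<n \<gamma>. \<Sum>k<n \<gamma>. \<Sum>j<n \<gamma>. entries z \<gamma> k s * (entries \<rho> \<gamma> s j * entries y \<gamma> j k))"
      by (rule sum.cong[OF refl], rule sum.swap)
    also have "\<dots> = (\<Sum>s<n \<gamma>. \<Sum>k<n \<gamma>. entries z \<gamma> k s * fn (entries y) (V \<gamma> s k))"
      by (intro sum.cong refl) (simp add: fn_V sum_distrib_left)
    finally show "(\<Sum>s<n \<gamma>. \<Sum>j<n \<gamma>. entries (y *\<^sub>f z) \<gamma> j s * entries \<rho> \<gamma> s j)
      = (\<Sum>s<n \<gamma>. \<Sum>j<n \<gamma>. entries z \<gamma> j s * fn (entries y) (V \<gamma> s j))" .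
  qed
  finally show ?thesis .
qed

lemma kron_index:
  assumes "A \<in> carrier_mat a a'" "B \<in> carrier_mat b b'" "i < a" "j < a'" "k < b" "l < b'"
  shows "kron A B $$ (i * b + k, j * b' + l) = A $$ (i, j) * B $$ (k, l)"
  using assms index_less[of i a k b] index_less[of j a' l b'] by (simp add: kron_def)

lemma kron_carrier: "A \<in> carrier_mat a a' \<Longrightarrow> B \<in> carrier_mat b b' \<Longrightarrow> kron A B \<in> carrier_mat (a * b) (a' * b')"
  by (simp add: kron_def)

lemma trace_kron:
  assumes D: "D \<in> carrier_mat (n \<alpha> * n \<beta>) (n \<alpha> * n \<beta>)"
    and x: "x \<in> carrier_mat (n \<alpha>) (n \<alpha>)" and y: "y \<in> carrier_mat (n \<beta>) (n \<beta>)"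
  shows "mat_trace (kron (\<rho> \<alpha>) (\<rho> \<beta>) * (D * kron x y)) =
    (\<Sum>i<n \<alpha>. \<Sum>k<n \<beta>. \<Sum>i'<n \<alpha>. \<Sum>k'<n \<beta>. \<Sum>j<n \<alpha>. \<Sum>l<n \<beta>.
      \<rho> \<alpha> $$ (i, i') * \<rho> \<beta> $$ (k, k') * D $$ (i' * n \<beta> + k', j * n \<beta> + l) * (x $$ (j, i) * y $$ (l, k)))"
proof -
  define m where "m = n \<alpha> * n \<beta>"
  have K: "kron (\<rho> \<alpha>) (\<rho> \<beta>) \<in> carrier_mat m m" "kron x y \<in> carrier_mat m m"
    unfolding m_def by (intro kron_carrier \<rho>_carrier x y)+
  have D': "D \<in> carrier_mat m m" using D by (simp add: m_def)
  have DQ: "D * kron x y \<in> carrier_mat m m" using D' K by simp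
  have "mat_trace (kron (\<rho> \<alpha>) (\<rho> \<beta>) * (D * kron x y))
    = (\<Sum>r<m. (kron (\<rho> \<alpha>) (\<rho> \<beta>) * (D * kron x y)) $$ (r, r))"
    using K by (simp add: mat_trace_def)
  also have "\<dots> = (\<Sum>r<m. \<Sum>s<m. \<Sum>t<m. kron (\<rho> \<alpha>) (\<rho> \<beta>) $$ (r, s) * D $$ (s, t) * kron x y $$ (t, r))"
  proof (rule sum.cong[OF refl])
    fix r assume "r \<in> {..<m}"
    then have r: "r < m" by simp
    have "(kron (\<rho> \<alpha>) (\<rho> \<beta>) * (D * kron x y)) $$ (r, r) = (\<Sum>s<m. kron (\<rho> \<alpha>) (\<rho> \<beta>) $$ (r, s) * (D * kron x y) $$ (s, r))"
      by (rule index_mult_mat_sum[OF K(1) DQ r r])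
    also have "\<dots> = (\<Sum>s<m. \<Sum>t<m. kron (\<rho> \<alpha>) (\<rho> \<beta>) $$ (r, s) * D $$ (s, t) * kron x y $$ (t, r))"
    proof (rule sum.cong[OF refl])
      fix s assume "s \<in> {..<m}"
      then have s: "s < m" by simp
      show "kron (\<rho> \<alpha>) (\<rho> \<beta>) $$ (r, s) * (D * kron x y) $$ (s, r) = (\<Sum>t<m. kron (\<rho> \<alpha>) (\<rho> \<beta>) $$ (r, s) * D $$ (s, t) * kron x y $$ (t, r))"
        unfolding index_mult_mat_sum[OF D' K(2) s r] by (simp add: sum_distrib_left mult.assoc)
    qed
    finally show "(kron (\<rho> \<alpha>) (\<rho> \<beta>) * (D * kron x y)) $$ (r, r)
      = (\<Sum>s<m. \<Sum>t<m. kron (\<rho> \<alpha>) (\<rho> \<beta>) $$ (r, s) * D $$ (s, t) * kron x y $$ (t, r))" .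
  qed
  also have "\<dots> = (\<Sum>i<n \<alpha>. \<Sum>k<n \<beta>. \<Sum>i'<n \<alpha>. \<Sum>k'<n \<beta>. \<Sum>j<n \<alpha>. \<Sum>l<n \<beta>.
      kron (\<rho> \<alpha>) (\<rho> \<beta>) $$ (i * n \<beta> + k, i' * n \<beta> + k') * D $$ (i' * n \<beta> + k', j * n \<beta> + l)
      * kron x y $$ (j * n \<beta> + l, i * n \<beta> + k))"
    unfolding m_def sum_mult_split ..
  finally show ?thesis
    by (simp add: kron_index[OF \<rho>_carrier \<rho>_carrier] kron_index[OF x y])
qed

lemma sum6_reorder:
  fixes f :: "nat \<Rightarrow> nat \<Rightarrow> nat \<Rightarrow> nat \<Rightarrow> nat \<Rightarrow> nat \<Rightarrow> complex"
  shows "(\<Sum>i\<in>A. \<Sum>k\<in>B. \<Sum>i'\<in>A. \<Sum>k'\<in>B. \<Sum>j\<in>A. \<Sum>l\<in>B. f i k i' k' j l)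
    = (\<Sum>k\<in>B. \<Sum>l\<in>B. \<Sum>i\<in>A. \<Sum>j\<in>A. \<Sum>k'\<in>B. \<Sum>i'\<in>A. f i k i' k' j l)"
proof -
  have "(\<Sum>i'\<in>A. \<Sum>k'\<in>B. \<Sum>j\<in>A. \<Sum>l\<in>B. g i' k' j l) = (\<Sum>l\<in>B. \<Sum>j\<in>A. \<Sum>k'\<in>B. \<Sum>i'\<in>A. g i' k' j l)"
    for g :: "nat \<Rightarrow> nat \<Rightarrow> nat \<Rightarrow> nat \<Rightarrow> complex"
  proof -
    have "(\<Sum>i'\<in>A. \<Sum>k'\<in>B. \<Sum>j\<in>A. \<Sum>l\<in>B. g i' k' j l) = (\<Sum>i'\<in>A. \<Sum>l\<in>B. \<Sum>j\<in>A. \<Sum>k'\<in>B. g i' k' j l)"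
      by (rule sum.cong[OF refl], rule sum_swap3)
    also have "\<dots> = (\<Sum>l\<in>B. \<Sum>i'\<in>A. \<Sum>j\<in>A. \<Sum>k'\<in>B. g i' k' j l)" by (rule sum.swap)
    also have "\<dots> = (\<Sum>l\<in>B. \<Sum>j\<in>A. \<Sum>k'\<in>B. \<Sum>i'\<in>A. g i' k' j l)"
      by (rule sum.cong[OF refl], subst sum.swap, rule sum.cong[OF refl], rule sum.swap)
    finally show ?thesis .
  qed
  then have "(\<Sum>i\<in>A. \<Sum>k\<in>B. \<Sum>i'\<in>A. \<Sum>k'\<in>B. \<Sum>j\<in>A. \<Sum>l\<in>B. f i k i' k' j l)
    = (\<Sum>i\<in>A. \<Sum>k\<in>B. \<Sum>l\<in>B. \<Sum>j\<in>A. \<Sum>k'\<in>B. \<Sum>i'\<in>A. f i k i' k' j l)" by simp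
  also have "\<dots> = (\<Sum>k\<in>B. \<Sum>i\<in>A. \<Sum>l\<in>B. \<Sum>j\<in>A. \<Sum>k'\<in>B. \<Sum>i'\<in>A. f i k i' k' j l)" by (rule sum.swap)
  also have "\<dots> = (\<Sum>k\<in>B. \<Sum>l\<in>B. \<Sum>i\<in>A. \<Sum>j\<in>A. \<Sum>k'\<in>B. \<Sum>i'\<in>A. f i k i' k' j l)"
    by (rule sum.cong[OF refl], rule sum.swap)
  finally show ?thesis .
qed

text \<open>By \<open>comult_index\<close> the entries of \<Delta> y are values of y on products of
  coefficients, and \<open>rho\<close> in both legs turns these into products of elements
  \<open>V\<close>. The coefficient of the second leg comes first, as in W_23 W_13, so F(x) stands
  to the left of F(P).\<close>

lemma haar_sq_comult:
  assumes y: "y \<in> linf n" and P: "P \<in> c00 n" and x: "x \<in> c00 n"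
  shows "haar_sq \<rho> (\<Delta> y *\<^sub>f (P \<otimes>\<^sub>f x)) = fn (entries y) (EF x * EF P)"
proof -
  define A B where "A = supp n P" and "B = supp n x"
  have fin: "finite A" "finite B" and Pf: "P \<in> families n" and xf: "x \<in> families n"
    using P x by (auto simp: A_def B_def c00_def)
  have Pc: "P \<alpha> \<in> carrier_mat (n \<alpha>) (n \<alpha>)" and xc: "x \<alpha> \<in> carrier_mat (n \<alpha>) (n \<alpha>)" for \<alpha>
    using Pf xf by (auto simp: families_def)
  have \<Delta>c: "\<Delta> y (\<alpha>, \<beta>) \<in> carrier_mat (n \<alpha> * n \<beta>) (n \<alpha> * n \<beta>)" for \<alpha> \<beta>
    using families_linf[OF comult_linf[OF y]] by (auto simp: families_def sq_dim_def)
  define X where "X = \<Delta> y *\<^sub>f (P \<otimes>\<^sub>f x)"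
  have X: "X (\<alpha>, \<beta>) = \<Delta> y (\<alpha>, \<beta>) * kron (P \<alpha>) (x \<beta>)" for \<alpha> \<beta>
    by (simp add: X_def fam_mult_def fam_tensor_def)
  have zero: "X (\<alpha>, \<beta>) = 0\<^sub>m (n \<alpha> * n \<beta>) (n \<alpha> * n \<beta>)" if "\<alpha> \<notin> A \<or> \<beta> \<notin> B" for \<alpha> \<beta>
  proof -
    have "kron (P \<alpha>) (x \<beta>) = 0\<^sub>m (n \<alpha> * n \<beta>) (n \<alpha> * n \<beta>)"
    proof (rule eq_matI)
      fix i j assume "i < dim_row (0\<^sub>m (n \<alpha> * n \<beta>) (n \<alpha> * n \<beta>) :: complex mat)"
        "j < dim_col (0\<^sub>m (n \<alpha> * n \<beta>) (n \<alpha> * n \<beta>) :: complex mat)"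
      then have ij: "i < n \<alpha> * n \<beta>" "j < n \<alpha> * n \<beta>" by auto
      then have "i div n \<beta> < n \<alpha>" "j div n \<beta> < n \<alpha>" "i mod n \<beta> < n \<beta>" "j mod n \<beta> < n \<beta>"
        using n_pos[of \<beta>] by (auto simp: less_mult_imp_div_less)
      then show "kron (P \<alpha>) (x \<beta>) $$ (i, j) = 0\<^sub>m (n \<alpha> * n \<beta>) (n \<alpha> * n \<beta>) $$ (i, j)"
        using that ij Pc[of \<alpha>] xc[of \<beta>] by (auto simp: kron_def A_def B_def supp_def)
    qed (use Pc[of \<alpha>] xc[of \<beta>] in \<open>auto simp: kron_def\<close>)
    then show ?thesis using \<Delta>c[of \<alpha> \<beta>] by (simp add: X)
  qed
  have term_eq: "mat_trace (kron (\<rho> \<alpha>) (\<rho> \<beta>) * X (\<alpha>, \<beta>))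
    = (\<Sum>k<n \<beta>. \<Sum>l<n \<beta>. \<Sum>i<n \<alpha>. \<Sum>j<n \<alpha>. entries x \<beta> l k * entries P \<alpha> j i * fn (entries y) (V \<beta> k l * V \<alpha> i j))"
    for \<alpha> \<beta>
  proof -
    have fnV: "fn (entries y) (V \<beta> k l * V \<alpha> i j)
      = (\<Sum>k'<n \<beta>. \<Sum>i'<n \<alpha>. \<rho> \<beta> $$ (k, k') * \<rho> \<alpha> $$ (i, i') * fn (entries y) (U \<beta> k' l * U \<alpha> i' j))" for i j k l
      by (simp add: V_def sum_product scaleC_mult_left scaleC_mult_right clinear_sum[OF fn_linear]
          clinear_scale_complex[OF fn_linear]) (simp add: entries_def mult_ac)
    have "mat_trace (kron (\<rho> \<alpha>) (\<rho> \<beta>) * X (\<alpha>, \<beta>))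
      = (\<Sum>i<n \<alpha>. \<Sum>k<n \<beta>. \<Sum>i'<n \<alpha>. \<Sum>k'<n \<beta>. \<Sum>j<n \<alpha>. \<Sum>l<n \<beta>.
        \<rho> \<alpha> $$ (i, i') * \<rho> \<beta> $$ (k, k') * fn (entries y) (U \<beta> k' l * U \<alpha> i' j) * (P \<alpha> $$ (j, i) * x \<beta> $$ (l, k)))"
      unfolding X trace_kron[OF \<Delta>c Pc xc] by (intro sum.cong refl) (simp add: comult_index[OF y])
    also have "\<dots> = (\<Sum>k<n \<beta>. \<Sum>l<n \<beta>. \<Sum>i<n \<alpha>. \<Sum>j<n \<alpha>. \<Sum>k'<n \<beta>. \<Sum>i'<n \<alpha>.
        \<rho> \<alpha> $$ (i, i') * \<rho> \<beta> $$ (k, k') * fn (entries y) (U \<beta> k' l * U \<alpha> i' j) * (P \<alpha> $$ (j, i) * x \<beta> $$ (l, k)))"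
      by (rule sum6_reorder)
    also have "\<dots> = (\<Sum>k<n \<beta>. \<Sum>l<n \<beta>. \<Sum>i<n \<alpha>. \<Sum>j<n \<alpha>. entries x \<beta> l k * entries P \<alpha> j i * fn (entries y) (V \<beta> k l * V \<alpha> i j))"
      unfolding fnV by (simp add: sum_distrib_left entries_def mult_ac)
    finally show ?thesis .
  qed
  have sq: "sq_dim (\<lambda>\<alpha>. dim_row (\<rho> \<alpha>)) = sq_dim n" by (simp add: dim_\<rho>)
  have "haar_sq \<rho> X = (\<Sum>(\<alpha>, \<beta>)\<in>supp (sq_dim n) X. d \<alpha> * d \<beta> * mat_trace (kron (\<rho> \<alpha>) (\<rho> \<beta>) * X (\<alpha>, \<beta>)))"
    unfolding haar_sq_def sq by (simp add: d_trace)
  also have "\<dots> = (\<Sum>(\<alpha>, \<beta>)\<in>A \<times> B. d \<alpha> * d \<beta> * mat_trace (kron (\<rho> \<alpha>) (\<rho> \<beta>) * X (\<alpha>, \<beta>)))"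
  proof (rule sum.mono_neutral_left)
    show "supp (sq_dim n) X \<subseteq> A \<times> B" using zero by (auto simp: supp_def sq_dim_def)
    show "\<forall>p\<in>A \<times> B - supp (sq_dim n) X. (case p of (\<alpha>, \<beta>) \<Rightarrow> d \<alpha> * d \<beta> * mat_trace (kron (\<rho> \<alpha>) (\<rho> \<beta>) * X (\<alpha>, \<beta>))) = 0"
    proof
      fix p assume p: "p \<in> A \<times> B - supp (sq_dim n) X"
      obtain \<alpha> \<beta> where ab: "p = (\<alpha>, \<beta>)" by (cases p)
      have "X (\<alpha>, \<beta>) = 0\<^sub>m (n \<alpha> * n \<beta>) (n \<alpha> * n \<beta>)" using p by (simp add: ab supp_def sq_dim_def)
      moreover have "kron (\<rho> \<alpha>) (\<rho> \<beta>) \<in> carrier_mat (n \<alpha> * n \<beta>) (n \<alpha> * n \<beta>)"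
        by (intro kron_carrier \<rho>_carrier)
      ultimately show "(case p of (\<alpha>, \<beta>) \<Rightarrow> d \<alpha> * d \<beta> * mat_trace (kron (\<rho> \<alpha>) (\<rho> \<beta>) * X (\<alpha>, \<beta>))) = 0"
        by (simp add: ab mat_trace_def)
    qed
  qed (use fin in simp)
  also have "\<dots> = (\<Sum>\<alpha>\<in>A. \<Sum>\<beta>\<in>B. d \<alpha> * d \<beta> * (\<Sum>k<n \<beta>. \<Sum>l<n \<beta>. \<Sum>i<n \<alpha>. \<Sum>j<n \<alpha>.
      entries x \<beta> l k * entries P \<alpha> j i * fn (entries y) (V \<beta> k l * V \<alpha> i j)))"
    by (simp add: sum.cartesian_product[symmetric] term_eq)
  also have "\<dots> = (\<Sum>\<beta>\<in>B. \<Sum>\<alpha>\<in>A. d \<alpha> * d \<beta> * (\<Sum>k<n \<beta>. \<Sum>l<n \<beta>. \<Sum>i<n \<alpha>. \<Sum>j<n \<alpha>.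
      entries x \<beta> l k * entries P \<alpha> j i * fn (entries y) (V \<beta> k l * V \<alpha> i j)))"
    by (rule sum.swap)
  also have "\<dots> = fn (entries y) (EF x * EF P)"
  proof -
    have right: "clinear (\<lambda>a. fn (entries y) (a * b))" for b
      using fn_linear[of "entries y"] by (simp add: clinear_def distrib_right scaleC_mult_left)
    have left: "clinear (\<lambda>b. fn (entries y) (a * b))" for a
      using fn_linear[of "entries y"] by (simp add: clinear_def distrib_left scaleC_mult_right)
    have swap: "(\<Sum>\<alpha>\<in>A. \<Sum>k<m. \<Sum>l<m. g \<alpha> k l) = (\<Sum>k<m. \<Sum>l<m. \<Sum>\<alpha>\<in>A. g \<alpha> k l)"
      for g :: "'i \<Rightarrow> nat \<Rightarrow> nat \<Rightarrow> complex" and m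
      by (subst sum.swap, rule sum.cong[OF refl], rule sum.swap)
    define e where "e = EF P"
    have "fn (entries y) (EF x * e) = (\<Sum>\<beta>\<in>B. \<Sum>k<n \<beta>. \<Sum>l<n \<beta>. d \<beta> * (entries x \<beta> l k * fn (entries y) (V \<beta> k l * e)))"
      unfolding EF_def[of x] clinear_FF[OF right] B_def[symmetric] by (simp only: sum_distrib_left)
    also have "\<dots> = (\<Sum>\<beta>\<in>B. \<Sum>k<n \<beta>. \<Sum>l<n \<beta>. \<Sum>\<alpha>\<in>A. \<Sum>i<n \<alpha>. \<Sum>j<n \<alpha>.
        d \<beta> * (entries x \<beta> l k * (d \<alpha> * (entries P \<alpha> j i * fn (entries y) (V \<beta> k l * V \<alpha> i j)))))"
      unfolding e_def EF_def[of P] clinear_FF[OF left] A_def[symmetric] by (simp only: sum_distrib_left)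
    also have "\<dots> = (\<Sum>\<beta>\<in>B. \<Sum>\<alpha>\<in>A. \<Sum>k<n \<beta>. \<Sum>l<n \<beta>. \<Sum>i<n \<alpha>. \<Sum>j<n \<alpha>.
        d \<beta> * (entries x \<beta> l k * (d \<alpha> * (entries P \<alpha> j i * fn (entries y) (V \<beta> k l * V \<alpha> i j)))))"
      by (simp only: swap)
    also have "\<dots> = (\<Sum>\<beta>\<in>B. \<Sum>\<alpha>\<in>A. d \<alpha> * d \<beta> * (\<Sum>k<n \<beta>. \<Sum>l<n \<beta>. \<Sum>i<n \<alpha>. \<Sum>j<n \<alpha>.
        entries x \<beta> l k * entries P \<alpha> j i * fn (entries y) (V \<beta> k l * V \<alpha> i j)))"
      by (simp add: sum_distrib_left mult_ac)
    finally show ?thesis unfolding e_def by (rule sym)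
  qed
  finally show ?thesis by (simp add: X_def)
qed

lemma EF_surj:
  assumes "a \<in> pw.pol"
  obtains z where "z \<in> c00 n" "EF z = a"
proof -
  define F where "F = csupp a"
  have F: "finite F" unfolding F_def by (rule finite_csupp[OF assms])
  obtain g where g: "a = FF F g" unfolding F_def using FF_surj[OF assms] by blast
  define z :: "'i family" where "z \<gamma> = (if \<gamma> \<in> F then mat (n \<gamma>) (n \<gamma>) (\<lambda>(i, j). g \<gamma> i j) else 0\<^sub>m (n \<gamma>) (n \<gamma>))" for \<gamma>
  have supp: "supp n z \<subseteq> F" by (auto simp: supp_def z_def)
  then have z: "z \<in> c00 n"
    using F by (auto simp: c00_def families_def z_def intro: finite_subset)
  have "EF z = FF F (entries z)" by (rule EF_superset[OF F supp])
  also have "\<dots> = a" unfolding g FF_def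
    by (intro sum.cong refl arg_cong2[of _ _ _ _ "(*\<^sub>C)"]) (simp add: entries_def z_def)
  finally show ?thesis using z that by blast
qed

lemma EF_inject:
  assumes z: "z \<in> c00 n" and z': "z' \<in> c00 n" and eq: "EF z = EF z'"
  shows "z = z'"
proof (rule families_eqI)
  show "z \<in> families n" "z' \<in> families n" using z z' by (auto simp: c00_def)
  fix \<gamma> i j assume ij: "i < n \<gamma>" "j < n \<gamma>"
  define F where "F = insert \<gamma> (supp n z \<union> supp n z')"
  have F: "finite F" using z z' by (simp add: F_def c00_def)
  have "EF z = FF F (entries z)" "EF z' = FF F (entries z')"
    using F by (auto intro!: EF_superset simp: F_def)
  then have "FF F (entries z) = FF F (entries z')" using eq by simp
  then show "entries z \<gamma> i j = entries z' \<gamma> i j"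
    by (rule FF_inject[OF F]) (use ij in \<open>auto simp: F_def\<close>)
qed

lemma fn_mat_unit:
  assumes a: "a \<in> pw.pol" and ij: "i < n \<gamma>" "j < n \<gamma>"
  shows "fn (entries (mat_unit n \<gamma> i j)) a = cf \<gamma> i j a"
proof (rule pw.clinear_eq_pol[OF fn_linear cf_linear _ a])
  fix \<beta> k l assume "k < n \<beta>" "l < n \<beta>"
  then show "fn (entries (mat_unit n \<gamma> i j)) (U \<beta> k l) = cf \<gamma> i j (U \<beta> k l)"
    by (auto simp: fn_U cf_U entries_mat_unit)
qed

lemma pol_eqI:
  assumes a: "a \<in> pw.pol" and b: "b \<in> pw.pol" and eq: "\<And>y. y \<in> c00 n \<Longrightarrow> fn (entries y) a = fn (entries y) b"
  shows "a = b"
proof -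
  define F where "F = csupp a \<union> csupp b"
  have F: "finite F" using finite_csupp a b by (simp add: F_def)
  have "cf \<gamma> i j a = cf \<gamma> i j b" if "i < n \<gamma>" "j < n \<gamma>" for \<gamma> i j
    using eq[OF mat_unit_c00, of \<gamma> i j] that a b by (simp add: fn_mat_unit)
  then show ?thesis
    using pol_expand[OF a F] pol_expand[OF b F] by (simp add: F_def)
qed

text \<open>F is a bijection from \<open>c00\<close> to \<open>pol\<close>, and \<open>pol\<close>
  is closed under products, so F(x) F(P) has exactly one preimage. Finitely supported y separate
  \<open>pol\<close>, which makes this preimage the element singled out by the definite
  description.\<close>

lemma convolution:
  assumes P: "P \<in> c00 n" and x: "x \<in> c00 n"
  shows "convolution n \<rho> \<Delta> P x \<in> c00 n"
    and "EF (convolution n \<rho> \<Delta> P x) = EF x * EF P"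
proof -
  have pol: "EF x * EF P \<in> pw.pol" by (simp add: pol_mult)
  obtain z where z: "z \<in> c00 n" "EF z = EF x * EF P" by (rule EF_surj[OF pol])
  have iff: "(\<forall>y\<in>c00 n. haar \<rho> (y *\<^sub>f z') = haar_sq \<rho> (\<Delta> y *\<^sub>f (P \<otimes>\<^sub>f x))) \<longleftrightarrow> EF z' = EF x * EF P"
    if z': "z' \<in> c00 n" for z'
  proof -
    have "(\<forall>y\<in>c00 n. haar \<rho> (y *\<^sub>f z') = haar_sq \<rho> (\<Delta> y *\<^sub>f (P \<otimes>\<^sub>f x)))
      \<longleftrightarrow> (\<forall>y\<in>c00 n. fn (entries y) (EF z') = fn (entries y) (EF x * EF P))"
      using z' P x by (simp add: haar_mult haar_sq_comult c00_subset_linf families_linf)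
    also have "\<dots> \<longleftrightarrow> EF z' = EF x * EF P"
      using pol_eqI[OF pol_EF pol] by auto
    finally show ?thesis .
  qed
  have "convolution n \<rho> \<Delta> P x = z"
    unfolding convolution_def
  proof (rule the_equality)
    show "z \<in> c00 n \<and> (\<forall>y\<in>c00 n. haar \<rho> (y *\<^sub>f z) = haar_sq \<rho> (\<Delta> y *\<^sub>f (P \<otimes>\<^sub>f x)))"
      using z iff by simp
    fix z' assume "z' \<in> c00 n \<and> (\<forall>y\<in>c00 n. haar \<rho> (y *\<^sub>f z') = haar_sq \<rho> (\<Delta> y *\<^sub>f (P \<otimes>\<^sub>f x)))"
    then show "z' = z" using iff[of z'] z EF_inject[of z' z] by simp
  qed
  then show "convolution n \<rho> \<Delta> P x \<in> c00 n" "EF (convolution n \<rho> \<Delta> P x) = EF x * EF P"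
    using z by auto
qed

text \<open>The shift to \<open>Suc m\<close> fits \<open>conv_power\<close>, which convolves one
  time less than its exponent.\<close>

lemma conv_power:
  assumes P: "P \<in> c00 n"
  shows "conv_power n \<rho> \<Delta> P (Suc m) \<in> c00 n"
    and "EF (conv_power n \<rho> \<Delta> P (Suc m)) = EF P ^ Suc m"
proof -
  have "conv_power n \<rho> \<Delta> P (Suc m) \<in> c00 n \<and> EF (conv_power n \<rho> \<Delta> P (Suc m)) = EF P ^ Suc m"
  proof (induction m)
    case 0
    then show ?case using P by (simp add: conv_power_def)
  next
    case (Suc m)
    have "conv_power n \<rho> \<Delta> P (Suc (Suc m)) = convolution n \<rho> \<Delta> P (conv_power n \<rho> \<Delta> P (Suc m))"
      by (simp add: conv_power_def)
    then show ?case using Suc convolution[OF P, of "conv_power n \<rho> \<Delta> P (Suc m)"]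
      by (simp add: power_commutes mult.assoc)
  qed
  then show "conv_power n \<rho> \<Delta> P (Suc m) \<in> c00 n" "EF (conv_power n \<rho> \<Delta> P (Suc m)) = EF P ^ Suc m"
    by auto
qed

section \<open>Bounds for slices of bounded families on pairs\<close>

lemma block_bound:
  assumes X: "op_bounded (sq_dim n) C (entries X)"
  shows "(\<Sum>i<n \<alpha>. \<Sum>k<n \<beta>. (cmod (\<Sum>j<n \<alpha>. \<Sum>l<n \<beta>. X (\<alpha>, \<beta>) $$ (i * n \<beta> + k, j * n \<beta> + l) * v j l))\<^sup>2)
    \<le> C * (\<Sum>j<n \<alpha>. \<Sum>l<n \<beta>. (cmod (v j l))\<^sup>2)"
  using X[unfolded op_bounded_def, rule_format, of "(\<alpha>, \<beta>)" "\<lambda>r. v (r div n \<beta>) (r mod n \<beta>)"]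
  by (simp add: sq_dim_def sum_mult_split entries_def)

text \<open>The norm estimate for a slice by the vector functional of \<xi> and \<eta>:
  Cauchy-Schwarz in the row index of the first leg, then the bound of X on the elementary tensor of
  \<xi> and y. The weight w is squared because C bounds a squared norm.\<close>

lemma compression_bound:
  assumes X: "op_bounded (sq_dim n) C (entries X)" and C: "0 \<le> C"
    and w: "(\<Sum>i<n \<alpha>. (cmod (\<xi> i))\<^sup>2) * (\<Sum>i<n \<alpha>. (cmod (\<eta> i))\<^sup>2) \<le> w\<^sup>2"
  shows "op_bounded n (C * w\<^sup>2) (\<lambda>\<beta> k l. \<Sum>i<n \<alpha>. \<Sum>j<n \<alpha>.
    X (\<alpha>, \<beta>) $$ (i * n \<beta> + k, j * n \<beta> + l) * \<xi> j * cnj (\<eta> i))"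
  unfolding op_bounded_def
proof (intro allI)
  fix \<beta> and y :: "nat \<Rightarrow> complex"
  define x where "x i k j l = X (\<alpha>, \<beta>) $$ (i * n \<beta> + k, j * n \<beta> + l)" for i k j l
  define v where "v i k = (\<Sum>j<n \<alpha>. \<Sum>l<n \<beta>. x i k j l * (\<xi> j * y l))" for i k
  define W where "W \<zeta> = (\<Sum>i<n \<alpha>. (cmod (\<zeta> i))\<^sup>2)" for \<zeta> :: "nat \<Rightarrow> complex"
  define Y where "Y = (\<Sum>l<n \<beta>. (cmod (y l))\<^sup>2)"
  have Wnn: "0 \<le> W \<zeta>" for \<zeta> by (simp add: W_def sum_nonneg)
  have "(\<Sum>k<n \<beta>. (cmod (\<Sum>l<n \<beta>. (\<Sum>i<n \<alpha>. \<Sum>j<n \<alpha>. x i k j l * \<xi> j * cnj (\<eta> i)) * y l))\<^sup>2)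
    = (\<Sum>k<n \<beta>. (cmod (\<Sum>i<n \<alpha>. v i k * cnj (\<eta> i)))\<^sup>2)"
  proof -
    have "(\<Sum>l<n \<beta>. (\<Sum>i<n \<alpha>. \<Sum>j<n \<alpha>. x i k j l * \<xi> j * cnj (\<eta> i)) * y l) = (\<Sum>i<n \<alpha>. v i k * cnj (\<eta> i))" for k
    proof -
      have "(\<Sum>l<n \<beta>. (\<Sum>i<n \<alpha>. \<Sum>j<n \<alpha>. x i k j l * \<xi> j * cnj (\<eta> i)) * y l)
        = (\<Sum>l<n \<beta>. \<Sum>i<n \<alpha>. \<Sum>j<n \<alpha>. x i k j l * (\<xi> j * y l) * cnj (\<eta> i))"
        by (simp only: sum_distrib_right) (simp only: mult_ac)
      also have "\<dots> = (\<Sum>i<n \<alpha>. \<Sum>l<n \<beta>. \<Sum>j<n \<alpha>. x i k j l * (\<xi> j * y l) * cnj (\<eta> i))" by (rule sum.swap)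
      also have "\<dots> = (\<Sum>i<n \<alpha>. \<Sum>j<n \<alpha>. \<Sum>l<n \<beta>. x i k j l * (\<xi> j * y l) * cnj (\<eta> i))"
        by (rule sum.cong[OF refl], rule sum.swap)
      finally show ?thesis by (simp add: v_def sum_distrib_right)
    qed
    then show ?thesis by simp
  qed
  also have "\<dots> \<le> (\<Sum>k<n \<beta>. (\<Sum>i<n \<alpha>. (cmod (v i k))\<^sup>2) * W \<eta>)"
  proof (rule sum_mono)
    fix k
    show "(cmod (\<Sum>i<n \<alpha>. v i k * cnj (\<eta> i)))\<^sup>2 \<le> (\<Sum>i<n \<alpha>. (cmod (v i k))\<^sup>2) * W \<eta>"
      using cauchy_schwarz_sum[of "\<lambda>i. v i k" "\<lambda>i. cnj (\<eta> i)" "n \<alpha>"] by (simp add: W_def)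
  qed
  also have "\<dots> = (\<Sum>i<n \<alpha>. \<Sum>k<n \<beta>. (cmod (v i k))\<^sup>2) * W \<eta>"
    by (subst sum.swap) (simp add: sum_distrib_right)
  also have "\<dots> \<le> C * (W \<xi> * Y) * W \<eta>"
  proof (rule mult_right_mono[OF _ Wnn])
    have "(\<Sum>i<n \<alpha>. \<Sum>k<n \<beta>. (cmod (v i k))\<^sup>2) \<le> C * (\<Sum>j<n \<alpha>. \<Sum>l<n \<beta>. (cmod (\<xi> j * y l))\<^sup>2)"
      unfolding v_def x_def by (rule block_bound[OF X])
    also have "(\<Sum>j<n \<alpha>. \<Sum>l<n \<beta>. (cmod (\<xi> j * y l))\<^sup>2) = W \<xi> * Y"
      by (simp add: W_def Y_def norm_mult power_mult_distrib sum_product)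
    finally show "(\<Sum>i<n \<alpha>. \<Sum>k<n \<beta>. (cmod (v i k))\<^sup>2) \<le> C * (W \<xi> * Y)" .
  qed
  also have "\<dots> = C * Y * (W \<xi> * W \<eta>)" by simp
  also have "\<dots> \<le> C * Y * w\<^sup>2"
    using w C by (intro mult_left_mono) (auto simp: W_def Y_def sum_nonneg)
  finally show "(\<Sum>k<n \<beta>. (cmod (\<Sum>l<n \<beta>. (\<Sum>i<n \<alpha>. \<Sum>j<n \<alpha>. X (\<alpha>, \<beta>) $$ (i * n \<beta> + k, j * n \<beta> + l) * \<xi> j * cnj (\<eta> i)) * y l))\<^sup>2)
    \<le> C * w\<^sup>2 * (\<Sum>l<n \<beta>. (cmod (y l))\<^sup>2)"
    by (simp add: x_def Y_def mult_ac)
qed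

text \<open>A single block is the compression by two unit vectors, so w = 1.\<close>

lemma block_op_bounded:
  assumes X: "op_bounded (sq_dim n) C (entries X)" and C: "0 \<le> C" and s: "s < n \<alpha>" "t < n \<alpha>"
  shows "op_bounded n C (\<lambda>\<beta> k l. X (\<alpha>, \<beta>) $$ (s * n \<beta> + k, t * n \<beta> + l))"
proof -
  define \<delta> where "\<delta> j i = (if i = j then 1 else (0::complex))" for j i :: nat
  have "op_bounded n (C * 1\<^sup>2) (\<lambda>\<beta> k l. \<Sum>i<n \<alpha>. \<Sum>j<n \<alpha>.
      X (\<alpha>, \<beta>) $$ (i * n \<beta> + k, j * n \<beta> + l) * \<delta> t j * cnj (\<delta> s i))"
  proof (rule compression_bound[OF X C])
    have "(\<Sum>i<n \<alpha>. (cmod (\<delta> j i))\<^sup>2) = 1" if "j < n \<alpha>" for j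
    proof -
      have "(cmod (\<delta> j i))\<^sup>2 = (if i = j then 1 else 0)" for i by (simp add: \<delta>_def)
      then show ?thesis using that by simp
    qed
    then show "(\<Sum>i<n \<alpha>. (cmod (\<delta> t i))\<^sup>2) * (\<Sum>i<n \<alpha>. (cmod (\<delta> s i))\<^sup>2) \<le> 1\<^sup>2" using s by simp
  qed
  moreover have "(\<Sum>i<n \<alpha>. \<Sum>j<n \<alpha>. f i j * \<delta> t j * cnj (\<delta> s i)) = f s t" for f
  proof -
    have "(\<Sum>i<n \<alpha>. \<Sum>j<n \<alpha>. f i j * \<delta> t j * cnj (\<delta> s i))
      = (\<Sum>i<n \<alpha>. \<Sum>j<n \<alpha>. (if i = s then if j = t then 1 else 0 else 0) * f i j)"
      by (intro sum.cong refl) (simp add: \<delta>_def)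
    then show ?thesis by (simp add: sum_double_delta[OF s])
  qed
  ultimately show ?thesis by simp
qed

text \<open>The complementary slice, with an entry of the second leg fixed. It ensures that the
  functional inside \<open>slice\<close> is evaluated on a member of \<open>linf\<close>, where its
  vector representation holds.\<close>

lemma block_family_linf:
  assumes X: "op_bounded (sq_dim n) C (entries X)" and C: "0 \<le> C" and kl: "k < n \<beta>" "l < n \<beta>"
  shows "(\<lambda>\<alpha>. mat (n \<alpha>) (n \<alpha>) (\<lambda>(i, j). X (\<alpha>, \<beta>) $$ (i * n \<beta> + k, j * n \<beta> + l))) \<in> linf n"
    (is "?B \<in> _")
proof -
  have "op_bounded n C (entries ?B)" unfolding op_bounded_def
  proof (intro allI)
    fix \<alpha> and y :: "nat \<Rightarrow> complex"
    define v where "v j l' = (if l' = l then y j else 0)" for j l'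
    have v: "(\<Sum>j<n \<alpha>. \<Sum>l'<n \<beta>. X (\<alpha>, \<beta>) $$ (i * n \<beta> + k, j * n \<beta> + l') * v j l')
      = (\<Sum>j<n \<alpha>. X (\<alpha>, \<beta>) $$ (i * n \<beta> + k, j * n \<beta> + l) * y j)" for i k
      using kl by (simp add: v_def if_distrib[of "\<lambda>c. _ * c"] cong: if_cong)
    have "(\<Sum>i<n \<alpha>. (cmod (\<Sum>j<n \<alpha>. entries ?B \<alpha> i j * y j))\<^sup>2)
      = (\<Sum>i<n \<alpha>. (cmod (\<Sum>j<n \<alpha>. X (\<alpha>, \<beta>) $$ (i * n \<beta> + k, j * n \<beta> + l) * y j))\<^sup>2)"
      by (simp add: entries_def)
    also have "\<dots> \<le> (\<Sum>i<n \<alpha>. \<Sum>k<n \<beta>. (cmod (\<Sum>j<n \<alpha>. X (\<alpha>, \<beta>) $$ (i * n \<beta> + k, j * n \<beta> + l) * y j))\<^sup>2)"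
      using kl by (intro sum_mono member_le_sum) auto
    also have "\<dots> \<le> C * (\<Sum>j<n \<alpha>. \<Sum>l<n \<beta>. (cmod (v j l))\<^sup>2)"
      using block_bound[OF X, of \<alpha> \<beta> v] unfolding v .
    also have "(\<Sum>j<n \<alpha>. \<Sum>l<n \<beta>. (cmod (v j l))\<^sup>2) = (\<Sum>j<n \<alpha>. (cmod (y j))\<^sup>2)"
    proof -
      have "(cmod (v j l'))\<^sup>2 = (if l' = l then (cmod (y j))\<^sup>2 else 0)" for j l' by (simp add: v_def)
      then show ?thesis using kl by simp
    qed
    finally show "(\<Sum>i<n \<alpha>. (cmod (\<Sum>j<n \<alpha>. entries ?B \<alpha> i j * y j))\<^sup>2) \<le> C * (\<Sum>j<n \<alpha>. (cmod (y j))\<^sup>2)" .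
  qed
  then show ?thesis using C unfolding linf_iff by (auto simp: families_def)
qed

lemma supp_range_projection:
  assumes z: "z \<in> families n"
  shows "supp n (range_projection n z) \<subseteq> supp n z"
proof
  fix \<gamma> assume g: "\<gamma> \<in> supp n (range_projection n z)"
  show "\<gamma> \<in> supp n z"
  proof (rule ccontr)
    assume out: "\<gamma> \<notin> supp n z"
    have "entries (range_projection n z) \<gamma> i j = 0" if ij: "i < n \<gamma>" "j < n \<gamma>" for i j
    proof -
      have "(\<lambda>i. entries (range_projection n z) \<gamma> i j) \<in> fn_range (n \<gamma>) (entries z \<gamma>)"
        unfolding range_projection(2)[OF z, symmetric] by (rule column_fn_range[OF ij(2)])
      then show ?thesis using ij by (auto simp: fn_range_def entries_outside[OF out])
    qed
    moreover have "range_projection n z \<gamma> \<in> carrier_mat (n \<gamma>) (n \<gamma>)"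
      using range_projection(1)[OF z] by (simp add: projection_def linf_def families_def)
    ultimately have "range_projection n z \<gamma> = 0\<^sub>m (n \<gamma>) (n \<gamma>)"
      by (intro eq_matI) (auto simp: entries_def)
    then show False using g by (simp add: supp_def)
  qed
qed

end

section \<open>The invariant mean\<close>

locale dqg_growth = dqg_dual \<Delta>G \<epsilon>G SG u \<rho> \<Delta> R sig rt rs
  for \<Delta>G :: "'a::complex_star_algebra \<Rightarrow> ('a, 'a) tensor" and \<epsilon>G SG
    and u :: "'i \<Rightarrow> 'a mat" and \<rho> :: "'i \<Rightarrow> complex mat"
    and \<Delta> :: "'i family \<Rightarrow> ('i \<times> 'i) family" and R :: "'i family \<Rightarrow> 'i family"
    and sig rt rs +
  fixes P :: "'i family"
  assumes P_c00: "P \<in> c00 n"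
    and P_projection: "projection n P"
    and P_triv: "P triv $$ (0, 0) = 1"
    and generating: "\<And>q. projection n q \<Longrightarrow>
      (\<And>m. 1 \<le> m \<Longrightarrow> proj_le (range_projection n (conv_power n \<rho> \<Delta> P m)) q) \<Longrightarrow> q = fam_one n"
    and root_haar: "(\<lambda>m. root m (Re (haar \<rho> (range_projection n (conv_power n \<rho> \<Delta> P m))))) \<longlonglongrightarrow> 1"

sublocale dqg_growth \<subseteq> growth \<Delta>G \<epsilon>G SG "irr_dim u" "\<lambda>\<alpha> i j. u \<alpha> $$ (i, j)" "trivial_index u"
    "entries \<rho>" sig rt rs "supp (irr_dim u) P" "entries P"
proof
  show "finite (supp n P)" using P_c00 by (simp add: c00_def)
  show "entries P \<gamma> i j = (\<Sum>m<n \<gamma>. entries P \<gamma> i m * cnj (entries P \<gamma> j m))" if "i < n \<gamma>" "j < n \<gamma>" for \<gamma> i j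
    using projection_entries[OF P_projection] that by simp
  show "entries P triv 0 0 = 1" using P_triv by (simp add: entries_def)
  then show "triv \<in> supp n P" using entries_outside[of triv P 0 0] n_triv by auto
qed

context dqg_growth
begin

lemma p_eq_EF: "p = EF P"
  by (simp add: p_def EF_def)

definition z :: "nat \<Rightarrow> 'i family" where "z m = conv_power n \<rho> \<Delta> P (Suc m)"

lemma z_c00: "z m \<in> c00 n"
  unfolding z_def by (rule conv_power(1)[OF P_c00])

lemma z_families: "z m \<in> families n"
  using z_c00[of m] by (simp add: c00_def)

lemma p_power: "p ^ Suc m = FF (supp n (z m)) (entries (z m))"
  unfolding EF_def[symmetric] p_eq_EF z_def by (rule conv_power(2)[OF P_c00, symmetric])

text \<open>\<open>power_bound\<close> for the density of the power: its range projection fixes the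
  columns on the left, and the counit of p is the positive number \<tau>.\<close>

lemma haar_range_bound:
  "(Re \<tau>) ^ Suc m \<le> sqrt (Re (haar \<rho> (range_projection n (z m)))) * ip.N (p ^ Suc m)"
proof -
  define q where "q = range_projection n (z m)"
  define B where "B = supp n (z m)"
  have B: "finite B" using z_c00[of m] by (simp add: B_def c00_def)
  have q: "projection n q" "fn_range (n \<gamma>) (entries q \<gamma>) = fn_range (n \<gamma>) (entries (z m) \<gamma>)" for \<gamma>
    unfolding q_def by (rule range_projection[OF z_families])+
  have "cmod (\<epsilon>G p) ^ Suc m \<le> sqrt (Re (haar_FF B (entries q))) * ip.N (p ^ Suc m)"
  proof (rule power_bound[OF B pol_p conj_p p_power[of m, folded B_def]])
    fix \<gamma> i j assume ij: "i < n \<gamma>" "j < n \<gamma>"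
    show "cnj (entries q \<gamma> i j) = entries q \<gamma> j i"
      "(\<Sum>k<n \<gamma>. entries q \<gamma> i k * entries q \<gamma> k j) = entries q \<gamma> i j"
      using projection_entries[OF q(1) ij] by simp_all
    show "(\<Sum>k<n \<gamma>. entries q \<gamma> i k * entries (z m) \<gamma> k j) = entries (z m) \<gamma> i j"
      by (rule projection_fixes_range[OF q(1) _ ij(1)], unfold q(2), rule column_fn_range[OF ij(2)])
  qed
  also have "haar_FF B (entries q) = haar \<rho> q"
    using q(1) supp_range_projection[OF z_families, of m]
    by (intro haar_eq[symmetric] B) (auto simp: B_def q_def projection_def families_linf)
  also have "cmod (\<epsilon>G p) = Re \<tau>"
    using \<tau>_pos unfolding counit_p by (subst \<tau>_real) simp
  finally show ?thesis by (simp add: q_def)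
qed

end

sublocale dqg_growth \<subseteq> subexponential \<Delta>G \<epsilon>G SG "irr_dim u" "\<lambda>\<alpha> i j. u \<alpha> $$ (i, j)" "trivial_index u"
    "entries \<rho>" sig rt rs "supp (irr_dim u) P" "entries P"
    "\<lambda>m. Re (haar \<rho> (range_projection (irr_dim u) (conv_power (irr_dim u) \<rho> \<Delta> P m)))"
proof
  fix m
  show "(Re \<tau>) ^ Suc m \<le> sqrt (Re (haar \<rho> (range_projection n (conv_power n \<rho> \<Delta> P (Suc m))))) * ip.N (p ^ Suc m)"
    using haar_range_bound[of m] by (simp only: z_def)
  show "(\<lambda>m. root m (Re (haar \<rho> (range_projection n (conv_power n \<rho> \<Delta> P m))))) \<longlonglongrightarrow> 1"
    by (rule root_haar)
qed

section \<open>Fixed vectors and the passage to the whole algebra\<close>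

context dqg_growth
begin

definition fixed_vectors :: "'i \<Rightarrow> (nat \<Rightarrow> complex) set" where
  "fixed_vectors \<gamma> = {v. \<forall>k<n \<gamma>. (\<Sum>j<n \<gamma>. v j *\<^sub>C U \<gamma> k j) \<in> fixers}"

lemma fixed_vectors_subspace:
  "(\<lambda>_. 0) \<in> fixed_vectors \<gamma>"
  "x \<in> fixed_vectors \<gamma> \<Longrightarrow> y \<in> fixed_vectors \<gamma> \<Longrightarrow> (\<lambda>b. x b + y b) \<in> fixed_vectors \<gamma>"
  "x \<in> fixed_vectors \<gamma> \<Longrightarrow> (\<lambda>b. c * x b) \<in> fixed_vectors \<gamma>"
proof -
  show "(\<lambda>_. 0) \<in> fixed_vectors \<gamma>" by (simp add: fixed_vectors_def fixers_zero)
  show "x \<in> fixed_vectors \<gamma> \<Longrightarrow> y \<in> fixed_vectors \<gamma> \<Longrightarrow> (\<lambda>b. x b + y b) \<in> fixed_vectors \<gamma>"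
    by (simp add: fixed_vectors_def scaleC_add_left sum.distrib fixers_add)
  have "(\<Sum>j<n \<gamma>. (c * x j) *\<^sub>C U \<gamma> k j) = c *\<^sub>C (\<Sum>j<n \<gamma>. x j *\<^sub>C U \<gamma> k j)" for k
    by (simp add: scaleC_sum_right scaleC_scaleC)
  then show "x \<in> fixed_vectors \<gamma> \<Longrightarrow> (\<lambda>b. c * x b) \<in> fixed_vectors \<gamma>"
    by (simp add: fixed_vectors_def fixers_scale)
qed

text \<open>Columns are fixed vectors by \<open>power_columns_fixed\<close>, outside the support
  because they vanish, and fixed vectors form a subspace.\<close>

lemma range_fixed: "fn_range (n \<gamma>) (entries (z m) \<gamma>) \<subseteq> fixed_vectors \<gamma>"
proof
  fix v assume "v \<in> fn_range (n \<gamma>) (entries (z m) \<gamma>)"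
  then obtain w where w: "\<And>i. i < n \<gamma> \<Longrightarrow> v i = (\<Sum>s<n \<gamma>. entries (z m) \<gamma> i s * w s)"
    by (auto simp: fn_range_def)
  have cols: "(\<lambda>i. entries (z m) \<gamma> i s) \<in> fixed_vectors \<gamma>" if s: "s < n \<gamma>" for s
  proof (cases "\<gamma> \<in> supp n (z m)")
    case True
    have "finite (supp n (z m))" using z_c00[of m] by (simp add: c00_def)
    from power_columns_fixed[OF this p_power True s] show ?thesis by (simp add: fixed_vectors_def)
  next
    case False
    then show ?thesis using s by (simp add: fixed_vectors_def entries_outside fixers_zero)
  qed
  have "(\<lambda>i. \<Sum>s<n \<gamma>. entries (z m) \<gamma> i s * w s) \<in> fixed_vectors \<gamma>"
    by (rule sum_closed[where x = "\<lambda>s i. entries (z m) \<gamma> i s"])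
      (use cols in \<open>auto intro: fixed_vectors_subspace\<close>)
  then show "v \<in> fixed_vectors \<gamma>" by (simp add: fixed_vectors_def w)
qed

text \<open>The projections onto the fixed vectors of all blocks form one projection Q. It dominates
  the range projection of every convolution power and is therefore the unit; so all unit vectors are
  fixed, which says that every coefficient is a fixer.\<close>

lemma U_fixers:
  assumes ij: "i < n \<gamma>" "j < n \<gamma>"
  shows "U \<gamma> i j \<in> fixers"
proof -
  define good where "good \<gamma> q \<longleftrightarrow> (\<forall>j<n \<gamma>. (\<lambda>i. q i j) \<in> fixed_vectors \<gamma>) \<and>
    (\<forall>v\<in>fixed_vectors \<gamma>. \<forall>i<n \<gamma>. (\<Sum>k<n \<gamma>. q i k * v k) = v i) \<and>
    (\<forall>i<n \<gamma>. \<forall>j<n \<gamma>. cnj (q i j) = q j i)" for \<gamma> and q :: "nat \<Rightarrow> nat \<Rightarrow> complex"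
  have "\<exists>q. good \<gamma> q" for \<gamma>
    unfolding good_def by (rule orthogonal_projection_exists) (rule fixed_vectors_subspace; assumption)+
  then obtain q where "\<And>\<gamma>. good \<gamma> (q \<gamma>)" by metis
  then have q: "\<And>\<gamma> j. j < n \<gamma> \<Longrightarrow> (\<lambda>i. q \<gamma> i j) \<in> fixed_vectors \<gamma>"
    "\<And>\<gamma> v i. v \<in> fixed_vectors \<gamma> \<Longrightarrow> i < n \<gamma> \<Longrightarrow> (\<Sum>k<n \<gamma>. q \<gamma> i k * v k) = v i"
    "\<And>\<gamma> i j. i < n \<gamma> \<Longrightarrow> j < n \<gamma> \<Longrightarrow> cnj (q \<gamma> i j) = q \<gamma> j i"
    by (simp_all add: good_def)
  define Q where "Q = (\<lambda>\<gamma>. mat (n \<gamma>) (n \<gamma>) (\<lambda>(i, j). q \<gamma> i j))"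
  have Qf: "Q \<in> families n" by (simp add: Q_def families_def)
  have Qe: "entries Q \<gamma> i j = q \<gamma> i j" if "i < n \<gamma>" "j < n \<gamma>" for \<gamma> i j
    using that by (simp add: Q_def entries_def)
  have "Q = fam_one n"
  proof (rule generating)
    show "projection n Q" by (rule projectionI[OF Qf]) (simp_all add: Qe q(3) q(2)[OF q(1)])
    fix m :: nat assume "1 \<le> m"
    then obtain k where k: "m = Suc k" by (cases m) auto
    define r where "r = range_projection n (z k)"
    have r: "projection n r" "fn_range (n \<gamma>) (entries r \<gamma>) = fn_range (n \<gamma>) (entries (z k) \<gamma>)" for \<gamma>
      unfolding r_def by (rule range_projection[OF z_families])+
    have rf: "r \<in> families n" using r(1) by (simp add: projection_def families_linf)
    have "Q *\<^sub>f r = r"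
    proof (rule families_eqI[OF families_mult[OF Qf rf] rf])
      fix \<gamma> i j assume ij: "i < n \<gamma>" "j < n \<gamma>"
      have "(\<lambda>i. entries r \<gamma> i j) \<in> fixed_vectors \<gamma>"
        using column_fn_range[OF ij(2), of "entries r \<gamma>"] range_fixed[of \<gamma> k] unfolding r(2) by blast
      then show "entries (Q *\<^sub>f r) \<gamma> i j = entries r \<gamma> i j"
        using ij q(2)[of "\<lambda>i. entries r \<gamma> i j"] by (simp add: fam_mult_entries[OF Qf rf] Qe)
    qed
    then show "proj_le (range_projection n (conv_power n \<rho> \<Delta> P m)) Q"
      by (simp add: proj_le_def k r_def z_def)
  qed
  then have "q \<gamma> k j = (if k = j then 1 else 0)" if "k < n \<gamma>" for k
    using Qe[OF that ij(2)] that ij by (simp add: fam_one_def entries_def)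
  then have "(\<Sum>k<n \<gamma>. q \<gamma> k j *\<^sub>C U \<gamma> i k) = U \<gamma> i j"
    using ij by (simp add: if_distrib[of "\<lambda>c. c *\<^sub>C _"] cong: if_cong)
  moreover have "(\<Sum>k<n \<gamma>. q \<gamma> k j *\<^sub>C U \<gamma> i k) \<in> fixers"
    using q(1)[OF ij(2)] ij by (simp add: fixed_vectors_def)
  ultimately show ?thesis by simp
qed

lemma pol_fixers: "a \<in> pw.pol \<Longrightarrow> a \<in> fixers"
  by (induction rule: pw.pol_induct) (simp_all add: U_fixers fixers_zero fixers_add fixers_scale)

lemma mu_cong:
  assumes "\<And>\<gamma> i j. i < n \<gamma> \<Longrightarrow> j < n \<gamma> \<Longrightarrow> g \<gamma> i j = g' \<gamma> i j"
  shows "mu k g = mu k g'"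
  unfolding mu_def by (rule vstate_cong) (rule assms)

lemma mu_fam_add: "x \<in> families n \<Longrightarrow> y \<in> families n \<Longrightarrow> mu k (entries (x +\<^sub>f y)) = mu k (entries x) + mu k (entries y)"
proof -
  assume "x \<in> families n" "y \<in> families n"
  then have c: "x \<gamma> \<in> carrier_mat (n \<gamma>) (n \<gamma>)" "y \<gamma> \<in> carrier_mat (n \<gamma>) (n \<gamma>)" for \<gamma> by (auto simp: families_def)
  have "mu k (entries (x +\<^sub>f y)) = mu k (\<lambda>\<gamma> i j. entries x \<gamma> i j + entries y \<gamma> i j)"
    by (rule mu_cong) (simp add: entries_def fam_add_def carrier_matD[OF c(1)] carrier_matD[OF c(2)])
  then show ?thesis by (simp add: mu_def vstate_add)
qed

lemma mu_fam_scale: "x \<in> families n \<Longrightarrow> mu k (entries (c \<cdot>\<^sub>f x)) = c * mu k (entries x)"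
proof -
  assume "x \<in> families n"
  then have c: "x \<gamma> \<in> carrier_mat (n \<gamma>) (n \<gamma>)" for \<gamma> by (auto simp: families_def)
  have "mu k (entries (c \<cdot>\<^sub>f x)) = mu k (\<lambda>\<gamma> i j. c * entries x \<gamma> i j)"
    by (rule mu_cong) (simp add: entries_def fam_scale_def carrier_matD[OF c])
  then show ?thesis by (simp add: mu_def vstate_scale)
qed

lemma mu_square:
  assumes x: "x \<in> families n"
  shows "mu k (entries (fam_adj x *\<^sub>f x)) = of_real ((ip.N (star (act (entries x) (star (aseq k)))))\<^sup>2)"
proof -
  have "mu k (entries (fam_adj x *\<^sub>f x)) = mu k (\<lambda>\<gamma> l q. \<Sum>r<n \<gamma>. cnj (entries x \<gamma> r l) * entries x \<gamma> r q)"
    by (rule mu_cong) (simp add: fam_mult_entries[OF families_adj[OF x] x] fam_adj_entries[OF x])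
  also have "\<dots> = of_real ((ip.N (star (act (entries x) (star (aseq k)))))\<^sup>2)"
    unfolding mu_def by (rule vstate_square) (simp add: pol_star)
  finally show ?thesis .
qed

lemma mu_fam_one: "mu k (entries (fam_one n)) = 1"
proof -
  have "mu k (entries (fam_one n)) = mu k (\<lambda>\<gamma> i j. if i = j then 1 else 0)"
    by (rule mu_cong) (simp add: entries_def fam_one_def)
  then show ?thesis by (simp add: mu_one)
qed

lemma mu_slice:
  assumes x: "x \<in> linf n" and \<omega>: "normal_functional n \<omega>"
  shows "(\<lambda>k. mu k (entries (slice n \<omega> (\<Delta> x))) - \<omega> (fam_one n) * mu k (entries x)) \<longlonglongrightarrow> 0"
    and "\<exists>B. \<forall>k. cmod (mu k (entries (slice n \<omega> (\<Delta> x)))) \<le> B"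
proof -
  obtain \<xi> \<eta> w where rep: "normal_rep n \<omega> \<xi> \<eta> w"
    using normal_functional_rep[OF \<omega>] by blast
  note w = rep[unfolded normal_rep_def, THEN conjunct1]
    rep[unfolded normal_rep_def, THEN conjunct2, THEN conjunct1, rule_format]
    rep[unfolded normal_rep_def, THEN conjunct2, THEN conjunct2, THEN conjunct1, rule_format]
  obtain C1 where C1: "0 \<le> C1" "op_bounded n C1 (entries x)" using x unfolding linf_iff by blast
  obtain C2 where C2: "0 \<le> C2" "op_bounded (sq_dim n) C2 (entries (\<Delta> x))"
    using comult_linf[OF x] unfolding linf_iff by blast
  \<comment> \<open>A common constant for x and \<Delta> x, as \<open>mu_normal_combination\<close>
    asks for.\<close>
  define C where "C = max C1 C2"
  have C: "0 \<le> C" "op_bounded n C (entries x)" "op_bounded (sq_dim n) C (entries (\<Delta> x))"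
    using C1(1) op_bounded_mono[OF C1(2), of C] op_bounded_mono[OF C2(2), of C] by (auto simp: C_def)
  define D where "D \<alpha> i j \<beta> k l = \<Delta> x (\<alpha>, \<beta>) $$ (i * n \<beta> + k, j * n \<beta> + l)" for \<alpha> \<beta> i j k l
  have D: "fn (entries x) (U \<beta> k l * U \<alpha> s t) = D \<alpha> s t \<beta> k l"
    if "k < n \<beta>" "l < n \<beta>" "s < n \<alpha>" "t < n \<alpha>" for \<alpha> \<beta> k l s t
    unfolding D_def by (rule comult_index[OF x that(3,4,1,2), symmetric])
  have D_bound: "op_bounded n C (D \<alpha> s t)" if "s < n \<alpha>" "t < n \<alpha>" for \<alpha> s t
    unfolding D_def by (rule block_op_bounded[OF C(3,1) that])
  have T_bound: "op_bounded n (C * (w p)\<^sup>2)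
      (\<lambda>\<beta> k l. \<Sum>i<n (snd p). \<Sum>j<n (snd p). D (snd p) i j \<beta> k l * \<xi> p j * cnj (\<eta> p i))" for p
    unfolding D_def by (rule compression_bound[OF C(3,1) w(3)])
  have S: "((\<lambda>p. \<Sum>i<n (snd p). \<Sum>j<n (snd p). D (snd p) i j \<beta> k l * \<xi> p j * cnj (\<eta> p i))
      has_sum entries (slice n \<omega> (\<Delta> x)) \<beta> k l) UNIV" if kl: "k < n \<beta>" "l < n \<beta>" for \<beta> k l
    using normal_rep_has_sum[OF rep block_family_linf[OF C(3,1) kl]] kl
    by (simp add: entries_def slice_def D_def)
  have one: "\<omega> (fam_one n) = (\<Sum>\<^sub>\<infinity>p. \<Sum>i<n (snd p). \<xi> p i * cnj (\<eta> p i))"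
  proof -
    have "(\<Sum>j<n (snd p). fam_one n (snd p) $$ (i, j) * \<xi> p j * cnj (\<eta> p i)) = \<xi> p i * cnj (\<eta> p i)"
      if "i < n (snd p)" for p i
    proof -
      have "(\<Sum>j<n (snd p). fam_one n (snd p) $$ (i, j) * \<xi> p j * cnj (\<eta> p i))
        = (\<Sum>j<n (snd p). if j = i then \<xi> p j * cnj (\<eta> p i) else 0)"
        using that by (intro sum.cong refl) (auto simp: fam_one_def)
      then show ?thesis using that by simp
    qed
    then have "((\<lambda>p. \<Sum>i<n (snd p). \<xi> p i * cnj (\<eta> p i)) has_sum \<omega> (fam_one n)) UNIV"
      using normal_rep_has_sum[OF rep fam_one_linf] by simp
    then show ?thesis by (simp add: infsumI)
  qed
  show "(\<lambda>k. mu k (entries (slice n \<omega> (\<Delta> x))) - \<omega> (fam_one n) * mu k (entries x)) \<longlonglongrightarrow> 0"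
    by (rule mu_normal_combination(1)[OF pol_fixers w D C(1,2) D_bound T_bound S one])
  show "\<exists>B. \<forall>k. cmod (mu k (entries (slice n \<omega> (\<Delta> x)))) \<le> B"
    by (rule mu_normal_combination(2)[OF pol_fixers w D C(1,2) D_bound T_bound S one])
qed

lemma amenable: "amenable u \<Delta>"
proof -
  \<comment> \<open>X contains every argument along which the states stay bounded: the entries of
    bounded families and, by \<open>mu_slice\<close>, those of slices. Limits at slices thus exist
    without a separate proof that slices lie in \<open>linf\<close>.\<close>
  define X where "X = {g. \<exists>B. \<forall>k. cmod (mu k g) \<le> B}"
  have "\<exists>F l. F \<noteq> bot \<and> F \<le> sequentially \<and> (\<forall>g\<in>X. ((\<lambda>k. mu k g) \<longlongrightarrow> l g) F)"
    by (rule pointwise_convergent_filter) (simp add: X_def)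
  then obtain F l where F: "F \<noteq> bot" "F \<le> sequentially"
    and "\<forall>g\<in>X. ((\<lambda>k. mu k g) \<longlongrightarrow> l g) F"
    by (elim exE conjE)
  then have lim: "\<And>g. g \<in> X \<Longrightarrow> ((\<lambda>k. mu k g) \<longlongrightarrow> l g) F" by simp
  have XI: "g \<in> X" if "\<And>k. cmod (mu k g) \<le> B" for g B
    unfolding X_def using that by (intro CollectI exI[of _ B] allI)
  have l_eq: "l g = L" if "g \<in> X" "((\<lambda>k. mu k g) \<longlongrightarrow> L) F" for g L
    using tendsto_unique[OF F(1) lim[OF that(1)] that(2)] .
  have X: "entries x \<in> X" if x: "x \<in> linf n" for x
  proof -
    obtain C where "0 \<le> C" "op_bounded n C (entries x)" using x unfolding linf_iff by blast
    then show ?thesis by (intro XI[of _ "sqrt C"] mu_bound)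
  qed
  define \<mu> where "\<mu> x = l (entries x)" for x
  have "linear_functional_on n \<mu>"
    unfolding linear_functional_on_def
  proof (intro conjI ballI allI)
    fix x y assume xy: "x \<in> linf n" "y \<in> linf n"
    obtain B B' where B: "cmod (mu k (entries x)) \<le> B" "cmod (mu k (entries y)) \<le> B'" for k
      using X[OF xy(1)] X[OF xy(2)] by (auto simp: X_def)
    have eq: "mu k (entries (x +\<^sub>f y)) = mu k (entries x) + mu k (entries y)" for k
      by (intro mu_fam_add families_linf xy)
    have "cmod (mu k (entries (x +\<^sub>f y))) \<le> B + B'" for k
      unfolding eq by (rule norm_triangle_le) (intro add_mono B)
    then have "entries (x +\<^sub>f y) \<in> X" by (rule XI)
    then show "\<mu> (x +\<^sub>f y) = \<mu> x + \<mu> y"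
      unfolding \<mu>_def by (rule l_eq) (unfold eq, intro tendsto_add lim X xy)
  next
    fix c x assume x: "x \<in> linf n"
    obtain B where B: "cmod (mu k (entries x)) \<le> B" for k
      using X[OF x] by (auto simp: X_def)
    have eq: "mu k (entries (c \<cdot>\<^sub>f x)) = c * mu k (entries x)" for k
      by (intro mu_fam_scale families_linf x)
    have "cmod (mu k (entries (c \<cdot>\<^sub>f x))) \<le> cmod c * B" for k
      unfolding eq norm_mult by (intro mult_left_mono B) simp
    then have "entries (c \<cdot>\<^sub>f x) \<in> X" by (rule XI)
    then show "\<mu> (c \<cdot>\<^sub>f x) = c * \<mu> x"
      unfolding \<mu>_def by (rule l_eq) (unfold eq, intro tendsto_mult tendsto_const lim X x)
  qed
  moreover have "0 \<le> \<mu> (fam_adj x *\<^sub>f x)" if x: "x \<in> linf n" for x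
  proof -
    obtain C where C: "0 \<le> C" "op_bounded n C (entries x)" using x unfolding linf_iff by blast
    define r where "r k = (ip.N (star (act (entries x) (star (aseq k)))))\<^sup>2" for k
    have mu: "mu k (entries (fam_adj x *\<^sub>f x)) = of_real (r k)" for k
      unfolding r_def by (rule mu_square[OF families_linf[OF x]])
    have "ip.N (star (act (entries x) (star (aseq k)))) \<le> sqrt C" for k
      using N_act_le[OF C(2,1), of "star (aseq k)"] by (simp add: pol_star star_star)
    then have "r k \<le> (sqrt C)\<^sup>2" for k
      unfolding r_def by (intro power_mono) (simp_all add: pol_star act_pol)
    then have "cmod (mu k (entries (fam_adj x *\<^sub>f x))) \<le> (sqrt C)\<^sup>2" for k
      unfolding mu norm_of_real by (simp add: abs_of_nonneg r_def)
    then have "entries (fam_adj x *\<^sub>f x) \<in> X" by (rule XI)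
    from lim[OF this] have lim: "((\<lambda>k. of_real (r k)) \<longlongrightarrow> \<mu> (fam_adj x *\<^sub>f x)) F"
      unfolding mu \<mu>_def .
    have "0 \<le> Re (\<mu> (fam_adj x *\<^sub>f x))"
      using tendsto_lowerbound[OF tendsto_Re[OF lim] _ F(1), of 0] by (simp add: r_def)
    \<comment> \<open>The order on complex numbers also asks for a vanishing imaginary part, which
      the limit inherits.\<close>
    moreover have "Im (\<mu> (fam_adj x *\<^sub>f x)) = 0"
      using tendsto_unique[OF F(1) tendsto_Im[OF lim]] by simp
    ultimately show ?thesis by (simp add: less_eq_complex_def)
  qed
  moreover have "\<mu> (fam_one n) = 1"
    unfolding \<mu>_def by (rule l_eq[OF X[OF fam_one_linf]]) (simp add: mu_fam_one)
  ultimately have "state_on n \<mu>" unfolding state_on_def by blast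
  moreover have "\<mu> (slice n \<omega> (\<Delta> x)) = \<omega> (fam_one n) * \<mu> x" if \<omega>: "normal_functional n \<omega>" and x: "x \<in> linf n" for \<omega> x
  proof -
    have "((\<lambda>k. (mu k (entries (slice n \<omega> (\<Delta> x))) - \<omega> (fam_one n) * mu k (entries x)) + \<omega> (fam_one n) * mu k (entries x))
      \<longlongrightarrow> 0 + \<omega> (fam_one n) * l (entries x)) F"
      by (intro tendsto_add tendsto_mult tendsto_const tendsto_mono[OF F(2) mu_slice(1)] lim X x \<omega>)
    then have "((\<lambda>k. mu k (entries (slice n \<omega> (\<Delta> x)))) \<longlongrightarrow> \<omega> (fam_one n) * l (entries x)) F" by simp
    moreover have "entries (slice n \<omega> (\<Delta> x)) \<in> X"
      using mu_slice(2)[OF x \<omega>] by (simp add: X_def)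
    ultimately show ?thesis unfolding \<mu>_def by (intro l_eq)
  qed
  ultimately show ?thesis unfolding amenable_def Let_def by blast
qed

end

theorem proposition5p15:
  fixes \<Delta>G :: "'a::complex_star_algebra \<Rightarrow> ('a, 'a) tensor"
    and \<epsilon>G :: "'a \<Rightarrow> complex"
    and SG :: "'a \<Rightarrow> 'a"
    and u :: "'i \<Rightarrow> 'a mat"
    and \<rho> :: "'i \<Rightarrow> complex mat"
    and \<Delta> :: "'i family \<Rightarrow> ('i \<times> 'i) family"
    and R :: "'i family \<Rightarrow> 'i family"
  assumes "discrete_quantum_group \<Delta>G \<epsilon>G SG u \<rho> \<Delta> R"
    and "subexponential_growth u \<rho> \<Delta> R"
  shows "amenable u \<Delta>"
proof -
  interpret discrete_quantum_group \<Delta>G \<epsilon>G SG u \<rho> \<Delta> R by (rule assms(1))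
  obtain sig rt rs where dd: "dual_data \<Delta>G \<epsilon>G SG n U triv (entries \<rho>) sig rt rs"
    using dual_data_exists by blast
  obtain P where P: "P \<in> c00 n" "projection n P" "P triv $$ (0, 0) = 1"
    "\<forall>q. projection n q \<and> (\<forall>m\<ge>1. proj_le (range_projection n (conv_power n \<rho> \<Delta> P m)) q) \<longrightarrow> q = fam_one n"
    "(\<lambda>m. root m (Re (haar \<rho> (range_projection n (conv_power n \<rho> \<Delta> P m))))) \<longlonglongrightarrow> 1"
    using assms(2) unfolding subexponential_growth_def Let_def by blast
  have "dqg_growth \<Delta>G \<epsilon>G SG u \<rho> \<Delta> R sig rt rs P"
    using P by (intro dqg_growth.intro dqg_dual.intro dqg_growth_axioms.intro assms(1) dd) auto
  then show ?thesis by (rule dqg_growth.amenable)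
qed

end
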